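(* Let $$\Lambda_2 = \sqrt{\tfrac{2}{\sqrt3}}\begin{pmatrix}1&\frac12\\0&\frac{\sqrt3}{2}\end{pmatrix}\mathbb{Z}^2 ,$$ and for every integer $n\ge1$ let $\Lambda_2(2\cdot3^{n-1}) = 2^{-1/2}3^{-(n-1)/2}\Lambda_2 \subset\mathbb{R}^2$ (the scaled hexagonal lattice of density $2\cdot 3^{n-1}$). Let $A_2(2\cdot3^{n-1})$ and $B_2(2\cdot3^{n-1})$ denote the sharp lower and upper spectral bounds of the Gaussian Gabor frame operator $S_{\Lambda_2(2\cdot3^{n-1})}$ on $L^2(\mathbb{R})$. Then for every integer $n\ge1$ $$B_2(2\cdot3^{n}) = \frac{B_2(2\cdot3^{n-1})+2A_2(2\cdot3^{n-1})}{3}$$ and $$A_2(2\cdot3^{n}) = \sqrt[3]{A_2(2\cdot3^{n-1})\,\frac{A_2(2\cdot3^{n-1})^2+A_2(2\cdot3^{n-1})B_2(2\cdot3^{n-1})+B_2(2\cdot3^{n-1})^2}{3}}\,.$$ Moreover $B_2(2)/A_2(2)=\sqrt[3]{2}$, and $$A_2(2) = \frac{1}{2\mathcal{L}_+} = \frac{1}{\mathsf{ag}_3(\sqrt[3]{2},1)} = b\!\left(e^{-\frac{2\pi}{\sqrt3}}\right) = 0.920371\ldots,$$ where $\mathcal{L}_+$ is the conjectural value of Landau's constant, $\mathsf{ag}_3$ is the cubic arithmetic-geometric mean and $b$ is the cubic analogue of $\theta_4^2$.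
   Context: Inner product and norm on $L^2(\mathbb{R})$: $\langle f,g\rangle = \int_{\mathbb{R}} f(t)\overline{g(t)}\,dt$, $\|f\|_2^2=\langle f,f\rangle$. Time-frequency shifts: for $(x,\omega)\in\mathbb{R}^2$, $\pi(x,\omega) f(t) = e^{2\pi i \omega t} f(t-x)$. Normalized Gaussian: $\varphi(t) = 2^{1/4}e^{-\pi t^2}$, so $\|\varphi\|_2=1$. Lattices: a lattice is $\Lambda = M\mathbb{Z}^2$ with $M\in \mathrm{GL}(2,\mathbb{R})$; its co-volume is $\mathrm{vol}(\Lambda)=|\det M|$ and its density is $\mathrm{vol}(\Lambda)^{-1}$. Gaussian Gabor frame operator (normalized by the co-volume): $S_\Lambda f = \mathrm{vol}(\Lambda)\sum_{\lambda\in\Lambda}\langle f,\pi(\lambda)\varphi\rangle\,\pi(\lambda)\varphi$ for $f \in L^2(\mathbb{R})$. Its sharp spectral bounds are the largest constant $A_\Lambda$ and the smallest constant $B_\Lambda$ such that $A_\Lambda\|f\|_2^2\le \langle S_\Lambda f,f\rangle = \mathrm{vol}(\Lambda)\sum_{\lambda\in\Lambda}|\langle f,\pi(\lambda)\varphi\rangle|^2\le B_\Lambda\|f\|_2^2$ for all $f\in L^2(\mathbb{R})$. Cubic arithmetic-geometric mean: for reals $a_0>b_0>0$, $\mathsf{ag}_3(a_0,b_0)$ is the common limit of the sequences $a_{n+1}=\frac{a_n+2b_n}{3}$, $b_{n+1}=\sqrt[3]{b_n\,\frac{a_n^2+a_nb_n+b_n^2}{3}}$ (real cube root). Cubic theta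 function: $b(q)=\sum_{m,n\in\mathbb{Z}}\zeta^{n-m}q^{m^2+mn+n^2}$ for $0<|q|<1$, where $\zeta^3=1$, $\zeta\ne1$. Conjectural value of Landau's constant: $\mathcal{L}_+=\dfrac{\Gamma(\frac13)\Gamma(\frac56)}{\Gamma(\frac16)}$, with $\Gamma$ Euler's Gamma function. *)

theory Defs
  imports "HOL-Analysis.Analysis"
begin

text \<open>Elements of \<open>L\<^sup>2(\<real>)\<close> are represented by Borel functions. Nothing is lost: every
  Lebesgue class has a Borel representative, and everything below depends only on classes.\<close>

definition L2 :: "(real \<Rightarrow> complex) set" where
  "L2 = {f \<in> borel_measurable lborel. integrable lborel (\<lambda>t. (cmod (f t))\<^sup>2)}"

definition L2_inner :: "(real \<Rightarrow> complex) \<Rightarrow> (real \<Rightarrow> complex) \<Rightarrow> complex" where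
  "L2_inner f g = (LINT t|lborel. f t * cnj (g t))"

definition L2_norm :: "(real \<Rightarrow> complex) \<Rightarrow> real" where
  "L2_norm f = sqrt (Re (L2_inner f f))"

text \<open>A point of the time-frequency plane is \<open>p = (x, \<omega>)\<close>.\<close>

definition tf_shift :: "real^2 \<Rightarrow> (real \<Rightarrow> complex) \<Rightarrow> real \<Rightarrow> complex" where
  "tf_shift p f t = exp (2 * complex_of_real pi * \<i> * complex_of_real (p $ 2 * t)) * f (t - p $ 1)"

definition gaussian :: "real \<Rightarrow> complex" where
  "gaussian t = complex_of_real (2 powr (1/4) * exp (- pi * t\<^sup>2))"

definition lattice_of :: "real^2^2 \<Rightarrow> (real^2) set" where
  "lattice_of M = {M *v z | z. \<forall>i. z $ i \<in> \<int>}"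

text \<open>The value \<open>\<bar>det M\<bar>\<close> does not depend on the choice of the generating matrix \<open>M\<close>.\<close>

definition covolume :: "(real^2) set \<Rightarrow> real" where
  "covolume \<Lambda> = (THE v. \<exists>M. invertible M \<and> \<Lambda> = lattice_of M \<and> v = \<bar>det M\<bar>)"

text \<open>The frame series converges unconditionally in \<open>L\<^sup>2(\<real>)\<close>, but in general not pointwise
  (the modulations do not decay), so its sum is the limit in the \<open>L\<^sup>2\<close> norm of the net of finite
  partial sums. This determines the sum up to a null set; \<open>SOME\<close> selects a representative.\<close>

definition L2_has_sum :: "('i \<Rightarrow> real \<Rightarrow> complex) \<Rightarrow> 'i set \<Rightarrow> (real \<Rightarrow> complex) \<Rightarrow> bool" where
  "L2_has_sum u I g \<longleftrightarrow> g \<in> L2 \<and>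
     ((\<lambda>F. L2_norm (\<lambda>t. (\<Sum>i\<in>F. u i t) - g t)) \<longlongrightarrow> 0) (finite_subsets_at_top I)"

definition gabor_frame_op :: "(real^2) set \<Rightarrow> (real \<Rightarrow> complex) \<Rightarrow> real \<Rightarrow> complex" where
  "gabor_frame_op \<Lambda> f = (\<lambda>t. complex_of_real (covolume \<Lambda>) *
     (SOME g. L2_has_sum
        (\<lambda>p t. L2_inner f (tf_shift p gaussian) * tf_shift p gaussian t) \<Lambda> g) t)"

text \<open>The inner product \<open>\<langle>S f, f\<rangle>\<close> is real, being equal to
  \<open>vol(\<Lambda>) \<Sum>\<^sub>p \<bar>\<langle>f, \<pi>(p) \<phi>\<rangle>\<bar>\<^sup>2\<close>; \<open>Re\<close> below only changes the type.\<close>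

definition lower_spectral_bound :: "(real^2) set \<Rightarrow> real" where
  "lower_spectral_bound \<Lambda> =
     (GREATEST A. \<forall>f\<in>L2. A * (L2_norm f)\<^sup>2 \<le> Re (L2_inner (gabor_frame_op \<Lambda> f) f))"

definition upper_spectral_bound :: "(real^2) set \<Rightarrow> real" where
  "upper_spectral_bound \<Lambda> =
     (LEAST B. \<forall>f\<in>L2. Re (L2_inner (gabor_frame_op \<Lambda> f) f) \<le> B * (L2_norm f)\<^sup>2)"

text \<open>\<open>hex_matrix\<close> is given by its rows; it has determinant 1.\<close>

definition hex_matrix :: "real^2^2" where
  "hex_matrix = sqrt (2 / sqrt 3) *\<^sub>R vector [vector [1, 1/2], vector [0, sqrt 3 / 2]]"

text \<open>The hexagonal lattice of density \<open>\<delta>\<close>; for \<open>\<delta> = 2 \<cdot> 3\<^bsup>n-1\<^esup>\<close> the scaling factor is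
  \<open>2\<^bsup>-1/2\<^esup> 3\<^bsup>-(n-1)/2\<^esup>\<close>.\<close>

definition hex_lattice :: "real \<Rightarrow> (real^2) set" where
  "hex_lattice \<delta> = (\<lambda>v. (\<delta> powr (-1/2)) *\<^sub>R v) ` lattice_of hex_matrix"

definition A2 :: "real \<Rightarrow> real" where
  "A2 \<delta> = lower_spectral_bound (hex_lattice \<delta>)"

definition B2 :: "real \<Rightarrow> real" where
  "B2 \<delta> = upper_spectral_bound (hex_lattice \<delta>)"

primrec ag3_seq :: "real \<Rightarrow> real \<Rightarrow> nat \<Rightarrow> real \<times> real" where
  "ag3_seq a0 b0 0 = (a0, b0)"
| "ag3_seq a0 b0 (Suc n) =
     (let (a, b) = ag3_seq a0 b0 n
      in ((a + 2 * b) / 3, root 3 (b * ((a\<^sup>2 + a * b + b\<^sup>2) / 3))))"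

definition ag3 :: "real \<Rightarrow> real \<Rightarrow> real" where
  "ag3 a0 b0 = (THE L. (\<lambda>n. fst (ag3_seq a0 b0 n)) \<longlonglongrightarrow> L \<and> (\<lambda>n. snd (ag3_seq a0 b0 n)) \<longlonglongrightarrow> L)"

text \<open>The primitive cube root of unity is \<open>cis (2\<pi>/3)\<close>; swapping \<open>m\<close> and \<open>n\<close> shows that its
  conjugate gives the same function. The exponent \<open>m\<^sup>2 + m n + n\<^sup>2\<close> is nonnegative.\<close>

definition cubic_theta_b :: "complex \<Rightarrow> complex" where
  "cubic_theta_b q =
     (\<Sum>\<^sub>\<infinity>(m, n)\<in>(UNIV :: (int \<times> int) set).
        cis (2 * pi / 3) powi (n - m) * q powi (m\<^sup>2 + m * n + n\<^sup>2))"

definition landau_plus :: real where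
  "landau_plus = Gamma (1/3) * Gamma (5/6) / Gamma (1/6)"

end

theory Submission
  imports Defs "HOL-Probability.Characteristic_Functions"
begin

text \<open>
  Since the density \<open>\<delta> = 2 \<cdot> 3\<^sup>n\<close> is an even integer, the time-frequency shifts over the adjoint
  lattice commute. Janssen's representation, which is Poisson summation for Gaussians extended by
  density, turns the normalized frame operator into \<open>\<Sum> q\<^bsup>Q(k)\<^esup> U\<^sub>k\<close> with a unitary representation \<open>U\<close>
  of \<open>\<int>\<^sup>2\<close>, \<open>Q(m, n) = m\<^sup>2 + m n + n\<^sup>2\<close> and \<open>q = exp (-\<pi>\<delta>/\<surd>3)\<close>. Its spectral bounds are the extrema of
  the symbol \<open>\<Sum> q\<^bsup>Q(k)\<^esup> \<chi>(k)\<close> over the characters \<open>\<chi>\<close> of \<open>\<int>\<^sup>2\<close>: positivity of Toeplitz forms gives the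
  bounds, and functions concentrated on one character give their sharpness. The maximum is \<open>a(q)\<close>,
  attained at the trivial character; the minimum is \<open>b(q)\<close>, attained where \<open>\<chi>\<close> takes cube roots of
  unity as values.

  Tripling the density replaces \<open>q\<close> by \<open>q\<^sup>3\<close>, so the recursion is the cubic transformation of the Borweins,
  \<open>a(q\<^sup>3) = (a(q) + 2b(q))/3\<close> and \<open>b(q\<^sup>3)\<^sup>3 = b(q)(a(q)\<^sup>2 + a(q)b(q) + b(q)\<^sup>2)/3\<close>. The modular inversion of \<open>a\<close> gives
  \<open>a\<^sup>3 = 2b\<^sup>3\<close> at \<open>q = exp (-2\<pi>/\<surd>3)\<close>. Iterating the transformation from there yields the cubic mean and, since
  the hypergeometric function \<open>F(1/3, 2/3; 1; z)\<close> obeys the same transformation, \<open>a(q) = F(1/3, 2/3; 1; 1/2)\<close>,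
  a quotient of Gamma values.
\<close>

section \<open>The cubic hypergeometric function\<close>

text \<open>The hard inequality is the location of the minimum of the symbol. It is treated as a
  perturbation problem: one number \<open>s\<close> measures how far a character is from the two
  minimizing ones, the contribution of each permutation orbit of lattice vectors differs from its
  value there by at most a multiple of \<open>s^2\<close>, and the six shortest vectors contribute
  an exact gain of the same order. This works for small nomes; the bound 1/32 suffices, and the
  largest nome that occurs, exp (-2 pi / sqrt 3), is about 0.027. The densities are twice an odd
  integer. Evenness makes the adjoint shifts commute, oddness determines the signs that make all
  coefficients of the symbol positive. The cubic identity is obtained by multiplying three
  one-variable theta series in two ways, so neither infinite products nor modular forms enter. The
  inversion carries the cube root of exp (-2 pi / sqrt 3) to its cube; tripling connects both with
  the nome itself, and the relations close up to one equation. Elements of L2 are functions and the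
  frame sum is fixed only up to a null set, so the operator is identified through its inner
  products.\<close>

definition cubic_hyp_coeff :: "nat \<Rightarrow> real" where
  "cubic_hyp_coeff n = pochhammer (1/3) n * pochhammer (2/3) n / (fact n)\<^sup>2"

definition cubic_hyp :: "real \<Rightarrow> real" where
  "cubic_hyp z = (\<Sum>n. cubic_hyp_coeff n * z ^ n)"

definition cubic_hyp' :: "real \<Rightarrow> real" where
  "cubic_hyp' z = (\<Sum>n. diffs cubic_hyp_coeff n * z ^ n)"

lemma cubic_hyp_coeff_0 [simp]: "cubic_hyp_coeff 0 = 1"
  by (simp add: cubic_hyp_coeff_def)

text \<open>The factor n^2 + n + 2/9 is (n + 1/3)(n + 2/3).\<close>

lemma cubic_hyp_coeff_Suc:
  "(real n + 1)\<^sup>2 * cubic_hyp_coeff (Suc n) = (real n ^ 2 + real n + 2/9) * cubic_hyp_coeff n"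
proof -
  have *: "(real n + 1)\<^sup>2 * (a * (1/3 + real n) * (b * (2/3 + real n)) / ((real n + 1) * f)\<^sup>2)
     = (real n ^ 2 + real n + 2/9) * (a * b / f\<^sup>2)" if "f > 0" for a b f :: real
  proof -
    have 1: "real n + 1 \<noteq> 0" by linarith
    have "(real n + 1)\<^sup>2 * (a * (1/3 + real n) * (b * (2/3 + real n)) / ((real n + 1) * f)\<^sup>2)
       = a * (1/3 + real n) * (b * (2/3 + real n)) / f\<^sup>2"
      using 1 by (simp add: power_mult_distrib)
    also have "\<dots> = (real n ^ 2 + real n + 2/9) * (a * b / f\<^sup>2)"
      by (simp add: field_simps power2_eq_square)
    finally show ?thesis .
  qed
  show ?thesis
    using *[of "fact n" "pochhammer (1/3) n" "pochhammer (2/3) n"]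
    by (simp add: cubic_hyp_coeff_def pochhammer_Suc add.commute)
qed

lemma cubic_hyp_coeff_pos: "cubic_hyp_coeff n > 0"
  by (simp add: cubic_hyp_coeff_def pochhammer_pos)

lemma cubic_hyp_coeff_le_1: "cubic_hyp_coeff n \<le> 1"
proof (induction n)
  case (Suc n)
  have "(real n + 1)\<^sup>2 * cubic_hyp_coeff (Suc n) \<le> (real n + 1)\<^sup>2 * 1"
    unfolding cubic_hyp_coeff_Suc
    by (intro mult_mono Suc.IH) (auto simp: power2_eq_square algebra_simps cubic_hyp_coeff_pos less_imp_le)
  then show ?case
    by (subst (asm) mult_le_cancel_left_pos) auto
qed simp

lemma summable_cubic_hyp:
  assumes "\<bar>z\<bar> < 1" shows "summable (\<lambda>n. cubic_hyp_coeff n * z ^ n)"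
proof (rule summable_comparison_test')
  show "summable (\<lambda>n. \<bar>z\<bar> ^ n)" using assms by (simp add: summable_geometric)
  show "norm (cubic_hyp_coeff n * z ^ n) \<le> \<bar>z\<bar> ^ n" if "n \<ge> 0" for n
    using cubic_hyp_coeff_le_1[of n] cubic_hyp_coeff_pos[of n]
    by (simp add: abs_mult power_abs mult_left_le_one_le)
qed

lemma cubic_hyp_deriv:
  assumes "\<bar>z\<bar> < 1" shows "(cubic_hyp has_real_derivative cubic_hyp' z) (at z)"
proof -
  obtain K where K: "\<bar>z\<bar> < K" "K < 1" using assms dense by blast
  show ?thesis unfolding cubic_hyp_def[abs_def] cubic_hyp'_def
    by (rule termdiffs_strong[of _ K]) (use K in \<open>auto intro: summable_cubic_hyp\<close>)
qed

text \<open>This is the hypergeometric equation in self-adjoint form. For the parameters 1/3, 2/3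
  and 1 the first-order coefficient 1 - 2z is the derivative of z(1 - z), so no second derivative
  has to be introduced.\<close>

lemma cubic_hyp_ode:
  assumes z: "\<bar>z\<bar> < 1"
  shows "((\<lambda>z. z * (1 - z) * cubic_hyp' z) has_real_derivative (2/9) * cubic_hyp z) (at z)"
proof -
  \<comment> \<open>\<open>d\<close> lists the coefficients of the termwise antiderivative of (2/9)
    F; the recursion \<open>dS\<close> recognizes them as those of z(1 - z) F'.\<close>
  define d where "d n = (case n of 0 \<Rightarrow> 0 | Suc n \<Rightarrow> (2/9) * cubic_hyp_coeff n / (real n + 1))" for n
  have dS: "d (Suc n) = (real n + 1) * cubic_hyp_coeff (Suc n) - real n * cubic_hyp_coeff n" for n
  proof -
    have "(real n + 1) * d (Suc n)
        = (real n + 1) * ((real n + 1) * cubic_hyp_coeff (Suc n) - real n * cubic_hyp_coeff n)"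
    proof -
      have "real n + 1 \<noteq> 0" by linarith
      then have "(real n + 1) * d (Suc n) = (2/9) * cubic_hyp_coeff n"
        using nonzero_mult_div_cancel_left[of "real n + 1" "(2/9) * cubic_hyp_coeff n"]
        by (simp add: d_def del: nonzero_mult_div_cancel_left)
      then show ?thesis
        using cubic_hyp_coeff_Suc[of n] by (simp add: power2_eq_square algebra_simps)
    qed
    then show ?thesis by simp
  qed
  have D: "(\<lambda>n. d n * w ^ n) sums (w * (1 - w) * cubic_hyp' w)" if w: "\<bar>w\<bar> < 1" for w
  proof -
    obtain K where K: "\<bar>w\<bar> < K" "K < 1" using w dense by blast
    have "summable (\<lambda>n. diffs cubic_hyp_coeff n * w ^ n)"
      by (rule termdiff_converges[of _ 1]) (use w summable_cubic_hyp in auto)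
    then have "(\<lambda>n. diffs cubic_hyp_coeff n * w ^ n) sums cubic_hyp' w"
      by (simp add: cubic_hyp'_def summable_sums)
    from sums_mult[OF this, of w]
    have 1: "(\<lambda>n. (real n + 1) * cubic_hyp_coeff (Suc n) * w ^ Suc n) sums (w * cubic_hyp' w)"
      by (simp add: diffs_def algebra_simps)
    then have "(\<lambda>n. real n * cubic_hyp_coeff n * w ^ n) sums (w * cubic_hyp' w)"
      using sums_Suc_iff[of "\<lambda>n. real n * cubic_hyp_coeff n * w ^ n"] by (simp add: add.commute)
    from sums_diff[OF 1 sums_mult[OF this, of w]]
    have "(\<lambda>n. d (Suc n) * w ^ Suc n) sums (w * (1 - w) * cubic_hyp' w)"
      by (simp add: dS algebra_simps)
    then show ?thesis
      using sums_Suc_iff[of "\<lambda>n. d n * w ^ n"] by (simp add: d_def)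
  qed
  obtain K where K: "\<bar>z\<bar> < K" "K < 1" using z dense by blast
  have "((\<lambda>w. \<Sum>n. d n * w ^ n) has_real_derivative (\<Sum>n. diffs d n * z ^ n)) (at z)"
    by (rule termdiffs_strong[of _ K]) (use K D[of K] in \<open>auto intro: sums_summable\<close>)
  moreover have "(\<Sum>n. diffs d n * z ^ n) = (2/9) * cubic_hyp z"
    unfolding cubic_hyp_def
    by (subst suminf_mult[symmetric])
       (use z summable_cubic_hyp in \<open>auto simp: diffs_def d_def field_simps intro!: suminf_cong\<close>)
  ultimately have "((\<lambda>w. \<Sum>n. d n * w ^ n) has_real_derivative (2/9) * cubic_hyp z) (at z)" by simp
  moreover have ev: "eventually (\<lambda>w. (\<Sum>n. d n * w ^ n) = w * (1 - w) * cubic_hyp' w) (nhds z)"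
  proof -
    have "eventually (\<lambda>w. w \<in> {-1<..<1}) (nhds z)"
      using z by (intro eventually_nhds_in_open) auto
    then show ?thesis
      by eventually_elim (use D in \<open>auto simp: abs_less_iff intro: sums_unique[symmetric]\<close>)
  qed
  ultimately show ?thesis
    using DERIV_cong_ev[OF refl ev refl] by blast
qed

lemma cubic_hyp_ge_1:
  assumes "0 \<le> z" "z < 1" shows "cubic_hyp z \<ge> 1"
proof -
  have "(\<Sum>n<1. cubic_hyp_coeff n * z ^ n) \<le> cubic_hyp z" unfolding cubic_hyp_def
    by (rule sum_le_suminf) (use assms summable_cubic_hyp in \<open>auto simp: cubic_hyp_coeff_pos less_imp_le\<close>)
  then show ?thesis by simp
qed

lemma cubic_hyp_0 [simp]: "cubic_hyp 0 = 1"
  by (simp add: cubic_hyp_def powser_zero)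

text \<open>Both sides, the right one as a function of \<open>x\<close> and the left one divided by \<open>1 + 2x\<close>, solve
  \<open>(x(1-x\<^sup>3)y')' = 2x\<^sup>2y\<close>. The Wronskian vanishes because the leading coefficient does at \<open>0\<close>.\<close>

lemma cubic_hyp_transformation:
  assumes "0 \<le> x" "x < 1"
  shows "cubic_hyp (1 - ((1 - x) / (1 + 2 * x)) ^ 3) = (1 + 2 * x) * cubic_hyp (x ^ 3)"
proof -
  \<comment> \<open>This fractional linear map is its own inverse. In the application it takes the
    ratio b/a at one nome to the number whose cube is the hypergeometric argument at the cubed
    nome.\<close>
  define s where "s x = (1 - x) / (1 + 2 * x)" for x :: real
  define z where "z x = 1 - s x ^ 3" for x
  define p where "p x = x * (1 - x ^ 3)" for x :: real
  define D where "D z = z * (1 - z) * cubic_hyp' z" for z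
  define y1 where "y1 x = cubic_hyp (x ^ 3)" for x
  define y2 where "y2 x = cubic_hyp (z x) / (1 + 2 * x)" for x
  define y1' where "y1' x = 3 * x\<^sup>2 * cubic_hyp' (x ^ 3)" for x
  define z' where "z' x = 9 * (s x)\<^sup>2 / (1 + 2 * x)\<^sup>2" for x
  define y2' where "y2' x = (cubic_hyp' (z x) * z' x * (1 + 2 * x) - 2 * cubic_hyp (z x)) / (1 + 2 * x)\<^sup>2" for x
  \<comment> \<open>\<open>P1\<close> and \<open>P2\<close> are p y1' and p y2' rewritten through
    \<open>D\<close>, whose derivative the differential equation provides; this keeps second
    derivatives out of the argument.\<close>
  define P1 where "P1 x = 3 * D (x ^ 3)" for x
  define P2 where "P2 x = (1 + 2 * x) * D (z x) - 2 * p x / (1 + 2 * x)\<^sup>2 * cubic_hyp (z x)" for x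
  have s': "(s has_real_derivative (- 3 / (1 + 2 * x)\<^sup>2)) (at x)" if "x \<ge> 0" for x
    unfolding s_def[abs_def] using that
    by (auto intro!: derivative_eq_intros simp: field_simps power2_eq_square)
  have sI: "0 < s x" "s x \<le> 1" if "0 \<le> x" "x < 1" for x
    using that by (auto simp: s_def field_simps)
  have zI: "0 \<le> z x" "z x < 1" if "0 \<le> x" "x < 1" for x
    using sI[OF that] power_le_one[of "s x" 3] by (auto simp: z_def)
  have zder: "(z has_real_derivative z' x) (at x)" if "x \<ge> 0" for x
    unfolding z_def[abs_def] z'_def using that
    by (auto intro!: derivative_eq_intros s' simp: field_simps)
  have x3: "0 \<le> x ^ 3" "x ^ 3 < 1" if "0 \<le> x" "x < 1" for x :: real
    using that power_strict_mono[of x 1 3] by auto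
  have y1d: "(y1 has_real_derivative y1' x) (at x)" if x: "0 \<le> x" "x < 1" for x
  proof -
    have "((\<lambda>x::real. x ^ 3) has_real_derivative 3 * x\<^sup>2) (at x)"
      by (auto intro!: derivative_eq_intros)
    from DERIV_chain2[OF cubic_hyp_deriv this] show ?thesis
      unfolding y1_def[abs_def] y1'_def using x3[OF x] by (simp add: mult.commute)
  qed
  have lin: "((\<lambda>x. 1 + 2 * x) has_real_derivative 2) (at x)" for x :: real
    by (auto intro!: derivative_eq_intros)
  have Dd: "(D has_real_derivative (2/9) * cubic_hyp z) (at z)" if "\<bar>z\<bar> < 1" for z
    unfolding D_def[abs_def] by (rule cubic_hyp_ode[OF that])
  have y2d: "(y2 has_real_derivative y2' x) (at x)" if x: "0 \<le> x" "x < 1" for x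
    using DERIV_divide[OF DERIV_chain2[OF cubic_hyp_deriv zder] lin, of x] x zI[OF x]
    unfolding y2_def[abs_def] y2'_def by (simp add: power2_eq_square algebra_simps)
  have P1d: "(P1 has_real_derivative 2 * x\<^sup>2 * y1 x) (at x)" if x: "0 \<le> x" "x < 1" for x
  proof -
    have "((\<lambda>x::real. x ^ 3) has_real_derivative 3 * x\<^sup>2) (at x)"
      by (auto intro!: derivative_eq_intros)
    from DERIV_cmult[OF DERIV_chain2[OF Dd this], of 3] show ?thesis
      unfolding P1_def[abs_def] y1_def using x3[OF x] by (simp add: mult_ac)
  qed
  have P1: "P1 x = p x * y1' x" for x
    by (simp add: P1_def p_def y1'_def D_def power2_eq_square power3_eq_cube)
  have ps: "p x = (1 - x) * z x * (1 + 2 * x) ^ 3 / 9" if "0 \<le> x" for x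
  proof -
    have "z x * (1 + 2 * x) ^ 3 = (1 + 2 * x) ^ 3 - (1 - x) ^ 3"
      using that by (simp add: z_def s_def power_divide field_simps)
    also have "\<dots> = 9 * (x * (1 + x + x\<^sup>2))" by (simp add: power2_eq_square power3_eq_cube algebra_simps)
    finally have e: "z x * (1 + 2 * x) ^ 3 = 9 * (x * (1 + x + x\<^sup>2))" .
    have "(1 - x) * z x * (1 + 2 * x) ^ 3 / 9 = (1 - x) * (z x * (1 + 2 * x) ^ 3) / 9" by simp
    also have "\<dots> = p x" unfolding e by (simp add: p_def power2_eq_square power3_eq_cube algebra_simps diff_divide_distrib)
    finally show ?thesis by simp
  qed
  \<comment> \<open>The leading coefficients of the two equations match under the substitution
    \<open>z\<close>. This is what allows p y2' to be expressed through
    \<open>D (z x)\<close>.\<close>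
  have pz: "p x * z' x / (1 + 2 * x)\<^sup>2 = z x * (1 - z x)" if "0 \<le> x" for x
  proof -
    have "1 - x = (1 + 2 * x) * s x" using that by (simp add: s_def)
    then have p: "p x = (1 + 2 * x) * s x * z x * (1 + 2 * x) ^ 3 / 9" using ps[OF that] by simp
    have *: "w * s x * z x * w ^ 3 / 9 * (9 * (s x)\<^sup>2 / w\<^sup>2) / w\<^sup>2 = s x ^ 3 * z x"
      if "w \<noteq> 0" for w
      using that by (simp add: divide_simps power2_eq_square power3_eq_cube)
    from *[of "1 + 2 * x"] have "p x * z' x / (1 + 2 * x)\<^sup>2 = s x ^ 3 * z x"
      using that unfolding p z'_def by simp
    then show ?thesis by (simp add: z_def)
  qed
  have P2: "P2 x = p x * y2' x" if "0 \<le> x" for x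
  proof -
    have "p x * y2' x = (1 + 2 * x) * (p x * z' x / (1 + 2 * x)\<^sup>2) * cubic_hyp' (z x)
        - 2 * p x / (1 + 2 * x)\<^sup>2 * cubic_hyp (z x)"
      by (simp add: y2'_def diff_divide_distrib algebra_simps)
    then show ?thesis by (simp add: P2_def D_def pz[OF that])
  qed
  \<comment> \<open>The derivative of 2p / (1 + 2x)^2 in closed form, so that the zeroth-order terms
    can be collected in \<open>e2\<close>; the first-order terms cancel by
    \<open>e1\<close>.\<close>
  define r' where "r' x = 2 * (1 - 2 * x - 4 * x ^ 3 - 4 * x ^ 4) / (1 + 2 * x) ^ 3" for x :: real
  have r'd: "((\<lambda>x. 2 * p x / (1 + 2 * x)\<^sup>2) has_real_derivative r' x) (at x)" if x: "0 \<le> x" for x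
  proof -
    have 1: "1 + 2 * x \<noteq> 0" using x by auto
    have d: "((\<lambda>x. 2 * p x / (1 + 2 * x)\<^sup>2) has_real_derivative
       (2 * (1 - 4 * x ^ 3) * (1 + 2 * x)\<^sup>2 - 2 * p x * (4 * (1 + 2 * x))) / ((1 + 2 * x)\<^sup>2 * (1 + 2 * x)\<^sup>2)) (at x)"
      unfolding p_def
      by (rule derivative_eq_intros refl | use x in \<open>simp; fail\<close>)+
         (use x in \<open>auto simp: algebra_simps power2_eq_square power3_eq_cube\<close>)
    have "2 * (1 - 4 * x ^ 3) * (1 + 2 * x)\<^sup>2 - 2 * p x * (4 * (1 + 2 * x))
       = (1 + 2 * x) * (2 * (1 - 2 * x - 4 * x ^ 3 - 4 * x ^ 4))"
      by (simp add: p_def power2_eq_square power3_eq_cube power4_eq_xxxx algebra_simps)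
    then have "(2 * (1 - 4 * x ^ 3) * (1 + 2 * x)\<^sup>2 - 2 * p x * (4 * (1 + 2 * x))) / ((1 + 2 * x)\<^sup>2 * (1 + 2 * x)\<^sup>2) = r' x"
      using 1 unfolding r'_def by (simp add: divide_simps power2_eq_square power3_eq_cube)
    with d show ?thesis by simp
  qed
  have P2d: "(P2 has_real_derivative 2 * x\<^sup>2 * y2 x) (at x)" if x: "0 \<le> x" "x < 1" for x
  proof -
    have 1: "1 + 2 * x > 0" using x by auto
    have d: "(P2 has_real_derivative (2 * D (z x) + (1 + 2 * x) * ((2/9) * cubic_hyp (z x) * z' x)
       - (r' x * cubic_hyp (z x) + 2 * p x / (1 + 2 * x)\<^sup>2 * (cubic_hyp' (z x) * z' x)))) (at x)"
      using DERIV_diff[OF DERIV_mult[OF lin[of x] DERIV_chain2[OF Dd zder[OF x(1)]]]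
              DERIV_mult[OF r'd[OF x(1)] DERIV_chain2[OF cubic_hyp_deriv zder[OF x(1)]]]] x zI[OF x]
      unfolding P2_def[abs_def] by (simp add: algebra_simps)
    have "2 * p x / (1 + 2 * x)\<^sup>2 * (cubic_hyp' (z x) * z' x) = 2 * (p x * z' x / (1 + 2 * x)\<^sup>2) * cubic_hyp' (z x)"
      by simp
    also have "\<dots> = 2 * D (z x)" by (simp add: pz x D_def)
    finally have e1: "2 * p x / (1 + 2 * x)\<^sup>2 * (cubic_hyp' (z x) * z' x) = 2 * D (z x)" .
    have e2: "(1 + 2 * x) * ((2/9) * z' x) - r' x = 2 * x\<^sup>2 / (1 + 2 * x)"
    proof -
      have "(1 + 2 * x) * ((2/9) * z' x) = 2 * (1 - x)\<^sup>2 / (1 + 2 * x) ^ 3"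
        using 1 by (simp add: z'_def s_def power_divide power2_eq_square power3_eq_cube divide_simps)
      then have "(1 + 2 * x) * ((2/9) * z' x) - r' x
         = (2 * (1 - x)\<^sup>2 - 2 * (1 - 2 * x - 4 * x ^ 3 - 4 * x ^ 4)) / (1 + 2 * x) ^ 3"
        by (simp add: r'_def diff_divide_distrib)
      also have "2 * (1 - x)\<^sup>2 - 2 * (1 - 2 * x - 4 * x ^ 3 - 4 * x ^ 4) = 2 * x\<^sup>2 * (1 + 2 * x)\<^sup>2"
        by (simp add: power2_eq_square power3_eq_cube power4_eq_xxxx algebra_simps)
      finally show ?thesis using 1 by (simp add: power2_eq_square power3_eq_cube divide_simps)
    qed
    have "2 * D (z x) + (1 + 2 * x) * ((2/9) * cubic_hyp (z x) * z' x)
       - (r' x * cubic_hyp (z x) + 2 * p x / (1 + 2 * x)\<^sup>2 * (cubic_hyp' (z x) * z' x))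
       = ((1 + 2 * x) * ((2/9) * z' x) - r' x) * cubic_hyp (z x)"
      unfolding e1 by (simp add: algebra_simps)
    also have "\<dots> = 2 * x\<^sup>2 * y2 x" unfolding e2 by (simp add: y2_def)
    finally show ?thesis using d by simp
  qed
  have W: "P1 x * y2 x - P2 x * y1 x = 0" if x: "0 \<le> x" "x < 1" for x
  proof (cases "x = 0")
    case True
    then show ?thesis by (simp add: P1_def P2_def D_def p_def z_def s_def)
  next
    case False
    have der: "((\<lambda>x. P1 x * y2 x - P2 x * y1 x) has_real_derivative 0) (at t)" if t: "0 \<le> t" "t < 1" for t
      by (rule derivative_eq_intros P1d P2d y1d y2d refl t)+
         (simp add: P1 P2[OF t(1)] algebra_simps)
    have "P1 x * y2 x - P2 x * y1 x = P1 0 * y2 0 - P2 0 * y1 0"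
    proof (rule DERIV_isconst2[where f = "\<lambda>x. P1 x * y2 x - P2 x * y1 x" and a = 0 and b = x and x = x])
      show "continuous_on {0..x} (\<lambda>x. P1 x * y2 x - P2 x * y1 x)"
        using x by (intro continuous_at_imp_continuous_on ballI DERIV_isCont[OF der]) auto
    qed (use der x False in auto)
    also have "\<dots> = 0" by (simp add: P1_def P2_def D_def p_def z_def s_def)
    finally show ?thesis .
  qed
  have y1pos: "y1 t > 0" if t: "0 \<le> t" "t < 1" for t
    using cubic_hyp_ge_1[OF x3[OF t]] by (simp add: y1_def)
  have "y2 x / y1 x = y2 0 / y1 0"
  proof (cases "x = 0")
    case False
    have der: "((\<lambda>x. y2 x / y1 x) has_real_derivative (y2' t * y1 t - y2 t * y1' t) / (y1 t * y1 t)) (at t)"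
      if t: "0 \<le> t" "t < 1" for t
      using DERIV_divide[OF y2d[OF t] y1d[OF t]] y1pos[OF t] by simp
    \<comment> \<open>The Wronskian is known only after multiplication by p, which vanishes at 0.
      The open interval is enough because the quotient is continuous up to the endpoint.\<close>
    have z: "y2' t * y1 t - y2 t * y1' t = 0" if t: "0 < t" "t < 1" for t
    proof -
      have "p t * (y2' t * y1 t - y2 t * y1' t) = - (P1 t * y2 t - P2 t * y1 t)"
        using t by (simp add: P1 P2 algebra_simps)
      then have "p t * (y2' t * y1 t - y2 t * y1' t) = 0"
        using W[of t] t by simp
      moreover have "p t > 0" using t x3[of t] by (simp add: p_def)
      ultimately show ?thesis by simp
    qed
    show ?thesis
    proof (rule DERIV_isconst2[where f = "\<lambda>x. y2 x / y1 x" and a = 0 and b = x and x = x])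
      show "continuous_on {0..x} (\<lambda>x. y2 x / y1 x)"
        using assms by (intro continuous_at_imp_continuous_on ballI DERIV_isCont[OF der]) auto
      show "((\<lambda>x. y2 x / y1 x) has_real_derivative 0) (at t)" if "0 < t" "t < x" for t
        using der[of t] z[of t] that assms by simp
    qed (use assms False in auto)
  qed simp
  also have "y2 0 / y1 0 = 1" by (simp add: y1_def y2_def z_def s_def)
  finally show ?thesis
    using y1pos[of x] assms by (simp add: y1_def y2_def z_def s_def field_simps)
qed

text \<open>Euler's integral with the binomial series of (1 - t/2)^(-1/3) integrated term by term.
  At the argument 1/2 the factors (1 - t/2)^(-1/3) and t^(-1/3) have equal exponents, and t = 1 -
  sqrt v turns their bases into the product (1 - v)/2; what remains is the Beta integral with
  parameters 1/6 and 2/3.\<close>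

lemma cubic_hyp_half:
  "cubic_hyp (1/2) = 2 powr (1/3) * Gamma (1/6) / (2 * Gamma (1/3) * Gamma (5/6))"
proof -
  define C :: real where "C = Gamma (2/3) * Gamma (1/3)"
  define h where "h n t = (pochhammer (1/3) n / fact n * (1/2) ^ n) *
     (t powr (real n + 2/3 - 1) * (1 - t) powr (1/3 - 1))" for n and t :: real
  define g where "g t = (1 - t/2) powr (-1/3) * (t powr (2/3 - 1) * (1 - t) powr (1/3 - 1))" for t :: real
  have hI: "(h n has_integral (cubic_hyp_coeff n * (1/2) ^ n * C)) {0<..<1}" for n
  proof -
    have np: "(2/3 :: real) \<notin> \<int>\<^sub>\<le>\<^sub>0" by (auto elim!: nonpos_Ints_cases)
    have "Gamma (2/3 :: real) \<noteq> 0" by (rule less_imp_neq[OF Gamma_real_pos, symmetric]) simp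
    then have "Beta (real n + 2/3) (1/3) = pochhammer (2/3) n * C / fact n"
      using pochhammer_Gamma[OF np, of n] Gamma_fact[of n, where 'a=real]
      by (simp add: Beta_def C_def add.commute)
    then have "pochhammer (1/3) n / fact n * (1/2) ^ n * Beta (real n + 2/3) (1/3)
        = cubic_hyp_coeff n * (1/2) ^ n * C"
      by (simp add: cubic_hyp_coeff_def power2_eq_square)
    moreover have "(h n has_integral pochhammer (1/3) n / fact n * (1/2) ^ n * Beta (real n + 2/3) (1/3)) {0<..<1}"
      unfolding h_def[abs_def]
      using has_integral_mult_right[OF has_integral_Beta_real[of "real n + 2/3" "1/3"],
          of "pochhammer (1/3) n / fact n * (1/2) ^ n"]
      by (simp add: has_integral_Icc_iff_Ioo)
    ultimately show ?thesis by simp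
  qed
  have hpos: "h n t \<ge> 0" for n t
    by (auto simp: h_def intro!: mult_nonneg_nonneg divide_nonneg_pos less_imp_le[OF pochhammer_pos])
  have part: "((\<lambda>t. \<Sum>n<k. h n t) has_integral (\<Sum>n<k. cubic_hyp_coeff n * (1/2) ^ n * C)) {0<..<1}" for k
    by (intro has_integral_sum hI) auto
  have sums: "(\<lambda>n. h n t) sums g t" if t: "t \<in> {0<..<1}" for t
  proof -
    have "(\<lambda>n. (- (1/3) gchoose n) * (- t/2) ^ n) sums (1 + - t/2) powr (- (1/3))"
      by (rule gen_binomial_real) (use t in auto)
    from sums_mult2[OF this, of "t powr (2/3 - 1) * (1 - t) powr (1/3 - 1)"]
    have "(\<lambda>n. (- (1/3) gchoose n) * (- t/2) ^ n * (t powr (2/3 - 1) * (1 - t) powr (1/3 - 1))) sums g t"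
      by (simp add: g_def)
    moreover have "(- (1/3) gchoose n) * (- t/2) ^ n * (t powr (2/3 - 1) * (1 - t) powr (1/3 - 1)) = h n t" for n
    proof -
      have "(- (1/3) gchoose n) * (- t/2) ^ n = pochhammer (1/3) n / fact n * (1/2) ^ n * t ^ n * ((-1) ^ n * (-1) ^ n)"
        by (simp add: gbinomial_pochhammer power_divide power_minus[of "t/2"])
      also have "(-1 :: real) ^ n * (-1) ^ n = 1" by (simp flip: power_mult_distrib)
      also have "t ^ n = t powr real n" using t by (simp add: powr_realpow)
      finally show ?thesis using t
        by (simp add: h_def powr_add[symmetric] mult_ac)
    qed
    ultimately show ?thesis by simp
  qed
  have lim: "(\<lambda>k. \<Sum>n<k. cubic_hyp_coeff n * (1/2) ^ n * C) \<longlonglongrightarrow> cubic_hyp (1/2) * C"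
    using sums_mult2[OF summable_sums[OF summable_cubic_hyp[of "1/2"]], of C]
    by (simp add: sums_def cubic_hyp_def)
  have mc: "g integrable_on {0<..<1} \<and> (\<lambda>k. integral {0<..<1} (\<lambda>t. \<Sum>n<k. h n t)) \<longlonglongrightarrow> integral {0<..<1} g"
  proof (rule monotone_convergence_increasing)
    show "(\<lambda>t. \<Sum>n<k. h n t) integrable_on {0<..<1}" for k using part by blast
    show "(\<Sum>n<k. h n t) \<le> (\<Sum>n<Suc k. h n t)" for k t using hpos by simp
    show "(\<lambda>k. \<Sum>n<k. h n t) \<longlonglongrightarrow> g t" if "t \<in> {0<..<1}" for t
      using sums[OF that] by (simp add: sums_def)
    show "bounded (range (\<lambda>k. integral {0<..<1} (\<lambda>t. \<Sum>n<k. h n t)))"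
      using convergent_imp_bounded[OF lim] by (simp add: integral_unique[OF part])
  qed
  then have gi: "(g has_integral cubic_hyp (1/2) * C) {0<..<1}"
    using LIMSEQ_unique[OF lim, of "integral {0<..<1} g"]
    by (simp add: integral_unique[OF part] has_integral_iff)
  define u where "u v = 1 - sqrt v" for v :: real
  have img: "u ` {0<..<1} = {0<..<1}"
  proof (rule set_eqI, rule iffI)
    fix t :: real assume t: "t \<in> {0<..<1}"
    then have "t = u ((1 - t)\<^sup>2)" by (simp add: u_def)
    moreover have "(1 - t)\<^sup>2 \<in> {0<..<1}" using t power_strict_mono[of "1 - t" 1 2] by simp
    ultimately show "t \<in> u ` {0<..<1}" by blast
  qed (auto simp: u_def)
  \<comment> \<open>The change of variables is formulated for absolutely integrable functions;
    \<open>g\<close> is nonnegative, so its integrability suffices.\<close>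
  have gabs: "g absolutely_integrable_on u ` {0<..<1} \<and> integral (u ` {0<..<1}) g = cubic_hyp (1/2) * C"
    unfolding img using gi
    by (auto simp: has_integral_iff g_def intro!: nonnegative_absolutely_integrable_1)
  have "(\<lambda>v. \<bar>- (inverse (sqrt v) / 2)\<bar> * g (u v)) absolutely_integrable_on {0<..<1} \<and>
     integral {0<..<1} (\<lambda>v. \<bar>- (inverse (sqrt v) / 2)\<bar> * g (u v)) = cubic_hyp (1/2) * C"
  proof (rule iffD2[OF has_absolute_integral_change_of_variables_1' gabs])
    show "(u has_real_derivative - (inverse (sqrt v) / 2)) (at v within {0<..<1})" if "v \<in> {0<..<1}" for v
      unfolding u_def[abs_def] using that by (auto intro!: derivative_eq_intros)
    show "inj_on u {0<..<1}" by (auto simp: inj_on_def u_def)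
  qed simp
  then have "((\<lambda>v. \<bar>- (inverse (sqrt v) / 2)\<bar> * g (u v)) has_integral cubic_hyp (1/2) * C) {0<..<1}"
    by (auto simp: has_integral_iff set_lebesgue_integral_eq_integral)
  moreover have "\<bar>- (inverse (sqrt v) / 2)\<bar> * g (u v)
      = 2 powr (1/3) / 2 * (v powr (1/6 - 1) * (1 - v) powr (2/3 - 1))" if v: "v \<in> {0<..<1}" for v
  proof -
    have "sqrt v < 1" using v by simp
    have s: "sqrt v = v powr (1/2)" using v by (simp add: powr_half_sqrt)
    have "(1 - u v / 2) powr (-1/3) * u v powr (2/3 - 1) = ((1 - u v / 2) * u v) powr (-1/3)"
      using v by (simp add: u_def powr_mult)
    also have "(1 - u v / 2) * u v = (1 - v) * (1/2)"
      using v by (simp add: u_def field_simps)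
    also have "((1 - v) * (1/2)) powr (-1/3) = (1 - v) powr (2/3 - 1) * 2 powr (1/3)"
      using v by (simp add: powr_mult powr_divide powr_minus field_simps)
    finally have "g (u v) = (1 - v) powr (2/3 - 1) * 2 powr (1/3) * (sqrt v) powr (-2/3)"
      by (simp add: g_def u_def mult_ac)
    then have "\<bar>- (inverse (sqrt v) / 2)\<bar> * g (u v) = 2 powr (1/3) / 2 * (1 - v) powr (2/3 - 1) *
        (inverse (sqrt v) * (sqrt v) powr (-2/3))"
      using v by (simp add: mult_ac)
    also have "inverse (sqrt v) * (sqrt v) powr (-2/3) = v powr (1/6 - 1)"
      unfolding s using v by (simp add: powr_powr powr_minus[symmetric] powr_add[symmetric])
    finally show ?thesis by (simp add: mult_ac)
  qed
  ultimately have "((\<lambda>v. 2 powr (1/3) / 2 * (v powr (1/6 - 1) * (1 - v) powr (2/3 - 1))) has_integral cubic_hyp (1/2) * C) {0<..<1}"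
    by (subst has_integral_cong[symmetric])
  moreover have "((\<lambda>v::real. 2 powr (1/3) / 2 * (v powr (1/6 - 1) * (1 - v) powr (2/3 - 1))) has_integral 2 powr (1/3) / 2 * Beta (1/6) (2/3)) {0<..<1}"
    using has_integral_mult_right[OF has_integral_Beta_real[of "1/6" "2/3"],
          of "2 powr (1/3) / 2"]
    by (simp add: has_integral_Icc_iff_Ioo)
  ultimately have "cubic_hyp (1/2) * C = 2 powr (1/3) / 2 * Beta (1/6) (2/3)"
    by (rule has_integral_unique)
  then have "cubic_hyp (1/2) * (Gamma (1/3) * Gamma (2/3))
      = (2 powr (1/3) * Gamma (1/6) / (2 * Gamma (5/6))) * Gamma (2/3)"
    by (simp add: C_def Beta_def mult_ac)
  moreover have "Gamma (2/3 :: real) \<noteq> 0" "Gamma (1/3 :: real) \<noteq> 0" "Gamma (5/6 :: real) \<noteq> 0"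
    by (rule less_imp_neq[OF Gamma_real_pos, symmetric], simp)+
  ultimately show ?thesis
    by (simp add: field_simps)
qed

section \<open>Poisson summation\<close>

lemma infsum_countable_complex:
  fixes f :: "'i::countable \<Rightarrow> complex"
  assumes "infinite (UNIV :: 'i set)"
  defines "b \<equiv> from_nat_into (UNIV :: 'i set)"
  shows "f summable_on UNIV \<longleftrightarrow> (\<Sum>n. ennreal (cmod (f (b n)))) < \<infinity>"
    and "f summable_on UNIV \<longleftrightarrow> summable (\<lambda>n. cmod (f (b n)))"
    and "f summable_on UNIV \<Longrightarrow> infsum f UNIV = (\<Sum>n. f (b n))"
proof -
  have bij: "bij_betw b UNIV UNIV"
    unfolding b_def by (rule bij_betw_from_nat_into) (use assms in auto)
  have 1: "f summable_on UNIV \<longleftrightarrow> (\<lambda>n. f (b n)) summable_on UNIV"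
    using summable_on_reindex_bij_betw[OF bij, of f] by simp
  also have "\<dots> \<longleftrightarrow> (\<lambda>n. cmod (f (b n))) summable_on UNIV"
    by (rule summable_on_iff_abs_summable_on_complex)
  also have "\<dots> \<longleftrightarrow> summable (\<lambda>n. cmod (f (b n)))"
    by (rule summable_on_UNIV_nonneg_real_iff) simp
  finally show 2: "f summable_on UNIV \<longleftrightarrow> summable (\<lambda>n. cmod (f (b n)))" .
  show "f summable_on UNIV \<longleftrightarrow> (\<Sum>n. ennreal (cmod (f (b n)))) < \<infinity>"
    unfolding 2
    using summable_suminf_not_top[of "\<lambda>n. cmod (f (b n))"] ennreal_suminf_neq_top[of "\<lambda>n. cmod (f (b n))"]
    by (metis infinity_ennreal_def less_top norm_ge_zero)
  assume s: "f summable_on UNIV"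
  have "infsum f UNIV = infsum (\<lambda>n. f (b n)) UNIV"
    using infsum_reindex_bij_betw[OF bij, of f] by simp
  also have "\<dots> = (\<Sum>n. f (b n))"
    using s 1 by (intro sums_unique has_sum_imp_sums has_sum_infsum) auto
  finally show "infsum f UNIV = (\<Sum>n. f (b n))" .
qed

text \<open>Outside the set of summability \<open>infsum\<close> takes its default value 0, and that
  set is described by the measurable condition that the series \<open>A\<close> of absolute values
  is finite.\<close>

lemma borel_measurable_infsum:
  fixes f :: "'i::countable \<Rightarrow> 'b \<Rightarrow> complex"
  assumes inf: "infinite (UNIV :: 'i set)" and [measurable]: "\<And>i. f i \<in> borel_measurable M"
  shows "(\<lambda>x. \<Sum>\<^sub>\<infinity>i. f i x) \<in> borel_measurable M"
proof -
  define b where "b = from_nat_into (UNIV :: 'i set)"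
  define A where "A x = (\<Sum>n. ennreal (cmod (f (b n) x)))" for x
  have [measurable]: "A \<in> borel_measurable M" unfolding A_def[abs_def] by measurable
  have "(\<Sum>\<^sub>\<infinity>i. f i x) = (if A x < \<infinity> then (\<Sum>n. f (b n) x) else 0)" for x
    using infsum_countable_complex(1,3)[OF inf, of "\<lambda>i. f i x"]
    by (auto simp: b_def A_def infsum_not_exists)
  then show ?thesis by simp
qed

text \<open>The theorem of Fubini and Tonelli for the product of \<open>M\<close> with a counting
  measure. The unordered sum is transferred to a series along an enumeration, where the convergence
  theorems for series of integrals apply.\<close>

lemma
  fixes f :: "'i::countable \<Rightarrow> 'b \<Rightarrow> complex"
  assumes inf: "infinite (UNIV :: 'i set)"
    and int: "\<And>i. integrable M (f i)"
    and sum: "(\<lambda>i. LINT x|M. cmod (f i x)) summable_on UNIV"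
  shows AE_summable_integrals: "AE x in M. (\<lambda>i. f i x) summable_on UNIV"
    and integrable_infsum: "integrable M (\<lambda>x. \<Sum>\<^sub>\<infinity>i. f i x)"
    and integral_has_sum: "((\<lambda>i. LINT x|M. f i x) has_sum (LINT x|M. (\<Sum>\<^sub>\<infinity>i. f i x))) UNIV"
proof -
  define b where "b = from_nat_into (UNIV :: 'i set)"
  have bij: "bij_betw b UNIV UNIV"
    unfolding b_def by (rule bij_betw_from_nat_into) (use assms in auto)
  note [measurable] = borel_measurable_integrable[OF int]
  define A where "A x = (\<Sum>n. ennreal (cmod (f (b n) x)))" for x
  have [measurable]: "A \<in> borel_measurable M" unfolding A_def[abs_def] by measurable
  have A: "(\<lambda>i. f i x) summable_on UNIV \<longleftrightarrow> A x < \<infinity>" for x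
    unfolding A_def b_def by (rule infsum_countable_complex(1)[OF inf])
  have ns: "summable (\<lambda>n. LINT x|M. cmod (f (b n) x))"
    using sum summable_on_reindex_bij_betw[OF bij, of "\<lambda>i. LINT x|M. cmod (f i x)"]
    by (simp add: summable_on_UNIV_nonneg_real_iff)
  have "(\<integral>\<^sup>+x. A x \<partial>M) = (\<Sum>n. \<integral>\<^sup>+x. cmod (f (b n) x) \<partial>M)"
    unfolding A_def by (intro nn_integral_suminf) auto
  also have "\<dots> = (\<Sum>n. ennreal (LINT x|M. cmod (f (b n) x)))"
    by (intro suminf_cong nn_integral_eq_integral integrable_norm int) auto
  also have "\<dots> \<noteq> \<infinity>"
    unfolding infinity_ennreal_def using ns by (intro ennreal_suminf_neq_top) auto
  finally have fin: "AE x in M. A x \<noteq> \<infinity>"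
    by (intro nn_integral_PInf_AE) auto
  then show ae: "AE x in M. (\<lambda>i. f i x) summable_on UNIV"
    by eventually_elim (simp add: A less_top)
  have ae2: "AE x in M. summable (\<lambda>n. cmod (f (b n) x))"
    using ae by eventually_elim (simp add: infsum_countable_complex(2)[OF inf] b_def)
  have m: "(\<lambda>x. \<Sum>\<^sub>\<infinity>i. f i x) \<in> borel_measurable M"
    by (rule borel_measurable_infsum[OF inf]) simp
  have aeq: "AE x in M. (\<Sum>\<^sub>\<infinity>i. f i x) = (\<Sum>n. f (b n) x)"
    using ae by eventually_elim (simp add: infsum_countable_complex(3)[OF inf] b_def)
  have i: "integrable M (\<lambda>x. \<Sum>n. f (b n) x)"
    by (rule integrable_suminf[OF int ae2 ns])
  show "integrable M (\<lambda>x. \<Sum>\<^sub>\<infinity>i. f i x)"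
    by (rule integrable_cong_AE_imp[OF i m]) (use aeq in auto)
  have "(LINT x|M. (\<Sum>\<^sub>\<infinity>i. f i x)) = (LINT x|M. (\<Sum>n. f (b n) x))"
    by (rule integral_cong_AE[OF m _ aeq]) (use i in auto)
  also have "\<dots> = (\<Sum>n. LINT x|M. f (b n) x)"
    by (rule integral_suminf[OF int ae2 ns])
  finally have e: "(LINT x|M. (\<Sum>\<^sub>\<infinity>i. f i x)) = (\<Sum>n. LINT x|M. f (b n) x)" .
  have s: "(\<lambda>i. LINT x|M. f i x) summable_on UNIV"
    by (rule abs_summable_summable, rule summable_on_comparison_test[OF sum])
       (auto intro: integral_norm_bound)
  with infsum_countable_complex(3)[OF inf this]
  show "((\<lambda>i. LINT x|M. f i x) has_sum (LINT x|M. (\<Sum>\<^sub>\<infinity>i. f i x))) UNIV"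
    by (simp add: has_sum_iff e b_def)
qed

section \<open>Trigonometric polynomials and uniqueness of Fourier coefficients\<close>

inductive trig_poly :: "(real \<Rightarrow> complex) \<Rightarrow> bool" where
  monom: "trig_poly (\<lambda>t. c * cis (2 * pi * of_int k * t))"
| add: "trig_poly f \<Longrightarrow> trig_poly g \<Longrightarrow> trig_poly (\<lambda>t. f t + g t)"

lemma trig_poly_const: "trig_poly (\<lambda>t. c)"
  using trig_poly.monom[of c 0] by simp

lemma trig_poly_mult:
  assumes "trig_poly f" "trig_poly g" shows "trig_poly (\<lambda>t. f t * g t)"
  using assms
proof (induction f)
  case (monom c k)
  from this show ?case
  proof (induction g)
    case (monom d l)
    have "(\<lambda>t. c * cis (2 * pi * real_of_int k * t) * (d * cis (2 * pi * real_of_int l * t)))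
      = (\<lambda>t. (c * d) * cis (2 * pi * of_int (k + l) * t))"
      by (auto simp: cis_mult algebra_simps)
    then show ?case by (metis trig_poly.monom)
  qed (simp add: distrib_left trig_poly.add)
qed (simp add: distrib_right trig_poly.add)

text \<open>Real polynomial functions on the plane are generated by real-linear functionals, and on
  the unit circle such a functional is a combination of e^(2 pi i t) and its conjugate.\<close>

lemma trig_poly_polynomial:
  fixes p :: "complex \<Rightarrow> real"
  assumes "real_polynomial_function p"
  shows "trig_poly (\<lambda>t. of_real (p (cis (2 * pi * t))))"
  using assms
proof (induction p)
  case (linear h)
  interpret bounded_linear h by fact
  have "complex_of_real (h (cis (2 * pi * t)))
    = ((h 1 - \<i> * h \<i>) / 2) * cis (2 * pi * of_int 1 * t) + ((h 1 + \<i> * h \<i>) / 2) * cis (2 * pi * of_int (-1) * t)" for t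
  proof -
    have "h (cis (2 * pi * t)) = h (cos (2 * pi * t) *\<^sub>R 1 + sin (2 * pi * t) *\<^sub>R \<i>)"
      by (rule arg_cong[of _ _ h]) (simp add: complex_eq_iff)
    also have "\<dots> = cos (2 * pi * t) * h 1 + sin (2 * pi * t) * h \<i>"
      by (simp add: add scaleR)
    finally show ?thesis
      by (simp add: complex_eq_iff algebra_simps diff_divide_distrib add_divide_distrib)
  qed
  then show ?case by (simp only:) (intro trig_poly.add trig_poly.monom)
qed (auto intro: trig_poly_const trig_poly.add trig_poly_mult)

lemma periodic_int:
  fixes f :: "real \<Rightarrow> 'a"
  assumes "\<And>t. f (t + 1) = f t"
  shows "f (t + of_int k) = f t"
proof (induction k rule: int_induct[of _ 0])
  case (step1 i)
  then show ?case using assms[of "t + of_int i"] by (simp add: add.assoc)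
next
  case (step2 i)
  then show ?case using assms[of "t + of_int (i - 1)"] by (simp add: add.assoc)
qed simp

text \<open>A continuous periodic function descends to a continuous function \<open>d\<close> on the
  unit circle, to which the theorem of Stone and Weierstrass applies.\<close>

lemma trig_poly_dense:
  fixes f :: "real \<Rightarrow> complex"
  assumes cont: "continuous_on {0..1} f" and per: "\<And>t. f (t + 1) = f t" and e: "e > 0"
  obtains P where "trig_poly P" "\<And>t. cmod (f t - P t) < e"
proof -
  define c where "c t = cis (2 * pi * t)" for t
  define d where "d z = f (SOME t. z = c t)" for z
  have fc: "f s = f t" if "c s = c t" for s t
  proof -
    have "\<exists>n::int. 2 * pi * s = 2 * pi * t + 2 * pi * n"
      using that unfolding sin_cos_eq_iff[symmetric] by (simp add: c_def complex_eq_iff)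
    then obtain n :: int where "2 * pi * s = 2 * pi * (t + of_int n)" by (auto simp: distrib_left)
    then have "s = t + of_int n" by (subst (asm) mult_left_cancel) auto
    then show ?thesis using periodic_int[of f, OF per] by simp
  qed
  have dc: "d (c t) = f t" for t
    unfolding d_def by (rule fc[OF someI2[of "\<lambda>s. c t = c s" t]]) auto
  have csurj: "c ` {0..1} = sphere 0 1"
  proof (intro equalityI subsetI)
    fix z :: complex assume z: "z \<in> sphere 0 1"
    then have "z = c (Arg2pi z / (2 * pi))"
      using Arg2pi_eq[of z] by (simp add: c_def cis_conv_exp mult.commute)
    moreover have "Arg2pi z / (2 * pi) \<in> {0..1}"
      using Arg2pi_ge_0[of z] Arg2pi_lt_2pi[of z] by (auto simp: field_simps)
    ultimately show "z \<in> c ` {0..1}" by blast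
  qed (auto simp: c_def)
  have cc: "continuous_on {0..1} c" unfolding c_def by (intro continuous_intros)
  \<comment> \<open>The parametrization \<open>c\<close> maps the compact interval onto the circle
    and is therefore a quotient map, so openness of preimages can be tested on the interval, where
    \<open>d\<close> becomes \<open>f\<close>. No continuous inverse of \<open>c\<close> is
    required.\<close>
  have "continuous_on (sphere 0 1) d"
    unfolding continuous_on_open_invariant
  proof (intro allI impI)
    fix B :: "complex set" assume B: "open B"
    have "openin (top_of_set {0..1}) ({0..1} \<inter> c -` (sphere 0 1 \<inter> d -` B))"
    proof -
      have "{0..1} \<inter> c -` (sphere 0 1 \<inter> d -` B) = {0..1} \<inter> f -` B"
        using csurj by (auto simp: dc)
      moreover have "openin (top_of_set {0..1}) ({0..1} \<inter> f -` B)"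
        by (rule continuous_openin_preimage_gen[OF cont B])
      ultimately show ?thesis by simp
    qed
    then have "openin (top_of_set (sphere 0 1)) (sphere 0 1 \<inter> d -` B)"
      by (subst Abstract_Topology_2.continuous_imp_quotient_map[OF cc csurj, symmetric]) auto
    then obtain A where "open A" "sphere 0 1 \<inter> d -` B = sphere 0 1 \<inter> A"
      by (auto simp: openin_open)
    then show "\<exists>A. open A \<and> A \<inter> sphere 0 1 = d -` B \<inter> sphere 0 1"
      by (intro exI[of _ A]) auto
  qed
  from Stone_Weierstrass_polynomial_function[OF compact_sphere this e]
  obtain g where g: "polynomial_function g" "\<And>z. z \<in> sphere 0 1 \<Longrightarrow> norm (d z - g z) < e" by blast
  have r: "real_polynomial_function (\<lambda>z. Re (g z))" "real_polynomial_function (\<lambda>z. Im (g z))"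
    using g(1) bounded_linear_Re bounded_linear_Im by (auto simp: polynomial_function_def o_def)
  define P where "P t = g (c t)" for t
  have Pe: "P = (\<lambda>t. of_real (Re (g (cis (2 * pi * t)))) + \<i> * of_real (Im (g (cis (2 * pi * t)))))"
    by (auto simp: P_def c_def complex_eq_iff)
  have "trig_poly P" unfolding Pe
    by (intro trig_poly.add trig_poly_mult trig_poly_const trig_poly_polynomial r)
  moreover have "cmod (f t - P t) < e" for t
    using g(2)[of "c t"] dc[of t] by (simp add: P_def) (simp add: c_def)
  ultimately show ?thesis using that by blast
qed

text \<open>The function is orthogonal to all trigonometric polynomials. With P uniformly within e
  of the conjugate of f, the integral of |f|^2 equals that of f (cnj f - P), hence is at most e
  times the integral of |f|.\<close>

lemma fourier_uniqueness:
  fixes f :: "real \<Rightarrow> complex"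
  assumes cont: "continuous_on UNIV f" and per: "\<And>t. f (t + 1) = f t"
    and zero: "\<And>k::int. integral {0..1} (\<lambda>t. f t * cis (2 * pi * of_int k * t)) = 0"
  shows "f t = 0"
proof -
  have int: "(\<lambda>t. f t * P t) integrable_on {0..1}" if "continuous_on UNIV P" for P
    by (intro integrable_continuous_interval continuous_intros continuous_on_subset[OF cont]
        continuous_on_subset[OF that]) auto
  have tc: "continuous_on UNIV P" if "trig_poly P" for P
    using that by induction (auto intro!: continuous_intros)
  have tz: "integral {0..1} (\<lambda>t. f t * P t) = 0" if "trig_poly P" for P
    using that
  proof induction
    case (monom c k)
    have "integral {0..1} (\<lambda>t. f t * (c * cis (2 * pi * of_int k * t)))
      = integral {0..1} (\<lambda>t. c * (f t * cis (2 * pi * of_int k * t)))"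
      by (simp add: mult_ac)
    also have "\<dots> = 0" using zero[of k] by simp
    finally show ?case .
  next
    case (add P Q)
    then show ?case
      by (simp add: distrib_left integral_add int tc)
  qed
  have c2: "continuous_on {0..1} (\<lambda>t. (cmod (f t))\<^sup>2)" "continuous_on {0..1} (\<lambda>t. cmod (f t))"
    by (intro continuous_intros continuous_on_subset[OF cont] subset_UNIV)+
  define I where "I = integral {0..1} (\<lambda>t. (cmod (f t))\<^sup>2)"
  define J where "J = integral {0..1} (\<lambda>t. cmod (f t))"
  have J: "J \<ge> 0" unfolding J_def by (intro integral_nonneg integrable_continuous_interval c2) auto
  have bound: "I \<le> e * J" if e: "e > 0" for e
  proof -
    have "continuous_on {0..1} (\<lambda>t. cnj (f t))"
      by (intro continuous_intros continuous_on_subset[OF cont]) auto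
    then obtain P where P: "trig_poly P" "\<And>t. cmod (cnj (f t) - P t) < e"
      using trig_poly_dense[of "\<lambda>t. cnj (f t)" e] per e by auto
    note ic = int[OF continuous_on_cnj[OF cont]] int[OF tc[OF P(1)]]
    have "of_real I = integral {0..1} (\<lambda>t. f t * cnj (f t))"
    proof -
      have "integral {0..1} (\<lambda>t. of_real ((cmod (f t))\<^sup>2) :: complex) = of_real I"
        unfolding I_def using integrable_continuous_interval[OF c2(1)]
        by (intro integral_unique has_integral_of_real integrable_integral)
      then show ?thesis by (simp only: complex_norm_square)
    qed
    also have "\<dots> = integral {0..1} (\<lambda>t. f t * cnj (f t)) - integral {0..1} (\<lambda>t. f t * P t)"
      using tz[OF P(1)] by simp
    also have "\<dots> = integral {0..1} (\<lambda>t. f t * (cnj (f t) - P t))"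
      using ic by (subst integral_diff[symmetric]) (auto simp: right_diff_distrib)
    finally have "cmod (of_real I) \<le> integral {0..1} (\<lambda>t. cmod (f t) * e)"
    proof (simp only:, intro integral_norm_bound_integral)
      show "(\<lambda>t. f t * (cnj (f t) - P t)) integrable_on {0..1}"
        by (intro int continuous_intros cont tc[OF P(1)])
      show "(\<lambda>t. cmod (f t) * e) integrable_on {0..1}"
        by (intro integrable_continuous_interval continuous_intros c2)
      show "norm (f x * (cnj (f x) - P x)) \<le> cmod (f x) * e" for x
        using P(2)[of x] by (simp add: norm_mult mult_left_mono)
    qed
    then show ?thesis by (simp add: J_def mult.commute)
  qed
  have "I \<le> 0"
  proof (rule field_le_epsilon)
    fix e :: real assume e: "e > 0"
    \<comment> \<open>The denominator is \<open>J + 1\<close> because \<open>J\<close> may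
      vanish.\<close>
    have "I \<le> e / (J + 1) * J" by (rule bound) (use J e in auto)
    also have "\<dots> \<le> e / (J + 1) * (J + 1)" using J e by (intro mult_left_mono) auto
    also have "\<dots> = e" using J by simp
    finally show "I \<le> 0 + e" by simp
  qed
  moreover have "I \<ge> 0" unfolding I_def by (intro integral_nonneg integrable_continuous_interval c2) auto
  ultimately have I0: "I = 0" by simp
  have z01: "f t = 0" if "t \<in> {0..1}" for t
    using integral_eq_0_iff[OF c2(1), THEN iffD1] I0 that unfolding I_def by auto
  have "f t = f (frac t + of_int \<lfloor>t\<rfloor>)" by (simp add: frac_def)
  also have "\<dots> = f (frac t)" by (rule periodic_int[of f, OF per])
  also have "\<dots> = 0" using frac_ge_0[of t] frac_lt_1[of t] by (intro z01) auto
  finally show ?thesis .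
qed

section \<open>Gaussian sums and integrals, Poisson summation on the line\<close>

lemma summable_int_geometric:
  fixes p :: real assumes "0 \<le> p" "p < 1"
  shows "(\<lambda>m::int. p ^ nat \<bar>m\<bar>) summable_on UNIV"
proof -
  have g: "(\<lambda>n. p ^ n) summable_on (UNIV :: nat set)"
    using assms by (simp add: summable_on_UNIV_nonneg_real_iff summable_geometric)
  have "(\<lambda>m::int. p ^ nat \<bar>m\<bar>) summable_on range int"
    by (subst summable_on_reindex) (use g in \<open>auto simp: o_def\<close>)
  moreover have "(\<lambda>m::int. p ^ nat \<bar>m\<bar>) summable_on range (\<lambda>n. - int n)"
    by (subst summable_on_reindex) (use g in \<open>auto simp: o_def inj_on_def\<close>)
  moreover have "(UNIV :: int set) = range int \<union> range (\<lambda>n. - int n)"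
    by (auto simp: image_iff) (metis int_cases2)
  ultimately show ?thesis by (metis summable_on_union)
qed

lemma summable_int_gauss:
  fixes a c :: real assumes "a > 0"
  shows "(\<lambda>m::int. exp (- (a * (of_int m + c)\<^sup>2))) summable_on UNIV"
proof (rule summable_on_comparison_test)
  show "(\<lambda>m::int. exp (a * c\<^sup>2) * exp (- a / 2) ^ nat \<bar>m\<bar>) summable_on UNIV"
    by (intro summable_on_cmult_right summable_int_geometric) (use assms in auto)
  fix m :: int
  have "\<bar>m\<bar> * 1 \<le> \<bar>m\<bar> * \<bar>m\<bar>" by (cases "m = 0", simp, rule mult_left_mono) auto
  then have "\<bar>real_of_int m\<bar> \<le> (real_of_int m)\<^sup>2"
    by (simp flip: of_int_abs of_int_mult of_int_power add: power2_eq_square abs_mult_self_eq)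
  \<comment> \<open>Completing the square shows (m + c)^2 \<ge> m^2/2 - c^2, which makes the shift
    harmless.\<close>
  moreover have "(of_int m + c)\<^sup>2 + c\<^sup>2 - (real_of_int m)\<^sup>2 / 2 = (of_int m + 2 * c)\<^sup>2 / 2"
    by (simp add: power2_eq_square algebra_simps add_divide_distrib)
  moreover have "(of_int m + 2 * c)\<^sup>2 / 2 \<ge> 0" by simp
  ultimately have "\<bar>real_of_int m\<bar> / 2 - c\<^sup>2 \<le> (of_int m + c)\<^sup>2" by linarith
  then have "a * (\<bar>real_of_int m\<bar> / 2 - c\<^sup>2) \<le> a * (of_int m + c)\<^sup>2"
    using assms by (intro mult_left_mono) auto
  then have "exp (- (a * (of_int m + c)\<^sup>2)) \<le> exp (a * c\<^sup>2 + of_nat (nat \<bar>m\<bar>) * (- a / 2))"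
    by (simp add: algebra_simps)
  also have "\<dots> = exp (a * c\<^sup>2) * exp (- a / 2) ^ nat \<bar>m\<bar>"
    by (simp only: exp_add exp_of_nat_mult)
  finally show "exp (- (a * (of_int m + c)\<^sup>2)) \<le> exp (a * c\<^sup>2) * exp (- a / 2) ^ nat \<bar>m\<bar>" .
qed auto

text \<open>This is the characteristic function of the standard normal distribution after the
  rescaling t -> c t with c^2 = 2 pi a.\<close>

lemma
  fixes a x :: real assumes a: "a > 0"
  shows integrable_gauss_cis: "integrable lborel (\<lambda>t. complex_of_real (exp (- (pi * a * t\<^sup>2))) * cis (2 * pi * x * t))"
    and integral_gauss_cis: "(LINT t|lborel. complex_of_real (exp (- (pi * a * t\<^sup>2))) * cis (2 * pi * x * t))
       = of_real (exp (- (pi * x\<^sup>2 / a)) / sqrt a)"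
proof -
  define c where "c = sqrt (2 * pi * a)"
  define s where "s = 2 * pi * x / c"
  have c: "c > 0" "c\<^sup>2 = 2 * pi * a" using a by (auto simp: c_def)
  define f where "f t = std_normal_density t *\<^sub>R iexp (s * t)" for t
  have [measurable]: "f \<in> borel_measurable borel"
    unfolding f_def[abs_def] normal_density_def by measurable
  have fi: "integrable lborel f"
    by (rule Bochner_Integration.integrable_bound[OF integrable_normal_density[of 1 0]])
       (auto simp: f_def normal_density_nonneg)
  have fe: "f (0 + c * t) = of_real (1 / sqrt (2 * pi)) * (complex_of_real (exp (- (pi * a * t\<^sup>2))) * cis (2 * pi * x * t))" for t
  proof -
    have "c\<^sup>2 * t\<^sup>2 / 2 = pi * a * t\<^sup>2" unfolding c by simp
    moreover have "s * (c * t) = 2 * pi * x * t" using c by (simp add: s_def)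
    moreover have "f (0 + c * t) = of_real (1 / sqrt (2 * pi)) * (complex_of_real (exp (- (c\<^sup>2 * t\<^sup>2 / 2))) * cis (s * (c * t)))"
      by (simp add: f_def normal_density_def power_mult_distrib cis_conv_exp scaleR_conv_of_real mult_ac)
    ultimately show ?thesis by (simp only:)
  qed
  have "integrable lborel (\<lambda>t. of_real (sqrt (2 * pi)) * f (0 + c * t))"
    using lborel_integrable_real_affine[OF fi, of c 0] c by (intro integrable_mult_right) auto
  then show "integrable lborel (\<lambda>t. complex_of_real (exp (- (pi * a * t\<^sup>2))) * cis (2 * pi * x * t))"
    unfolding fe mult.assoc[symmetric] of_real_mult[symmetric] by simp
  have "exp (- (s\<^sup>2) / 2) = char std_normal_distribution s"
    by (simp add: char_std_normal_distribution)
  also have "\<dots> = (LINT t|lborel. f t)"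
    unfolding char_def f_def by (subst integral_density) (auto simp: normal_density_nonneg)
  also have "\<dots> = c *\<^sub>R (LINT t|lborel. f (0 + c * t))"
    using lborel_integral_real_affine[of c f 0] c by simp
  also have "(LINT t|lborel. f (0 + c * t)) = of_real (1 / sqrt (2 * pi)) *
      (LINT t|lborel. complex_of_real (exp (- (pi * a * t\<^sup>2))) * cis (2 * pi * x * t))"
    unfolding fe by (rule integral_mult_right_zero)
  finally have "complex_of_real (exp (- (s\<^sup>2) / 2)) = of_real (c / sqrt (2 * pi)) *
      (LINT t|lborel. complex_of_real (exp (- (pi * a * t\<^sup>2))) * cis (2 * pi * x * t))"
    by (simp add: scaleR_conv_of_real)
  moreover have "c / sqrt (2 * pi) = sqrt a"
    by (simp add: c_def real_sqrt_mult)
  moreover have "s\<^sup>2 / 2 = pi * x\<^sup>2 / a"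
    unfolding s_def power_divide c using a by (simp add: power2_eq_square)
  ultimately show "(LINT t|lborel. complex_of_real (exp (- (pi * a * t\<^sup>2))) * cis (2 * pi * x * t))
       = of_real (exp (- (pi * x\<^sup>2 / a)) / sqrt a)"
    using a by (simp add: field_simps)
qed

text \<open>The line is tiled by the half-open intervals on which the floor is constant; translating
  every piece to floor 0 and summing gives the periodization. The half-open tiles avoid any overlap
  at integers.\<close>

lemma integral_periodization:
  fixes u :: "real \<Rightarrow> complex"
  assumes u: "integrable lborel u"
  shows "(LINT t|lborel. (if \<lfloor>t\<rfloor> = 0 then (\<Sum>\<^sub>\<infinity>m::int. u (of_int m + t)) else 0)) = (LINT t|lborel. u t)"
proof -
  note [measurable] = borel_measurable_integrable[OF u]
  define f where "f m t = (if \<lfloor>t\<rfloor> = m then u t else 0)" for m :: int and t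
  define g where "g m t = (if \<lfloor>t\<rfloor> = 0 then u (of_int m + t) else 0)" for m :: int and t
  have fi: "integrable lborel (f m)" for m
    by (rule Bochner_Integration.integrable_bound[OF u]) (auto simp: f_def[abs_def])
  have fg: "f m (of_int m + 1 * t) = g m t" for m t
    by (simp add: f_def g_def)
  have gi: "integrable lborel (g m)" for m
    using lborel_integrable_real_affine[OF fi[of m], of 1 "of_int m"] unfolding fg by simp
  have fgI: "(LINT t|lborel. f m t) = (LINT t|lborel. g m t)" for m
    using lborel_integral_real_affine[of 1 "f m" "of_int m"] unfolding fg by simp
  have fgN: "(LINT t|lborel. cmod (f m t)) = (LINT t|lborel. cmod (g m t))" for m
    using lborel_integral_real_affine[of 1 "\<lambda>t. cmod (f m t)" "of_int m"] unfolding fg by simp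
  have sf: "(\<lambda>m. LINT t|lborel. cmod (f m t)) summable_on UNIV"
  proof (rule nonneg_bounded_partial_sums_imp_summable_on)
    show "eventually (\<lambda>F. (\<Sum>m\<in>F. LINT t|lborel. cmod (f m t)) \<le> (LINT t|lborel. cmod (u t))) (finite_subsets_at_top UNIV)"
    proof (rule eventually_finite_subsets_at_top_weakI)
      fix F :: "int set" assume F: "finite F"
      have "(\<Sum>m\<in>F. LINT t|lborel. cmod (f m t)) = (LINT t|lborel. (\<Sum>m\<in>F. cmod (f m t)))"
        by (intro Bochner_Integration.integral_sum[symmetric] integrable_norm fi)
      also have "\<dots> \<le> (LINT t|lborel. cmod (u t))"
      proof (intro integral_mono Bochner_Integration.integrable_sum integrable_norm fi u)
        fix t show "(\<Sum>m\<in>F. cmod (f m t)) \<le> cmod (u t)"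
          using F by (simp add: f_def if_distrib[of cmod] sum.delta cong: if_cong)
      qed
      finally show "(\<Sum>m\<in>F. LINT t|lborel. cmod (f m t)) \<le> (LINT t|lborel. cmod (u t))" .
    qed
  qed auto
  have "(\<Sum>\<^sub>\<infinity>m. f m t) = u t" for t
  proof -
    have "(\<Sum>\<^sub>\<infinity>m. f m t) = (\<Sum>\<^sub>\<infinity>m\<in>{\<lfloor>t\<rfloor>}. f m t)"
      by (rule infsum_cong_neutral) (auto simp: f_def)
    then show ?thesis by (simp add: f_def)
  qed
  then have s1: "((\<lambda>m. LINT t|lborel. f m t) has_sum (LINT t|lborel. u t)) UNIV"
    using integral_has_sum[OF _ fi sf] by simp
  have eq: "(\<Sum>\<^sub>\<infinity>m. g m t) = (if \<lfloor>t\<rfloor> = 0 then (\<Sum>\<^sub>\<infinity>m::int. u (of_int m + t)) else 0)" for t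
    by (simp add: g_def)
  note sg = sf[unfolded fgN]
  show "(LINT t|lborel. (if \<lfloor>t\<rfloor> = 0 then (\<Sum>\<^sub>\<infinity>m::int. u (of_int m + t)) else 0)) = (LINT t|lborel. u t)"
    using has_sum_unique[OF integral_has_sum[OF _ gi sg] s1[unfolded fgI]] unfolding eq by simp
qed

lemma
  fixes f :: "real \<Rightarrow> complex"
  assumes f: "continuous_on UNIV f"
  shows integrable_unit: "integrable lborel (\<lambda>t. if \<lfloor>t\<rfloor> = 0 then f t else 0)"
    and integral_unit: "(LINT t|lborel. (if \<lfloor>t\<rfloor> = 0 then f t else 0)) = integral {0..1} f"
proof -
  have i: "set_integrable lborel {0..1} f"
    unfolding set_integrable_def
    by (intro borel_integrable_compact continuous_on_subset[OF f]) auto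
  have [measurable]: "f \<in> borel_measurable borel"
    by (rule borel_measurable_continuous_onI[OF f])
  have ae: "AE t in lborel. indicator {0..1} t *\<^sub>R f t = (if \<lfloor>t\<rfloor> = 0 then f t else 0)"
    using AE_lborel_singleton[of 1]
    by eventually_elim (auto simp: indicator_def floor_eq_iff)
  have m: "(\<lambda>t. if \<lfloor>t\<rfloor> = 0 then f t else 0) \<in> borel_measurable lborel" by measurable
  show "integrable lborel (\<lambda>t. if \<lfloor>t\<rfloor> = 0 then f t else 0)"
    using i unfolding set_integrable_def by (rule integrable_cong_AE_imp[OF _ m ae])
  have "integral {0..1} f = (LINT t|lborel. indicator {0..1} t *\<^sub>R f t)"
    using set_borel_integral_eq_integral(2)[OF i] by (simp add: set_lebesgue_integral_def)
  also have "\<dots> = (LINT t|lborel. (if \<lfloor>t\<rfloor> = 0 then f t else 0))"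
    by (rule integral_cong_AE[OF _ m ae]) simp
  finally show "(LINT t|lborel. (if \<lfloor>t\<rfloor> = 0 then f t else 0)) = integral {0..1} f" ..
qed

lemma integral_cis_unit: "integral {0..1} (\<lambda>t. cis (2 * pi * of_int k * t)) = (if k = 0 then 1 else 0)"
proof (cases "k = 0")
  case False
  define F where "F t = cis (2 * pi * of_int k * t) / (2 * pi * \<i> * of_int k)" for t
  have "((\<lambda>t. cis (2 * pi * of_int k * t)) has_integral F 1 - F 0) {0..1}"
  proof (rule fundamental_theorem_of_calculus)
    show "(F has_vector_derivative cis (2 * pi * of_int k * t)) (at t within {0..1})" for t
      unfolding F_def has_vector_derivative_def using False
      by (auto intro!: derivative_eq_intros simp: scaleR_conv_of_real field_simps)
  qed simp
  moreover have "F 1 = F 0"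
    using cis_multiple_2pi[of "of_int k"] by (simp add: F_def)
  ultimately show ?thesis using False by (simp add: integral_unique)
qed simp

lemma continuous_on_infsum:
  fixes f :: "'i \<Rightarrow> 'a::topological_space \<Rightarrow> 'c::banach"
  assumes "\<And>i. continuous_on S (f i)" "\<And>i x. x \<in> S \<Longrightarrow> norm (f i x) \<le> M i" "M summable_on UNIV"
  shows "continuous_on S (\<lambda>x. \<Sum>\<^sub>\<infinity>i. f i x)"
proof (rule uniform_limit_theorem[rotated])
  show "uniform_limit S (\<lambda>X y. \<Sum>x\<in>X. f x y) (\<lambda>y. \<Sum>\<^sub>\<infinity>x. f x y) (finite_subsets_at_top UNIV)"
    by (rule Weierstrass_m_test_general) (use assms in auto)
qed (use assms(1) in \<open>auto intro!: always_eventually continuous_on_sum\<close>)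

text \<open>As functions of \<open>b\<close>, both sides are continuous and have period 1: the
  modulation is attached to m + b, not to m, for this reason. Their Fourier coefficients agree, by
  unfolding on the left and by orthogonality on the right, so uniqueness replaces Fourier
  inversion.\<close>

lemma poisson_gauss:
  fixes a b c :: real assumes a: "a > 0"
  shows "(\<Sum>\<^sub>\<infinity>m::int. complex_of_real (exp (- (pi * a * (of_int m + b)\<^sup>2))) * cis (2 * pi * c * (of_int m + b)))
     = of_real (1 / sqrt a) * (\<Sum>\<^sub>\<infinity>k::int. complex_of_real (exp (- (pi * (of_int k - c)\<^sup>2 / a))) * cis (2 * pi * of_int k * b))"
proof -
  define g where "g x = complex_of_real (exp (- (pi * a * x\<^sup>2))) * cis (2 * pi * c * x)" for x
  define G where "G t = (\<Sum>\<^sub>\<infinity>m::int. g (of_int m + t))" for t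
  define h where "h k = exp (- (pi * (of_int k - c)\<^sup>2 / a)) / sqrt a" for k :: int
  define H where "H t = (\<Sum>\<^sub>\<infinity>k::int. of_real (h k) * cis (2 * pi * of_int k * t))" for t
  have gG: "cmod (g x) = exp (- (pi * a * x\<^sup>2))" for x by (simp add: g_def norm_mult)
  have hs: "h summable_on UNIV"
  proof -
    have "(\<lambda>k::int. exp (- (pi / a * (of_int k + (- c))\<^sup>2)) * (1 / sqrt a)) summable_on UNIV"
      by (intro summable_on_cmult_left summable_int_gauss) (use a in auto)
    then show ?thesis by (simp add: h_def[abs_def])
  qed
  have hpos: "h k \<ge> 0" for k using a by (simp add: h_def)
  have Hc: "continuous_on UNIV H" unfolding H_def
    by (rule continuous_on_infsum[where M = h])
       (use hs hpos in \<open>auto intro!: continuous_intros simp: norm_mult\<close>)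
  have Gc: "continuous_on UNIV G"
  proof -
    \<comment> \<open>The M-test has no majorant valid on the whole line, since the peak of the m-th
      term moves with t; on a bounded interval the bound by exp (- pi a m^2 / 2) up to a constant is
      uniform.\<close>
    have "continuous_on {-R<..<R} G" for R
      unfolding G_def
    proof (rule continuous_on_infsum)
      show "(\<lambda>m::int. exp (pi * a * R\<^sup>2) * exp (- (pi * a / 2 * (of_int m + 0)\<^sup>2))) summable_on UNIV"
        by (intro summable_on_cmult_right summable_int_gauss) (use a in auto)
      fix m :: int and x :: real assume x: "x \<in> {-R<..<R}"
      have "x\<^sup>2 \<le> R\<^sup>2" using x by (intro power2_le_iff_abs_le[THEN iffD2]) auto
      moreover have "(of_int m + x)\<^sup>2 + x\<^sup>2 - (real_of_int m)\<^sup>2 / 2 = (of_int m + 2 * x)\<^sup>2 / 2"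
        by (simp add: power2_eq_square algebra_simps add_divide_distrib)
      moreover have "(of_int m + 2 * x)\<^sup>2 / 2 \<ge> 0" by simp
      ultimately have "(real_of_int m)\<^sup>2 / 2 - R\<^sup>2 \<le> (of_int m + x)\<^sup>2" by linarith
      then have "pi * a * ((real_of_int m)\<^sup>2 / 2 - R\<^sup>2) \<le> pi * a * (of_int m + x)\<^sup>2"
        using a by (intro mult_left_mono) auto
      then show "norm (g (of_int m + x)) \<le> exp (pi * a * R\<^sup>2) * exp (- (pi * a / 2 * (of_int m + 0)\<^sup>2))"
        unfolding gG by (simp add: exp_add[symmetric] algebra_simps)
    qed (auto simp: g_def intro!: continuous_intros)
    then have "isCont G x" for x
      by (rule continuous_on_interior[where S = "{-(\<bar>x\<bar>+1)<..<\<bar>x\<bar>+1}"]) (auto simp: interior_open)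
    then show ?thesis by (simp add: continuous_at_imp_continuous_on)
  qed
  have Gp: "G (t + 1) = G t" for t
    unfolding G_def
    by (rule infsum_reindex_bij_witness[of _ "\<lambda>m. m - 1" "\<lambda>m. m + 1"]) (auto simp: algebra_simps)
  have cisk: "cis (2 * pi * of_int k * (t + of_int m)) = cis (2 * pi * of_int k * t)" for k m :: int and t
  proof -
    have "cis (2 * pi * of_int k * (t + of_int m)) = cis (2 * pi * of_int k * t) * cis (2 * pi * of_int (k * m))"
      by (simp add: cis_mult algebra_simps)
    then show ?thesis by (simp add: cis_multiple_2pi)
  qed
  have Hp: "H (t + 1) = H t" for t
    unfolding H_def using cisk[of _ t 1] by simp
  have GI: "integral {0..1} (\<lambda>t. G t * cis (2 * pi * of_int k * t)) = of_real (h (-k))" for k :: int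
  proof -
    define u where "u t = g t * cis (2 * pi * of_int k * t)" for t
    have ue: "u t = complex_of_real (exp (- (pi * a * t\<^sup>2))) * cis (2 * pi * (c + of_int k) * t)" for t
      by (simp add: u_def g_def mult.assoc cis_mult algebra_simps)
    have ui: "integrable lborel u"
      unfolding ue using integrable_gauss_cis[OF a] by simp
    have "integral {0..1} (\<lambda>t. G t * cis (2 * pi * of_int k * t))
        = (LINT t|lborel. (if \<lfloor>t\<rfloor> = 0 then G t * cis (2 * pi * of_int k * t) else 0))"
      by (rule integral_unit[symmetric]) (intro continuous_intros Gc)
    also have "\<dots> = (LINT t|lborel. (if \<lfloor>t\<rfloor> = 0 then (\<Sum>\<^sub>\<infinity>m::int. u (of_int m + t)) else 0))"
      unfolding G_def u_def
      by (intro Bochner_Integration.integral_cong refl if_cong)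
         (use cisk in \<open>simp add: infsum_cmult_left' add.commute\<close>)
    also have "\<dots> = (LINT t|lborel. u t)" by (rule integral_periodization[OF ui])
    also have "\<dots> = of_real (h (-k))"
      unfolding ue integral_gauss_cis[OF a] by (simp add: h_def power2_commute[of c] power2_eq_square algebra_simps)
    finally show ?thesis .
  qed
  have HI: "integral {0..1} (\<lambda>t. H t * cis (2 * pi * of_int j * t)) = of_real (h (-j))" for j :: int
  proof -
    define f where "f k t = (if \<lfloor>t\<rfloor> = 0 then of_real (h k) * cis (2 * pi * of_int (k + j) * t) else 0)" for k :: int and t
    have ci: "continuous_on UNIV (\<lambda>t. of_real (h k) * cis (2 * pi * of_int (k + j) * t))" for k
      by (intro continuous_intros)
    have fi: "integrable lborel (f k)" for k
      unfolding f_def by (rule integrable_unit[OF ci])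
    have fI: "(LINT t|lborel. f k t) = (if k = - j then of_real (h (-j)) else 0)" for k
    proof -
      have "(LINT t|lborel. f k t) = integral {0..1} (\<lambda>t. of_real (h k) * cis (2 * pi * of_int (k + j) * t))"
        unfolding f_def by (rule integral_unit[OF ci])
      also have "\<dots> = of_real (h k) * (if k + j = 0 then 1 else 0)"
        by (simp only: integral_mult_right integral_cis_unit)
      finally show ?thesis by auto
    qed
    have fN: "(LINT t|lborel. cmod (f k t)) = h k" for k
    proof -
      have "(LINT t|lborel. cmod (f k t)) = (LINT t|lborel. Re (if \<lfloor>t::real\<rfloor> = 0 then of_real (h k) else 0))"
        by (rule Bochner_Integration.integral_cong) (auto simp: f_def norm_mult hpos)
      also have "\<dots> = Re (LINT t|lborel. (if \<lfloor>t::real\<rfloor> = 0 then of_real (h k) else 0))"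
        by (intro integral_Re integrable_unit) auto
      also have "\<dots> = h k" by (subst integral_unit) auto
      finally show ?thesis .
    qed
    have cj: "of_real (h k) * cis (2 * pi * of_int (k + j) * t)
        = of_real (h k) * cis (2 * pi * of_int k * t) * cis (2 * pi * of_int j * t)" for k t
      by (simp add: mult.assoc cis_mult distrib_left distrib_right)
    have "integral {0..1} (\<lambda>t. H t * cis (2 * pi * of_int j * t))
        = (LINT t|lborel. (if \<lfloor>t\<rfloor> = 0 then H t * cis (2 * pi * of_int j * t) else 0))"
      by (rule integral_unit[symmetric]) (intro continuous_intros Hc)
    also have "\<dots> = (LINT t|lborel. (\<Sum>\<^sub>\<infinity>k. f k t))"
      unfolding H_def f_def cj
      by (intro Bochner_Integration.integral_cong refl) (auto simp: infsum_cmult_left')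
    finally have "((\<lambda>k. LINT t|lborel. f k t) has_sum integral {0..1} (\<lambda>t. H t * cis (2 * pi * of_int j * t))) UNIV"
      using integral_has_sum[of lborel f, OF _ fi] hs by (simp add: fN)
    moreover have "((\<lambda>k. LINT t|lborel. f k t) has_sum of_real (h (-j))) UNIV"
      unfolding fI by (rule has_sum_finite_neutralI[of "{-j}"]) auto
    ultimately show ?thesis by (rule has_sum_unique)
  qed
  have "G b - H b = 0"
  proof (rule fourier_uniqueness[of "\<lambda>t. G t - H t"])
    fix k :: int
    have "(\<lambda>t. G t * cis (2 * pi * of_int k * t)) integrable_on {0..1}"
         "(\<lambda>t. H t * cis (2 * pi * of_int k * t)) integrable_on {0..1}"
      by (intro integrable_continuous_interval continuous_intros continuous_on_subset[OF Gc]
          continuous_on_subset[OF Hc] subset_UNIV)+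
    then show "integral {0..1} (\<lambda>t. (G t - H t) * cis (2 * pi * of_int k * t)) = 0"
      by (simp only: left_diff_distrib) (simp add: integral_diff GI HI)
  qed (auto intro!: continuous_intros Gc Hc simp: Gp Hp)
  then have "G b = H b" by simp
  also have "H b = of_real (1 / sqrt a) * (\<Sum>\<^sub>\<infinity>k::int. complex_of_real (exp (- (pi * (of_int k - c)\<^sup>2 / a))) * cis (2 * pi * of_int k * b))"
    unfolding H_def h_def infsum_cmult_right'[symmetric] by (simp add: field_simps)
  finally show ?thesis by (simp add: G_def g_def)
qed

section \<open>Poisson summation over the hexagonal lattice\<close>

lemma summable_on_norm_le:
  fixes f :: "'i \<Rightarrow> complex"
  assumes "g summable_on A" "\<And>x. x \<in> A \<Longrightarrow> cmod (f x) \<le> g x"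
  shows "f summable_on A"
  by (rule abs_summable_summable, rule summable_on_comparison_test[OF assms(1)]) (use assms(2) in auto)

lemma summable_on_product_nonneg:
  fixes f :: "'i \<Rightarrow> real" and g :: "'j \<Rightarrow> real"
  assumes "f summable_on A" "g summable_on B" "\<And>x. f x \<ge> 0" "\<And>y. g y \<ge> 0"
  shows "(\<lambda>(x, y). f x * g y) summable_on A \<times> B"
proof (rule summable_on_SigmaI)
  show "((\<lambda>y. case (x, y) of (x, y) \<Rightarrow> f x * g y) has_sum f x * infsum g B) B" for x
    using has_sum_cmult_right[OF has_sum_infsum[OF assms(2)], of "f x"] by simp
qed (use assms in \<open>auto intro: summable_on_cmult_left\<close>)

lemma summable_gauss_hex:
  fixes A B c :: real
  assumes A: "A > 0" and B: "B > 0"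
  shows "(\<lambda>(m::int, n::int). exp (- (A * (of_int m + of_int n / 2)\<^sup>2)) * exp (- (B * (of_int n + c)\<^sup>2))) summable_on UNIV"
proof -
  \<comment> \<open>The constants come from the identity 2(x + y/2)^2 + 3y^2/2 = x^2 + y^2 + (x +
    y)^2; half of \<open>B\<close> is given up to absorb the shift \<open>c\<close>.\<close>
  define k where "k = min (A/2) (B/3)"
  have k: "k > 0" "2 * k \<le> A" "3 * k \<le> B" using A B by (auto simp: k_def)
  have "(\<lambda>(m::int, n::int). (exp (B * c\<^sup>2) * exp (- (k * (of_int m + 0)\<^sup>2))) * exp (- (k * (of_int n + 0)\<^sup>2))) summable_on UNIV \<times> UNIV"
    by (intro summable_on_product_nonneg summable_on_cmult_right summable_int_gauss k) auto
  then have "(\<lambda>(m::int, n::int). exp (B * c\<^sup>2) * exp (- (k * (of_int m + 0)\<^sup>2)) * exp (- (k * (of_int n + 0)\<^sup>2))) summable_on UNIV"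
    by simp
  then show ?thesis
  proof (rule summable_on_comparison_test)
    fix p :: "int \<times> int"
    obtain m n where p: "p = (m, n)" by force
    define x y where "x = real_of_int m" and "y = real_of_int n"
    have "(y + c)\<^sup>2 + c\<^sup>2 - y\<^sup>2 / 2 = (y + 2 * c)\<^sup>2 / 2"
      by (simp add: power2_eq_square algebra_simps add_divide_distrib)
    then have "y\<^sup>2 / 2 \<le> (y + c)\<^sup>2 + c\<^sup>2" by (smt (verit) zero_le_power2 divide_nonneg_pos)
    then have "B * (y\<^sup>2 / 2) \<le> B * ((y + c)\<^sup>2 + c\<^sup>2)" using B by (intro mult_left_mono) auto
    moreover have "3 * k * y\<^sup>2 \<le> B * y\<^sup>2" using k by (intro mult_right_mono) auto
    moreover have "2 * k * (x + y / 2)\<^sup>2 \<le> A * (x + y / 2)\<^sup>2" using k by (intro mult_right_mono) auto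
    moreover have "2 * (x + y / 2)\<^sup>2 + 3 * (y\<^sup>2 / 2) - (x\<^sup>2 + y\<^sup>2) = (x + y)\<^sup>2"
      by (simp add: power2_eq_square algebra_simps add_divide_distrib)
    then have "x\<^sup>2 + y\<^sup>2 \<le> 2 * (x + y / 2)\<^sup>2 + 3 * (y\<^sup>2 / 2)" by (smt (verit) zero_le_power2)
    then have "k * (x\<^sup>2 + y\<^sup>2) \<le> k * (2 * (x + y / 2)\<^sup>2 + 3 * (y\<^sup>2 / 2))" using k by (intro mult_left_mono) auto
    ultimately have "k * x\<^sup>2 + k * y\<^sup>2 \<le> A * (x + y / 2)\<^sup>2 + B * (y + c)\<^sup>2 + B * c\<^sup>2"
      by (simp add: algebra_simps)
    then show "(case p of (m, n) \<Rightarrow> exp (- (A * (of_int m + of_int n / 2)\<^sup>2)) * exp (- (B * (of_int n + c)\<^sup>2)))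
      \<le> (case p of (m, n) \<Rightarrow> exp (B * c\<^sup>2) * exp (- (k * (of_int m + 0)\<^sup>2)) * exp (- (k * (of_int n + 0)\<^sup>2)))"
      unfolding p x_def y_def by (simp add: exp_add[symmetric])
  qed auto
qed

text \<open>Two applications of the one-dimensional formula, in m for fixed n and then in n for
  fixed dual index. The parameters \<open>w\<close> and \<open>d\<close> are carried along because
  products of coefficients of two modulated Gaussians depend on the mean and the difference of their
  frequencies.\<close>

lemma poisson_hex:
  fixes r s w d :: real
  assumes r: "r > 0" and s: "s > 0"
  shows "(\<Sum>\<^sub>\<infinity>(m, n)\<in>(UNIV :: (int \<times> int) set).
       complex_of_real (exp (- (pi * (r * (of_int m + of_int n / 2))\<^sup>2)) * exp (- (pi * (s * of_int n - w)\<^sup>2)))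
         * cis (pi * d * r * (of_int m + of_int n / 2)))
     = of_real (1 / (r * s)) * (\<Sum>\<^sub>\<infinity>(m, n)\<in>(UNIV :: (int \<times> int) set).
       complex_of_real (exp (- (pi * ((of_int m + of_int n / 2) / s)\<^sup>2)) * exp (- (pi * (of_int n / r + d / 2)\<^sup>2)))
         * cis (- (2 * pi * w * ((of_int m + of_int n / 2) / s))))"
    (is "?L = of_real (1 / (r * s)) * ?R")
proof -
  define E where "E n = complex_of_real (exp (- (pi * (s * of_int n - w)\<^sup>2)))" for n :: int
  define F where "F k = complex_of_real (exp (- (pi * (of_int k / r - d / 2)\<^sup>2)))" for k :: int
  have Es: "(\<lambda>n. exp (- (pi * (s * of_int n - w)\<^sup>2))) summable_on (UNIV :: int set)"
  proof -
    have "pi * (s * of_int n - w)\<^sup>2 = pi * s\<^sup>2 * (of_int n + (- w / s))\<^sup>2" for n :: int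
      using s by (simp add: power_mult_distrib[symmetric] field_simps)
    then show ?thesis using summable_int_gauss[of "pi * s\<^sup>2" "- w / s"] s by (simp add: mult.assoc)
  qed
  have Fs: "(\<lambda>n. exp (- (pi * (of_int n / r - d / 2)\<^sup>2))) summable_on (UNIV :: int set)"
  proof -
    have "pi * (of_int n / r - d / 2)\<^sup>2 = pi * (1 / r)\<^sup>2 * (of_int n + (- d * r / 2))\<^sup>2" for n :: int
      using r by (simp add: power_mult_distrib[symmetric] field_simps)
    then show ?thesis using summable_int_gauss[of "pi * (1 / r)\<^sup>2" "- d * r / 2"] r by (simp add: mult.assoc)
  qed
  define f where "f m n = complex_of_real (exp (- (pi * (r * (of_int m + of_int n / 2))\<^sup>2)) * exp (- (pi * (s * of_int n - w)\<^sup>2)))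
         * cis (pi * d * r * (of_int m + of_int n / 2))" for m n :: int
  have fs: "(\<lambda>(m, n). f m n) summable_on UNIV \<times> UNIV"
  proof -
    have "(\<lambda>(m::int, n::int). exp (- (pi * r\<^sup>2 * (of_int m + of_int n / 2)\<^sup>2)) * exp (- (pi * s\<^sup>2 * (of_int n + (- w / s))\<^sup>2))) summable_on UNIV"
      by (rule summable_gauss_hex) (use r s in auto)
    moreover have "pi * s\<^sup>2 * (of_int n + (- w / s))\<^sup>2 = pi * (s * of_int n - w)\<^sup>2" for n :: int
      using s by (simp add: power_mult_distrib[symmetric] field_simps)
    ultimately have "(\<lambda>(m::int, n::int). exp (- (pi * (r * (of_int m + of_int n / 2))\<^sup>2)) * exp (- (pi * (s * of_int n - w)\<^sup>2))) summable_on UNIV \<times> UNIV"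
      by (simp add: power_mult_distrib mult.assoc)
    then show ?thesis
      by (rule summable_on_norm_le) (auto simp: f_def norm_mult)
  qed
  have inner1: "(\<Sum>\<^sub>\<infinity>m. f m n) = of_real (1 / r) * (\<Sum>\<^sub>\<infinity>k. E n * (F k * cis (pi * of_int k * of_int n)))" for n
  proof -
    have "(\<Sum>\<^sub>\<infinity>m. f m n) = (\<Sum>\<^sub>\<infinity>m. E n * (complex_of_real (exp (- (pi * r\<^sup>2 * (of_int m + of_int n / 2)\<^sup>2))) *
          cis (2 * pi * (d * r / 2) * (of_int m + of_int n / 2))))"
      by (rule infsum_cong) (simp add: f_def E_def power_mult_distrib mult_ac)
    also have "\<dots> = E n * (of_real (1 / sqrt (r\<^sup>2)) * (\<Sum>\<^sub>\<infinity>k::int. complex_of_real (exp (- (pi * (of_int k - d * r / 2)\<^sup>2 / r\<^sup>2)))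
          * cis (2 * pi * of_int k * (of_int n / 2))))"
      unfolding infsum_cmult_right' by (subst poisson_gauss) (use r in auto)
    also have "(\<Sum>\<^sub>\<infinity>k::int. complex_of_real (exp (- (pi * (of_int k - d * r / 2)\<^sup>2 / r\<^sup>2)))
          * cis (2 * pi * of_int k * (of_int n / 2))) = (\<Sum>\<^sub>\<infinity>k. F k * cis (pi * of_int k * of_int n))"
    proof (rule infsum_cong)
      fix k :: int
      have "(of_int k - d * r / 2)\<^sup>2 / r\<^sup>2 = (of_int k / r - d / 2)\<^sup>2"
        using r by (simp add: power_divide[symmetric] diff_divide_distrib)
      then have "pi * (of_int k - d * r / 2)\<^sup>2 / r\<^sup>2 = pi * (of_int k / r - d / 2)\<^sup>2"
        by (simp flip: times_divide_eq_right)
      moreover have "2 * pi * of_int k * (of_int n / 2) = pi * of_int k * real_of_int n" by simp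
      ultimately show "complex_of_real (exp (- (pi * (of_int k - d * r / 2)\<^sup>2 / r\<^sup>2))) * cis (2 * pi * of_int k * (of_int n / 2))
          = F k * cis (pi * of_int k * of_int n)"
        by (simp only: F_def)
    qed
    finally show ?thesis using r by (simp add: infsum_cmult_right')
  qed
  have EFs: "(\<lambda>(n, k). E n * (F k * cis (pi * of_int k * of_int n))) summable_on UNIV \<times> UNIV"
    by (rule summable_on_norm_le[OF summable_on_product_nonneg[OF Es Fs]])
       (auto simp: E_def F_def norm_mult)
  \<comment> \<open>After the first summation the half-integer shift n/2 has become the sign (-1)^(k
    n). It acts as a modulation of frequency k/2 in n and returns as the shift of l by k/2, which is
    why the dual lattice is hexagonal again.\<close>
  have inner2: "(\<Sum>\<^sub>\<infinity>n. E n * (F k * cis (pi * of_int k * of_int n)))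
     = of_real (1 / s) * (\<Sum>\<^sub>\<infinity>l. F k * (complex_of_real (exp (- (pi * ((of_int l - of_int k / 2) / s)\<^sup>2)))
         * cis (- (2 * pi * w * ((of_int l - of_int k / 2) / s)))))" for k
  proof -
    have e: "E n * (F k * cis (pi * of_int k * of_int n)) = F k * cis (pi * of_int k * w / s) *
        (complex_of_real (exp (- (pi * s\<^sup>2 * (of_int n + (- w / s))\<^sup>2))) * cis (2 * pi * (of_int k / 2) * (of_int n + (- w / s))))" for n :: int
    proof -
      have "pi * s\<^sup>2 * (of_int n + (- w / s))\<^sup>2 = pi * (s * of_int n - w)\<^sup>2"
        using s by (simp add: power_mult_distrib[symmetric] field_simps)
      moreover have "cis (pi * of_int k * of_int n) = cis (pi * of_int k * w / s) * cis (2 * pi * (of_int k / 2) * (of_int n + (- w / s)))"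
        using s by (simp add: cis_mult field_simps)
      ultimately show ?thesis by (simp add: E_def mult_ac)
    qed
    have "(\<Sum>\<^sub>\<infinity>n. E n * (F k * cis (pi * of_int k * of_int n))) = F k * cis (pi * of_int k * w / s) *
       (of_real (1 / sqrt (s\<^sup>2)) * (\<Sum>\<^sub>\<infinity>l::int. complex_of_real (exp (- (pi * (of_int l - of_int k / 2)\<^sup>2 / s\<^sup>2)))
          * cis (2 * pi * of_int l * (- w / s))))"
      unfolding e infsum_cmult_right' by (subst poisson_gauss) (use s in auto)
    also have "\<dots> = of_real (1 / s) * (\<Sum>\<^sub>\<infinity>l::int. F k * (cis (pi * of_int k * w / s) * (complex_of_real (exp (- (pi * (of_int l - of_int k / 2)\<^sup>2 / s\<^sup>2)))
          * cis (2 * pi * of_int l * (- w / s)))))"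
      unfolding infsum_cmult_right' using s by simp
    also have "(\<Sum>\<^sub>\<infinity>l::int. F k * (cis (pi * of_int k * w / s) * (complex_of_real (exp (- (pi * (of_int l - of_int k / 2)\<^sup>2 / s\<^sup>2)))
          * cis (2 * pi * of_int l * (- w / s))))) = (\<Sum>\<^sub>\<infinity>l. F k * (complex_of_real (exp (- (pi * ((of_int l - of_int k / 2) / s)\<^sup>2)))
         * cis (- (2 * pi * w * ((of_int l - of_int k / 2) / s)))))"
    proof (rule infsum_cong)
      fix l :: int
      have "cis (pi * of_int k * w / s) * cis (2 * pi * of_int l * (- w / s)) = cis (- (2 * pi * w * ((of_int l - of_int k / 2) / s)))"
      proof -
        have "pi * of_int k * w / s + 2 * pi * of_int l * (- w / s) = - (2 * pi * w * ((of_int l - of_int k / 2) / s))"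
          using s by (simp add: divide_simps) (simp add: algebra_simps)
        then show ?thesis by (simp only: cis_mult)
      qed
      then show "F k * (cis (pi * of_int k * w / s) * (complex_of_real (exp (- (pi * (of_int l - of_int k / 2)\<^sup>2 / s\<^sup>2)))
          * cis (2 * pi * of_int l * (- w / s)))) = F k * (complex_of_real (exp (- (pi * ((of_int l - of_int k / 2) / s)\<^sup>2)))
         * cis (- (2 * pi * w * ((of_int l - of_int k / 2) / s))))"
        by (simp add: power_divide mult_ac)
    qed
    finally show ?thesis .
  qed
  define g where "g k l = F k * (complex_of_real (exp (- (pi * ((of_int l - of_int k / 2) / s)\<^sup>2)))
         * cis (- (2 * pi * w * ((of_int l - of_int k / 2) / s))))" for k l :: int
  have gR: "g (-n) m = complex_of_real (exp (- (pi * ((of_int m + of_int n / 2) / s)\<^sup>2)) * exp (- (pi * (of_int n / r + d / 2)\<^sup>2)))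
         * cis (- (2 * pi * w * ((of_int m + of_int n / 2) / s)))" for m n
    by (simp add: g_def F_def power2_commute[of _ "d / 2"] power2_eq_square algebra_simps)
  have gs: "(\<lambda>(k, l). g k l) summable_on UNIV \<times> UNIV"
  proof -
    have "(\<lambda>(m::int, n::int). exp (- (pi * (1 / s)\<^sup>2 * (of_int m + of_int n / 2)\<^sup>2)) * exp (- (pi * (1 / r)\<^sup>2 * (of_int n + d * r / 2)\<^sup>2))) summable_on UNIV"
      by (rule summable_gauss_hex) (use r s in auto)
    then have "(\<lambda>(m, n). g (-n) m) summable_on UNIV"
    proof (rule summable_on_norm_le)
      fix p :: "int \<times> int"
      obtain m n where p: "p = (m, n)" by force
      have "(1 / s)\<^sup>2 * (of_int m + of_int n / 2)\<^sup>2 = ((of_int m + of_int n / 2) / s)\<^sup>2"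
        by (simp add: power_divide)
      moreover have "(1 / r)\<^sup>2 * (of_int n + d * r / 2)\<^sup>2 = (of_int n / r + d / 2)\<^sup>2"
        using r by (simp add: power_mult_distrib[symmetric] field_simps)
      ultimately show "cmod (case p of (m, n) \<Rightarrow> g (-n) m) \<le> (case p of (m, n) \<Rightarrow> exp (- (pi * (1 / s)\<^sup>2 * (of_int m + of_int n / 2)\<^sup>2)) * exp (- (pi * (1 / r)\<^sup>2 * (of_int n + d * r / 2)\<^sup>2)))"
        unfolding p by (simp add: gR norm_mult mult.assoc)
    qed
    also have "?this \<longleftrightarrow> (\<lambda>(k, l). g k l) summable_on UNIV \<times> UNIV"
      by (rule summable_on_reindex_bij_witness[of _ "\<lambda>(k, l). (l, -k)" "\<lambda>(m, n). (-n, m)"]) auto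
    finally show ?thesis .
  qed
  have "?L = (\<Sum>\<^sub>\<infinity>(m, n)\<in>UNIV \<times> UNIV. f m n)" by (simp add: f_def)
  also have "\<dots> = (\<Sum>\<^sub>\<infinity>m. \<Sum>\<^sub>\<infinity>n. f m n)" by (rule infsum_Sigma'_banach[OF fs, symmetric])
  also have "\<dots> = (\<Sum>\<^sub>\<infinity>n. \<Sum>\<^sub>\<infinity>m. f m n)" by (rule infsum_swap_banach[OF fs])
  also have "\<dots> = of_real (1 / r) * (\<Sum>\<^sub>\<infinity>n. \<Sum>\<^sub>\<infinity>k. E n * (F k * cis (pi * of_int k * of_int n)))"
    unfolding inner1 by (rule infsum_cmult_right')
  also have "(\<Sum>\<^sub>\<infinity>n. \<Sum>\<^sub>\<infinity>k. E n * (F k * cis (pi * of_int k * of_int n))) = (\<Sum>\<^sub>\<infinity>k. \<Sum>\<^sub>\<infinity>n. E n * (F k * cis (pi * of_int k * of_int n)))"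
    by (rule infsum_swap_banach[OF EFs])
  also have "\<dots> = of_real (1 / s) * (\<Sum>\<^sub>\<infinity>k. \<Sum>\<^sub>\<infinity>l. g k l)"
    unfolding inner2 g_def by (rule infsum_cmult_right')
  also have "(\<Sum>\<^sub>\<infinity>k. \<Sum>\<^sub>\<infinity>l. g k l) = (\<Sum>\<^sub>\<infinity>(k, l)\<in>UNIV \<times> UNIV. g k l)"
    by (rule infsum_Sigma'_banach[OF gs])
  \<comment> \<open>The dual indices appear as l - k/2; exchanging them and reversing the sign of k
    restores the shape m + n/2.\<close>
  also have "\<dots> = (\<Sum>\<^sub>\<infinity>(m, n)\<in>UNIV. g (-n) m)"
    by (rule infsum_reindex_bij_witness[of _ "\<lambda>(m, n). (-n, m)" "\<lambda>(k, l). (l, -k)"]) auto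
  also have "\<dots> = ?R" by (simp only: gR)
  finally show ?thesis by (simp add: mult.assoc)
qed

section \<open>Cubic theta functions\<close>

definition hex_form :: "int \<Rightarrow> int \<Rightarrow> int" where "hex_form m n = m\<^sup>2 + m * n + n\<^sup>2"

lemma hex_form_commute: "hex_form n m = hex_form m n"
  by (simp add: hex_form_def algebra_simps)

lemma real_hex_form: "real_of_int (hex_form m n) = (of_int m + of_int n / 2)\<^sup>2 + 3/4 * (of_int n)\<^sup>2"
  by (simp add: hex_form_def power2_eq_square algebra_simps)

definition cubic_a :: "real \<Rightarrow> real" where
  "cubic_a q = (\<Sum>\<^sub>\<infinity>(m, n)\<in>UNIV. q powi hex_form m n)"

definition w3 :: "int \<Rightarrow> complex" where "w3 k = cis (2 * pi / 3 * of_int k)"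

lemma w3_add: "w3 (k + l) = w3 k * w3 l"
  by (simp only: w3_def cis_mult of_int_add distrib_left)

lemma w3_0 [simp]: "w3 0 = 1" by (simp add: w3_def)

lemma cmod_w3 [simp]: "cmod (w3 k) = 1" by (simp add: w3_def)

lemma w3_3 [simp]: "w3 (3 * k) = 1"
proof -
  have "2 * pi / 3 * of_int (3 * k) = 2 * pi * of_int k" by simp
  then show ?thesis by (simp only: w3_def) (rule cis_multiple_2pi, simp)
qed

lemma w3_cong: "k mod 3 = l mod 3 \<Longrightarrow> w3 k = w3 l"
proof -
  assume "k mod 3 = l mod 3"
  then have "3 dvd k - l" by (metis mod_eq_dvd_iff)
  then obtain j where "k = l + 3 * j" by (auto simp: dvd_def algebra_simps)
  then show ?thesis by (simp add: w3_add)
qed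

lemma cnj_w3: "cnj (w3 k) = w3 (- k)"
  by (simp add: w3_def cis_cnj)

lemma w3_1: "w3 1 = Complex (-1/2) (sqrt 3 / 2)"
  by (simp add: w3_def complex_eq_iff cos_120 sin_120)

lemma w3_2: "w3 2 = Complex (-1/2) (- sqrt 3 / 2)"
  using w3_add[of 1 1] by (simp add: w3_1 complex_eq_iff)

text \<open>Orthogonality of the three characters of Z/3.\<close>

lemma w3_sum: "1 + w3 k + w3 (2 * k) = (if k mod 3 = 0 then 3 else 0)"
proof -
  have d: "w3 (2 * k) = w3 k * w3 k" unfolding w3_add[symmetric] by simp
  have s: "w3 1 * w3 1 = w3 2" "w3 2 * w3 2 = w3 1"
    using w3_add[of 1 1] w3_add[of 2 2] w3_cong[of 4 1] by simp_all
  consider "k mod 3 = 0" | "k mod 3 = 1" | "k mod 3 = 2" by linarith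
  then show ?thesis
  proof cases
    case 1
    then have "w3 k = w3 0" by (intro w3_cong) simp
    with 1 show ?thesis by (simp add: d)
  next
    case 2
    then have "w3 k = w3 1" by (intro w3_cong) simp
    with 2 show ?thesis by (simp add: d s) (simp add: w3_1 w3_2 complex_eq_iff)
  next
    case 3
    then have "w3 k = w3 2" by (intro w3_cong) simp
    with 3 show ?thesis by (simp add: d s) (simp add: w3_1 w3_2 complex_eq_iff)
  qed
qed

lemma powi_eq_exp: "p > 0 \<Longrightarrow> p powi k = exp (ln p * of_int k)" for p :: real
  by (metis exp_ln exp_power_int mult.commute)

lemma summable_hex:
  fixes q :: real
  assumes "0 < q" "q < 1"
  shows "(\<lambda>(m, n). q powi hex_form m n) summable_on UNIV"
proof -
  define x where "x = - ln q"
  have x: "x > 0" using assms by (simp add: x_def)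
  have "(\<lambda>(m::int, n::int). exp (- (x * (of_int m + of_int n / 2)\<^sup>2)) * exp (- (3 * x / 4 * (of_int n + 0)\<^sup>2))) summable_on UNIV"
    by (rule summable_gauss_hex) (use x in auto)
  moreover have "q powi hex_form m n = exp (- (x * (of_int m + of_int n / 2)\<^sup>2)) * exp (- (3 * x / 4 * (of_int n + 0)\<^sup>2))" for m n
    unfolding powi_eq_exp[OF assms(1)] real_hex_form exp_add[symmetric] by (simp add: x_def algebra_simps)
  ultimately show ?thesis by simp
qed

lemma summable_hex_weight:
  assumes "0 < q" "q < 1" "\<And>m n. cmod (c m n) \<le> 1"
  shows "(\<lambda>(m, n). complex_of_real (q powi hex_form m n) * c m n) summable_on A"
proof (rule summable_on_norm_le)
  show "(\<lambda>(m, n). q powi hex_form m n) summable_on A"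
    by (rule summable_on_subset_banach[OF summable_hex]) (use assms in auto)
  show "cmod (case x of (m, n) \<Rightarrow> complex_of_real (q powi hex_form m n) * c m n) \<le> (case x of (m, n) \<Rightarrow> q powi hex_form m n)" for x
    using assms by (auto simp: norm_mult norm_power_int split: prod.splits intro!: mult_left_le)
qed

lemma infsum_of_real_complex: "infsum (\<lambda>x. complex_of_real (f x)) A = of_real (infsum f A)"
  using summable_on_bounded_linear_iff[OF bounded_linear_of_real bounded_linear_Re, of f A]
  by (intro infsum_bounded_linear_strong bounded_linear_of_real) simp

lemma of_real_cubic_a: "of_real (cubic_a q) = (\<Sum>\<^sub>\<infinity>(m, n)\<in>UNIV. complex_of_real (q powi hex_form m n))"
  unfolding cubic_a_def infsum_of_real_complex[symmetric] by (simp add: case_prod_unfold)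

lemma cubic_theta_b_altdef:
  assumes "0 < q"
  shows "cubic_theta_b (of_real q) = (\<Sum>\<^sub>\<infinity>(m, n)\<in>UNIV. complex_of_real (q powi hex_form m n) * w3 (n - m))"
  unfolding cubic_theta_b_def w3_def hex_form_def
  by (intro infsum_cong) (auto simp: cis_power_int of_real_power_int mult.commute)

definition cubic_b :: "real \<Rightarrow> real" where "cubic_b q = Re (cubic_theta_b (of_real q))"

lemma of_real_cubic_b:
  assumes "0 < q"
  shows "of_real (cubic_b q) = cubic_theta_b (of_real q)"
proof -
  have "cnj (cubic_theta_b (of_real q)) = (\<Sum>\<^sub>\<infinity>(m, n)\<in>UNIV. complex_of_real (q powi hex_form m n) * w3 (m - n))"
    unfolding cubic_theta_b_altdef[OF assms] infsum_cnj[symmetric]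
    by (intro infsum_cong) (auto simp: cnj_w3)
  also have "\<dots> = cubic_theta_b (of_real q)"
    unfolding cubic_theta_b_altdef[OF assms]
    by (rule infsum_reindex_bij_witness[of _ prod.swap prod.swap]) (auto simp: hex_form_commute)
  finally show ?thesis by (metis Reals_cnj_iff cubic_b_def of_real_Re)
qed

lemma cubic_b_sum:
  assumes "0 < q"
  shows "of_real (cubic_b q) = (\<Sum>\<^sub>\<infinity>(m, n)\<in>UNIV. complex_of_real (q powi hex_form m n) * w3 (n - m))"
    and "of_real (cubic_b q) = (\<Sum>\<^sub>\<infinity>(m, n)\<in>UNIV. complex_of_real (q powi hex_form m n) * w3 (m - n))"
proof -
  show 1: "of_real (cubic_b q) = (\<Sum>\<^sub>\<infinity>(m, n)\<in>UNIV. complex_of_real (q powi hex_form m n) * w3 (n - m))"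
    by (simp add: of_real_cubic_b[OF assms] cubic_theta_b_altdef[OF assms])
  show "of_real (cubic_b q) = (\<Sum>\<^sub>\<infinity>(m, n)\<in>UNIV. complex_of_real (q powi hex_form m n) * w3 (m - n))"
    unfolding 1
    by (rule infsum_reindex_bij_witness[of _ prod.swap prod.swap]) (auto simp: hex_form_commute)
qed

section \<open>Splitting the hexagonal lattice into classes modulo 3\<close>

definition hex_class :: "int \<Rightarrow> (int \<times> int) set" where
  "hex_class r = {(u, v). (u - v) mod 3 = r mod 3}"

lemma hex_class_iff: "(u, v) \<in> hex_class r \<longleftrightarrow> (\<exists>k. u = v + r + 3 * k)"
proof -
  have "(u, v) \<in> hex_class r \<longleftrightarrow> 3 dvd (u - v) - r"
    by (simp add: hex_class_def mod_eq_dvd_iff)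
  also have "\<dots> \<longleftrightarrow> (\<exists>k. u = v + r + 3 * k)"
    unfolding dvd_def by (rule ex_cong1) linarith
  finally show ?thesis .
qed

lemma hex_classE:
  assumes "x \<in> hex_class r"
  obtains u v k where "x = (u, v)" "u = v + r + 3 * k"
  using assms by (cases x) (auto simp: hex_class_iff)

text \<open>The theta series of a coset of the sublattice of index 3. With t = 0 it is a combination
  of a and b, with t = 1 it produces b at the cubed nome; the product formula for theta series needs
  both.\<close>

definition hex_part :: "real \<Rightarrow> int \<Rightarrow> int \<Rightarrow> complex" where
  "hex_part q t r = (\<Sum>\<^sub>\<infinity>(u, v)\<in>hex_class r. of_real (q powi hex_form u v) * w3 (t * v))"

text \<open>The indicator of the coset is the average of three characters of u - v - r. The trivial
  one contributes a, each of the other two contributes b up to a cube root of unity.\<close>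

lemma hex_part_0:
  assumes q: "0 < q" "q < 1"
  shows "hex_part q 0 r = (if r mod 3 = 0 then of_real ((cubic_a q + 2 * cubic_b q) / 3) else of_real ((cubic_a q - cubic_b q) / 3))"
proof -
  define f where "f c = (\<Sum>\<^sub>\<infinity>(u, v)\<in>UNIV. complex_of_real (q powi hex_form u v) * c u v)" for c :: "int \<Rightarrow> int \<Rightarrow> complex"
  have s: "(\<lambda>(u, v). complex_of_real (q powi hex_form u v) * c u v) summable_on UNIV" if "\<And>u v. cmod (c u v) \<le> 1" for c
    using summable_hex_weight[OF q that] .
  have fa: "f (\<lambda>u v. 1) = of_real (cubic_a q)"
    by (simp add: f_def of_real_cubic_a)
  have fb: "f (\<lambda>u v. w3 (u - v - r)) = w3 (- r) * of_real (cubic_b q)"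
  proof -
    have "f (\<lambda>u v. w3 (u - v - r)) = (\<Sum>\<^sub>\<infinity>(u, v)\<in>UNIV. w3 (- r) * (complex_of_real (q powi hex_form u v) * w3 (u - v)))"
      unfolding f_def by (intro infsum_cong) (auto simp flip: w3_add)
    then show ?thesis
      using infsum_cmult_right'[of "w3 (- r)" "\<lambda>(u, v). complex_of_real (q powi hex_form u v) * w3 (u - v)" UNIV]
      by (simp add: case_prod_unfold cubic_b_sum(2)[OF q(1)])
  qed
  have fc: "f (\<lambda>u v. w3 (2 * (u - v - r))) = w3 (- 2 * r) * of_real (cubic_b q)"
  proof -
    have "w3 (2 * (u - v - r)) = w3 (- 2 * r) * w3 (v - u)" for u v
    proof -
      have "2 * (u - v - r) = (- 2 * r + (v - u)) + 3 * (u - v)" by simp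
      then show ?thesis by (simp only: w3_add w3_3 mult_1_right)
    qed
    then have "f (\<lambda>u v. w3 (2 * (u - v - r))) = (\<Sum>\<^sub>\<infinity>(u, v)\<in>UNIV. w3 (- 2 * r) * (complex_of_real (q powi hex_form u v) * w3 (v - u)))"
      unfolding f_def by (intro infsum_cong) (auto simp: mult_ac)
    then show ?thesis
      using infsum_cmult_right'[of "w3 (- 2 * r)" "\<lambda>(u, v). complex_of_real (q powi hex_form u v) * w3 (v - u)" UNIV]
      by (simp add: case_prod_unfold cubic_b_sum(1)[OF q(1)])
  qed
  have "3 * hex_part q 0 r = (\<Sum>\<^sub>\<infinity>(u, v)\<in>hex_class r. 3 * of_real (q powi hex_form u v))"
    unfolding hex_part_def infsum_cmult_right'[symmetric] by (intro infsum_cong) auto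
  also have "\<dots> = (\<Sum>\<^sub>\<infinity>(u, v)\<in>UNIV. complex_of_real (q powi hex_form u v) * 1 + complex_of_real (q powi hex_form u v) * w3 (u - v - r)
       + complex_of_real (q powi hex_form u v) * w3 (2 * (u - v - r)))"
  proof (rule infsum_cong_neutral)
    have e: "complex_of_real x * 1 + complex_of_real x * w3 k + complex_of_real x * w3 (2 * k) = (if k mod 3 = 0 then 3 * of_real x else 0)" for x k
      using arg_cong[OF w3_sum[of k], of "\<lambda>z. of_real x * z"] by (simp add: distrib_left mult.commute)
    have m: "(u - v - r) mod 3 = 0 \<longleftrightarrow> (u, v) \<in> hex_class r" for u v
      by (simp add: hex_class_def mod_eq_dvd_iff dvd_eq_mod_eq_0)
    fix x :: "int \<times> int"
    obtain u v where x: "x = (u, v)" by force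
    have c: "(case x of (u, v) \<Rightarrow> complex_of_real (q powi hex_form u v) * 1 + complex_of_real (q powi hex_form u v) * w3 (u - v - r)
       + complex_of_real (q powi hex_form u v) * w3 (2 * (u - v - r))) = (if x \<in> hex_class r then 3 * of_real (q powi hex_form u v) else 0)"
      unfolding x prod.case e m ..
    show "(case x of (u, v) \<Rightarrow> 3 * complex_of_real (q powi hex_form u v)) = (case x of (u, v) \<Rightarrow> complex_of_real (q powi hex_form u v) * 1 + complex_of_real (q powi hex_form u v) * w3 (u - v - r)
       + complex_of_real (q powi hex_form u v) * w3 (2 * (u - v - r)))" if "x \<in> hex_class r \<inter> UNIV"
      unfolding c using that by (simp add: x)
    show "(case x of (u, v) \<Rightarrow> complex_of_real (q powi hex_form u v) * 1 + complex_of_real (q powi hex_form u v) * w3 (u - v - r)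
       + complex_of_real (q powi hex_form u v) * w3 (2 * (u - v - r))) = 0" if "x \<in> UNIV - hex_class r"
      unfolding c using that by simp
  qed auto
  also have "\<dots> = f (\<lambda>u v. 1) + f (\<lambda>u v. w3 (u - v - r)) + f (\<lambda>u v. w3 (2 * (u - v - r)))"
  proof -
    note s1 = s[of "\<lambda>u v. 1"] and s2 = s[of "\<lambda>u v. w3 (u - v - r)"] and s3 = s[of "\<lambda>u v. w3 (2 * (u - v - r))"]
    show ?thesis unfolding f_def
      using infsum_add[OF s1 s2] infsum_add[OF summable_on_add[OF s1 s2] s3]
      by (simp add: case_prod_unfold)
  qed
  also have "\<dots> = of_real (cubic_a q) + (w3 (- r) + w3 (2 * (- r))) * of_real (cubic_b q)"
    unfolding fa fb fc by (simp add: algebra_simps)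
  also have "w3 (- r) + w3 (2 * (- r)) = (if r mod 3 = 0 then 3 else 0) - 1"
  proof -
    have "(- r) mod 3 = 0 \<longleftrightarrow> r mod 3 = 0" by presburger
    then show ?thesis using w3_sum[of "- r"] by (auto simp: algebra_simps eq_diff_eq)
  qed
  finally have e: "3 * hex_part q 0 r = of_real (cubic_a q) + ((if r mod 3 = 0 then 3 else 0) - 1) * of_real (cubic_b q)" .
  show ?thesis
  proof (cases "r mod 3 = 0")
    case True
    then have "3 * hex_part q 0 r = 3 * of_real ((cubic_a q + 2 * cubic_b q) / 3)" using e by simp
    then have "hex_part q 0 r = of_real ((cubic_a q + 2 * cubic_b q) / 3)"
      by (rule mult_left_cancel[THEN iffD1, rotated]) simp
    with True show ?thesis by simp
  next
    case False
    then have "3 * hex_part q 0 r = 3 * of_real ((cubic_a q - cubic_b q) / 3)" using e by simp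
    then have "hex_part q 0 r = of_real ((cubic_a q - cubic_b q) / 3)"
      by (rule mult_left_cancel[THEN iffD1, rotated]) simp
    with False show ?thesis by simp
  qed
qed

lemma hex_form_rotate: "hex_form (- u - v) u = hex_form u v"
  by (simp add: hex_form_def power2_eq_square algebra_simps)

text \<open>The rotation of order 3, (u, v) -> (-u - v, u), preserves the quadratic form and the
  coset, but multiplies the twisted sum by \<open>w3 (- r)\<close>, which differs from 1.\<close>

lemma hex_part_1:
  assumes r: "r mod 3 \<noteq> 0"
  shows "hex_part q 1 r = 0"
proof -
  have "hex_part q 1 r = (\<Sum>\<^sub>\<infinity>(u, v)\<in>hex_class r. of_real (q powi hex_form u v) * w3 (- u - v))"
    unfolding hex_part_def
  proof (rule infsum_reindex_bij_witness[of _ "\<lambda>(u, v). (v, - u - v)" "\<lambda>(u, v). (- u - v, u)"])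
    fix x assume "x \<in> hex_class r"
    then obtain u v k where x: "x = (u, v)" "u = v + r + 3 * k" by (rule hex_classE)
    have "- u - v = u + r + 3 * (- v - r - 2 * k)" using x by simp
    then show "(case x of (u, v) \<Rightarrow> (- u - v, u)) \<in> hex_class r"
      unfolding x(1) prod.case hex_class_iff by blast
    have "v = (- u - v) + r + 3 * (v + k)" using x by simp
    then show "(case x of (u, v) \<Rightarrow> (v, - u - v)) \<in> hex_class r"
      unfolding x(1) prod.case hex_class_iff by blast
  qed (auto simp: hex_form_rotate)
  also have "\<dots> = (\<Sum>\<^sub>\<infinity>(u, v)\<in>hex_class r. w3 (- r) * (of_real (q powi hex_form u v) * w3 (1 * v)))"
  proof (rule infsum_cong)
    fix x assume x: "x \<in> hex_class r"
    then obtain u v k where uv: "x = (u, v)" "u = v + r + 3 * k" by (rule hex_classE)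
    have "- u - v = - r + (v + 3 * (- v - k))" using uv by simp
    then have "w3 (- u - v) = w3 (- r) * w3 v"
      by (simp only: w3_add w3_3 mult_1_right)
    then show "(case x of (u, v) \<Rightarrow> of_real (q powi hex_form u v) * w3 (- u - v)) = (case x of (u, v) \<Rightarrow> w3 (- r) * (of_real (q powi hex_form u v) * w3 (1 * v)))"
      by (simp add: uv(1))
  qed
  also have "\<dots> = w3 (- r) * hex_part q 1 r"
    unfolding hex_part_def infsum_cmult_right'[symmetric] by (simp add: case_prod_unfold)
  finally have "(1 - w3 (- r)) * hex_part q 1 r = 0" by (simp add: algebra_simps)
  moreover have "w3 (- r) \<noteq> 1"
  proof
    assume "w3 (- r) = 1"
    moreover from this have "w3 (2 * (- r)) = 1" unfolding mult_2 w3_add by simp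
    moreover have "(- r) mod 3 \<noteq> 0" using r by presburger
    ultimately show False using w3_sum[of "- r"] by simp
  qed
  ultimately show ?thesis by simp
qed

text \<open>Multiplication by \<open>\<surd>(-3)\<close> maps the hexagonal lattice onto the sublattice \<open>hex_class 0\<close>.\<close>

lemma hex_part_tripling:
  "hex_part q t 0 = (\<Sum>\<^sub>\<infinity>(m, n)\<in>UNIV. of_real ((q ^ 3) powi hex_form m n) * w3 (t * (n - m)))"
  unfolding hex_part_def
proof (rule infsum_reindex_bij_witness[of _ "\<lambda>(m, n). (2 * m + n, n - m)" "\<lambda>(u, v). ((u - v) div 3, v + (u - v) div 3)"])
  fix x assume "x \<in> hex_class 0"
  then obtain u v k where "x = (u, v)" "u = v + 0 + 3 * k" by (rule hex_classE)
  then show "(case case x of (u, v) \<Rightarrow> ((u - v) div 3, v + (u - v) div 3) of (m, n) \<Rightarrow> (2 * m + n, n - m)) = x"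
    by auto
next
  have h: "hex_form (2 * m + n) (n - m) = 3 * hex_form m n" for m n
    by (simp add: hex_form_def power2_eq_square algebra_simps)
  fix x assume "x \<in> hex_class 0"
  then obtain u v k where x: "x = (u, v)" "u = v + 0 + 3 * k" by (rule hex_classE)
  have "hex_form u v = 3 * hex_form k (v + k)" using h[of k "v + k"] x by (simp add: algebra_simps)
  then show "(case case x of (u, v) \<Rightarrow> ((u - v) div 3, v + (u - v) div 3) of (m, n) \<Rightarrow> of_real ((q ^ 3) powi hex_form m n) * w3 (t * (n - m)))
     = (case x of (u, v) \<Rightarrow> of_real (q powi hex_form u v) * w3 (t * v))"
    by (simp add: x power_int_mult)
next
  fix x :: "int \<times> int"
  obtain m n where x: "x = (m, n)" by force
  have e: "2 * m + n - (n - m) = 3 * m" by simp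
  show "(case case x of (m, n) \<Rightarrow> (2 * m + n, n - m) of (u, v) \<Rightarrow> ((u - v) div 3, v + (u - v) div 3)) = x"
    unfolding x prod.case e by simp
  have "2 * m + n = (n - m) + 0 + 3 * m" by simp
  then show "(case x of (m, n) \<Rightarrow> (2 * m + n, n - m)) \<in> hex_class 0"
    unfolding x prod.case hex_class_iff by blast
qed simp

lemma cubic_a_cube:
  assumes "0 < q" "q < 1"
  shows "cubic_a (q ^ 3) = (cubic_a q + 2 * cubic_b q) / 3"
proof -
  have "of_real (cubic_a (q ^ 3)) = hex_part q 0 0"
    unfolding hex_part_tripling of_real_cubic_a by simp
  also have "\<dots> = of_real ((cubic_a q + 2 * cubic_b q) / 3)"
    using hex_part_0[OF assms, of 0] by simp
  finally show ?thesis by (simp only: of_real_eq_iff)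
qed

section \<open>Products of theta series and the cubic identity\<close>

definition theta_part :: "real \<Rightarrow> real \<Rightarrow> int \<Rightarrow> complex" where
  "theta_part p x r = (\<Sum>\<^sub>\<infinity>n\<in>{n. n mod 3 = r mod 3}. of_real (p powi n\<^sup>2 * x powi n))"

text \<open>The one-variable theta series at the nome p^3, its argument x multiplied by the k-th
  power of a cube root of unity.\<close>

definition theta_twist :: "real \<Rightarrow> real \<Rightarrow> int \<Rightarrow> complex" where
  "theta_twist p x k = (\<Sum>\<^sub>\<infinity>n. of_real (p powi (3 * n\<^sup>2) * x powi n) * w3 (k * n))"

lemma summable_theta:
  fixes p x :: real
  assumes "0 < p" "p < 1" "0 < x" "0 < c"
  shows "(\<lambda>n. p powi (c * n\<^sup>2) * x powi n) summable_on A"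
proof -
  define l where "l = - ln p * of_int c"
  define d where "d = ln x"
  have l: "l > 0" using assms by (auto simp: l_def intro!: mult_neg_pos)
  have "(\<lambda>n::int. exp (d\<^sup>2 / (4 * l)) * exp (- (l * (of_int n + (- d / (2 * l)))\<^sup>2))) summable_on UNIV"
    by (intro summable_on_cmult_right summable_int_gauss l)
  moreover have "p powi (c * n\<^sup>2) * x powi n = exp (d\<^sup>2 / (4 * l)) * exp (- (l * (of_int n + (- d / (2 * l)))\<^sup>2))" for n
  proof -
    have "d\<^sup>2 / (4 * l) - l * (of_int n + (- d / (2 * l)))\<^sup>2 = - l * of_int (n\<^sup>2) + d * of_int n"
      using l by (simp add: power2_eq_square divide_simps) (simp add: algebra_simps)
    then show ?thesis
      using assms by (simp add: powi_eq_exp exp_add[symmetric] l_def d_def mult_ac)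
  qed
  ultimately show ?thesis by (simp add: summable_on_subset_banach[of _ UNIV])
qed

lemma
  fixes f :: "'i \<Rightarrow> complex" and g :: "'j \<Rightarrow> complex"
  assumes f: "f summable_on A" and g: "g summable_on B"
  shows summable_on_product: "(\<lambda>(x, y). f x * g y) summable_on A \<times> B"
    and infsum_product: "(\<Sum>\<^sub>\<infinity>(x, y)\<in>A \<times> B. f x * g y) = infsum f A * infsum g B"
proof -
  have "(\<lambda>(x, y). cmod (f x) * cmod (g y)) summable_on A \<times> B"
    using f g by (intro summable_on_product_nonneg) (auto simp flip: summable_on_iff_abs_summable_on_complex)
  then show s: "(\<lambda>(x, y). f x * g y) summable_on A \<times> B"
    by (rule summable_on_norm_le) (auto simp: norm_mult)
  have "(\<Sum>\<^sub>\<infinity>(x, y)\<in>A \<times> B. f x * g y) = (\<Sum>\<^sub>\<infinity>x\<in>A. \<Sum>\<^sub>\<infinity>y\<in>B. f x * g y)"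
    by (rule infsum_Sigma'_banach[OF s, symmetric])
  then show "(\<Sum>\<^sub>\<infinity>(x, y)\<in>A \<times> B. f x * g y) = infsum f A * infsum g B"
    by (simp add: infsum_cmult_right' infsum_cmult_left')
qed

lemma hex_class_cong: "r mod 3 = s mod 3 \<Longrightarrow> hex_class r = hex_class s"
  by (simp add: hex_class_def)

lemma infsum_mod_3:
  fixes K :: "int \<Rightarrow> complex"
  assumes "K summable_on UNIV"
  shows "infsum K UNIV = (\<Sum>r\<in>{0,1,2}. infsum K {n. n mod 3 = r mod 3})"
proof -
  have "(UNIV :: int set) = \<Union> ((\<lambda>r. {n. n mod 3 = r mod 3}) ` {0,1,2})"
  proof -
    have "n mod 3 = 0 mod 3 \<or> n mod 3 = 1 mod 3 \<or> n mod 3 = 2 mod 3" for n :: int by auto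
    then show ?thesis by auto
  qed
  then have "infsum K UNIV = infsum K (\<Union>r\<in>{0,1,2}. {n. n mod 3 = r mod 3})" by simp
  also have "\<dots> = (\<Sum>r\<in>{0,1,2}. infsum K {n. n mod 3 = r mod 3})"
    by (rule sum_infsum[symmetric]) (auto intro: summable_on_subset_banach[OF assms])
  finally show ?thesis .
qed

text \<open>The summation indices a, b, c are replaced by their sum n and the differences u = a - b,
  v = b - c. Then 3(a^2 + b^2 + c^2) = n^2 + 2(u^2 + u v + v^2), which separates a one-variable
  theta series from a hexagonal one; the only coupling left is the congruence u - v = n modulo
  3.\<close>

lemma theta_twist_product:
  assumes p: "0 < p" "p < 1" and x: "0 < x"
  shows "theta_twist p x j * theta_twist p x (j + t) * theta_twist p x (j + 2 * t)
    = (\<Sum>r\<in>{0,1,2}. w3 (j * r) * hex_part (p\<^sup>2) t r * theta_part p x r)"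
proof -
  define f where "f k n = complex_of_real (p powi (3 * n\<^sup>2) * x powi n) * w3 (k * n)" for k n
  have fs: "f k summable_on A" for k A
    by (rule summable_on_norm_le[OF summable_theta[OF p x, of 3]]) (use p x in \<open>auto simp: f_def norm_mult norm_power_int\<close>)
  have tw: "theta_twist p x k = infsum (f k) UNIV" for k
    by (simp only: theta_twist_def f_def[abs_def])
  define G where "G n = complex_of_real (p powi n\<^sup>2 * x powi n) * w3 (j * n)" for n
  define H where "H = (\<lambda>(u, v). complex_of_real (p\<^sup>2 powi hex_form u v) * w3 (t * v))"
  define F where "F = (\<lambda>((a, b), c). f j a * f (j + t) b * f (j + 2 * t) c)"
  have FG: "F ((u + v + k, v + k), k) = G (3 * k + u + 2 * v) * H (u, v)" for u v k
  proof -
    have pa: "p powi (a + b) = p powi a * p powi b" for a b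
      using p by (simp add: power_int_add)
    have p2: "p\<^sup>2 powi h = p powi (2 * h)" for h by (simp add: power_int_mult)
    have "3 * (u + v + k)\<^sup>2 + 3 * (v + k)\<^sup>2 + 3 * k\<^sup>2 = (3 * k + u + 2 * v)\<^sup>2 + 2 * hex_form u v"
      by (simp add: hex_form_def power2_eq_square algebra_simps)
    then have e1: "p powi (3 * (u + v + k)\<^sup>2) * p powi (3 * (v + k)\<^sup>2) * p powi (3 * k\<^sup>2) = p powi (3 * k + u + 2 * v)\<^sup>2 * p\<^sup>2 powi hex_form u v"
      unfolding p2 pa[symmetric] by (rule arg_cong)
    have e2: "x powi (u + v + k) * x powi (v + k) * x powi k = x powi (3 * k + u + 2 * v)"
      using x by (simp add: power_int_add[symmetric] algebra_simps)
    have e3: "w3 (j * (u + v + k)) * w3 ((j + t) * (v + k)) * w3 ((j + 2 * t) * k) = w3 (j * (3 * k + u + 2 * v)) * w3 (t * v)"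
    proof -
      have "j * (u + v + k) + (j + t) * (v + k) + (j + 2 * t) * k = j * (3 * k + u + 2 * v) + t * v + 3 * (t * k)"
        by (simp add: algebra_simps)
      then have "w3 (j * (u + v + k) + (j + t) * (v + k) + (j + 2 * t) * k) = w3 (j * (3 * k + u + 2 * v) + t * v + 3 * (t * k))" by simp
      then show ?thesis by (simp only: w3_add w3_3 mult_1_right)
    qed
    have "F ((u + v + k, v + k), k) =
       of_real (p powi (3 * (u + v + k)\<^sup>2) * p powi (3 * (v + k)\<^sup>2) * p powi (3 * k\<^sup>2)) *
       of_real (x powi (u + v + k) * x powi (v + k) * x powi k) *
       (w3 (j * (u + v + k)) * w3 ((j + t) * (v + k)) * w3 ((j + 2 * t) * k))"
      unfolding F_def f_def prod.case of_real_mult by (simp only: mult_ac)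
    also have "\<dots> = G (3 * k + u + 2 * v) * H (u, v)"
      unfolding e1 e2 e3 G_def H_def prod.case of_real_mult by (simp only: mult_ac)
    finally show ?thesis .
  qed
  have Fs: "F summable_on (UNIV \<times> UNIV) \<times> UNIV"
    using summable_on_product[OF summable_on_product[OF fs[of j UNIV] fs[of "j + t" UNIV]] fs[of "j + 2 * t" UNIV]]
    by (simp add: F_def case_prod_unfold)
  have "theta_twist p x j * theta_twist p x (j + t) * theta_twist p x (j + 2 * t) = infsum F ((UNIV \<times> UNIV) \<times> UNIV)"
    using infsum_product[OF summable_on_product[OF fs[of j UNIV] fs[of "j + t" UNIV]] fs[of "j + 2 * t" UNIV]]
      infsum_product[OF fs[of j UNIV] fs[of "j + t" UNIV]]
    by (simp add: F_def tw case_prod_unfold)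
  \<comment> \<open>The inverse recovers c as (n - u - 2v)/3, and the congruence defining
    \<open>hex_class n\<close> is exactly divisibility by 3. Outside that class the rounded quotient
    is irrelevant.\<close>
  define ii where "ii = (\<lambda>(n, (u, v)). ((u + v + (n - u - 2 * v) div 3, v + (n - u - 2 * v) div 3), (n - u - 2 * v) div 3 :: int))"
  define jj where "jj = (\<lambda>((a, b), c). (a + b + c, (a - b, b - c)) :: int \<times> int \<times> int)"
  have 1: "ii (jj y) = y" and 2: "jj y \<in> Sigma UNIV hex_class" and 3: "(\<lambda>(n, y). G n * H y) (jj y) = F y" for y
  proof -
    obtain a b c where y: "y = ((a, b), c)" by (metis surj_pair)
    have e: "a + b + c - (a - b) - 2 * (b - c) = 3 * c" by simp
    show "ii (jj y) = y" unfolding y ii_def jj_def prod.case e by simp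
    have "a - b = (b - c) + (a + b + c) + 3 * (- b)" by simp
    then show "jj y \<in> Sigma UNIV hex_class"
      unfolding y jj_def prod.case mem_Sigma_iff hex_class_iff by blast
    show "(\<lambda>(n, y). G n * H y) (jj y) = F y"
      using FG[of "a - b" "b - c" c] by (simp add: y jj_def algebra_simps)
  qed
  have 4: "jj (ii z) = z" if "z \<in> Sigma UNIV hex_class" for z
  proof -
    obtain n u v where z: "z = (n, (u, v))" by (metis surj_pair)
    with that have "(u, v) \<in> hex_class n" by auto
    then obtain k where k: "u = v + n + 3 * k" by (auto simp: hex_class_iff)
    have e: "n - u - 2 * v = 3 * (- v - k)" using k by simp
    show ?thesis unfolding z ii_def jj_def prod.case e using k by simp
  qed
  have Gs: "(\<lambda>(n, y). G n * H y) summable_on Sigma UNIV hex_class"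
    using Fs summable_on_reindex_bij_witness[of "(UNIV \<times> UNIV) \<times> UNIV" ii jj "Sigma UNIV hex_class" "\<lambda>(n, y). G n * H y" F] 1 2 3 4
    by simp
  have "infsum F ((UNIV \<times> UNIV) \<times> UNIV) = (\<Sum>\<^sub>\<infinity>(n, y)\<in>Sigma UNIV hex_class. G n * H y)"
    by (rule infsum_reindex_bij_witness[of _ ii jj]) (use 1 2 3 4 in auto)
  also have "\<dots> = (\<Sum>\<^sub>\<infinity>n. \<Sum>\<^sub>\<infinity>y\<in>hex_class n. G n * H y)"
    by (rule infsum_Sigma'_banach[OF Gs, symmetric])
  also have "\<dots> = (\<Sum>\<^sub>\<infinity>n. G n * hex_part (p\<^sup>2) t n)"
    by (simp add: infsum_cmult_right' hex_part_def H_def)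
  also have "\<dots> = (\<Sum>r\<in>{0,1,2}. \<Sum>\<^sub>\<infinity>n\<in>{n. n mod 3 = r mod 3}. G n * hex_part (p\<^sup>2) t n)"
  proof -
    define K where "K n = G n * hex_part (p\<^sup>2) t n" for n
    have "K summable_on UNIV"
      using summable_on_Sigma_banach[OF Gs] by (simp add: K_def[abs_def] infsum_cmult_right' hex_part_def H_def)
    from infsum_mod_3[OF this] show ?thesis unfolding K_def[abs_def] .
  qed
  also have "\<dots> = (\<Sum>r\<in>{0,1,2}. w3 (j * r) * hex_part (p\<^sup>2) t r * theta_part p x r)"
  proof (rule sum.cong[OF refl])
    fix r :: int
    have "(\<Sum>\<^sub>\<infinity>n\<in>{n. n mod 3 = r mod 3}. G n * hex_part (p\<^sup>2) t n)
       = (\<Sum>\<^sub>\<infinity>n\<in>{n. n mod 3 = r mod 3}. (w3 (j * r) * hex_part (p\<^sup>2) t r) * of_real (p powi n\<^sup>2 * x powi n))"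
    proof (rule infsum_cong)
      fix n assume "n \<in> {n. n mod 3 = r mod 3}"
      then have n: "n mod 3 = r mod 3" by simp
      have "hex_part (p\<^sup>2) t n = hex_part (p\<^sup>2) t r" by (simp only: hex_part_def hex_class_cong[OF n])
      moreover have "w3 (j * n) = w3 (j * r)" by (rule w3_cong) (metis n mod_mult_right_eq)
      ultimately show "G n * hex_part (p\<^sup>2) t n = (w3 (j * r) * hex_part (p\<^sup>2) t r) * of_real (p powi n\<^sup>2 * x powi n)"
        by (simp add: G_def)
    qed
    then show "(\<Sum>\<^sub>\<infinity>n\<in>{n. n mod 3 = r mod 3}. G n * hex_part (p\<^sup>2) t n) = w3 (j * r) * hex_part (p\<^sup>2) t r * theta_part p x r"
      by (simp add: infsum_cmult_right' theta_part_def)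
  qed
  finally show ?thesis
    using \<open>_ = infsum F ((UNIV \<times> UNIV) \<times> UNIV)\<close> by simp
qed

text \<open>By n^2 + 2n = (n + 1)^2 - 1 the factor p^(2n) moves the residue by one and costs a
  factor 1/p.\<close>

lemma theta_part_shift:
  assumes "0 < p"
  shows "theta_part p (p\<^sup>2) r = of_real (1 / p) * theta_part p 1 (r + 1)"
proof -
  have "theta_part p (p\<^sup>2) r = (\<Sum>\<^sub>\<infinity>n\<in>{n. n mod 3 = (r + 1) mod 3}. of_real (1 / p) * of_real (p powi n\<^sup>2 * 1 powi n))"
    unfolding theta_part_def
  proof (rule infsum_reindex_bij_witness[of _ "\<lambda>n. n - 1" "\<lambda>n. n + 1"])
    fix n :: int
    have pa: "p powi (a + b) = p powi a * p powi b" for a b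
      using assms by (simp add: power_int_add)
    have "(n + 1)\<^sup>2 = (n\<^sup>2 + 2 * n) + 1" by (simp add: power2_eq_square algebra_simps)
    then have "p powi (n + 1)\<^sup>2 = p powi n\<^sup>2 * p powi (2 * n) * p"
      by (simp only: pa power_int_1_right)
    then show "complex_of_real (1 / p) * of_real (p powi (n + 1)\<^sup>2 * 1 powi (n + 1)) = of_real (p powi n\<^sup>2 * p\<^sup>2 powi n)"
      using assms by (simp add: power_int_mult)
  next
    fix n :: int
    have "n - r = (n + 1) - (r + 1)" "n - (r + 1) = (n - 1) - r" by simp_all
    then show "n \<in> {n. n mod 3 = r mod 3} \<Longrightarrow> n + 1 \<in> {n. n mod 3 = (r + 1) mod 3}"
      and "n \<in> {n. n mod 3 = (r + 1) mod 3} \<Longrightarrow> n - 1 \<in> {n. n mod 3 = r mod 3}"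
      unfolding mem_Collect_eq mod_eq_dvd_iff by metis+
  qed simp_all
  also have "\<dots> = of_real (1 / p) * theta_part p 1 (r + 1)"
    unfolding theta_part_def by (rule infsum_cmult_right')
  finally show ?thesis .
qed

text \<open>The determinant-like relation below holds for every \<open>x\<close>. The substitution \<open>x = p\<^sup>2\<close> permutes
  the three parts of the theta series cyclically, and subtracting the relation at \<open>x = 1\<close> leaves
  the cubic identity times a nonzero factor.\<close>

lemma theta_part_relation:
  fixes P x :: real
  assumes P: "0 < P" "P < 1" and x: "0 < x"
  defines "p \<equiv> sqrt P" and "A \<equiv> (cubic_a P + 2 * cubic_b P) / 3" and "C \<equiv> (cubic_a P - cubic_b P) / 3"
  shows "of_real (cubic_b (P ^ 3)) ^ 3 * theta_part p x 0 ^ 3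
    = of_real A ^ 3 * theta_part p x 0 ^ 3 + of_real C ^ 3 * (theta_part p x 1 ^ 3 + theta_part p x 2 ^ 3)
      - 3 * of_real A * of_real C ^ 2 * theta_part p x 0 * theta_part p x 1 * theta_part p x 2"
proof -
  have p: "0 < p" "p < 1" "p\<^sup>2 = P" using P by (auto simp: p_def)
  define a b c where "a = of_real A * theta_part p x 0" and "b = of_real C * theta_part p x 1" and "c = of_real C * theta_part p x 2"
  define w where "w = w3 1"
  have w: "w3 2 = w * w" "w3 4 = w" "1 + w + w * w = 0"
    using w3_add[of 1 1] w3_cong[of 4 1] w3_sum[of 1] by (simp_all add: w_def)
  \<comment> \<open>Three equal twists (t = 0) give the discrete Fourier transform of the triple a,
    b, c.\<close>
  have T: "theta_twist p x j * theta_twist p x j * theta_twist p x j = a + w3 j * b + w3 (2 * j) * c" for j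
    using theta_twist_product[OF p(1,2) x, of j 0] unfolding p(3)
    by (simp add: hex_part_0[OF P] A_def C_def a_def b_def c_def mult_ac)
  \<comment> \<open>Three different twists (t = 1) leave only the residue 0, because the twisted
    sums over the other cosets vanish.\<close>
  have "theta_twist p x 0 * theta_twist p x 1 * theta_twist p x 2 = hex_part P 1 0 * theta_part p x 0"
    using theta_twist_product[OF p(1,2) x, of 0 1] unfolding p(3) by (simp add: hex_part_1)
  also have "hex_part P 1 0 = of_real (cubic_b (P ^ 3))"
    using cubic_b_sum(1)[of "P ^ 3"] P unfolding hex_part_tripling by simp
  finally have e: "theta_twist p x 0 * theta_twist p x 1 * theta_twist p x 2 = of_real (cubic_b (P ^ 3)) * theta_part p x 0" .
  \<comment> \<open>The cube of the product of the three twists is also the product of their cubes,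
    that is, the circulant determinant a^3 + b^3 + c^3 - 3abc.\<close>
  have "(of_real (cubic_b (P ^ 3)) * theta_part p x 0) ^ 3
      = (theta_twist p x 0 * theta_twist p x 0 * theta_twist p x 0) * (theta_twist p x 1 * theta_twist p x 1 * theta_twist p x 1)
        * (theta_twist p x 2 * theta_twist p x 2 * theta_twist p x 2)"
    unfolding e[symmetric] by (simp only: power3_eq_cube mult_ac)
  also have "\<dots> = (a + b + c) * (a + w * b + w * w * c) * (a + w * w * b + w * c)"
    unfolding T by (simp add: w w_def[symmetric])
  also have "\<dots> = (a + b + c) * ((a + w * b + w * w * c) * (a + w * w * b + w * c))"
    by (simp only: mult.assoc)
  also have "(a + w * b + w * w * c) * (a + w * w * b + w * c)
     = a * a + (w + w * w) * (a * b + a * c) + w * w * w * (b * b + c * c) + (w * w + w * w * w * w) * (b * c)"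
    by (simp add: algebra_simps)
  also have "\<dots> = a * a + b * b + c * c - a * b - a * c - b * c"
  proof -
    have ww: "w + w * w = - 1" using w(3) by (simp add: eq_neg_iff_add_eq_0 add_ac)
    have "w3 1 * w3 2 = 1" using w3_3[of 1] w3_add[of 1 2] by simp
    then have www: "w * w * w = 1" unfolding w(1) by (simp only: w_def[symmetric] mult.assoc)
    show ?thesis unfolding www using ww by (simp add: algebra_simps)
  qed
  also have "(a + b + c) * \<dots> = a ^ 3 + b ^ 3 + c ^ 3 - 3 * a * b * c"
    by (simp add: power3_eq_cube algebra_simps)
  finally show ?thesis
    by (simp add: a_def b_def c_def power_mult_distrib algebra_simps power2_eq_square)
qed

theorem cubic_identity:
  fixes P :: real
  assumes P: "0 < P" "P < 1"
  shows "cubic_b (P ^ 3) ^ 3 = ((cubic_a P + 2 * cubic_b P) / 3) ^ 3 - ((cubic_a P - cubic_b P) / 3) ^ 3"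
proof -
  define p where "p = sqrt P"
  define A C where "A = (cubic_a P + 2 * cubic_b P) / 3" and "C = (cubic_a P - cubic_b P) / 3"
  have p: "0 < p" "p < 1" using P by (auto simp: p_def)
  define e where "e r = (\<Sum>\<^sub>\<infinity>n\<in>{n. n mod 3 = r mod 3}. p powi n\<^sup>2)" for r :: int
  have te: "theta_part p 1 r = of_real (e r)" for r
    unfolding theta_part_def e_def infsum_of_real_complex[symmetric] by simp
  have e_nonneg: "e r \<ge> 0" for r unfolding e_def using p by (intro infsum_nonneg) auto
  have e2: "e 2 = e 1"
    unfolding e_def
  proof (rule infsum_reindex_bij_witness[of _ uminus uminus])
    fix n :: int assume "n \<in> {n. n mod 3 = 2 mod 3}" then show "- n \<in> {n. n mod 3 = 1 mod 3}" by simp presburger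
  next
    fix n :: int assume "n \<in> {n. n mod 3 = 1 mod 3}" then show "- n \<in> {n. n mod 3 = 2 mod 3}" by simp presburger
  qed auto
  have e3: "e 3 = e 0" by (simp add: e_def)
  \<comment> \<open>This difference is the theta series twisted by a cube root of unity. Its
    positivity is invisible in the alternating form, but Poisson summation turns it into a sum of
    positive Gaussians.\<close>
  have "e 0 - e 1 > 0"
  proof -
    define a where "a = - ln p / pi"
    have a: "a > 0" using p by (simp add: a_def field_simps)
    have pe: "p powi n\<^sup>2 = exp (- (pi * a * (of_int n + 0)\<^sup>2))" for n
      using p by (simp add: powi_eq_exp a_def)
    have s: "(\<lambda>n. complex_of_real (p powi n\<^sup>2) * w3 n) summable_on UNIV"
      by (rule summable_on_norm_le[OF summable_theta[OF p, of 1 1]]) (use p in \<open>auto simp: norm_mult norm_power_int\<close>)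
    define h where "h k = exp (- (pi * (real_of_int k - 1/3)\<^sup>2 / a))" for k :: int
    have "(\<lambda>k::int. exp (- (pi / a * (real_of_int k + - (1/3))\<^sup>2))) summable_on UNIV"
      by (rule summable_int_gauss) (use a in auto)
    then have hs: "h summable_on UNIV" by (simp add: h_def[abs_def])
    have hpos: "0 < infsum h UNIV"
    proof -
      have "0 < sum h {0}" by (simp add: h_def)
      also have "\<dots> \<le> infsum h UNIV" by (rule finite_sum_le_infsum[OF hs]) (auto simp: h_def)
      finally show ?thesis .
    qed
    have cl: "(\<Sum>\<^sub>\<infinity>n\<in>{n. n mod 3 = r mod 3}. complex_of_real (p powi n\<^sup>2) * w3 n) = of_real (e r) * w3 r" for r
    proof -
      have "(\<Sum>\<^sub>\<infinity>n\<in>{n. n mod 3 = r mod 3}. complex_of_real (p powi n\<^sup>2) * w3 n)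
         = (\<Sum>\<^sub>\<infinity>n\<in>{n. n mod 3 = r mod 3}. complex_of_real (p powi n\<^sup>2) * w3 r)"
        by (intro infsum_cong) (auto intro: w3_cong)
      then show ?thesis unfolding e_def infsum_of_real_complex[symmetric] by (simp only: infsum_cmult_left')
    qed
    have "of_real (e 0 - e 1) = (\<Sum>\<^sub>\<infinity>n. complex_of_real (p powi n\<^sup>2) * w3 n)"
      unfolding infsum_mod_3[OF s] cl by (simp add: e2 w3_1 w3_2 complex_eq_iff)
    also have "\<dots> = of_real (1 / sqrt a) * of_real (infsum h UNIV)"
      using poisson_gauss[OF a, of 0 "1/3"]
      unfolding infsum_of_real_complex[symmetric] h_def pe w3_def by simp
    finally have "e 0 - e 1 = 1 / sqrt a * infsum h UNIV" by (simp only: of_real_mult[symmetric] of_real_eq_iff)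
    then show ?thesis using hpos a by simp
  qed
  then have "e 0 ^ 3 - e 1 ^ 3 \<noteq> 0"
    using power_strict_mono[of "e 1" "e 0" 3] e_nonneg by simp
  have "complex_of_real (cubic_b (P ^ 3) ^ 3 * e 0 ^ 3)
      = of_real (A ^ 3 * e 0 ^ 3 + C ^ 3 * (e 1 ^ 3 + e 1 ^ 3) - 3 * A * C ^ 2 * e 0 * e 1 * e 1)"
    using theta_part_relation[OF P, of 1] by (simp add: te e2 p_def[symmetric] A_def C_def)
  then have r1: "cubic_b (P ^ 3) ^ 3 * e 0 ^ 3 = A ^ 3 * e 0 ^ 3 + C ^ 3 * (e 1 ^ 3 + e 1 ^ 3) - 3 * A * C ^ 2 * e 0 * e 1 * e 1"
    by (simp only: of_real_eq_iff)
  \<comment> \<open>At x = p^2 the parts 0, 1, 2 become e 1, e 2 = e 1 and e 3 = e 0, each divided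
    by p; the common factor 1/p^3 is removed afterwards.\<close>
  have "complex_of_real (cubic_b (P ^ 3) ^ 3 * (e 1 / p) ^ 3)
      = of_real (A ^ 3 * (e 1 / p) ^ 3 + C ^ 3 * ((e 1 / p) ^ 3 + (e 0 / p) ^ 3) - 3 * A * C ^ 2 * (e 1 / p) * (e 1 / p) * (e 0 / p))"
    using theta_part_relation[OF P, of "p\<^sup>2"] p
    by (simp add: p_def[symmetric] theta_part_shift[OF p(1)] te e2 e3 A_def C_def)
  then have "cubic_b (P ^ 3) ^ 3 * (e 1 / p) ^ 3 = A ^ 3 * (e 1 / p) ^ 3 + C ^ 3 * ((e 1 / p) ^ 3 + (e 0 / p) ^ 3) - 3 * A * C ^ 2 * (e 1 / p) * (e 1 / p) * (e 0 / p)"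
    by (simp only: of_real_eq_iff)
  then have "(cubic_b (P ^ 3) ^ 3 * e 1 ^ 3) / p ^ 3 = (A ^ 3 * e 1 ^ 3 + C ^ 3 * (e 1 ^ 3 + e 0 ^ 3) - 3 * A * C ^ 2 * e 1 * e 1 * e 0) / p ^ 3"
    by (simp add: power_divide add_divide_distrib diff_divide_distrib distrib_left power3_eq_cube)
  then have r2: "cubic_b (P ^ 3) ^ 3 * e 1 ^ 3 = A ^ 3 * e 1 ^ 3 + C ^ 3 * (e 1 ^ 3 + e 0 ^ 3) - 3 * A * C ^ 2 * e 1 * e 1 * e 0"
    using p by simp
  \<comment> \<open>The mixed terms of both relations are 3 A C^2 e 0 (e 1)^2 or its analogue with e
    0 and e 1 exchanged only in the order of the factors, so they cancel in the difference.\<close>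
  have "(cubic_b (P ^ 3) ^ 3 - (A ^ 3 - C ^ 3)) * (e 0 ^ 3 - e 1 ^ 3) = 0"
    using r1 r2 by (simp add: algebra_simps)
  then show ?thesis
    using \<open>e 0 ^ 3 - e 1 ^ 3 \<noteq> 0\<close> by (simp add: A_def C_def)
qed

lemma cubic_b_cube:
  assumes "0 < q" "q < 1"
  shows "cubic_b (q ^ 3) = root 3 (cubic_b q * (((cubic_b q)\<^sup>2 + cubic_b q * cubic_a q + (cubic_a q)\<^sup>2) / 3))"
proof -
  have "cubic_b (q ^ 3) ^ 3 = cubic_b q * (((cubic_b q)\<^sup>2 + cubic_b q * cubic_a q + (cubic_a q)\<^sup>2) / 3)"
    unfolding cubic_identity[OF assms] by (simp add: power2_eq_square power3_eq_cube field_simps)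
  then show ?thesis by (metis odd_real_root_unique odd_numeral)
qed

section \<open>Modular inversion and iterated tripling of the nome\<close>

lemma cubic_a_inversion:
  assumes t: "t > 0"
  shows "cubic_a (exp (- (2 * pi * t / sqrt 3))) = 1 / t * cubic_a (exp (- (2 * pi / t / sqrt 3)))"
proof -
  \<comment> \<open>The scales are chosen so that (r x)^2 + (s y)^2 is a multiple of x^2 + 3y^2/4,
    the quadratic form in the coordinates x = m + n/2 and y = n; the area factor is then r s =
    t.\<close>
  define r where "r = sqrt (2 * t / sqrt 3)"
  define s where "s = sqrt (sqrt 3 * t / 2)"
  have rs: "r > 0" "s > 0" "r\<^sup>2 = 2 * t / sqrt 3" "s\<^sup>2 = sqrt 3 * t / 2" using t by (auto simp: r_def s_def)
  have s3: "sqrt 3 * sqrt 3 = (3::real)" by simp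
  have "r * s = sqrt (t * t)" unfolding r_def s_def real_sqrt_mult[symmetric] by (simp add: field_simps)
  then have rst: "r * s = t" using t by simp
  have e1: "exp (- (2 * pi * t / sqrt 3)) powi hex_form m n = exp (- (pi * (r * (of_int m + of_int n / 2))\<^sup>2)) * exp (- (pi * (s * of_int n - 0)\<^sup>2))" for m n
  proof -
    have "pi * (r * (of_int m + of_int n / 2))\<^sup>2 + pi * (s * of_int n - 0)\<^sup>2 = 2 * pi * t / sqrt 3 * of_int (hex_form m n)"
      unfolding power_mult_distrib rs real_hex_form diff_0_right using s3 t by (simp add: field_simps)
    then show ?thesis unfolding exp_add[symmetric] exp_power_int by (simp add: algebra_simps)
  qed
  have e2: "exp (- (2 * pi / t / sqrt 3)) powi hex_form m n = exp (- (pi * ((of_int m + of_int n / 2) / s)\<^sup>2)) * exp (- (pi * (of_int n / r + 0 / 2)\<^sup>2))" for m n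
  proof -
    have "pi * ((of_int m + of_int n / 2) / s)\<^sup>2 + pi * (of_int n / r + 0 / 2)\<^sup>2 = 2 * pi / t / sqrt 3 * of_int (hex_form m n)"
      unfolding power_divide rs real_hex_form add_0_right div_0 using s3 t by (simp add: field_simps)
    then show ?thesis unfolding exp_add[symmetric] exp_power_int by (simp add: algebra_simps)
  qed
  have "complex_of_real (cubic_a (exp (- (2 * pi * t / sqrt 3)))) = of_real (1 / t) * of_real (cubic_a (exp (- (2 * pi / t / sqrt 3))))"
    unfolding of_real_cubic_a e1 e2 using poisson_hex[OF rs(1,2), of 0 0] by (simp add: rst)
  then show ?thesis by (simp only: of_real_mult[symmetric] of_real_eq_iff)
qed

lemma cubic_a_ge_1:
  assumes "0 < q" "q < 1" shows "cubic_a q \<ge> 1"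
proof -
  have "sum (\<lambda>(m, n). q powi hex_form m n) {(0, 0)} \<le> cubic_a q"
    unfolding cubic_a_def by (rule finite_sum_le_infsum[OF summable_hex[OF assms]]) (use assms in auto)
  then show ?thesis by (simp add: hex_form_def)
qed

lemma hex_form_pos:
  assumes "(m, n) \<noteq> (0, 0)" shows "hex_form m n \<ge> 1"
proof -
  have e: "4 * hex_form m n = (2 * m + n)\<^sup>2 + 3 * n\<^sup>2"
    by (simp add: hex_form_def power2_eq_square algebra_simps)
  have "4 * hex_form m n \<noteq> 0"
  proof
    assume "4 * hex_form m n = 0"
    then have "n\<^sup>2 = 0" "(2 * m + n)\<^sup>2 = 0" using e by (smt (verit) zero_le_power2)+
    then show False using assms by simp
  qed
  moreover have "4 * hex_form m n \<ge> 0" unfolding e by simp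
  ultimately show ?thesis by linarith
qed

lemma hex_form_nonneg: "hex_form m n \<ge> 0"
  using hex_form_pos[of m n] by (cases "(m, n) = (0, 0)") (auto simp: hex_form_def)

text \<open>All exponents away from the origin are at least 1, and q^k \<le> (q/r) r^k for k \<ge>
  1. This linear bound gives the limit at 0 directly.\<close>

lemma cubic_a_bound:
  assumes q: "0 < q" "q \<le> r" "r < 1"
  shows "cubic_a q - 1 \<le> q / r * (cubic_a r - 1)"
proof -
  define S where "S = UNIV - {(0 :: int, 0 :: int)}"
  have a: "cubic_a x = 1 + (\<Sum>\<^sub>\<infinity>(m, n)\<in>S. x powi hex_form m n)" if "0 < x" "x < 1" for x
  proof -
    have "cubic_a x = infsum (\<lambda>(m, n). x powi hex_form m n) (insert (0, 0) S)"
      by (simp add: cubic_a_def S_def insert_absorb)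
    also have "\<dots> = 1 + (\<Sum>\<^sub>\<infinity>(m, n)\<in>S. x powi hex_form m n)"
      by (subst infsum_insert) (use that summable_on_subset_banach[OF summable_hex[OF that]] in \<open>auto simp: S_def hex_form_def\<close>)
    finally show ?thesis .
  qed
  have s: "(\<lambda>(m, n). x powi hex_form m n) summable_on S" if "0 < x" "x < 1" for x :: real
    by (rule summable_on_subset_banach[OF summable_hex[OF that]]) simp
  have "(\<Sum>\<^sub>\<infinity>(m, n)\<in>S. q powi hex_form m n) \<le> (\<Sum>\<^sub>\<infinity>z\<in>S. q / r * (case z of (m, n) \<Rightarrow> r powi hex_form m n))"
  proof (rule infsum_mono)
    show "(\<lambda>(m, n). q powi hex_form m n) summable_on S" by (rule s) (use q in auto)
    show "(\<lambda>z. q / r * (case z of (m, n) \<Rightarrow> r powi hex_form m n)) summable_on S"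
      by (intro summable_on_cmult_right s) (use q in auto)
    fix z assume zS: "z \<in> S"
    obtain m n where "z = (m, n)" by force
    with zS have z: "z = (m, n)" "(m, n) \<noteq> (0, 0)" by (auto simp: S_def)
    obtain k where k: "hex_form m n = int (Suc k)"
      using hex_form_pos[OF z(2)] by (intro that[of "nat (hex_form m n - 1)"]) simp
    have "q powi hex_form m n = q * q ^ k" by (simp only: k power_int_of_nat power_Suc)
    also have "\<dots> \<le> q * r ^ k" using q by (intro mult_left_mono power_mono) auto
    also have "\<dots> = q / r * r powi hex_form m n" using q by (simp only: k power_int_of_nat power_Suc) simp
    finally show "(case z of (m, n) \<Rightarrow> q powi hex_form m n) \<le> q / r * (case z of (m, n) \<Rightarrow> r powi hex_form m n)"
      by (simp add: z)
  qed
  also have "\<dots> = q / r * (\<Sum>\<^sub>\<infinity>(m, n)\<in>S. r powi hex_form m n)"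
    by (rule infsum_cmult_right')
  finally show ?thesis using q a[of q] a[of r] by simp
qed

definition hex_nome :: "nat \<Rightarrow> real" where "hex_nome n = exp (- (2 * pi / sqrt 3)) ^ 3 ^ n"

lemma hex_nome_bounds: "0 < hex_nome n" "hex_nome n < 1"
  by (auto simp: hex_nome_def power_less_one_iff)

lemma hex_nome_Suc: "hex_nome (Suc n) = hex_nome n ^ 3"
  by (simp add: hex_nome_def power_mult[symmetric] mult.commute)

lemma hex_nome_0: "hex_nome 0 = exp (- (2 * pi / sqrt 3))"
  by (simp add: hex_nome_def)

lemma cubic_a_limit: "(\<lambda>n. cubic_a (hex_nome n)) \<longlonglongrightarrow> 1"
proof (rule tendsto_sandwich)
  define q where "q = hex_nome 0"
  have q: "0 < q" "q < 1" unfolding q_def by (rule hex_nome_bounds)+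
  have qd: "q = exp (- (2 * pi / sqrt 3))" by (simp add: q_def hex_nome_0)
  have hq: "hex_nome n \<le> q ^ n" "hex_nome n \<le> q" for n
  proof -
    have "n \<le> 3 ^ n"
    proof (induction n)
      case (Suc n)
      have "(1::nat) \<le> 3 ^ n" by simp
      with Suc show ?case unfolding power_Suc by linarith
    qed simp
    then show "hex_nome n \<le> q ^ n"
      unfolding qd hex_nome_def by (intro power_decreasing) auto
    show "hex_nome n \<le> q"
      unfolding qd hex_nome_def
      using power_decreasing[of 1 "3 ^ n" "exp (- (2 * pi / sqrt 3))"] by simp
  qed
  show "\<forall>\<^sub>F n in sequentially. 1 \<le> cubic_a (hex_nome n)"
    by (intro always_eventually allI cubic_a_ge_1 hex_nome_bounds)
  show "\<forall>\<^sub>F n in sequentially. cubic_a (hex_nome n) \<le> 1 + q ^ n * ((cubic_a q - 1) / q)"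
  proof (intro always_eventually allI)
    fix n
    have "cubic_a (hex_nome n) - 1 \<le> hex_nome n / q * (cubic_a q - 1)"
      by (rule cubic_a_bound) (use hex_nome_bounds hq q in auto)
    also have "\<dots> = hex_nome n * ((cubic_a q - 1) / q)" by simp
    also have "\<dots> \<le> q ^ n * ((cubic_a q - 1) / q)"
      using hq q cubic_a_ge_1[OF q] by (intro mult_right_mono) auto
    finally show "cubic_a (hex_nome n) \<le> 1 + q ^ n * ((cubic_a q - 1) / q)" by simp
  qed
  have "(\<lambda>n. 1 + q ^ n * ((cubic_a q - 1) / q)) \<longlonglongrightarrow> 1 + 0 * ((cubic_a q - 1) / q)"
    using q by (intro tendsto_intros LIMSEQ_realpow_zero) auto
  then show "(\<lambda>n. 1 + q ^ n * ((cubic_a q - 1) / q)) \<longlonglongrightarrow> 1" by simp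
qed simp

lemma cubic_a_hex_nome_Suc: "cubic_a (hex_nome (Suc n)) = (cubic_a (hex_nome n) + 2 * cubic_b (hex_nome n)) / 3"
  unfolding hex_nome_Suc by (rule cubic_a_cube) (rule hex_nome_bounds)+

lemma cubic_b_limit: "(\<lambda>n. cubic_b (hex_nome n)) \<longlonglongrightarrow> 1"
proof -
  \<comment> \<open>Solving the tripling formula for b reduces its limit to that of a.\<close>
  have "cubic_b (hex_nome n) = (3 * cubic_a (hex_nome (Suc n)) - cubic_a (hex_nome n)) / 2" for n
    unfolding cubic_a_hex_nome_Suc by (simp add: field_simps)
  moreover
  have "(\<lambda>n. (3 * cubic_a (hex_nome (Suc n)) - cubic_a (hex_nome n)) / 2) \<longlonglongrightarrow> (3 * 1 - 1) / 2"
    by (intro tendsto_intros cubic_a_limit LIMSEQ_Suc[OF cubic_a_limit]) simp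
  then have "(\<lambda>n. (3 * cubic_a (hex_nome (Suc n)) - cubic_a (hex_nome n)) / 2) \<longlonglongrightarrow> 1" by simp
  ultimately show ?thesis by (simp only:)
qed

text \<open>Let q be the nome and P its cube root. Inversion at t = 1/3 gives a(P) = 3 a(q^3) = a(q)
  + 2 b(q), and tripling from P to q then forces b(P) = a(q) - b(q). Inserted into the cubic
  identity at P this reads b(q)^3 = a(q)^3 - b(q)^3.\<close>

lemma cubic_a_b_fixed_point: "cubic_a (hex_nome 0) ^ 3 = 2 * cubic_b (hex_nome 0) ^ 3"
proof -
  define P where "P = exp (- (2 * pi * (1/3) / sqrt 3))"
  have P: "0 < P" "P < 1" by (auto simp: P_def)
  have PP: "P ^ 3 = hex_nome 0"
    by (simp add: P_def hex_nome_0 exp_of_nat_mult[symmetric])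
  have "cubic_a P = 3 * cubic_a (hex_nome 1)"
  proof -
    have "exp (- (2 * pi / (1/3) / sqrt 3)) = hex_nome 1"
      by (simp add: hex_nome_def exp_of_nat_mult[symmetric])
    then show ?thesis using cubic_a_inversion[of "1/3"] unfolding P_def by simp
  qed
  then have a: "cubic_a P = cubic_a (hex_nome 0) + 2 * cubic_b (hex_nome 0)"
    using cubic_a_hex_nome_Suc[of 0] by simp
  have b: "cubic_b P = cubic_a (hex_nome 0) - cubic_b (hex_nome 0)"
    using cubic_a_cube[OF P] a unfolding PP by simp
  show ?thesis
    using cubic_identity[OF P] unfolding PP a b by (simp add: algebra_simps)
qed

lemma cubic_ratio: "cubic_a (hex_nome 0) = root 3 2 * cubic_b (hex_nome 0)"
  using arg_cong[OF cubic_a_b_fixed_point, of "root 3"]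
  by (simp add: real_root_mult odd_real_root_power_cancel)

text \<open>The sign of b is not evident from its series. At the initial nome it follows from the
  ratio with a \<ge> 1; afterwards the cubic identity shows that the next b has a positive cube and
  that the next a^3 - b^3 is the cube of a positive number.\<close>

lemma cubic_b_pos_le: "0 < cubic_b (hex_nome n) \<and> cubic_b (hex_nome n) < cubic_a (hex_nome n)"
proof (induction n)
  case 0
  have "root 3 2 > (1 :: real)" by simp
  moreover have "0 < root 3 2 * cubic_b (hex_nome 0)"
    using cubic_a_ge_1[OF hex_nome_bounds, of 0] by (simp add: cubic_ratio)
  ultimately have "cubic_b (hex_nome 0) > 0" by (simp add: zero_less_mult_iff)
  with \<open>root 3 2 > 1\<close> show ?case by (simp add: cubic_ratio)
next
  case (Suc n)
  let ?a = "cubic_a (hex_nome n)" and ?b = "cubic_b (hex_nome n)"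
  have "cubic_b (hex_nome (Suc n)) ^ 3 = ?b * ((?b\<^sup>2 + ?b * ?a + ?a\<^sup>2) / 3)"
    unfolding hex_nome_Suc cubic_identity[OF hex_nome_bounds] by (simp add: power2_eq_square power3_eq_cube field_simps)
  moreover have "?b * ((?b\<^sup>2 + ?b * ?a + ?a\<^sup>2) / 3) > 0"
    using Suc by (intro mult_pos_pos divide_pos_pos add_pos_pos) auto
  ultimately have "cubic_b (hex_nome (Suc n)) ^ 3 > 0" by (simp only:)
  then have pos: "cubic_b (hex_nome (Suc n)) > 0" unfolding zero_less_power_eq by simp
  have "cubic_b (hex_nome (Suc n)) ^ 3 < cubic_a (hex_nome (Suc n)) ^ 3"
    unfolding cubic_a_hex_nome_Suc unfolding hex_nome_Suc cubic_identity[OF hex_nome_bounds] using Suc by simp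
  then have "cubic_b (hex_nome (Suc n)) < cubic_a (hex_nome (Suc n))"
    by (rule power_less_imp_less_base) (use cubic_a_ge_1[OF hex_nome_bounds, of "Suc n"] in simp)
  with pos show ?case by simp
qed

text \<open>The quotient F(1 - (b/a)^3) / a is unchanged when the nome is cubed, by the cubic
  transformation, and tends to F(0) = 1. At the initial nome the argument is 1/2 because a^3 = 2
  b^3.\<close>

lemma cubic_a_hex_nome_hyp: "cubic_a (hex_nome 0) = cubic_hyp (1/2)"
proof -
  define a b where "a n = cubic_a (hex_nome n)" and "b n = cubic_b (hex_nome n)" for n
  define z where "z n = 1 - (b n / a n) ^ 3" for n
  have ab: "0 < b n" "b n < a n" for n using cubic_b_pos_le[of n] by (auto simp: a_def b_def)
  have step: "cubic_hyp (z (Suc n)) / a (Suc n) = cubic_hyp (z n) / a n" for n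
  proof -
    define s where "s = b n / a n"
    \<comment> \<open>This is (a - b)/(a + 2b), so x^3 is the argument 1 - (b/a)^3 at the cubed
      nome, and the factor 1 + 2x is the quotient of a at the two nomes.\<close>
    define x where "x = (1 - s) / (1 + 2 * s)"
    have s: "0 < s" "s < 1" using ab[of n] by (auto simp: s_def)
    have x: "0 \<le> x" "x < 1" using s by (auto simp: x_def)
    have "1 + 2 * x = 3 / (1 + 2 * s)" "1 - x = 3 * s / (1 + 2 * s)"
      using s by (auto simp: x_def divide_simps)
    then have xs: "(1 - x) / (1 + 2 * x) = s" using s by simp
    have aS: "a (Suc n) = a n * (1 + 2 * s) / 3"
      unfolding a_def cubic_a_hex_nome_Suc using ab[of n] by (simp add: s_def a_def b_def field_simps)
    have "z (Suc n) = x ^ 3"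
    proof -
      have c: "b (Suc n) ^ 3 = a (Suc n) ^ 3 - ((a n - b n) / 3) ^ 3"
        unfolding a_def b_def cubic_a_hex_nome_Suc unfolding hex_nome_Suc by (rule cubic_identity[OF hex_nome_bounds])
      have "z (Suc n) = (a (Suc n) ^ 3 - b (Suc n) ^ 3) / a (Suc n) ^ 3"
        using ab[of "Suc n"] by (simp add: z_def power_divide diff_divide_distrib)
      also have "\<dots> = ((a n - b n) / 3 / a (Suc n)) ^ 3" by (simp only: c power_divide) simp
      also have "(a n - b n) / 3 / a (Suc n) = x"
        using ab[of n] s by (simp add: aS x_def s_def divide_simps) (simp add: algebra_simps)
      finally show ?thesis .
    qed
    moreover have "cubic_hyp (z n) = (1 + 2 * x) * cubic_hyp (x ^ 3)"
      using cubic_hyp_transformation[OF x] unfolding xs by (simp add: z_def s_def)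
    ultimately show ?thesis
      using \<open>1 + 2 * x = 3 / (1 + 2 * s)\<close> s ab[of n] by (simp add: aS divide_simps)
  qed
  have const: "cubic_hyp (z n) / a n = cubic_hyp (z 0) / a 0" for n
    by (induction n) (simp_all add: step)
  have "(\<lambda>n. cubic_hyp (z n) / a n) \<longlonglongrightarrow> cubic_hyp 0 / 1"
  proof (intro tendsto_intros)
    have "z \<longlonglongrightarrow> 1 - (1 / 1) ^ 3"
      unfolding z_def a_def b_def by (intro tendsto_intros cubic_a_limit cubic_b_limit) simp
    then have "z \<longlonglongrightarrow> 0" by simp
    then show "(\<lambda>n. cubic_hyp (z n)) \<longlonglongrightarrow> cubic_hyp 0"
      by (rule isCont_tendsto_compose[OF DERIV_isCont[OF cubic_hyp_deriv], rotated]) simp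
    show "a \<longlonglongrightarrow> 1" unfolding a_def by (rule cubic_a_limit)
  qed simp
  moreover have "(\<lambda>n. cubic_hyp (z n) / a n) = (\<lambda>n. cubic_hyp (z 0) / a 0)"
    by (rule ext) (rule const)
  ultimately have "cubic_hyp (z 0) / a 0 = 1"
    by (simp add: LIMSEQ_const_iff)
  moreover have "z 0 = 1/2"
    using cubic_a_b_fixed_point ab[of 0] by (simp add: z_def a_def b_def power_divide)
  ultimately show ?thesis using ab[of 0] by (simp add: a_def)
qed

lemma cubic_b_landau: "cubic_b (hex_nome 0) = 1 / (2 * landau_plus)"
proof -
  have r: "root 3 2 = 2 powr (1/3)" by (simp add: root_powr_inverse)
  have "root 3 2 * cubic_b (hex_nome 0) = cubic_hyp (1/2)"
    using cubic_ratio cubic_a_hex_nome_hyp by simp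
  also have "\<dots> = root 3 2 * (Gamma (1/6) / (2 * Gamma (1/3) * Gamma (5/6)))"
    unfolding cubic_hyp_half r by simp
  finally have "cubic_b (hex_nome 0) = Gamma (1/6) / (2 * Gamma (1/3) * Gamma (5/6))"
    by (rule mult_left_cancel[THEN iffD1, rotated]) simp
  then show ?thesis by (simp add: landau_plus_def)
qed

text \<open>The iteration is homogeneous, so dividing the pair (a, b) along the cubed nomes by its
  initial b gives the sequence that starts at (root 3 2, 1). Both components of the undivided pair
  tend to 1.\<close>

lemma cubic_b_ag3: "cubic_b (hex_nome 0) = 1 / ag3 (root 3 2) 1"
proof -
  define b where "b = cubic_b (hex_nome 0)"
  have b: "b > 0" using cubic_b_pos_le[of 0] by (simp add: b_def)
  have seq: "ag3_seq (root 3 2) 1 n = (cubic_a (hex_nome n) / b, cubic_b (hex_nome n) / b)" for n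
  proof (induction n)
    case 0
    then show ?case using b by (simp add: cubic_ratio b_def)
  next
    case (Suc n)
    let ?A = "cubic_a (hex_nome n)" and ?B = "cubic_b (hex_nome n)"
    have "?B / b * (((?A / b)\<^sup>2 + ?A / b * (?B / b) + (?B / b)\<^sup>2) / 3) = ?B * ((?B\<^sup>2 + ?B * ?A + ?A\<^sup>2) / 3) / b ^ 3"
      using b by (simp add: power2_eq_square power3_eq_cube field_simps)
    then have 1: "root 3 (?B / b * (((?A / b)\<^sup>2 + ?A / b * (?B / b) + (?B / b)\<^sup>2) / 3)) = cubic_b (hex_nome (Suc n)) / b"
      unfolding hex_nome_Suc cubic_b_cube[OF hex_nome_bounds]
      using b by (simp only: real_root_divide) (simp add: real_root_power_cancel)
    have 2: "(?A / b + 2 * (?B / b)) / 3 = cubic_a (hex_nome (Suc n)) / b"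
      unfolding cubic_a_hex_nome_Suc by (simp add: add_divide_distrib)
    show ?case unfolding ag3_seq.simps Suc Let_def prod.case 1 2 ..
  qed
  have lim: "(\<lambda>n. fst (ag3_seq (root 3 2) 1 n)) \<longlonglongrightarrow> 1 / b" "(\<lambda>n. snd (ag3_seq (root 3 2) 1 n)) \<longlonglongrightarrow> 1 / b"
    unfolding seq fst_conv snd_conv using b by (intro tendsto_intros cubic_a_limit cubic_b_limit; simp)+
  have "ag3 (root 3 2) 1 = 1 / b"
    unfolding ag3_def by (rule the_equality) (use lim LIMSEQ_unique in blast)+
  then show ?thesis by (simp add: b_def)
qed

lemma cube_le_imp_le: "x ^ 3 \<le> y ^ 3 \<Longrightarrow> 0 \<le> y \<Longrightarrow> x \<le> (y :: real)"
  unfolding numeral_3_eq_3 by (rule power_le_imp_le_base)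

text \<open>The normalization by the limit decides which initial values are possible: a never falls
  below 1, and b increases to 1. Two steps of the recursion from a value above the lower bracket's
  complement, or from one too large, already violate this: too small an initial b gives a 2 < 1, too
  large a one gives b 2 > 1.\<close>

lemma cubic_b_numeric: "0.920371 \<le> cubic_b (hex_nome 0)" "cubic_b (hex_nome 0) < 0.920372"
proof -
  define a b where "a n = cubic_a (hex_nome n)" and "b n = cubic_b (hex_nome n)" for n
  have ab: "0 < b n" "b n < a n" for n using cubic_b_pos_le[of n] by (auto simp: a_def b_def)
  have bS: "b (Suc n) ^ 3 = b n * ((b n)\<^sup>2 + b n * a n + (a n)\<^sup>2) / 3" for n
    unfolding a_def b_def hex_nome_Suc cubic_identity[OF hex_nome_bounds] by (simp add: power2_eq_square power3_eq_cube field_simps)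
  have aS: "a (Suc n) = (a n + 2 * b n) / 3" for n
    unfolding a_def b_def by (rule cubic_a_hex_nome_Suc)
  have a1: "a n \<ge> 1" for n unfolding a_def by (rule cubic_a_ge_1[OF hex_nome_bounds])
  \<comment> \<open>The cube of the next b is b times the mean of b^2, a b and a^2, each of which is
    at least b^2.\<close>
  have "b n \<le> b (Suc n)" for n
  proof (rule power_le_imp_le_base[of _ 2])
    have "(b n)\<^sup>2 \<le> (a n)\<^sup>2" using ab[of n] by (intro power_mono) auto
    moreover have "(b n)\<^sup>2 \<le> b n * a n"
      unfolding power2_eq_square using ab[of n] by (intro mult_left_mono) auto
    ultimately have "3 * (b n)\<^sup>2 \<le> (b n)\<^sup>2 + b n * a n + (a n)\<^sup>2" by linarith
    then have "b n * (3 * (b n)\<^sup>2) \<le> b n * ((b n)\<^sup>2 + b n * a n + (a n)\<^sup>2)"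
      using ab[of n] by (intro mult_left_mono) auto
    then show "b n ^ Suc 2 \<le> b (Suc n) ^ Suc 2"
      using bS[of n] by (simp add: power2_eq_square power3_eq_cube numeral_2_eq_2)
  qed (use ab[of "Suc n"] in simp)
  then have "incseq b" by (rule incseq_SucI)
  then have b1: "b n \<le> 1" for n by (rule incseq_le) (simp add: b_def[abs_def] cubic_b_limit)
  define r where "r = root 3 (2 :: real)"
  have r3: "r ^ 3 = 2" "r \<ge> 0" by (auto simp: r_def)
  have a0: "a 0 = r * b 0" by (simp add: a_def b_def r_def cubic_ratio)
  have rl: "1.2599210 \<le> r"
    by (rule cube_le_imp_le[OF _ r3(2)], unfold r3(1)) (simp add: power3_eq_cube)
  have ru: "r \<le> 1.2599211"
    by (rule cube_le_imp_le, unfold r3(1)) (simp_all add: power3_eq_cube)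
  have bs1: "b 1 ^ 3 = b 0 ^ 3 * (1 + r + r\<^sup>2) / 3"
    using bS[of 0] by (simp add: a0 power2_eq_square power3_eq_cube algebra_simps)
  have as1: "a 1 = (r + 2) / 3 * b 0"
    using aS[of 0] by (simp add: a0 algebra_simps)
  show "0.920371 \<le> cubic_b (hex_nome 0)"
  proof (rule ccontr)
    assume "\<not> ?thesis"
    then have b0: "b 0 \<le> 0.920371" by (simp add: b_def)
    have "b 1 ^ 3 \<le> 0.920371 ^ 3 * (1 + 1.2599211 + 1.2599211\<^sup>2) / 3"
    proof -
      have "r\<^sup>2 \<le> 1.2599211\<^sup>2" using ru r3 by (intro power_mono)
      then have "1 + r + r\<^sup>2 \<le> 1 + 1.2599211 + 1.2599211\<^sup>2" using ru by linarith
      moreover have "b 0 ^ 3 \<le> 0.920371 ^ 3" using b0 ab[of 0] by (intro power_mono) linarith+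
      ultimately show ?thesis unfolding bs1 using r3 by (intro divide_right_mono mult_mono) simp_all
    qed
    also have "\<dots> \<le> 0.9999437 ^ 3" by (simp add: power2_eq_square power3_eq_cube)
    finally have b1': "b 1 \<le> 0.9999437"
      by (rule cube_le_imp_le) simp
    have "a 1 \<le> (1.2599211 + 2) / 3 * 0.920371"
      unfolding as1 using b0 ab(1)[of 0] ru r3 by (intro mult_mono) simp_all
    with b1' show False using aS[of 1] a1[of 2] by (simp add: numeral_2_eq_2)
  qed
  show "cubic_b (hex_nome 0) < 0.920372"
  proof (rule ccontr)
    assume "\<not> ?thesis"
    then have b0: "b 0 \<ge> 0.920372" by (simp add: b_def)
    have "0.9999443 ^ 3 \<le> 0.920372 ^ 3 * (1 + 1.2599210 + 1.2599210\<^sup>2 :: real) / 3"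
      by (simp add: power2_eq_square power3_eq_cube)
    also have "\<dots> \<le> b 1 ^ 3"
    proof -
      have "1.2599210\<^sup>2 \<le> r\<^sup>2" using rl by (intro power_mono) simp_all
      then have "1 + 1.2599210 + 1.2599210\<^sup>2 \<le> 1 + r + r\<^sup>2" using rl by linarith
      moreover have "0.920372 ^ 3 \<le> b 0 ^ 3" using b0 by (intro power_mono) simp_all
      ultimately show ?thesis unfolding bs1 using ab(1)[of 0] by (intro divide_right_mono mult_mono) simp_all
    qed
    finally have b1': "0.9999443 \<le> b 1"
      by (rule cube_le_imp_le) (use ab(1)[of 1] in simp)
    have "1.0001132 \<le> (1.2599210 + 2) / 3 * (0.920372 :: real)" by simp
    also have "\<dots> \<le> a 1"
      unfolding as1 using b0 rl by (intro mult_mono) simp_all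
    finally have a1': "1.0001132 \<le> a 1" .
    have "1 < 0.9999443 * (0.9999443\<^sup>2 + 0.9999443 * 1.0001132 + 1.0001132\<^sup>2) / (3 :: real)"
      by (simp add: power2_eq_square)
    also have "\<dots> \<le> b (Suc 1) ^ 3"
    proof -
      have "0.9999443\<^sup>2 \<le> (b 1)\<^sup>2" "1.0001132\<^sup>2 \<le> (a 1)\<^sup>2" "0.9999443 * 1.0001132 \<le> b 1 * a 1"
        using a1' b1' by (intro power_mono mult_mono; simp)+
      then have "0.9999443\<^sup>2 + 0.9999443 * 1.0001132 + 1.0001132\<^sup>2 \<le> (b 1)\<^sup>2 + b 1 * a 1 + (a 1)\<^sup>2"
        by linarith
      then show ?thesis unfolding bS using b1' by (intro divide_right_mono mult_mono) simp_all
    qed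
    also have "\<dots> \<le> 1 ^ 3" using b1[of "Suc 1"] ab[of "Suc 1"] by (intro power_mono) auto
    finally show False by simp
  qed
qed

section \<open>The minimum of the hexagonal symbol\<close>

text \<open>Every character of \<open>\<int>\<^sup>2\<close> has the form \<open>\<chi>(m, n) = x\<^sup>m y\<^sup>n z\<^bsup>-m-n\<^esup>\<close> with \<open>x y z = 1\<close>, and its sum over
  the six permutations of \<open>(m, n, -m-n)\<close> is \<open>orbit m n (-m-n)\<close> below. The distance of \<open>\<chi>\<close> from the
  characters \<open>\<zeta>\<^bsup>\<plusminus>(n-m)\<^esup>\<close> is measured by \<open>s = \<bar>x + y + z\<bar>\<close>, which vanishes only at them.\<close>

locale unit_triple =
  fixes x y z :: complex
  assumes norms: "cmod x = 1" "cmod y = 1" "cmod z = 1" and prod1: "x * y * z = 1"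
begin

definition psum :: "int \<Rightarrow> complex" where "psum k = x powi k + y powi k + z powi k"

lemma nonzero: "x \<noteq> 0" "y \<noteq> 0" "z \<noteq> 0" using norms by auto

lemma cnj_eq: "cnj x = y * z" "cnj y = x * z" "cnj z = x * y"
proof -
  have "cnj x * x = 1" "cnj y * y = 1" "cnj z * z = 1"
    using norms by (simp_all add: complex_norm_square[symmetric] mult.commute)
  then have "cnj x * x = (y * z) * x" "cnj y * y = (x * z) * y" "cnj z * z = (x * y) * z"
    using prod1 by (simp_all add: mult_ac)
  then show "cnj x = y * z" "cnj y = x * z" "cnj z = x * y"
    using nonzero by simp_all
qed

lemma psum_minus: "psum (- k) = cnj (psum k)"
proof -
  have "w powi (- k) = cnj (w powi k)" if "cmod w = 1" for w
  proof -
    have "w powi k * cnj (w powi k) = 1"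
      using that complex_norm_square[of "w powi k"] by (simp add: norm_power_int)
    then show ?thesis unfolding power_int_minus by (rule inverse_unique)
  qed
  then show ?thesis using norms by (simp add: psum_def)
qed

lemma psum_bound: "cmod (psum k) \<le> 3"
proof -
  have "cmod (psum k) \<le> cmod (x powi k) + cmod (y powi k) + cmod (z powi k)"
    unfolding psum_def by (meson norm_triangle_le norm_triangle_mono order_refl)
  then show ?thesis by (simp add: norm_power_int norms)
qed

lemma psum_0: "psum 0 = 3" by (simp add: psum_def)

definition s where "s = cmod (psum 1)"

lemma s_nonneg: "0 \<le> s" by (simp add: s_def)

text \<open>Newton's recursion for the roots of w^3 - e1 w^2 + e2 w - 1. Since the roots are
  unimodular with product 1, e2 is the conjugate of e1.\<close>

lemma psum_rec: "psum (k + 3) = psum 1 * psum (k + 2) - cnj (psum 1) * psum (k + 1) + psum k"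
proof -
  have r: "w ^ 3 = (x + y + z) * w\<^sup>2 - (y * z + x * z + x * y) * w + 1" if "w = x \<or> w = y \<or> w = z" for w
  proof -
    have "(w - x) * (w - y) * (w - z) = 0" using that by auto
    moreover have "(w - x) * (w - y) * (w - z) = w ^ 3 - (x + y + z) * w\<^sup>2 + (y * z + x * z + x * y) * w - x * y * z"
      by (simp add: power2_eq_square power3_eq_cube algebra_simps)
    ultimately show ?thesis using prod1 by (simp add: algebra_simps)
  qed
  have "w powi (k + 3) = (x + y + z) * w powi (k + 2) - (y * z + x * z + x * y) * w powi (k + 1) + w powi k"
    if "w = x \<or> w = y \<or> w = z" for w
  proof -
    have "w \<noteq> 0" using that nonzero by auto
    then have "w powi (k + 3) = w powi k * w ^ 3" "w powi (k + 2) = w powi k * w\<^sup>2" "w powi (k + 1) = w powi k * w"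
      by (simp_all add: power_int_add)
    then show ?thesis unfolding r[OF that] by (simp add: algebra_simps)
  qed
  then have e: "x powi (k + 3) = (x + y + z) * x powi (k + 2) - (y * z + x * z + x * y) * x powi (k + 1) + x powi k"
    "y powi (k + 3) = (x + y + z) * y powi (k + 2) - (y * z + x * z + x * y) * y powi (k + 1) + y powi k"
    "z powi (k + 3) = (x + y + z) * z powi (k + 2) - (y * z + x * z + x * y) * z powi (k + 1) + z powi k"
    by blast+
  have c: "cnj (psum 1) = y * z + x * z + x * y" by (simp add: psum_def cnj_eq)
  show ?thesis unfolding c unfolding psum_def e power_int_1_right by (simp add: algebra_simps)
qed

text \<open>At s = 0 the triple consists of the cube roots of unity, with power sums 3 or 0. For k
  divisible by 3 the error is quadratic in s, because in the recursion a factor of size s meets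
  power sums that are themselves of order s.\<close>

lemma psum_estimate_nat:
  "if k mod 3 = 0 then cmod (psum (int k) - 3) \<le> (real k)\<^sup>2 * s\<^sup>2 else cmod (psum (int k)) \<le> 3 * real k * s"
proof (induction k rule: less_induct)
  case (less k)
  have s3: "s \<le> 3" unfolding s_def by (rule psum_bound)
  consider "k = 0" | "k = 1" | "k = 2" | j where "k = j + 3"
    by (metis One_nat_def Suc_1 add.commute add_2_eq_Suc' le_Suc_ex less_2_cases linorder_not_less numeral_3_eq_3 le_neq_implies_less less_Suc_eq)
  then show ?case
  proof cases
    case 1 then show ?thesis by (simp add: psum_0)
  next
    case 2 then show ?thesis using s_nonneg by (simp add: s_def[symmetric])
  next
    case 3
    have "psum 2 = psum 1 * psum 1 - 2 * cnj (psum 1)"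
      using psum_rec[of "-1"] by (simp add: psum_0 psum_minus)
    then have "cmod (psum 2) \<le> cmod (psum 1 * psum 1) + cmod (2 * cnj (psum 1))"
      by (metis norm_triangle_ineq4)
    also have "\<dots> = s * s + 2 * s" by (simp add: norm_mult s_def)
    also have "\<dots> \<le> 6 * s" using mult_right_mono[OF s3 s_nonneg] s_nonneg by linarith
    finally show ?thesis using 3 by simp
  next
    case (4 j)
    have i: "int k = int j + 3" "int (j + 2) = int j + 2" "int (j + 1) = int j + 1" using 4 by auto
    show ?thesis
    proof (cases "j mod 3 = 0")
      case True
      then have m: "k mod 3 = 0" "(j + 2) mod 3 \<noteq> 0" "(j + 1) mod 3 \<noteq> 0" using 4 by presburger+
      have b: "cmod (psum (int j + 2)) \<le> 3 * real (j + 2) * s" "cmod (psum (int j + 1)) \<le> 3 * real (j + 1) * s"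
        "cmod (psum (int j) - 3) \<le> (real j)\<^sup>2 * s\<^sup>2"
        using less[of "j + 2"] less[of "j + 1"] less[of j] m True 4 by (auto simp: add.commute)
      have "psum (int k) - 3 = psum 1 * psum (int j + 2) - cnj (psum 1) * psum (int j + 1) + (psum (int j) - 3)"
        unfolding i(1) psum_rec by simp
      also have "cmod \<dots> \<le> cmod (psum 1 * psum (int j + 2)) + cmod (cnj (psum 1) * psum (int j + 1)) + cmod (psum (int j) - 3)"
        by (meson norm_triangle_ineq norm_triangle_ineq4 order_trans add_mono order_refl)
      also have "\<dots> = s * cmod (psum (int j + 2)) + s * cmod (psum (int j + 1)) + cmod (psum (int j) - 3)"
        by (simp add: norm_mult s_def)
      also have "\<dots> \<le> s * (3 * real (j + 2) * s) + s * (3 * real (j + 1) * s) + (real j)\<^sup>2 * s\<^sup>2"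
        using b s_nonneg by (intro add_mono mult_left_mono) auto
      \<comment> \<open>The induction closes exactly: 3(j + 2) + 3(j + 1) + j^2 = (j + 3)^2.\<close>
      also have "\<dots> = (real k)\<^sup>2 * s\<^sup>2" using 4 by (simp add: power2_eq_square algebra_simps)
      finally show ?thesis using m by simp
    next
      case False
      then have m: "k mod 3 \<noteq> 0" using 4 by presburger
      have b: "cmod (psum (int j)) \<le> 3 * real j * s"
        using less[of j] False 4 by auto
      have "psum (int k) = psum 1 * psum (int j + 2) - cnj (psum 1) * psum (int j + 1) + psum (int j)"
        unfolding i(1) by (rule psum_rec)
      also have "cmod \<dots> \<le> cmod (psum 1 * psum (int j + 2)) + cmod (cnj (psum 1) * psum (int j + 1)) + cmod (psum (int j))"
        by (meson norm_triangle_ineq norm_triangle_ineq4 order_trans add_mono order_refl)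
      also have "\<dots> = s * cmod (psum (int j + 2)) + s * cmod (psum (int j + 1)) + cmod (psum (int j))"
        by (simp add: norm_mult s_def)
      also have "\<dots> \<le> s * 3 + s * 3 + 3 * real j * s"
        using b s_nonneg psum_bound by (intro add_mono mult_left_mono) auto
      also have "\<dots> \<le> 3 * real k * s" using 4 s_nonneg by (simp add: algebra_simps)
      finally show ?thesis using m by simp
    qed
  qed
qed

lemma psum_estimate:
  shows "k mod 3 = 0 \<Longrightarrow> cmod (psum k - 3) \<le> (of_int k)\<^sup>2 * s\<^sup>2"
    and "k mod 3 \<noteq> 0 \<Longrightarrow> cmod (psum k) \<le> 3 * \<bar>of_int k\<bar> * s"
proof -
  have "(k mod 3 = 0 \<longrightarrow> cmod (psum k - 3) \<le> (of_int k)\<^sup>2 * s\<^sup>2) \<and> (k mod 3 \<noteq> 0 \<longrightarrow> cmod (psum k) \<le> 3 * \<bar>of_int k\<bar> * s)"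
  proof (cases k rule: int_cases2)
    case (nonneg n)
    have "(int n mod 3 = 0) = (n mod 3 = 0)" by presburger
    then show ?thesis using psum_estimate_nat[of n] nonneg by (auto split: if_splits)
  next
    case (nonpos n)
    have "(- int n mod 3 = 0) = (n mod 3 = 0)" by presburger
    moreover have "cmod (psum (- int n) - 3) = cmod (psum (int n) - 3)"
      unfolding psum_minus by (metis complex_cnj_diff complex_cnj_numeral complex_mod_cnj)
    moreover have "cmod (psum (- int n)) = cmod (psum (int n))" by (simp add: psum_minus)
    ultimately show ?thesis using psum_estimate_nat[of n] nonpos by (auto split: if_splits)
  qed
  then show "k mod 3 = 0 \<Longrightarrow> cmod (psum k - 3) \<le> (of_int k)\<^sup>2 * s\<^sup>2"
    and "k mod 3 \<noteq> 0 \<Longrightarrow> cmod (psum k) \<le> 3 * \<bar>of_int k\<bar> * s" by auto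
qed

text \<open>Inclusion and exclusion over coinciding positions: the sum over the six assignments is
  p_a p_b p_c minus the three terms of type p_(a+b) p_c plus 2 p_(a+b+c). For a + b + c = 0 these
  terms are |p_c|^2 and so on, and 2 p_0 = 6.\<close>

definition orbit :: "int \<Rightarrow> int \<Rightarrow> int \<Rightarrow> complex" where
  "orbit a b c = psum a * psum b * psum c
     - of_real ((cmod (psum a))\<^sup>2 + (cmod (psum b))\<^sup>2 + (cmod (psum c))\<^sup>2) + 6"

lemma sq_diff_bound:
  assumes "k mod 3 = 0"
  shows "\<bar>(cmod (psum k))\<^sup>2 - 9\<bar> \<le> 6 * ((of_int k)\<^sup>2 * s\<^sup>2)"
proof -
  have "\<bar>(cmod (psum k))\<^sup>2 - 9\<bar> = \<bar>cmod (psum k) - 3\<bar> * (cmod (psum k) + 3)"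
  proof -
    have "(cmod (psum k))\<^sup>2 - 9 = (cmod (psum k) - 3) * (cmod (psum k) + 3)"
      by (simp add: power2_eq_square algebra_simps)
    then show ?thesis by (simp add: abs_mult)
  qed
  also have "\<dots> \<le> cmod (psum k - 3) * 6"
  proof (rule mult_mono)
    show "\<bar>cmod (psum k) - 3\<bar> \<le> cmod (psum k - 3)"
      using norm_triangle_ineq3[of "psum k" 3] by simp
  qed (use psum_bound[of k] in auto)
  also have "\<dots> \<le> 6 * ((of_int k)\<^sup>2 * s\<^sup>2)" using psum_estimate(1)[OF assms] by simp
  finally show ?thesis .
qed

lemma sq_bound:
  assumes "k mod 3 \<noteq> 0"
  shows "(cmod (psum k))\<^sup>2 \<le> 9 * (of_int k)\<^sup>2 * s\<^sup>2"
  using power_mono[OF psum_estimate(2)[OF assms], of 2] by (simp add: power_mult_distrib)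

lemma prod_bound:
  assumes "a mod 3 \<noteq> 0" "b mod 3 \<noteq> 0"
  shows "cmod (psum a * psum b * psum c) \<le> 27/2 * ((of_int a)\<^sup>2 + (of_int b)\<^sup>2) * s\<^sup>2"
proof -
  have "cmod (psum a * psum b * psum c) \<le> (3 * \<bar>of_int a\<bar> * s) * (3 * \<bar>of_int b\<bar> * s) * 3"
    unfolding norm_mult using psum_estimate(2) assms psum_bound s_nonneg by (intro mult_mono) auto
  also have "\<dots> = 27 * (\<bar>of_int a\<bar> * \<bar>of_int b\<bar>) * s\<^sup>2" by (simp add: power2_eq_square)
  also have "\<dots> \<le> 27 * (((of_int a)\<^sup>2 + (of_int b)\<^sup>2) / 2) * s\<^sup>2"
    using sum_squares_bound[of "\<bar>real_of_int a\<bar>" "\<bar>real_of_int b\<bar>"] by (intro mult_right_mono) auto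
  finally show ?thesis by simp
qed

lemma orbit_estimate_same:
  assumes "a mod 3 = b mod 3" "b mod 3 = c mod 3"
  shows "cmod (orbit a b c - 6) \<le> 45/2 * ((of_int a)\<^sup>2 + (of_int b)\<^sup>2 + (of_int c)\<^sup>2) * s\<^sup>2"
proof (cases "a mod 3 = 0")
  case True
  define d where "d k = psum k - 3" for k
  define A B C where "A = (real_of_int a)\<^sup>2 * s\<^sup>2" and "B = (real_of_int b)\<^sup>2 * s\<^sup>2" and "C = (real_of_int c)\<^sup>2 * s\<^sup>2"
  have d: "cmod (d a) \<le> A" "cmod (d b) \<le> B" "cmod (d c) \<le> C"
    unfolding d_def A_def B_def C_def using psum_estimate(1) assms True by auto
  have nn: "A \<ge> 0" "B \<ge> 0" "C \<ge> 0" by (simp_all add: A_def B_def C_def)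
  define e where "e = ((cmod (psum a))\<^sup>2 - 9) + ((cmod (psum b))\<^sup>2 - 9) + ((cmod (psum c))\<^sup>2 - 9)"
  have e: "\<bar>e\<bar> \<le> 6 * A + 6 * B + 6 * C"
    unfolding e_def A_def B_def C_def
    using sq_diff_bound[of a] sq_diff_bound[of b] sq_diff_bound[of c] assms True by linarith
  have "orbit a b c - 6 = d a * psum b * psum c + 3 * d b * psum c + 9 * d c - of_real e"
    by (simp add: orbit_def d_def e_def algebra_simps)
  also have "cmod \<dots> \<le> cmod (d a * psum b * psum c) + cmod (3 * d b * psum c) + cmod (9 * d c) + cmod (of_real e)"
    by (meson norm_triangle_ineq norm_triangle_ineq4 order_trans add_mono order_refl)
  also have "\<dots> \<le> A * 3 * 3 + 3 * B * 3 + 9 * C + (6 * A + 6 * B + 6 * C)"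
    unfolding norm_mult norm_of_real using d e nn psum_bound by (intro add_mono mult_mono) auto
  also have "\<dots> \<le> 45/2 * (A + B + C)" using nn by simp
  finally show ?thesis by (simp add: A_def B_def C_def algebra_simps)
next
  case False
  have "orbit a b c - 6 = psum a * psum b * psum c - of_real ((cmod (psum a))\<^sup>2 + (cmod (psum b))\<^sup>2 + (cmod (psum c))\<^sup>2)"
    by (simp add: orbit_def)
  also have "cmod \<dots> \<le> cmod (psum a * psum b * psum c) + cmod (of_real ((cmod (psum a))\<^sup>2 + (cmod (psum b))\<^sup>2 + (cmod (psum c))\<^sup>2))"
    by (rule norm_triangle_ineq4)
  also have "\<dots> \<le> 27/2 * ((of_int a)\<^sup>2 + (of_int b)\<^sup>2) * s\<^sup>2 + (9 * (of_int a)\<^sup>2 * s\<^sup>2 + 9 * (of_int b)\<^sup>2 * s\<^sup>2 + 9 * (of_int c)\<^sup>2 * s\<^sup>2)"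
    unfolding norm_of_real using sq_bound[of a] sq_bound[of b] sq_bound[of c] prod_bound[of a b c] assms False
    by (intro add_mono) (auto simp: abs_of_nonneg intro!: add_mono)
  \<comment> \<open>The constant 45/2 is 27/2 from the triple product plus 9 from a square.\<close>
  also have "\<dots> \<le> 45/2 * ((of_int a)\<^sup>2 + (of_int b)\<^sup>2 + (of_int c)\<^sup>2) * s\<^sup>2"
    by (simp add: algebra_simps)
  finally show ?thesis .
qed

text \<open>Only the power sum with index divisible by 3 survives at s = 0; its square 9 leaves the
  value -9 + 6 = -3.\<close>

lemma orbit_estimate_diff:
  assumes "a mod 3 \<noteq> 0" "b mod 3 \<noteq> 0" "c mod 3 = 0"
  shows "cmod (orbit a b c + 3) \<le> 45/2 * ((of_int a)\<^sup>2 + (of_int b)\<^sup>2 + (of_int c)\<^sup>2) * s\<^sup>2"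
proof -
  have "orbit a b c + 3 = psum a * psum b * psum c - of_real ((cmod (psum a))\<^sup>2 + (cmod (psum b))\<^sup>2 + ((cmod (psum c))\<^sup>2 - 9))"
    by (simp add: orbit_def)
  also have "cmod \<dots> \<le> cmod (psum a * psum b * psum c) + cmod (of_real ((cmod (psum a))\<^sup>2 + (cmod (psum b))\<^sup>2 + ((cmod (psum c))\<^sup>2 - 9)))"
    by (rule norm_triangle_ineq4)
  also have "\<dots> \<le> 27/2 * ((of_int a)\<^sup>2 + (of_int b)\<^sup>2) * s\<^sup>2 + (9 * (of_int a)\<^sup>2 * s\<^sup>2 + 9 * (of_int b)\<^sup>2 * s\<^sup>2 + 6 * ((of_int c)\<^sup>2 * s\<^sup>2))"
  proof (intro add_mono prod_bound assms)
    have "\<bar>(cmod (psum a))\<^sup>2\<bar> = (cmod (psum a))\<^sup>2" "\<bar>(cmod (psum b))\<^sup>2\<bar> = (cmod (psum b))\<^sup>2" by simp_all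
    then show "cmod (of_real ((cmod (psum a))\<^sup>2 + (cmod (psum b))\<^sup>2 + ((cmod (psum c))\<^sup>2 - 9)))
        \<le> 9 * (of_int a)\<^sup>2 * s\<^sup>2 + 9 * (of_int b)\<^sup>2 * s\<^sup>2 + 6 * ((of_int c)\<^sup>2 * s\<^sup>2)"
      unfolding norm_of_real using sq_bound[of a] sq_bound[of b] sq_diff_bound[of c] assms by linarith
  qed
  also have "\<dots> \<le> 45/2 * ((of_int a)\<^sup>2 + (of_int b)\<^sup>2 + (of_int c)\<^sup>2) * s\<^sup>2"
    by (simp add: algebra_simps)
  finally show ?thesis .
qed

lemma orbit_commute: "orbit a b c = orbit b c a" "orbit a b c = orbit c a b"
  by (simp_all add: orbit_def algebra_simps)

text \<open>The subtracted number is the orbit sum at s = 0: 6 if m, n, -m-n agree modulo 3, and -3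
  if they are distinct, in which case exactly one of them is divisible by 3. The sum of their
  squares is 2 \<open>hex_form m n\<close>, which doubles 45/2.\<close>

lemma orbit_estimate:
  "cmod (orbit m n (- m - n) - of_real (6 * Re (w3 (n - m)))) \<le> 45 * of_int (hex_form m n) * s\<^sup>2"
proof -
  have sq: "(real_of_int m)\<^sup>2 + (of_int n)\<^sup>2 + (of_int (- m - n))\<^sup>2 = 2 * of_int (hex_form m n)"
    by (simp add: hex_form_def power2_eq_square algebra_simps)
  define c where "c = - m - n"
  have sq': "(real_of_int m)\<^sup>2 + (of_int n)\<^sup>2 + (of_int c)\<^sup>2 = 2 * of_int (hex_form m n)"
    using sq by (simp only: c_def)
  consider "(n - m) mod 3 = 0" | "(n - m) mod 3 = 1" | "(n - m) mod 3 = 2" by linarith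
  then have "cmod (orbit m n c - of_real (6 * Re (w3 (n - m)))) \<le> 45/2 * ((of_int m)\<^sup>2 + (of_int n)\<^sup>2 + (of_int c)\<^sup>2) * s\<^sup>2"
  proof cases
    case 1
    then have "w3 (n - m) = 1" using w3_cong[of "n - m" 0] by simp
    moreover from 1 have "m mod 3 = n mod 3" "n mod 3 = c mod 3" unfolding c_def by presburger+
    ultimately show ?thesis using orbit_estimate_same[of m n c] by simp
  next
    case 2
    then have w: "of_real (6 * Re (w3 (n - m))) = (- 3 :: complex)" using w3_cong[of "n - m" 1] by (simp add: w3_1)
    have "(m mod 3 = 0 \<and> n mod 3 \<noteq> 0 \<and> c mod 3 \<noteq> 0) \<or> (m mod 3 \<noteq> 0 \<and> n mod 3 = 0 \<and> c mod 3 \<noteq> 0) \<or> (m mod 3 \<noteq> 0 \<and> n mod 3 \<noteq> 0 \<and> c mod 3 = 0)"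
      using 2 unfolding c_def by presburger
    then show ?thesis unfolding w
      using orbit_estimate_diff[of n c m] orbit_estimate_diff[of c m n] orbit_estimate_diff[of m n c] orbit_commute[of m n c]
      by (elim disjE conjE) (simp_all add: add_ac)
  next
    case 3
    then have w: "of_real (6 * Re (w3 (n - m))) = (- 3 :: complex)" using w3_cong[of "n - m" 2] by (simp add: w3_2)
    have "(m mod 3 = 0 \<and> n mod 3 \<noteq> 0 \<and> c mod 3 \<noteq> 0) \<or> (m mod 3 \<noteq> 0 \<and> n mod 3 = 0 \<and> c mod 3 \<noteq> 0) \<or> (m mod 3 \<noteq> 0 \<and> n mod 3 \<noteq> 0 \<and> c mod 3 = 0)"
      using 3 unfolding c_def by presburger
    then show ?thesis unfolding w
      using orbit_estimate_diff[of n c m] orbit_estimate_diff[of c m n] orbit_estimate_diff[of m n c] orbit_commute[of m n c]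
      by (elim disjE conjE) (simp_all add: add_ac)
  qed
  then show ?thesis unfolding sq' by (simp add: c_def)
qed

end

section \<open>Tail estimate for the hexagonal series\<close>

lemma has_sum_int_geometric_half: "((\<lambda>m::int. (1/2 :: real) ^ nat \<bar>m\<bar>) has_sum 3) UNIV"
proof -
  have g: "((\<lambda>n. (1/2 :: real) ^ n) has_sum 2) UNIV"
    by (rule norm_summable_imp_has_sum) (use geometric_sums[of "1/2 :: real"] in \<open>auto simp: summable_geometric\<close>)
  have h1: "((\<lambda>m::int. (1/2 :: real) ^ nat \<bar>m\<bar>) has_sum 2) (range int)"
    by (subst has_sum_reindex) (use g in \<open>auto simp: o_def\<close>)
  have h2: "((\<lambda>m::int. (1/2 :: real) ^ nat \<bar>m\<bar>) has_sum 1) (range (\<lambda>n. - int (Suc n)))"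
  proof (subst has_sum_reindex)
    have "((\<lambda>n. (1/2) * (1/2 :: real) ^ n) has_sum (1/2) * 2) UNIV" by (intro has_sum_cmult_right g)
    moreover have "nat \<bar>- int (Suc n)\<bar> = Suc n" for n by simp
    ultimately show "((\<lambda>m::int. (1/2 :: real) ^ nat \<bar>m\<bar>) \<circ> (\<lambda>n. - int (Suc n)) has_sum 1) UNIV"
      by (simp only: o_def power_Suc) simp
  qed (auto simp: inj_on_def)
  have d: "range int \<inter> range (\<lambda>n. - int (Suc n)) = {}" by auto
  have u: "range int \<union> range (\<lambda>n. - int (Suc n)) = UNIV"
  proof (intro set_eqI iffI UNIV_I)
    fix k :: int show "k \<in> range int \<union> range (\<lambda>n. - int (Suc n))"
      by (cases k) auto
  qed
  show ?thesis using has_sum_Un_disjoint[OF h1 h2 d] unfolding u by simp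
qed

text \<open>The origin together with the six vectors on which \<open>hex_form\<close> is 1.\<close>

definition hex_short :: "(int \<times> int) set" where
  "hex_short = {(0,0), (1,0), (-1,0), (0,1), (0,-1), (1,-1), (-1,1)}"

lemma hex_form_abs:
  assumes "(m, n) \<notin> hex_short" shows "hex_form m n \<ge> \<bar>m\<bar> + \<bar>n\<bar>" "hex_form m n \<ge> 3"
proof -
  define a b where "a = \<bar>m\<bar>" and "b = \<bar>n\<bar>"
  have "m * n \<ge> - (a * b)" unfolding a_def b_def abs_mult[symmetric] by linarith
  then have 1: "hex_form m n \<ge> hex_form a (- b)"
    by (simp add: hex_form_def a_def b_def)
  \<comment> \<open>Shifting the form to the centre (1, -1) produces the linear terms a + b; the
    remaining value of the form is at least 1 unless a = b = 1.\<close>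
  have 2: "hex_form a (- b) = hex_form (a - 1) (1 - b) - 1 + a + b"
    by (simp add: hex_form_def power2_eq_square algebra_simps)
  have h: "hex_form m n \<ge> \<bar>m\<bar> + \<bar>n\<bar>"
  proof (cases "a = 1 \<and> b = 1")
    case True
    then have "m = 1 \<or> m = -1" "n = 1 \<or> n = -1" unfolding a_def b_def by auto
    then show ?thesis using assms by (auto simp: hex_short_def hex_form_def)
  next
    case False
    then have "hex_form (a - 1) (1 - b) \<ge> 1" by (intro hex_form_pos) auto
    then show ?thesis using 1 2 by (simp add: a_def b_def)
  qed
  show "hex_form m n \<ge> 3"
  proof (cases "a + b \<ge> 3")
    case False
    then have mn: "m \<in> {-2..2}" "n \<in> {-2..2}" "\<bar>m\<bar> + \<bar>n\<bar> \<le> 2"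
      unfolding a_def b_def by auto
    have "{-2..2} = {-2, -1, 0, 1, 2 :: int}" by auto
    with mn have "m \<in> {-2, -1, 0, 1, 2}" "n \<in> {-2, -1, 0, 1, 2}" by metis+
    then show ?thesis using assms mn(3) unfolding hex_short_def
      by (elim insertE emptyE) (simp_all add: hex_form_def)
  qed (use h a_def b_def in linarith)
  show "hex_form m n \<ge> \<bar>m\<bar> + \<bar>n\<bar>" by (rule h)
qed

text \<open>The estimate k q^k \<le> 24 q^3 2^(-k), an equality at k = 3, reduces the tail to a
  geometric series. The sum of 2^(-|m|-|n|) over the plane is 9, its part over
  \<open>hex_short\<close> is 1 + 4/2 + 2/4 = 7/2. Finally 45 * 24 * 11/2 = 5940, and 5940/32^2 is
  below 6.\<close>

lemma hex_tail_bound: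
  fixes q :: real
  assumes q: "0 < q" "q \<le> 1/32"
  shows "(\<lambda>(m, n). 45 * of_int (hex_form m n) * q powi hex_form m n) summable_on - hex_short"
    and "(\<Sum>\<^sub>\<infinity>(m, n)\<in>- hex_short. 45 * of_int (hex_form m n) * q powi hex_form m n) \<le> 6 * q"
proof -
  define g where "g = (\<lambda>(m, n). (1/2 :: real) ^ nat \<bar>m\<bar> * (1/2) ^ nat \<bar>n\<bar>)"
  have "(g has_sum 3 * 3) (UNIV \<times> UNIV)"
  proof (rule has_sum_SigmaI)
    show "((\<lambda>n. g (m, n)) has_sum ((1/2) ^ nat \<bar>m\<bar> * 3)) UNIV" for m
      unfolding g_def prod.case by (intro has_sum_cmult_right has_sum_int_geometric_half)
    show "((\<lambda>m::int. (1/2 :: real) ^ nat \<bar>m\<bar> * 3) has_sum 3 * 3) UNIV"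
      by (intro has_sum_cmult_left has_sum_int_geometric_half)
    show "g summable_on UNIV \<times> UNIV"
      unfolding g_def by (intro summable_on_product_nonneg has_sum_imp_summable[OF has_sum_int_geometric_half]) auto
  qed
  then have g9: "(g has_sum 9) UNIV" by simp
  have gs: "sum g hex_short = 7/2" by (simp add: hex_short_def g_def)
  have "(g has_sum (9 - 7/2)) (UNIV - hex_short)"
    by (rule has_sum_Diff[OF g9]) (use gs in \<open>auto simp: hex_short_def intro!: has_sum_finiteI\<close>)
  then have g11: "(g has_sum 11/2) (- hex_short)" by (simp add: Compl_eq_Diff_UNIV)
  have pw: "real k * q ^ k \<le> 24 * q ^ 3 * (1/2) ^ k" if "k \<ge> 3" for k
    using that
  proof (induction k rule: nat_induct_at_least)
    case base
    then show ?case by (simp add: power3_eq_cube)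
  next
    case (Suc k)
    have "real (Suc k) * q \<le> 1/2 * real k"
    proof -
      have "real (Suc k) * q \<le> real (Suc k) * (1/32)" using q by (intro mult_left_mono) auto
      also have "\<dots> \<le> 1/2 * real k" using Suc.hyps by simp
      finally show ?thesis .
    qed
    then have "real (Suc k) * q * q ^ k \<le> 1/2 * real k * q ^ k" using q by (intro mult_right_mono) auto
    also have "\<dots> \<le> 1/2 * (24 * q ^ 3 * (1/2) ^ k)" using Suc.IH by simp
    finally show ?case by simp
  qed
  have bd: "45 * of_int (hex_form m n) * q powi hex_form m n \<le> 1080 * q ^ 3 * g (m, n)" if mn: "(m, n) \<notin> hex_short" for m n
  proof -
    define k where "k = nat (hex_form m n)"
    have k: "hex_form m n = int k" "k \<ge> 3" "k \<ge> nat \<bar>m\<bar> + nat \<bar>n\<bar>"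
      using hex_form_abs[OF mn] by (auto simp: k_def)
    have "real k * q ^ k \<le> 24 * q ^ 3 * (1/2) ^ k" by (rule pw[OF k(2)])
    also have "\<dots> \<le> 24 * q ^ 3 * (1/2) ^ (nat \<bar>m\<bar> + nat \<bar>n\<bar>)"
      using q k(3) by (intro mult_left_mono power_decreasing) auto
    finally show ?thesis unfolding k(1) g_def prod.case by (simp add: power_add)
  qed
  have s: "(\<lambda>z. 1080 * q ^ 3 * g z) summable_on - hex_short"
    by (intro summable_on_cmult_right has_sum_imp_summable[OF g11])
  show sm: "(\<lambda>(m, n). 45 * of_int (hex_form m n) * q powi hex_form m n) summable_on - hex_short"
    by (rule summable_on_comparison_test[OF s]) (use bd q hex_form_nonneg in auto)
  have "(\<Sum>\<^sub>\<infinity>(m, n)\<in>- hex_short. 45 * of_int (hex_form m n) * q powi hex_form m n) \<le> (\<Sum>\<^sub>\<infinity>z\<in>- hex_short. 1080 * q ^ 3 * g z)"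
    by (rule infsum_mono[OF sm s]) (use bd in auto)
  also have "\<dots> = 1080 * q ^ 3 * (11/2)"
    using infsumI[OF g11] by (simp add: infsum_cmult_right')
  also have "\<dots> = 5940 * q * q\<^sup>2" by (simp add: power3_eq_cube power2_eq_square)
  also have "\<dots> \<le> 5940 * q * (1/32)\<^sup>2" using q by (intro mult_left_mono power_mono) auto
  also have "\<dots> \<le> 6 * q" using q by (simp add: power2_eq_square)
  finally show "(\<Sum>\<^sub>\<infinity>(m, n)\<in>- hex_short. 45 * of_int (hex_form m n) * q powi hex_form m n) \<le> 6 * q" .
qed

section \<open>Lower bound of the symbol at every character\<close>

context unit_triple
begin

definition chi :: "int \<Rightarrow> int \<Rightarrow> complex" where "chi m n = x powi m * y powi n * z powi (- m - n)"

lemma cmod_chi [simp]: "cmod (chi m n) = 1"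
  by (simp add: chi_def norm_mult norm_power_int norms)

text \<open>A polynomial identity in nine variables, specialized by the relations that hold because
  the three exponents add up to 0.\<close>

lemma orbit_eq_sum:
  "orbit m n (- m - n) = chi m n + chi n m + chi n (- m - n) + chi (- m - n) n + chi m (- m - n) + chi (- m - n) m"
proof -
  define c where "c = - m - n"
  have c: "- n - c = m" "- m - c = n" "- c - m = n" "- c - n = m" "- n - m = c" "- m - n = c" by (simp_all add: c_def)
  define X Y Z where "X k = x powi k" and "Y k = y powi k" and "Z k = z powi k" for k
  have one: "X m * X n * X c = 1" "Y m * Y n * Y c = 1" "Z m * Z n * Z c = 1"
    using nonzero by (simp_all add: X_def Y_def Z_def c_def power_int_add[symmetric])
  have half: "of_real ((cmod (psum k))\<^sup>2) = psum k * psum (- k)" for k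
    unfolding psum_minus by (rule complex_norm_square)
  have inv: "psum (- c) = X m * X n + Y m * Y n + Z m * Z n" "psum (- m) = X n * X c + Y n * Y c + Z n * Z c"
    "psum (- n) = X m * X c + Y m * Y c + Z m * Z c"
    using nonzero by (simp_all add: psum_def X_def Y_def Z_def c_def power_int_add[symmetric] add.commute)
  have p: "psum m = X m + Y m + Z m" "psum n = X n + Y n + Z n" "psum c = X c + Y c + Z c"
    by (simp_all add: psum_def X_def Y_def Z_def)
  have ring: "(X m + Y m + Z m) * (X n + Y n + Z n) * (X c + Y c + Z c)
     - ((X m + Y m + Z m) * (X n * X c + Y n * Y c + Z n * Z c) + (X n + Y n + Z n) * (X m * X c + Y m * Y c + Z m * Z c)
        + (X c + Y c + Z c) * (X m * X n + Y m * Y n + Z m * Z n)) + 2 * (X m * X n * X c + Y m * Y n * Y c + Z m * Z n * Z c)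
     = X m * Y n * Z c + X n * Y m * Z c + X n * Y c * Z m + X c * Y n * Z m + X m * Y c * Z n + X c * Y m * Z n"
    by (simp add: algebra_simps)
  have "orbit m n c = X m * Y n * Z c + X n * Y m * Z c + X n * Y c * Z m + X c * Y n * Z m + X m * Y c * Z n + X c * Y m * Z n"
  proof -
    have six: "2 * (1 + 1 + 1) = (6 :: complex)" by simp
    show ?thesis
      unfolding ring[unfolded one six, symmetric] orbit_def of_real_add half inv
      unfolding p by (simp only: add.assoc)
  qed
  then show ?thesis
    unfolding chi_def c_def[symmetric] c X_def Y_def Z_def .
qed

text \<open>For the six shortest vectors the orbit sum exceeds its minimum by exactly \<open>s\<^sup>2\<close> each, and this
  gain dominates the possible loss from all longer vectors.\<close>

lemma char_lower_bound:
  assumes q: "0 < q" "q \<le> 1/32"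
  shows "cubic_b q \<le> Re (\<Sum>\<^sub>\<infinity>(m, n)\<in>UNIV. of_real (q powi hex_form m n) * chi m n)"
proof -
  have q1: "q < 1" using q by simp
  define F where "F = (\<Sum>\<^sub>\<infinity>(m, n)\<in>UNIV. of_real (q powi hex_form m n) * chi m n)"
  define G where "G = (\<lambda>(m, n). complex_of_real (q powi hex_form m n) * chi m n)"
  have Gs: "G summable_on A" for A unfolding G_def by (rule summable_hex_weight) (use q q1 in auto)
  have Fh: "(G has_sum F) UNIV" unfolding F_def G_def[symmetric] by (rule has_sum_infsum[OF Gs])
  have rb: "((G \<circ> f) has_sum F) UNIV" if "\<And>a. i (f a) = a" "\<And>a. f (i a) = a" for f i :: "int \<times> int \<Rightarrow> int \<times> int"
    using has_sum_reindex_bij_witness[of UNIV i f UNIV G "G \<circ> f" F F] that Fh by (simp add: o_def)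
  \<comment> \<open>These are the five nontrivial permutations of (m, n, -m-n): three involutions
    and two mutually inverse 3-cycles. All preserve the form, so six copies of the symbol add up to
    the series of orbit sums.\<close>
  define f1 f2 f3 f4 f5 :: "int \<times> int \<Rightarrow> int \<times> int" where
    "f1 = (\<lambda>(m, n). (n, m))" and "f2 = (\<lambda>(m, n). (n, - m - n))" and "f3 = (\<lambda>(m, n). (- m - n, n))"
    and "f4 = (\<lambda>(m, n). (m, - m - n))" and "f5 = (\<lambda>(m, n). (- m - n, m))"
  have ff: "f1 (f1 z) = z" "f3 (f3 z) = z" "f4 (f4 z) = z" "f2 (f5 z) = z" "f5 (f2 z) = z" for z
    by (simp_all add: f1_def f2_def f3_def f4_def f5_def case_prod_unfold)
  note h6 = has_sum_add[OF has_sum_add[OF has_sum_add[OF has_sum_add[OF has_sum_add[OF Fh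
      rb[of f1 f1, OF ff(1) ff(1)]] rb[of f5 f2, OF ff(5) ff(4)]] rb[of f3 f3, OF ff(2) ff(2)]] rb[of f4 f4, OF ff(3) ff(3)]] rb[of f2 f5, OF ff(4) ff(5)]]
  have Q: "hex_form n m = hex_form m n" "hex_form n (- m - n) = hex_form m n" "hex_form (- m - n) n = hex_form m n"
    "hex_form m (- m - n) = hex_form m n" "hex_form (- m - n) m = hex_form m n" for m n
    by (simp_all add: hex_form_def power2_eq_square algebra_simps)
  have "((\<lambda>(m, n). of_real (q powi hex_form m n) * orbit m n (- m - n)) has_sum (6 * F)) UNIV"
  proof -
    have e: "of_real (q powi hex_form m n) * orbit m n (- m - n) = G (m, n) + (G \<circ> f1) (m, n) + (G \<circ> f2) (m, n)
        + (G \<circ> f3) (m, n) + (G \<circ> f4) (m, n) + (G \<circ> f5) (m, n)" for m n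
    proof -
      have g: "G (a, b) = of_real (q powi hex_form m n) * chi a b" if "hex_form a b = hex_form m n" for a b
        by (simp only: G_def prod.case that)
      show ?thesis
        unfolding o_def f1_def f2_def f3_def f4_def f5_def prod.case
          g[OF refl] g[OF Q(1)] g[OF Q(2)] g[OF Q(3)] g[OF Q(4)] g[OF Q(5)] orbit_eq_sum
        by (simp only: distrib_left)
    qed
    have "F + F + F + F + F + F = 6 * F" by simp
    then show ?thesis using h6 unfolding case_prod_beta e prod.collapse by (simp only:)
  qed
  from has_sum_Re[OF this]
  have o: "((\<lambda>(m, n). q powi hex_form m n * Re (orbit m n (- m - n))) has_sum (6 * Re F)) UNIV"
    by (simp add: case_prod_unfold del: of_real_power_int)
  have "((\<lambda>(m, n). complex_of_real (q powi hex_form m n) * w3 (n - m)) has_sum of_real (cubic_b q)) UNIV"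
    unfolding cubic_b_sum(1)[OF q(1)] by (rule has_sum_infsum, rule summable_hex_weight) (use q q1 in auto)
  from has_sum_cmult_right[OF has_sum_Re[OF this], of 6]
  have b: "((\<lambda>(m, n). q powi hex_form m n * (6 * Re (w3 (n - m)))) has_sum (6 * cubic_b q)) UNIV"
    by (simp add: case_prod_unfold mult_ac del: of_real_power_int)
  define D where "D = (\<lambda>(m, n). q powi hex_form m n * (Re (orbit m n (- m - n)) - 6 * Re (w3 (n - m))))"
  have D: "(D has_sum (6 * Re F - 6 * cubic_b q)) UNIV"
    using has_sum_add[OF o has_sum_uminusI[OF b]] by (simp add: D_def case_prod_unfold algebra_simps)
  have fin: "finite hex_short" by (simp add: hex_short_def)
  have e: "psum 1 * cnj (psum 1) = of_real (s\<^sup>2)"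
    using complex_norm_square[of "psum 1"] by (simp add: s_def)
  \<comment> \<open>For a shortest vector the power sums have indices 1, 0, -1 in some order, and
    the orbit sum is 3s^2 - (2s^2 + 9) + 6.\<close>
  have root: "Re (orbit 1 0 (-1)) = s\<^sup>2 - 3" "Re (orbit (-1) 0 1) = s\<^sup>2 - 3" "Re (orbit 0 1 (-1)) = s\<^sup>2 - 3"
    "Re (orbit 0 (-1) 1) = s\<^sup>2 - 3" "Re (orbit 1 (-1) 0) = s\<^sup>2 - 3" "Re (orbit (-1) 1 0) = s\<^sup>2 - 3"
  proof -
    have "orbit 1 0 (-1) = 3 * (psum 1 * cnj (psum 1)) - of_real (s\<^sup>2 + 9 + s\<^sup>2) + 6"
      "orbit (-1) 0 1 = 3 * (psum 1 * cnj (psum 1)) - of_real (s\<^sup>2 + 9 + s\<^sup>2) + 6"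
      "orbit 0 1 (-1) = 3 * (psum 1 * cnj (psum 1)) - of_real (s\<^sup>2 + 9 + s\<^sup>2) + 6"
      "orbit 0 (-1) 1 = 3 * (psum 1 * cnj (psum 1)) - of_real (s\<^sup>2 + 9 + s\<^sup>2) + 6"
      "orbit 1 (-1) 0 = 3 * (psum 1 * cnj (psum 1)) - of_real (s\<^sup>2 + 9 + s\<^sup>2) + 6"
      "orbit (-1) 1 0 = 3 * (psum 1 * cnj (psum 1)) - of_real (s\<^sup>2 + 9 + s\<^sup>2) + 6"
      by (simp_all add: orbit_def psum_0 psum_minus s_def[symmetric])
    then show "Re (orbit 1 0 (-1)) = s\<^sup>2 - 3" "Re (orbit (-1) 0 1) = s\<^sup>2 - 3" "Re (orbit 0 1 (-1)) = s\<^sup>2 - 3"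
      "Re (orbit 0 (-1) 1) = s\<^sup>2 - 3" "Re (orbit 1 (-1) 0) = s\<^sup>2 - 3" "Re (orbit (-1) 1 0) = s\<^sup>2 - 3"
      unfolding e by simp_all
  qed
  have w: "Re (w3 1) = - (1/2)" "Re (w3 (-1)) = - (1/2)" "Re (w3 2) = - (1/2)" "Re (w3 (-2)) = - (1/2)"
  proof -
    show "Re (w3 1) = - (1/2)" "Re (w3 2) = - (1/2)" by (simp_all add: w3_1 w3_2)
    then show "Re (w3 (-1)) = - (1/2)" "Re (w3 (-2)) = - (1/2)" by (simp_all add: cnj_w3[symmetric])
  qed
  have ds: "D (0, 0) = 0" "D (1, 0) = q * s\<^sup>2" "D (-1, 0) = q * s\<^sup>2" "D (0, 1) = q * s\<^sup>2" "D (0, -1) = q * s\<^sup>2"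
    "D (1, -1) = q * s\<^sup>2" "D (-1, 1) = q * s\<^sup>2"
    by (simp_all add: D_def hex_form_def root w) (simp add: orbit_def psum_0)
  have sumD: "sum D hex_short = 6 * q * s\<^sup>2"
    by (simp add: hex_short_def ds)
  have Dh: "(D has_sum (6 * Re F - 6 * cubic_b q - 6 * q * s\<^sup>2)) (- hex_short)"
    unfolding Compl_eq_Diff_UNIV
    by (rule has_sum_Diff[OF D]) (use fin sumD in \<open>auto intro!: has_sum_finiteI\<close>)
  have Th: "((\<lambda>z. - s\<^sup>2 * (case z of (m, n) \<Rightarrow> 45 * of_int (hex_form m n) * q powi hex_form m n)) has_sum
     (- s\<^sup>2 * (\<Sum>\<^sub>\<infinity>(m, n)\<in>- hex_short. 45 * of_int (hex_form m n) * q powi hex_form m n))) (- hex_short)"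
    by (intro has_sum_cmult_right has_sum_infsum hex_tail_bound q)
  have "- s\<^sup>2 * (\<Sum>\<^sub>\<infinity>(m, n)\<in>- hex_short. 45 * of_int (hex_form m n) * q powi hex_form m n) \<le> 6 * Re F - 6 * cubic_b q - 6 * q * s\<^sup>2"
  proof (rule has_sum_mono[OF Th Dh])
    fix z assume "z \<in> - hex_short"
    obtain m n where z: "z = (m, n)" by force
    have "- (45 * of_int (hex_form m n) * s\<^sup>2) \<le> Re (orbit m n (- m - n) - of_real (6 * Re (w3 (n - m))))"
      using orbit_estimate[of m n] abs_Re_le_cmod[of "orbit m n (- m - n) - of_real (6 * Re (w3 (n - m)))"] by linarith
    then have "q powi hex_form m n * (- (45 * of_int (hex_form m n) * s\<^sup>2)) \<le> q powi hex_form m n * (Re (orbit m n (- m - n)) - 6 * Re (w3 (n - m)))"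
      using q by (intro mult_left_mono) auto
    then show "- s\<^sup>2 * (case z of (m, n) \<Rightarrow> 45 * of_int (hex_form m n) * q powi hex_form m n) \<le> D z"
      by (simp add: z D_def mult_ac)
  qed
  \<comment> \<open>The possible loss 6 q s^2 is exactly matched by the gain 6 q s^2 of the six
    shortest vectors.\<close>
  moreover have "s\<^sup>2 * (\<Sum>\<^sub>\<infinity>(m, n)\<in>- hex_short. 45 * of_int (hex_form m n) * q powi hex_form m n) \<le> s\<^sup>2 * (6 * q)"
    by (intro mult_left_mono hex_tail_bound q) simp
  ultimately have "6 * cubic_b q \<le> 6 * Re F" by (simp add: mult_ac)
  then show ?thesis by (simp add: F_def)
qed

end

text \<open>Rotating all three unit numbers by the common angle -c makes their product 1 and leaves
  the character unchanged, since the exponents m, n, -m-n add up to 0.\<close>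

lemma hex_char_lower_bound:
  fixes a b :: real
  assumes q: "0 < q" "q \<le> 1/32"
  shows "cubic_b q \<le> Re (\<Sum>\<^sub>\<infinity>(m, n)\<in>UNIV. of_real (q powi hex_form m n) * cis (a * of_int m + b * of_int n))"
proof -
  define c where "c = (a + b) / 3"
  interpret unit_triple "cis (a - c)" "cis (b - c)" "cis (- c)"
    by unfold_locales (simp_all add: cis_mult c_def field_simps)
  have "chi m n = cis (a * of_int m + b * of_int n)" for m n
    by (simp add: chi_def cis_power_int cis_mult algebra_simps)
  then show ?thesis using char_lower_bound[OF q] by simp
qed

section \<open>Square-integrable functions\<close>

lemma L2_measurable: "f \<in> L2 \<Longrightarrow> f \<in> borel_measurable borel"
  and L2_integrable: "f \<in> L2 \<Longrightarrow> integrable lborel (\<lambda>t. (cmod (f t))\<^sup>2)"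
  by (auto simp: L2_def)

lemma L2I: "f \<in> borel_measurable borel \<Longrightarrow> integrable lborel (\<lambda>t. (cmod (f t))\<^sup>2) \<Longrightarrow> f \<in> L2"
  by (simp add: L2_def)

lemma L2_bound:
  assumes "g \<in> L2" "f \<in> borel_measurable borel" "\<And>t. cmod (f t) \<le> cmod (g t)"
  shows "f \<in> L2"
proof (rule L2I)
  show "integrable lborel (\<lambda>t. (cmod (f t))\<^sup>2)"
    by (rule Bochner_Integration.integrable_bound[OF L2_integrable[OF assms(1)]])
       (use assms in \<open>auto intro!: power_mono\<close>)
qed (rule assms)

lemma L2_cmult: "f \<in> L2 \<Longrightarrow> (\<lambda>t. c * f t) \<in> L2"
  by (auto simp: L2_def norm_mult power_mult_distrib)

lemma norm_add_sq_le: "(cmod (a + b))\<^sup>2 \<le> 2 * (cmod a)\<^sup>2 + 2 * (cmod b)\<^sup>2"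
proof -
  have "(cmod (a + b))\<^sup>2 \<le> (cmod a + cmod b)\<^sup>2" by (intro power_mono norm_triangle_ineq) auto
  also have "\<dots> \<le> 2 * (cmod a)\<^sup>2 + 2 * (cmod b)\<^sup>2"
    using sum_squares_bound[of "cmod a" "cmod b"] by (simp add: power2_sum)
  finally show ?thesis .
qed

lemma L2_add:
  assumes "f \<in> L2" "g \<in> L2" shows "(\<lambda>t. f t + g t) \<in> L2"
proof (rule L2I)
  note [measurable] = L2_measurable[OF assms(1)] L2_measurable[OF assms(2)]
  show "(\<lambda>t. f t + g t) \<in> borel_measurable borel" by measurable
  have "integrable lborel (\<lambda>t. 2 * (cmod (f t))\<^sup>2 + 2 * (cmod (g t))\<^sup>2)"
    using assms by (intro Bochner_Integration.integrable_add integrable_mult_right L2_integrable) auto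
  then show "integrable lborel (\<lambda>t. (cmod (f t + g t))\<^sup>2)"
    by (rule Bochner_Integration.integrable_bound) (auto simp: norm_add_sq_le)
qed

lemma L2_diff: "f \<in> L2 \<Longrightarrow> g \<in> L2 \<Longrightarrow> (\<lambda>t. f t - g t) \<in> L2"
  using L2_add[of f "\<lambda>t. - 1 * g t"] L2_cmult[of g "-1"] by simp

lemma L2_zero: "(\<lambda>t. 0) \<in> L2" by (simp add: L2_def)

lemma L2_sum: "(\<And>i. i \<in> F \<Longrightarrow> f i \<in> L2) \<Longrightarrow> (\<lambda>t. \<Sum>i\<in>F. f i t) \<in> L2"
  by (induction F rule: infinite_finite_induct) (auto intro: L2_zero L2_add)

lemma cnj_measurable [measurable]: "cnj \<in> borel_measurable borel"
  by (intro borel_measurable_continuous_onI continuous_intros)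

lemma L2_inner_integrable:
  assumes "f \<in> L2" "g \<in> L2" shows "integrable lborel (\<lambda>t. f t * cnj (g t))"
proof -
  note [measurable] = L2_measurable[OF assms(1)] L2_measurable[OF assms(2)]
  have "integrable lborel (\<lambda>t. (cmod (f t))\<^sup>2 + (cmod (g t))\<^sup>2)"
    using assms by (intro Bochner_Integration.integrable_add L2_integrable) auto
  then show ?thesis
  proof (rule Bochner_Integration.integrable_bound)
    have "2 * (cmod (f t) * cmod (g t)) \<le> (cmod (f t))\<^sup>2 + (cmod (g t))\<^sup>2" for t
      using sum_squares_bound[of "cmod (f t)" "cmod (g t)"] by simp
    then show "AE t in lborel. norm (f t * cnj (g t)) \<le> norm ((cmod (f t))\<^sup>2 + (cmod (g t))\<^sup>2)"
      by (intro AE_I2) (smt (verit) norm_mult complex_mod_cnj mult_nonneg_nonneg norm_ge_zero real_norm_def)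
  qed simp
qed

lemma L2_inner_add_left: "f \<in> L2 \<Longrightarrow> g \<in> L2 \<Longrightarrow> h \<in> L2 \<Longrightarrow> L2_inner (\<lambda>t. f t + g t) h = L2_inner f h + L2_inner g h"
  by (simp add: L2_inner_def distrib_right L2_inner_integrable)

lemma L2_inner_diff_left: "f \<in> L2 \<Longrightarrow> g \<in> L2 \<Longrightarrow> h \<in> L2 \<Longrightarrow> L2_inner (\<lambda>t. f t - g t) h = L2_inner f h - L2_inner g h"
  by (simp add: L2_inner_def left_diff_distrib L2_inner_integrable)

lemma L2_inner_cmult_left: "L2_inner (\<lambda>t. c * f t) h = c * L2_inner f h"
  by (simp add: L2_inner_def mult.assoc)

lemma L2_inner_commute: "L2_inner g f = cnj (L2_inner f g)"
  by (simp add: L2_inner_def mult.commute flip: Bochner_Integration.integral_cnj)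

lemma L2_inner_add_right: "f \<in> L2 \<Longrightarrow> g \<in> L2 \<Longrightarrow> h \<in> L2 \<Longrightarrow> L2_inner h (\<lambda>t. f t + g t) = L2_inner h f + L2_inner h g"
  by (simp add: L2_inner_commute[of h] L2_inner_add_left)

lemma L2_inner_diff_right: "f \<in> L2 \<Longrightarrow> g \<in> L2 \<Longrightarrow> h \<in> L2 \<Longrightarrow> L2_inner h (\<lambda>t. f t - g t) = L2_inner h f - L2_inner h g"
  by (simp add: L2_inner_commute[of h] L2_inner_diff_left)

lemma L2_inner_cmult_right: "L2_inner h (\<lambda>t. c * f t) = cnj c * L2_inner h f"
  by (simp add: L2_inner_commute[of h] L2_inner_cmult_left)

lemma L2_inner_zero [simp]: "L2_inner (\<lambda>t. 0) h = 0" "L2_inner h (\<lambda>t. 0) = 0"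
  by (simp_all add: L2_inner_def)

lemma L2_inner_sum_left: "(\<And>i. i \<in> F \<Longrightarrow> f i \<in> L2) \<Longrightarrow> h \<in> L2 \<Longrightarrow> L2_inner (\<lambda>t. \<Sum>i\<in>F. f i t) h = (\<Sum>i\<in>F. L2_inner (f i) h)"
  by (induction F rule: infinite_finite_induct) (auto simp: L2_inner_add_left L2_sum)

lemma L2_inner_sum_right: "(\<And>i. i \<in> F \<Longrightarrow> f i \<in> L2) \<Longrightarrow> h \<in> L2 \<Longrightarrow> L2_inner h (\<lambda>t. \<Sum>i\<in>F. f i t) = (\<Sum>i\<in>F. L2_inner h (f i))"
  by (simp add: L2_inner_commute[of h] L2_inner_sum_left)

lemma L2_inner_self: "L2_inner f f = of_real (LINT t|lborel. (cmod (f t))\<^sup>2)"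
  by (simp add: L2_inner_def flip: complex_norm_square integral_complex_of_real)

lemma L2_norm_sq: "(L2_norm f)\<^sup>2 = (LINT t|lborel. (cmod (f t))\<^sup>2)"
  by (simp add: L2_norm_def L2_inner_self)

lemma L2_inner_self_norm: "L2_inner f f = of_real ((L2_norm f)\<^sup>2)"
  by (simp add: L2_inner_self L2_norm_sq)

lemma L2_norm_nonneg [simp]: "L2_norm f \<ge> 0"
  by (simp add: L2_norm_def L2_inner_self)

lemma L2_Cauchy_Schwarz:
  assumes "f \<in> L2" "g \<in> L2"
  shows "cmod (L2_inner f g) \<le> L2_norm f * L2_norm g"
proof -
  note [measurable] = L2_measurable[OF assms(1)] L2_measurable[OF assms(2)]
  define c where "c = (LINT t|lborel. cmod (f t) * cmod (g t))"
  have i: "integrable lborel (\<lambda>t. cmod (f t) * cmod (g t))"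
    using integrable_norm[OF L2_inner_integrable[OF assms]] by (simp add: norm_mult)
  have c0: "c \<ge> 0" by (simp add: c_def)
  have "(ennreal c)\<^sup>2 = (\<integral>\<^sup>+t. ennreal (cmod (f t)) * ennreal (cmod (g t)) \<partial>lborel)\<^sup>2"
    unfolding c_def using nn_integral_eq_integral[OF i] by (simp add: ennreal_mult)
  also have "\<dots> \<le> (\<integral>\<^sup>+t. (ennreal (cmod (f t)))\<^sup>2 \<partial>lborel) * (\<integral>\<^sup>+t. (ennreal (cmod (g t)))\<^sup>2 \<partial>lborel)"
    by (rule Cauchy_Schwarz_nn_integral) auto
  also have "\<dots> = ennreal ((L2_norm f)\<^sup>2) * ennreal ((L2_norm g)\<^sup>2)"
    unfolding L2_norm_sq
    using nn_integral_eq_integral[OF L2_integrable[OF assms(1)]] nn_integral_eq_integral[OF L2_integrable[OF assms(2)]]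
    by (simp add: ennreal_power)
  also have "\<dots> = ennreal ((L2_norm f * L2_norm g)\<^sup>2)"
    by (simp add: power_mult_distrib ennreal_mult)
  finally have "c\<^sup>2 \<le> (L2_norm f * L2_norm g)\<^sup>2"
    using c0 by (simp add: ennreal_power)
  then have "c \<le> L2_norm f * L2_norm g" by (rule power2_le_imp_le) simp
  moreover have "cmod (L2_inner f g) \<le> c"
    unfolding L2_inner_def c_def using integral_norm_bound[of lborel "\<lambda>t. f t * cnj (g t)"] by (simp add: norm_mult)
  ultimately show ?thesis by simp
qed

lemma L2_norm_add_sq:
  assumes "f \<in> L2" "g \<in> L2"
  shows "(L2_norm (\<lambda>t. f t + g t))\<^sup>2 = (L2_norm f)\<^sup>2 + 2 * Re (L2_inner f g) + (L2_norm g)\<^sup>2"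
proof -
  have "complex_of_real ((L2_norm (\<lambda>t. f t + g t))\<^sup>2) = L2_inner f f + (L2_inner f g + cnj (L2_inner f g)) + L2_inner g g"
    unfolding L2_inner_self_norm[symmetric] L2_inner_commute[of g f, symmetric]
    using assms by (simp add: L2_inner_add_left L2_inner_add_right L2_add)
  also have "\<dots> = of_real ((L2_norm f)\<^sup>2 + 2 * Re (L2_inner f g) + (L2_norm g)\<^sup>2)"
    by (simp only: L2_inner_self_norm complex_add_cnj of_real_add)
  finally show ?thesis by (simp only: of_real_eq_iff)
qed

lemma L2_norm_triangle:
  assumes "f \<in> L2" "g \<in> L2"
  shows "L2_norm (\<lambda>t. f t + g t) \<le> L2_norm f + L2_norm g"
proof (rule power2_le_imp_le)
  have "Re (L2_inner f g) \<le> L2_norm f * L2_norm g"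
    using complex_Re_le_cmod L2_Cauchy_Schwarz[OF assms] order_trans by blast
  then show "(L2_norm (\<lambda>t. f t + g t))\<^sup>2 \<le> (L2_norm f + L2_norm g)\<^sup>2"
    unfolding L2_norm_add_sq[OF assms] by (simp add: power2_sum)
qed simp

lemma L2_norm_cmult: "L2_norm (\<lambda>t. c * f t) = cmod c * L2_norm f"
proof -
  have "(L2_norm (\<lambda>t. c * f t))\<^sup>2 = (cmod c * L2_norm f)\<^sup>2"
    by (simp add: L2_norm_sq norm_mult power_mult_distrib)
  then show ?thesis by (simp add: power2_eq_iff_nonneg)
qed

lemma L2_norm_minus_commute: "L2_norm (\<lambda>t. f t - g t) = L2_norm (\<lambda>t. g t - f t)"
  using L2_norm_cmult[of "-1" "\<lambda>t. f t - g t"] by simp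

lemma L2_norm_tendsto_0:
  fixes h :: "nat \<Rightarrow> real \<Rightarrow> complex"
  assumes h: "\<And>n. h n \<in> borel_measurable borel" and g: "integrable lborel (\<lambda>t. (g t)\<^sup>2)" "g \<in> borel_measurable borel"
    and lim: "AE t in lborel. (\<lambda>n. h n t) \<longlonglongrightarrow> 0" and bd: "\<And>n t. cmod (h n t) \<le> g t"
  shows "(\<lambda>n. L2_norm (h n)) \<longlonglongrightarrow> 0"
proof -
  note [measurable] = h g(2)
  have "(\<lambda>n. LINT t|lborel. (cmod (h n t))\<^sup>2) \<longlonglongrightarrow> (LINT (t::real)|lborel. 0)"
  proof (rule integral_dominated_convergence[OF _ _ g(1)])
    show "AE t in lborel. (\<lambda>n. (cmod (h n t))\<^sup>2) \<longlonglongrightarrow> 0"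
      using lim
    proof eventually_elim
      case (elim t)
      then have "(\<lambda>n. (cmod (h n t))\<^sup>2) \<longlonglongrightarrow> (cmod 0)\<^sup>2" by (intro tendsto_intros)
      then show ?case by simp
    qed
    show "AE t in lborel. norm ((cmod (h n t))\<^sup>2) \<le> (g t)\<^sup>2" for n
      using bd by (auto intro!: power_mono)
  qed auto
  then have "(\<lambda>n. sqrt ((L2_norm (h n))\<^sup>2)) \<longlonglongrightarrow> sqrt 0"
    unfolding L2_norm_sq by (intro tendsto_real_sqrt) simp
  then show ?thesis by simp
qed

section \<open>Density of modulated Gaussians\<close>

lemma gaussian_real: "gaussian t = of_real (2 powr (1/4) * exp (- (pi * t\<^sup>2)))"
  by (simp add: gaussian_def)

lemma cmod_gaussian: "cmod (gaussian t) = 2 powr (1/4) * exp (- (pi * t\<^sup>2))"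
  unfolding gaussian_real norm_of_real by simp

lemma gaussian_nonzero: "gaussian t \<noteq> 0"
  by (simp add: gaussian_real)

lemma gaussian_measurable [measurable]: "gaussian \<in> borel_measurable borel"
  unfolding gaussian_real[abs_def] by measurable

lemma powr_quarter_sq: "(2 powr (1/4))\<^sup>2 = sqrt (2::real)"
  by (simp add: powr_half_sqrt[symmetric] power2_eq_square powr_add[symmetric])

lemma gaussian_L2: "gaussian \<in> L2"
proof (rule L2I)
  have "integrable lborel (\<lambda>t. Re (of_real (sqrt 2) * (complex_of_real (exp (- (pi * 2 * t\<^sup>2))) * cis (2 * pi * 0 * t))))"
    by (intro integrable_Re integrable_mult_right integrable_gauss_cis) simp
  then show "integrable lborel (\<lambda>t. (cmod (gaussian t))\<^sup>2)"
    by (simp add: cmod_gaussian power_mult_distrib powr_quarter_sq exp_double[symmetric] mult_ac flip: exp_of_nat_mult)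
qed simp

text \<open>Modulations of a single Gaussian span a dense subspace, and all inner products between
  them are explicit Gaussians, so the identities to be extended by density concern a family with one
  real parameter.\<close>

inductive gauss_span :: "(real \<Rightarrow> complex) \<Rightarrow> bool" where
  monom: "gauss_span (\<lambda>t. c * (cis (2 * pi * w * t) * gaussian t))"
| add: "gauss_span f \<Longrightarrow> gauss_span g \<Longrightarrow> gauss_span (\<lambda>t. f t + g t)"

lemma gauss_mult_L2:
  assumes "f \<in> borel_measurable borel" "\<And>t. cmod (f t) \<le> M"
  shows "(\<lambda>t. f t * gaussian t) \<in> L2"
proof -
  have M: "M \<ge> 0" using assms(2)[of 0] norm_ge_zero order_trans by blast
  show ?thesis
  proof (rule L2_bound[OF L2_cmult[OF gaussian_L2, of "of_real M"]])
    show "(\<lambda>t. f t * gaussian t) \<in> borel_measurable borel" using assms(1) by measurable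
    show "cmod (f t * gaussian t) \<le> cmod (of_real M * gaussian t)" for t
      using assms(2)[of t] M by (simp add: norm_mult mult_right_mono)
  qed
qed

lemma gauss_span_L2: "gauss_span f \<Longrightarrow> f \<in> L2"
proof (induction rule: gauss_span.induct)
  case (monom c w)
  have "(\<lambda>t. cis (2 * pi * w * t) * gaussian t) \<in> L2"
    by (rule gauss_mult_L2[of _ 1]) (auto simp: cis_conv_exp)
  then show ?case by (rule L2_cmult)
qed (rule L2_add)

lemma gauss_span_trig:
  assumes "trig_poly P" shows "gauss_span (\<lambda>t. P (a * t + b) * gaussian t)"
  using assms
proof induction
  case (monom c k)
  have "(\<lambda>t. c * cis (2 * pi * of_int k * (a * t + b)) * gaussian t)
    = (\<lambda>t. (c * cis (2 * pi * of_int k * b)) * (cis (2 * pi * (of_int k * a) * t) * gaussian t))"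
    by (auto simp: cis_mult algebra_simps)
  then show ?case by (simp only: gauss_span.monom)
next
  case (add f g)
  then show ?case by (simp only: distrib_right) (rule gauss_span.add)
qed

definition L2_approx :: "(real \<Rightarrow> complex) \<Rightarrow> bool" where
  "L2_approx f \<longleftrightarrow> (\<forall>e>0. \<exists>d. gauss_span d \<and> L2_norm (\<lambda>t. f t - d t) < e)"

lemma L2_approx_limit:
  assumes f: "f \<in> L2" and h: "\<And>n. h n \<in> L2" "\<And>n. L2_approx (h n)"
    and lim: "(\<lambda>n. L2_norm (\<lambda>t. f t - h n t)) \<longlonglongrightarrow> 0"
  shows "L2_approx f"
  unfolding L2_approx_def
proof (intro allI impI)
  fix e :: real assume e: "e > 0"
  then have "eventually (\<lambda>n. L2_norm (\<lambda>t. f t - h n t) < e / 2) sequentially"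
    by (intro order_tendstoD(2)[OF lim]) auto
  then obtain n where n: "L2_norm (\<lambda>t. f t - h n t) < e / 2"
    using eventually_happens'[OF sequentially_bot] by blast
  obtain d where d: "gauss_span d" "L2_norm (\<lambda>t. h n t - d t) < e / 2"
    using h(2)[of n] e unfolding L2_approx_def by (metis half_gt_zero)
  have "L2_norm (\<lambda>t. (f t - h n t) + (h n t - d t)) \<le> L2_norm (\<lambda>t. f t - h n t) + L2_norm (\<lambda>t. h n t - d t)"
    by (intro L2_norm_triangle L2_diff f h gauss_span_L2 d)
  with n d show "\<exists>d. gauss_span d \<and> L2_norm (\<lambda>t. f t - d t) < e"
    by (intro exI[of _ d]) auto
qed

lemma integrable_gaussian_sq: "integrable lborel (\<lambda>t. (M * cmod (gaussian t))\<^sup>2)"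
  using L2_integrable[OF gaussian_L2] by (simp add: power_mult_distrib)

text \<open>The factor w is cut off to an interval of length 2R, made periodic and approximated
  uniformly by a trigonometric polynomial. Outside the interval the approximation is wrong but
  bounded, and the Gaussian suppresses the error as R grows.\<close>

lemma L2_approx_continuous:
  assumes w: "continuous_on UNIV w" and M: "\<And>t. cmod (w t) \<le> M"
  shows "L2_approx (\<lambda>t. w t * gaussian t)"
proof -
  have M0: "M \<ge> 0" using M[of 0] norm_ge_zero order_trans by blast
  have [measurable]: "w \<in> borel_measurable borel" by (rule borel_measurable_continuous_onI[OF w])
  have ex: "\<exists>P. trig_poly P \<and> (\<forall>t. \<bar>t\<bar> \<le> R - 1 \<longrightarrow> cmod (w t - P (t / (2 * R) + 1/2)) < 1 / R) \<and> (\<forall>t. cmod (P t) \<le> M + 1)"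
    if R: "R \<ge> 1" for R
  proof -
    \<comment> \<open>The trapezoid is 1 for |t| \<le> R - 1 and 0 at |t| = R, so the rescaled
      function vanishes at both ends of the unit interval and its periodic continuation is
      continuous.\<close>
    define W where "W t = of_real (max 0 (min 1 (R - \<bar>t\<bar>))) * w t" for t
    define F where "F u = W (2 * R * (u - 1/2))" for u
    have Fc: "continuous_on UNIV F" unfolding F_def W_def
      by (intro continuous_intros continuous_on_compose2[OF w]) auto
    have F01: "F 0 = 0" "F 1 = 0" using R by (auto simp: F_def W_def)
    have "continuous_on {0..1} (\<lambda>u. F (frac u))"
    proof (rule continuous_on_eq[of _ F])
      show "F u = F (frac u)" if "u \<in> {0..1}" for u
        using that F01 by (cases "u = 1") (auto simp: frac_eq)
    qed (rule continuous_on_subset[OF Fc], simp)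
    moreover have "F (frac (u + 1)) = F (frac u)" for u by (simp add: frac_1_eq)
    ultimately obtain P where P: "trig_poly P" "\<And>u. cmod (F (frac u) - P u) < 1 / R"
      using trig_poly_dense[of "\<lambda>u. F (frac u)" "1 / R"] R by auto
    have Fb: "cmod (F u) \<le> M" for u
    proof -
      have "cmod (F u) = \<bar>max 0 (min 1 (R - \<bar>2 * R * (u - 1/2)\<bar>))\<bar> * cmod (w (2 * R * (u - 1/2)))"
        unfolding F_def W_def norm_mult norm_of_real ..
      also have "\<dots> \<le> 1 * M" by (intro mult_mono M) auto
      finally show ?thesis by simp
    qed
    have "cmod (P t) \<le> M + 1" for t
    proof -
      have "cmod (P t) \<le> cmod (F (frac t)) + cmod (F (frac t) - P t)"
        by (metis norm_minus_commute norm_triangle_sub)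
      also have "\<dots> \<le> M + 1 / R" using P(2)[of t] Fb by (intro add_mono) auto
      also have "\<dots> \<le> M + 1" using R by simp
      finally show ?thesis .
    qed
    moreover have "cmod (w t - P (t / (2 * R) + 1/2)) < 1 / R" if t: "\<bar>t\<bar> \<le> R - 1" for t
    proof -
      have "t / (2 * R) < 1/2" "- (1/2) \<le> t / (2 * R)" using t R by (auto simp: divide_simps)
      then have "frac (t / (2 * R) + 1/2) = t / (2 * R) + 1/2"
        by (intro frac_eq[THEN iffD2]) simp
      moreover have "F (t / (2 * R) + 1/2) = w t"
      proof -
        have "2 * R * (t / (2 * R) + 1/2 - 1/2) = t" using R by simp
        moreover have "max 0 (min 1 (R - \<bar>t\<bar>)) = 1" using t by simp
        ultimately show ?thesis by (simp only: F_def W_def of_real_1 mult_1)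
      qed
      ultimately show ?thesis using P(2)[of "t / (2 * R) + 1/2"] by simp
    qed
    ultimately show ?thesis using P(1) by blast
  qed
  have "\<forall>n. \<exists>P. trig_poly P \<and> (\<forall>t. \<bar>t\<bar> \<le> real (Suc n) - 1 \<longrightarrow> cmod (w t - P (t / (2 * real (Suc n)) + 1/2)) < 1 / real (Suc n)) \<and> (\<forall>t. cmod (P t) \<le> M + 1)"
    by (intro allI ex) simp
  from choice[OF this] obtain P where P: "\<And>n. trig_poly (P n)"
      "\<And>n t. \<bar>t\<bar> \<le> real (Suc n) - 1 \<Longrightarrow> cmod (w t - P n (t / (2 * real (Suc n)) + 1/2)) < 1 / real (Suc n)"
      "\<And>n t. cmod (P n t) \<le> M + 1" by blast
  define h where "h n t = P n (1 / (2 * real (Suc n)) * t + 1/2) * gaussian t" for n t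
  have hs: "gauss_span (h n)" for n
    unfolding h_def by (rule gauss_span_trig[OF P(1)])
  have hL: "h n \<in> L2" for n by (rule gauss_span_L2[OF hs])
  have wL: "(\<lambda>t. w t * gaussian t) \<in> L2" by (rule gauss_mult_L2[OF _ M]) simp
  have z: "L2_norm (\<lambda>t. 0) = 0" by (simp add: L2_norm_def)
  show ?thesis
  proof (rule L2_approx_limit[OF wL hL])
    show "L2_approx (h n)" for n
      unfolding L2_approx_def using hs[of n] by (auto intro!: exI[of _ "h n"] simp: z)
    show "(\<lambda>n. L2_norm (\<lambda>t. w t * gaussian t - h n t)) \<longlonglongrightarrow> 0"
    proof (rule L2_norm_tendsto_0)
      show "(\<lambda>t. w t * gaussian t - h n t) \<in> borel_measurable borel" for n
        using L2_measurable[OF L2_diff[OF wL hL[of n]]] .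
      show "integrable lborel (\<lambda>t. ((2 * M + 1) * cmod (gaussian t))\<^sup>2)"
        by (rule integrable_gaussian_sq)
      have e: "w t * gaussian t - h n t = (w t - P n (t / (2 * real (Suc n)) + 1/2)) * gaussian t" for n t
        by (simp add: h_def algebra_simps)
      show "cmod (w t * gaussian t - h n t) \<le> (2 * M + 1) * cmod (gaussian t)" for n t
        unfolding e norm_mult
        using norm_triangle_ineq4[of "w t" "P n (t / (2 * real (Suc n)) + 1/2)"] M[of t] P(3)[of n "t / (2 * real (Suc n)) + 1/2"]
        by (intro mult_right_mono) (linarith, simp)
      show "AE t in lborel. (\<lambda>n. w t * gaussian t - h n t) \<longlonglongrightarrow> 0"
      proof (rule AE_I2)
        fix t :: real
        have "(\<lambda>n. w t - P n (t / (2 * real (Suc n)) + 1/2)) \<longlonglongrightarrow> 0"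
        proof (rule Lim_null_comparison)
          show "(\<lambda>n. 1 / real (Suc n)) \<longlonglongrightarrow> 0" using LIMSEQ_inverse_real_of_nat by (simp add: inverse_eq_divide)
          have "eventually (\<lambda>n. n \<ge> nat \<lceil>\<bar>t\<bar>\<rceil>) sequentially" by (rule eventually_ge_at_top)
          then show "eventually (\<lambda>n. cmod (w t - P n (t / (2 * real (Suc n)) + 1/2)) \<le> 1 / real (Suc n)) sequentially"
          proof eventually_elim
            case (elim n)
            then have "\<bar>t\<bar> \<le> real (Suc n) - 1" by simp
            then show ?case using P(2)[of t n] by simp
          qed
        qed
        then have "(\<lambda>n. (w t - P n (t / (2 * real (Suc n)) + 1/2)) * gaussian t) \<longlonglongrightarrow> 0 * gaussian t"
          by (intro tendsto_intros)
        then show "(\<lambda>n. w t * gaussian t - h n t) \<longlonglongrightarrow> 0" unfolding e by simp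
      qed
    qed simp
  qed
qed

text \<open>A measurable function is almost everywhere a limit of continuous ones; these are
  truncated to the bound of v so that dominated convergence applies.\<close>

lemma L2_approx_bounded:
  assumes v: "v \<in> borel_measurable borel" and M: "\<And>t. cmod (v t) \<le> M" and M0: "M > 0"
  shows "L2_approx (\<lambda>t. v t * gaussian t)"
proof -
  note [measurable] = v
  have "v measurable_on UNIV"
    by (rule lebesgue_measurable_imp_measurable_on) (use v in \<open>auto intro: measurable_completion\<close>)
  then obtain N g where N: "negligible N" and g: "\<And>n. continuous_on UNIV (g n)"
      "\<And>t. t \<notin> N \<Longrightarrow> (\<lambda>n. g n t) \<longlonglongrightarrow> v t"
    unfolding measurable_on_def by auto
  \<comment> \<open>The radial retraction onto the disc of radius M: continuous, bounded by M and
    the identity on the values of v.\<close>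
  define T where "T z = of_real (M / max M (cmod z)) * z" for z :: complex
  have Tc: "continuous_on UNIV T" unfolding T_def using M0 by (intro continuous_intros) auto
  have Tb: "cmod (T z) \<le> M" for z
    using M0 by (auto simp: T_def norm_mult norm_divide max_def divide_simps)
  have Tv: "T (v t) = v t" for t using M[of t] M0 by (simp add: T_def max_def)
  define h where "h n t = T (g n t) * gaussian t" for n t
  have gc: "continuous_on UNIV (\<lambda>t. T (g n t))" for n
    by (rule continuous_on_compose2[OF Tc g(1)]) auto
  have gm [measurable]: "(\<lambda>t. T (g n t)) \<in> borel_measurable borel" for n by (rule borel_measurable_continuous_onI[OF gc])
  have hL: "h n \<in> L2" for n unfolding h_def by (rule gauss_mult_L2[OF gm Tb])
  have vL: "(\<lambda>t. v t * gaussian t) \<in> L2" by (rule gauss_mult_L2[OF v M])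
  show ?thesis
  proof (rule L2_approx_limit[OF vL hL])
    show "L2_approx (h n)" for n unfolding h_def by (rule L2_approx_continuous[OF gc Tb])
    show "(\<lambda>n. L2_norm (\<lambda>t. v t * gaussian t - h n t)) \<longlonglongrightarrow> 0"
    proof (rule L2_norm_tendsto_0)
      show "(\<lambda>t. v t * gaussian t - h n t) \<in> borel_measurable borel" for n
        using L2_measurable[OF L2_diff[OF vL hL[of n]]] .
      show "integrable lborel (\<lambda>t. ((2 * M) * cmod (gaussian t))\<^sup>2)"
        by (rule integrable_gaussian_sq)
      have e: "v t * gaussian t - h n t = (v t - T (g n t)) * gaussian t" for n t
        by (simp add: h_def algebra_simps)
      show "cmod (v t * gaussian t - h n t) \<le> (2 * M) * cmod (gaussian t)" for n t
        unfolding e norm_mult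
        using norm_triangle_ineq4[of "v t" "T (g n t)"] M[of t] Tb[of "g n t"]
        by (intro mult_right_mono) (linarith, simp)
      have "AE t in lebesgue. t \<notin> N" using N by (simp add: negligible_iff_null_sets AE_not_in)
      then have "AE t in lborel. t \<notin> N" by (simp add: AE_completion_iff)
      then show "AE t in lborel. (\<lambda>n. v t * gaussian t - h n t) \<longlonglongrightarrow> 0"
      proof eventually_elim
        case (elim t)
        have "isCont T (v t)" using Tc by (simp add: continuous_on_eq_continuous_at)
        then have "(\<lambda>n. T (g n t)) \<longlonglongrightarrow> T (v t)"
          by (rule isCont_tendsto_compose) (rule g(2)[OF elim])
        then have "(\<lambda>n. (v t - T (g n t)) * gaussian t) \<longlonglongrightarrow> (v t - v t) * gaussian t"
          unfolding Tv by (intro tendsto_intros)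
        then show ?case unfolding e by simp
      qed
    qed simp
  qed
qed

text \<open>The Gaussian has no zeros, so every function is a multiple f / \<open>gaussian\<close>
  of it; truncating this quotient reduces the claim to bounded factors.\<close>

lemma gauss_span_dense:
  assumes f: "f \<in> L2"
  shows "L2_approx f"
proof -
  note [measurable] = L2_measurable[OF f]
  define v where "v n t = (if cmod (f t / gaussian t) \<le> real (Suc n) then f t / gaussian t else 0)" for n t
  have vm [measurable]: "v n \<in> borel_measurable borel" for n unfolding v_def[abs_def] by measurable
  have vb: "cmod (v n t) \<le> real (Suc n)" for n t by (auto simp: v_def)
  have vf: "v n t * gaussian t = (if cmod (f t / gaussian t) \<le> real (Suc n) then f t else 0)" for n t
    by (simp add: v_def gaussian_nonzero)
  show ?thesis
  proof (rule L2_approx_limit[OF f])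
    show "(\<lambda>t. v n t * gaussian t) \<in> L2" for n by (rule gauss_mult_L2[OF vm vb])
    then have d: "(\<lambda>t. f t - v n t * gaussian t) \<in> L2" for n by (rule L2_diff[OF f])
    show "L2_approx (\<lambda>t. v n t * gaussian t)" for n by (rule L2_approx_bounded[OF vm vb]) simp
    show "(\<lambda>n. L2_norm (\<lambda>t. f t - v n t * gaussian t)) \<longlonglongrightarrow> 0"
    proof (rule L2_norm_tendsto_0[OF L2_measurable[OF d] L2_integrable[OF f]])
      show "AE t in lborel. (\<lambda>n. f t - v n t * gaussian t) \<longlonglongrightarrow> 0"
      proof (rule AE_I2)
        fix t
        have "eventually (\<lambda>n. n \<ge> nat \<lceil>cmod (f t / gaussian t)\<rceil>) sequentially" by (rule eventually_ge_at_top)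
        then have "eventually (\<lambda>n. f t - v n t * gaussian t = 0) sequentially"
        proof eventually_elim
          case (elim n)
          then have "cmod (f t / gaussian t) \<le> real (Suc n)" by linarith
          then show ?case unfolding vf by simp
        qed
        then show "(\<lambda>n. f t - v n t * gaussian t) \<longlonglongrightarrow> 0" by (rule tendsto_eventually)
      qed
      show "cmod (f t - v n t * gaussian t) \<le> cmod (f t)" for n t unfolding vf by auto
    qed measurable
  qed
qed

section \<open>Toeplitz forms\<close>

lemma has_sum_sum:
  fixes f :: "'i \<Rightarrow> 'x \<Rightarrow> complex"
  assumes "\<And>i. i \<in> F \<Longrightarrow> (f i has_sum s i) A"
  shows "((\<lambda>x. \<Sum>i\<in>F. f i x) has_sum (\<Sum>i\<in>F. s i)) A"
  using assms by (induction F rule: infinite_finite_induct) (auto intro: has_sum_add)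

text \<open>Tannery's theorem, transferred to unordered sums along an enumeration.\<close>

lemma infsum_dominated_convergence:
  fixes f :: "nat \<Rightarrow> 'i::countable \<Rightarrow> complex"
  assumes inf: "infinite (UNIV :: 'i set)"
    and lim: "\<And>i. (\<lambda>n. f n i) \<longlonglongrightarrow> g i" and bound: "\<And>n i. cmod (f n i) \<le> h i" and h: "h summable_on UNIV"
  shows "(\<lambda>n. infsum (f n) UNIV) \<longlonglongrightarrow> infsum g UNIV"
proof -
  define b where "b = from_nat_into (UNIV :: 'i set)"
  have bij: "bij_betw b UNIV UNIV"
    unfolding b_def by (rule bij_betw_from_nat_into) (use inf in auto)
  have h0: "h i \<ge> 0" for i using bound[of 0 i] norm_ge_zero order_trans by blast
  have "(\<lambda>n. h (b n)) summable_on UNIV"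
    using h summable_on_reindex_bij_betw[OF bij, of h] by simp
  then have hs: "summable (\<lambda>n. h (b n))"
    using h0 by (simp add: summable_on_UNIV_nonneg_real_iff)
  have gb: "cmod (g i) \<le> h i" for i
    by (rule tendsto_upperbound[OF tendsto_norm[OF lim]]) (use bound in auto)
  have fs: "f n summable_on UNIV" for n by (rule summable_on_norm_le[OF h]) (use bound in auto)
  have gs: "g summable_on UNIV" by (rule summable_on_norm_le[OF h]) (use gb in auto)
  have "(\<lambda>n. \<Sum>k. f n (b k)) \<longlonglongrightarrow> (\<Sum>k. g (b k))"
  proof -
    have "eventually (\<lambda>(k, n). norm (f n (b k)) \<le> h (b k)) (at_top \<times>\<^sub>F sequentially)"
      using bound by (intro always_eventually) auto
    from tannerys_theorem[OF lim this hs] show ?thesis by simp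
  qed
  then show ?thesis
    using infsum_countable_complex(3)[OF inf fs] infsum_countable_complex(3)[OF inf gs]
    by (simp add: b_def)
qed

lemma infinite_UNIV_int_prod [simp]: "infinite (UNIV :: (int \<times> int) set)"
  by (simp add: finite_prod)

definition dot2 :: "real \<Rightarrow> real \<Rightarrow> int \<times> int \<Rightarrow> real" where
  "dot2 a b k = a * of_int (fst k) + b * of_int (snd k)"

lemma dot2_diff: "dot2 a b (k - l) = dot2 a b k - dot2 a b l"
  by (simp add: dot2_def algebra_simps)

definition mult_of :: "nat \<Rightarrow> int \<times> int \<Rightarrow> bool" where
  "mult_of K k \<longleftrightarrow> int K dvd fst k \<and> int K dvd snd k"

lemma sum_roots_of_unity:
  assumes "K > 0"
  shows "(\<Sum>j<K. cis (2 * pi * real j / real K * of_int m)) = (if int K dvd m then of_nat K else 0)"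
proof -
  define z where "z = cis (2 * pi * of_int m / real K)"
  have t: "cis (2 * pi * real j / real K * of_int m) = z ^ j" for j
  proof -
    have "2 * pi * real j / real K * of_int m = real j * (2 * pi * of_int m / real K)" by simp
    then show ?thesis unfolding z_def Complex.DeMoivre by (simp only:)
  qed
  have zK: "z ^ K = 1"
    using assms cis_multiple_2pi[of "of_int m"] by (simp add: z_def Complex.DeMoivre)
  show ?thesis
  proof (cases "int K dvd m")
    case True
    then obtain l where "m = int K * l" by auto
    then have "2 * pi * of_int m / real K = 2 * pi * of_int l" using assms by simp
    then have "z = 1" by (simp only: z_def) (rule cis_multiple_2pi, simp)
    then show ?thesis using True unfolding t by simp
  next
    case False
    have "z \<noteq> 1"
    proof
      assume "z = 1"
      then obtain n :: int where "2 * pi * of_int m / real K = 2 * pi * of_int n"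
        using sin_cos_eq_iff[of "2 * pi * of_int m / real K" 0] by (auto simp: z_def complex_eq_iff)
      then have "real_of_int m = of_int n * real K" using assms by (simp add: field_simps)
      then have "m = n * int K" by (metis of_int_eq_iff of_int_mult of_int_of_nat_eq)
      then show False using False by simp
    qed
    then show ?thesis using False zK geometric_sum[of z K] unfolding t by simp
  qed
qed

text \<open>Averaging the symbol against \<open>\<bar>\<Sum> \<xi>\<^sub>k e\<^bsup>-ik\<theta>\<^esup>\<bar>\<^sup>2\<close> over \<open>K\<close>-th roots of unity gives the Toeplitz
  form up to aliasing, which disappears as \<open>K\<close> tends to infinity.\<close>

lemma toeplitz_nonneg:
  fixes w :: "int \<times> int \<Rightarrow> complex" and x :: "int \<times> int \<Rightarrow> complex"
  assumes w: "w summable_on UNIV"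
    and pos: "\<And>a b. 0 \<le> Re (\<Sum>\<^sub>\<infinity>k. w k * cis (dot2 a b k))"
    and L: "finite L"
  shows "0 \<le> Re (\<Sum>k\<in>L. \<Sum>l\<in>L. w (k - l) * (x k * cnj (x l)))"
proof -
  \<comment> \<open>The aliased coefficients: sampling at roots of unity of order
    \<open>Suc K\<close> cannot distinguish indices congruent modulo \<open>Suc K\<close>.\<close>
  define T where "T K m = (\<Sum>\<^sub>\<infinity>k. if mult_of (Suc K) (k - m) then w k else 0)" for K m
  have wn: "(\<lambda>k. cmod (w k)) summable_on UNIV"
    using w summable_on_iff_abs_summable_on_complex by blast
  have Tlim: "(\<lambda>K. T K m) \<longlonglongrightarrow> w m" for m
  proof -
    have "(\<lambda>K. T K m) \<longlonglongrightarrow> (\<Sum>\<^sub>\<infinity>k. if k = m then w k else 0)"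
      unfolding T_def
    proof (rule infsum_dominated_convergence[OF _ _ _ wn])
      fix k
      have "eventually (\<lambda>K. nat \<bar>fst (k - m)\<bar> + nat \<bar>snd (k - m)\<bar> \<le> K) sequentially" by (rule eventually_ge_at_top)
      then have "eventually (\<lambda>K. (if mult_of (Suc K) (k - m) then w k else 0) = (if k = m then w k else 0)) sequentially"
      proof eventually_elim
        case (elim K)
        have "mult_of (Suc K) (k - m) \<longleftrightarrow> k = m"
        proof
          assume a: "mult_of (Suc K) (k - m)"
          have "fst (k - m) = 0"
          proof (rule ccontr)
            assume "fst (k - m) \<noteq> 0"
            then have "int (Suc K) \<le> \<bar>fst (k - m)\<bar>" using a by (intro zdvd_imp_le) (auto simp: mult_of_def)
            then show False using elim by linarith
          qed
          moreover have "snd (k - m) = 0"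
          proof (rule ccontr)
            assume "snd (k - m) \<noteq> 0"
            then have "int (Suc K) \<le> \<bar>snd (k - m)\<bar>" using a by (intro zdvd_imp_le) (auto simp: mult_of_def)
            then show False using elim by linarith
          qed
          ultimately show "k = m" by (simp add: prod_eq_iff)
        qed (simp add: mult_of_def)
        then show ?case by simp
      qed
      then show "(\<lambda>K. if mult_of (Suc K) (k - m) then w k else 0) \<longlonglongrightarrow> (if k = m then w k else 0)"
        by (rule tendsto_eventually)
    qed auto
    also have "(\<Sum>\<^sub>\<infinity>k. if k = m then w k else 0) = (\<Sum>\<^sub>\<infinity>k\<in>{m}. w k)"
      by (rule infsum_cong_neutral) auto
    finally show ?thesis by simp
  qed
  have T: "0 \<le> Re (\<Sum>k\<in>L. \<Sum>l\<in>L. T K (k - l) * (x k * cnj (x l)))" for K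
  proof -
    define n where "n = Suc K"
    define ang where "ang j = 2 * pi * real j / real n" for j
    define F where "F a b = (\<Sum>\<^sub>\<infinity>k. w k * cis (dot2 a b k))" for a b
    define P where "P a b = (\<Sum>k\<in>L. x k * cis (- dot2 a b k))" for a b
    have Fs: "((\<lambda>k. w k * cis (dot2 a b k)) has_sum F a b) UNIV" for a b
      unfolding F_def by (intro has_sum_infsum summable_on_norm_le[OF wn]) (simp add: norm_mult)
    have PP: "of_real ((cmod (P a b))\<^sup>2) = (\<Sum>k\<in>L. \<Sum>l\<in>L. (x k * cnj (x l)) * cis (- dot2 a b (k - l)))" for a b
    proof -
      have "complex_of_real ((cmod (P a b))\<^sup>2) = P a b * cnj (P a b)" by (rule complex_norm_square)
      also have "\<dots> = (\<Sum>k\<in>L. \<Sum>l\<in>L. (x k * cis (- dot2 a b k)) * (cnj (x l) * cis (dot2 a b l)))"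
        unfolding P_def cnj_sum complex_cnj_mult cis_cnj minus_minus by (rule sum_product)
      also have "\<dots> = (\<Sum>k\<in>L. \<Sum>l\<in>L. (x k * cnj (x l)) * cis (- dot2 a b (k - l)))"
      proof (intro sum.cong refl)
        fix k l
        have "cis (- dot2 a b (k - l)) = cis (- dot2 a b k) * cis (dot2 a b l)"
          unfolding cis_mult dot2_diff by simp
        then show "(x k * cis (- dot2 a b k)) * (cnj (x l) * cis (dot2 a b l)) = (x k * cnj (x l)) * cis (- dot2 a b (k - l))"
          by (simp add: mult_ac)
      qed
      finally show ?thesis .
    qed
    \<comment> \<open>Summing the sampled symbol against a character selects one residue class in
      each coordinate, by orthogonality of roots of unity.\<close>
    have key: "(\<Sum>j<n. \<Sum>i<n. F (ang j) (ang i) * cis (- dot2 (ang j) (ang i) m)) = of_nat n * of_nat n * T K m" for m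
    proof -
      have "((\<lambda>k. \<Sum>j<n. \<Sum>i<n. w k * cis (dot2 (ang j) (ang i) k) * cis (- dot2 (ang j) (ang i) m))
         has_sum (\<Sum>j<n. \<Sum>i<n. F (ang j) (ang i) * cis (- dot2 (ang j) (ang i) m))) UNIV"
        by (intro has_sum_sum has_sum_cmult_left Fs)
      moreover have "(\<Sum>j<n. \<Sum>i<n. w k * cis (dot2 (ang j) (ang i) k) * cis (- dot2 (ang j) (ang i) m))
         = of_nat n * of_nat n * (if mult_of n (k - m) then w k else 0)" for k
      proof -
        have "(\<Sum>j<n. \<Sum>i<n. w k * cis (dot2 (ang j) (ang i) k) * cis (- dot2 (ang j) (ang i) m))
          = (\<Sum>j<n. \<Sum>i<n. w k * (cis (ang j * of_int (fst (k - m))) * cis (ang i * of_int (snd (k - m)))))"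
          by (intro sum.cong refl) (simp add: mult.assoc cis_mult dot2_def algebra_simps)
        also have "\<dots> = w k * (\<Sum>j<n. \<Sum>i<n. cis (ang j * of_int (fst (k - m))) * cis (ang i * of_int (snd (k - m))))"
          by (simp only: sum_distrib_left)
        also have "(\<Sum>j<n. \<Sum>i<n. cis (ang j * of_int (fst (k - m))) * cis (ang i * of_int (snd (k - m))))
          = (\<Sum>j<n. cis (ang j * of_int (fst (k - m)))) * (\<Sum>i<n. cis (ang i * of_int (snd (k - m))))"
          by (rule sum_product[symmetric])
        also have "w k * \<dots> = of_nat n * of_nat n * (if mult_of n (k - m) then w k else 0)"
          using sum_roots_of_unity[of n "fst (k - m)"] sum_roots_of_unity[of n "snd (k - m)"]
          by (simp add: ang_def n_def mult_of_def)
        finally show ?thesis .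
      qed
      ultimately have "((\<lambda>k. of_nat n * of_nat n * (if mult_of n (k - m) then w k else 0))
         has_sum (\<Sum>j<n. \<Sum>i<n. F (ang j) (ang i) * cis (- dot2 (ang j) (ang i) m))) UNIV" by simp
      then show ?thesis
        unfolding T_def n_def[symmetric] infsum_cmult_right'[symmetric] by (rule infsumI[symmetric])
    qed
    have "0 \<le> Re (\<Sum>j<n. \<Sum>i<n. F (ang j) (ang i) * of_real ((cmod (P (ang j) (ang i)))\<^sup>2))"
      unfolding Re_sum by (intro sum_nonneg) (use pos in \<open>auto simp: F_def\<close>)
    also have "(\<Sum>j<n. \<Sum>i<n. F (ang j) (ang i) * of_real ((cmod (P (ang j) (ang i)))\<^sup>2))
       = (\<Sum>k\<in>L. \<Sum>l\<in>L. (x k * cnj (x l)) * (\<Sum>j<n. \<Sum>i<n. F (ang j) (ang i) * cis (- dot2 (ang j) (ang i) (k - l))))"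
    proof -
      have "(\<Sum>j<n. \<Sum>i<n. F (ang j) (ang i) * of_real ((cmod (P (ang j) (ang i)))\<^sup>2))
        = (\<Sum>j<n. \<Sum>i<n. \<Sum>k\<in>L. \<Sum>l\<in>L. (x k * cnj (x l)) * (F (ang j) (ang i) * cis (- dot2 (ang j) (ang i) (k - l))))"
        unfolding PP sum_distrib_left by (intro sum.cong refl) (simp only: mult_ac)
      also have "\<dots> = (\<Sum>j<n. \<Sum>k\<in>L. \<Sum>i<n. \<Sum>l\<in>L. (x k * cnj (x l)) * (F (ang j) (ang i) * cis (- dot2 (ang j) (ang i) (k - l))))"
        by (intro sum.cong refl sum.swap)
      also have "\<dots> = (\<Sum>k\<in>L. \<Sum>j<n. \<Sum>i<n. \<Sum>l\<in>L. (x k * cnj (x l)) * (F (ang j) (ang i) * cis (- dot2 (ang j) (ang i) (k - l))))"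
        by (rule sum.swap)
      also have "\<dots> = (\<Sum>k\<in>L. \<Sum>j<n. \<Sum>l\<in>L. \<Sum>i<n. (x k * cnj (x l)) * (F (ang j) (ang i) * cis (- dot2 (ang j) (ang i) (k - l))))"
        by (intro sum.cong refl sum.swap)
      also have "\<dots> = (\<Sum>k\<in>L. \<Sum>l\<in>L. \<Sum>j<n. \<Sum>i<n. (x k * cnj (x l)) * (F (ang j) (ang i) * cis (- dot2 (ang j) (ang i) (k - l))))"
        by (intro sum.cong refl sum.swap)
      finally show ?thesis unfolding sum_distrib_left .
    qed
    also have "\<dots> = of_real (real n * real n) * (\<Sum>k\<in>L. \<Sum>l\<in>L. T K (k - l) * (x k * cnj (x l)))"
      unfolding key sum_distrib_left by (intro sum.cong refl) (simp add: mult_ac)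
    also have "Re \<dots> = real n * real n * Re (\<Sum>k\<in>L. \<Sum>l\<in>L. T K (k - l) * (x k * cnj (x l)))"
      by (simp only: Re_complex_of_real times_complex.sel Im_complex_of_real mult_zero_left diff_zero)
    finally have "real n * real n * 0 \<le> real n * real n * Re (\<Sum>k\<in>L. \<Sum>l\<in>L. T K (k - l) * (x k * cnj (x l)))"
      by (simp only: mult_zero_right)
    then show ?thesis by (rule mult_left_le_imp_le) (simp add: n_def)
  qed
  have "(\<lambda>K. Re (\<Sum>k\<in>L. \<Sum>l\<in>L. T K (k - l) * (x k * cnj (x l)))) \<longlonglongrightarrow> Re (\<Sum>k\<in>L. \<Sum>l\<in>L. w (k - l) * (x k * cnj (x l)))"
    by (intro tendsto_intros Tlim)
  then show ?thesis by (rule tendsto_lowerbound) (use T in auto)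
qed

definition ibox :: "nat \<Rightarrow> (int \<times> int) set" where "ibox N = {0..<int N} \<times> {0..<int N}"

lemma finite_ibox [simp]: "finite (ibox N)" by (simp add: ibox_def)

lemma card_ibox: "card (ibox N) = N * N" by (simp add: ibox_def card_cartesian_product)

text \<open>A difference m = (a, b) occurs in the double sum with relative frequency (1 - |a|/N)(1 -
  |b|/N) for large N. These Fejer weights are at most 1 and tend to 1.\<close>

lemma fejer_limit:
  fixes g :: "int \<times> int \<Rightarrow> complex"
  assumes g: "g summable_on UNIV"
  shows "(\<lambda>N. (\<Sum>k\<in>ibox N. \<Sum>l\<in>ibox N. g (k - l)) / of_nat (N * N)) \<longlonglongrightarrow> infsum g UNIV"
proof -
  have gn: "(\<lambda>k. cmod (g k)) summable_on UNIV"
    using g summable_on_iff_abs_summable_on_complex by blast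
  define c where "c N m = real (card {k \<in> ibox N. k - m \<in> ibox N}) / real (N * N)" for N m
  have "(\<Sum>k\<in>ibox N. \<Sum>l\<in>ibox N. g (k - l)) / of_nat (N * N) = (\<Sum>\<^sub>\<infinity>m. of_real (c N m) * g m)" for N
  proof -
    have "((\<lambda>m. if k - m \<in> ibox N then g m else 0) has_sum (\<Sum>l\<in>ibox N. g (k - l))) UNIV" for k
    proof -
      have "(g has_sum (\<Sum>m\<in>(\<lambda>l. k - l) ` ibox N. g m)) ((\<lambda>l. k - l) ` ibox N)" by (rule has_sum_finite) simp
      moreover have "(\<Sum>m\<in>(\<lambda>l. k - l) ` ibox N. g m) = (\<Sum>l\<in>ibox N. g (k - l))"
        by (subst sum.reindex) (auto simp: inj_on_def)
      moreover have "(g has_sum S) ((\<lambda>l. k - l) ` ibox N) \<longleftrightarrow> ((\<lambda>m. if k - m \<in> ibox N then g m else 0) has_sum S) UNIV" for S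
      proof (rule has_sum_cong_neutral)
        fix m assume "m \<in> UNIV - (\<lambda>l. k - l) ` ibox N"
        then have "k - m \<notin> ibox N" by (metis DiffD2 diff_diff_eq2 add_diff_cancel_left' imageI)
        then show "(if k - m \<in> ibox N then g m else 0) = 0" by simp
      qed auto
      ultimately show ?thesis by simp
    qed
    then have "((\<lambda>m. \<Sum>k\<in>ibox N. if k - m \<in> ibox N then g m else 0) has_sum (\<Sum>k\<in>ibox N. \<Sum>l\<in>ibox N. g (k - l))) UNIV"
      by (intro has_sum_sum)
    from has_sum_cmult_left[OF this, of "1 / of_nat (N * N)"]
    have "((\<lambda>m. (\<Sum>k\<in>ibox N. if k - m \<in> ibox N then g m else 0) * (1 / of_nat (N * N))) has_sum (\<Sum>k\<in>ibox N. \<Sum>l\<in>ibox N. g (k - l)) / of_nat (N * N)) UNIV"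
      by simp
    moreover have "(\<Sum>k\<in>ibox N. if k - m \<in> ibox N then g m else 0) * (1 / of_nat (N * N)) = of_real (c N m) * g m" for m
      by (simp add: c_def sum.If_cases Int_def)
    ultimately show ?thesis by (simp add: infsumI)
  qed
  moreover have "(\<lambda>N. \<Sum>\<^sub>\<infinity>m. of_real (c N m) * g m) \<longlonglongrightarrow> infsum g UNIV"
  proof (rule infsum_dominated_convergence[OF _ _ _ gn])
    fix m :: "int \<times> int"
    have c1: "c N m \<le> 1" for N
    proof -
      have "card {k \<in> ibox N. k - m \<in> ibox N} \<le> N * N"
        unfolding card_ibox[symmetric] by (intro card_mono) auto
      then have "real (card {k \<in> ibox N. k - m \<in> ibox N}) \<le> real (N * N)" by (simp only: of_nat_le_iff)
      then show ?thesis unfolding c_def by (intro divide_le_eq_1[THEN iffD2]) auto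
    qed
    have c0: "c N m \<ge> 0" for N by (simp add: c_def)
    show "cmod (of_real (c N m) * g m) \<le> cmod (g m)" for N
      using c0 c1 by (simp add: norm_mult mult_left_le_one_le)
    obtain a b where m: "m = (a, b)" by force
    have cN: "c N m = (1 - \<bar>of_int a\<bar> / real N) * (1 - \<bar>of_int b\<bar> / real N)" if N: "N \<ge> nat \<bar>a\<bar> + nat \<bar>b\<bar> + 1" for N
    proof -
      have "{k \<in> ibox N. k - m \<in> ibox N} = {max 0 a..<min (int N) (int N + a)} \<times> {max 0 b..<min (int N) (int N + b)}"
        by (auto simp: ibox_def m)
      then have "card {k \<in> ibox N. k - m \<in> ibox N} = nat (int N - \<bar>a\<bar>) * nat (int N - \<bar>b\<bar>)"
        by (simp add: card_cartesian_product) (simp add: max_def min_def abs_if)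
      moreover have ab: "real (nat (int N - \<bar>a\<bar>)) = real N - \<bar>of_int a\<bar>" "real (nat (int N - \<bar>b\<bar>)) = real N - \<bar>of_int b\<bar>"
        using N by (auto simp: of_nat_nat)
      moreover have "real N \<noteq> 0" using N by simp
      ultimately show ?thesis unfolding c_def
        by (simp only: of_nat_mult ab) (simp add: field_simps)
    qed
    have "(\<lambda>N. (1 - \<bar>of_int a\<bar> / real N) * (1 - \<bar>of_int b\<bar> / real N)) \<longlonglongrightarrow> (1 - 0) * (1 - 0)"
      by (intro tendsto_intros lim_const_over_n)
    then have lim: "(\<lambda>N. (1 - \<bar>of_int a\<bar> / real N) * (1 - \<bar>of_int b\<bar> / real N)) \<longlonglongrightarrow> (1 :: real)" by simp
    have "(\<lambda>N. c N m) \<longlonglongrightarrow> 1"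
    proof (rule Lim_transform_eventually[OF lim])
      show "eventually (\<lambda>N. (1 - \<bar>of_int a\<bar> / real N) * (1 - \<bar>of_int b\<bar> / real N) = c N m) sequentially"
        using eventually_ge_at_top[of "nat \<bar>a\<bar> + nat \<bar>b\<bar> + 1"] by eventually_elim (simp only: cN)
    qed
    then have "(\<lambda>N. of_real (c N m) * g m) \<longlonglongrightarrow> of_real 1 * g m" by (intro tendsto_intros)
    then show "(\<lambda>N. of_real (c N m) * g m) \<longlonglongrightarrow> g m" by simp
  qed simp
  ultimately show ?thesis by simp
qed

section \<open>The hexagonal Gabor frame operator\<close>

lemma
  fixes a b :: "'i \<Rightarrow> complex"
  assumes a: "(\<lambda>i. (cmod (a i))\<^sup>2) summable_on A" and b: "(\<lambda>i. (cmod (b i))\<^sup>2) summable_on A"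
  shows summable_on_l2_product: "(\<lambda>i. a i * b i) summable_on A"
    and infsum_l2_Cauchy_Schwarz:
      "(cmod (\<Sum>\<^sub>\<infinity>i\<in>A. a i * b i))\<^sup>2 \<le> (\<Sum>\<^sub>\<infinity>i\<in>A. (cmod (a i))\<^sup>2) * (\<Sum>\<^sub>\<infinity>i\<in>A. (cmod (b i))\<^sup>2)"
proof -
  show s: "(\<lambda>i. a i * b i) summable_on A"
  proof (rule summable_on_norm_le[OF summable_on_add[OF a b]])
    fix i
    have "2 * (cmod (a i) * cmod (b i)) \<le> (cmod (a i))\<^sup>2 + (cmod (b i))\<^sup>2"
      using sum_squares_bound[of "cmod (a i)" "cmod (b i)"] by simp
    moreover have "0 \<le> cmod (a i) * cmod (b i)" by simp
    ultimately show "cmod (a i * b i) \<le> (cmod (a i))\<^sup>2 + (cmod (b i))\<^sup>2"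
      unfolding norm_mult by linarith
  qed
  have "((\<lambda>F. (cmod (\<Sum>i\<in>F. a i * b i))\<^sup>2) \<longlongrightarrow> (cmod (\<Sum>\<^sub>\<infinity>i\<in>A. a i * b i))\<^sup>2) (finite_subsets_at_top A)"
    by (intro tendsto_intros infsum_tendsto s)
  then show "(cmod (\<Sum>\<^sub>\<infinity>i\<in>A. a i * b i))\<^sup>2 \<le> (\<Sum>\<^sub>\<infinity>i\<in>A. (cmod (a i))\<^sup>2) * (\<Sum>\<^sub>\<infinity>i\<in>A. (cmod (b i))\<^sup>2)"
  proof (rule tendsto_upperbound)
    show "eventually (\<lambda>F. (cmod (\<Sum>i\<in>F. a i * b i))\<^sup>2 \<le> (\<Sum>\<^sub>\<infinity>i\<in>A. (cmod (a i))\<^sup>2) * (\<Sum>\<^sub>\<infinity>i\<in>A. (cmod (b i))\<^sup>2)) (finite_subsets_at_top A)"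
    proof (rule eventually_finite_subsets_at_top_weakI)
      fix F assume F: "finite F" "F \<subseteq> A"
      have "cmod (\<Sum>i\<in>F. a i * b i) \<le> (\<Sum>i\<in>F. cmod (a i) * cmod (b i))"
        using norm_sum[of "\<lambda>i. a i * b i" F] by (simp add: norm_mult)
      then have "(cmod (\<Sum>i\<in>F. a i * b i))\<^sup>2 \<le> (\<Sum>i\<in>F. cmod (a i) * cmod (b i))\<^sup>2"
        by (intro power_mono) auto
      also have "\<dots> \<le> (\<Sum>i\<in>F. (cmod (a i))\<^sup>2) * (\<Sum>i\<in>F. (cmod (b i))\<^sup>2)"
        by (rule Cauchy_Schwarz_ineq_sum)
      also have "\<dots> \<le> (\<Sum>\<^sub>\<infinity>i\<in>A. (cmod (a i))\<^sup>2) * (\<Sum>\<^sub>\<infinity>i\<in>A. (cmod (b i))\<^sup>2)"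
        by (intro mult_mono finite_sum_le_infsum a b F infsum_nonneg sum_nonneg) auto
      finally show "(cmod (\<Sum>i\<in>F. a i * b i))\<^sup>2 \<le> (\<Sum>\<^sub>\<infinity>i\<in>A. (cmod (a i))\<^sup>2) * (\<Sum>\<^sub>\<infinity>i\<in>A. (cmod (b i))\<^sup>2)" .
    qed
  qed simp
qed

lemma
  fixes u f :: "real \<Rightarrow> complex"
  assumes u: "u \<in> borel_measurable borel" "\<And>t. cmod (u t) = 1" and f: "f \<in> L2"
  shows L2_unimodular_shift: "(\<lambda>t. u t * f (t - x)) \<in> L2"
    and L2_norm_unimodular_shift: "L2_norm (\<lambda>t. u t * f (t - x)) = L2_norm f"
proof -
  note [measurable] = u(1) L2_measurable[OF f]
  have n: "(cmod (u t * f (t - x)))\<^sup>2 = (cmod (f (- x + 1 * t)))\<^sup>2" for t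
    by (simp add: norm_mult u)
  have i: "integrable lborel (\<lambda>t. (cmod (f (- x + 1 * t)))\<^sup>2)"
    by (rule lborel_integrable_real_affine[OF L2_integrable[OF f]]) simp
  show "(\<lambda>t. u t * f (t - x)) \<in> L2"
    by (rule L2I) (use i n in \<open>simp_all\<close>)
  have "(L2_norm (\<lambda>t. u t * f (t - x)))\<^sup>2 = (L2_norm f)\<^sup>2"
    unfolding L2_norm_sq n using lborel_integral_real_affine[of 1 "\<lambda>t. (cmod (f t))\<^sup>2" "- x"] by simp
  then show "L2_norm (\<lambda>t. u t * f (t - x)) = L2_norm f" by simp
qed

lemma L2_norm_cmod: "L2_norm (\<lambda>t. of_real (cmod (f t))) = L2_norm f"
  by (simp add: L2_norm_def L2_inner_self)

lemma cis_measurable [measurable]: "(\<lambda>t. cis (a * t)) \<in> borel_measurable borel"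
  by (intro borel_measurable_continuous_onI continuous_intros)

lemma tf_shift_cis: "tf_shift p f = (\<lambda>t. cis (2 * pi * p $ 2 * t) * f (t - p $ 1))"
  by (rule ext) (simp add: tf_shift_def cis_conv_exp mult_ac)

lemma tf_shift_L2: "f \<in> L2 \<Longrightarrow> tf_shift p f \<in> L2"
  unfolding tf_shift_cis by (rule L2_unimodular_shift) auto

text \<open>The product of the two Gaussians is a Gaussian centred at the midpoint x/2; moving the
  origin there produces the phase, and the rest is a Fourier transform of a Gaussian.\<close>

lemma ambiguity_gaussian:
  "(LINT t|lborel. cis (2 * pi * y * t) * (gaussian t * gaussian (t - x)))
    = cis (pi * y * x) * of_real (exp (- (pi / 2 * (x\<^sup>2 + y\<^sup>2))))"
proof -
  have g: "gaussian (x / 2 + 1 * t) * gaussian (x / 2 + 1 * t - x) = of_real (sqrt 2 * exp (- (pi / 2 * x\<^sup>2))) * of_real (exp (- (pi * 2 * t\<^sup>2)))" for t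
  proof -
    have "(x / 2 + 1 * t)\<^sup>2 + (x / 2 + 1 * t - x)\<^sup>2 = x\<^sup>2 / 2 + 2 * t\<^sup>2"
      by (simp add: power2_eq_square algebra_simps)
    then have "- (pi * (x / 2 + 1 * t)\<^sup>2) + - (pi * (x / 2 + 1 * t - x)\<^sup>2) = - (pi / 2 * x\<^sup>2) + - (pi * 2 * t\<^sup>2)"
      by (simp add: algebra_simps flip: distrib_left)
    then have "exp (- (pi * (x / 2 + 1 * t)\<^sup>2)) * exp (- (pi * (x / 2 + 1 * t - x)\<^sup>2)) = exp (- (pi / 2 * x\<^sup>2)) * exp (- (pi * 2 * t\<^sup>2))"
      unfolding exp_add[symmetric] by (rule arg_cong)
    then have "2 powr (1/4) * exp (- (pi * (x / 2 + 1 * t)\<^sup>2)) * (2 powr (1/4) * exp (- (pi * (x / 2 + 1 * t - x)\<^sup>2)))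
        = sqrt 2 * exp (- (pi / 2 * x\<^sup>2)) * exp (- (pi * 2 * t\<^sup>2))"
      unfolding powr_quarter_sq[symmetric] power2_eq_square by (simp only: mult_ac)
    then show ?thesis unfolding gaussian_real of_real_mult[symmetric] by (rule arg_cong)
  qed
  have "(LINT t|lborel. cis (2 * pi * y * t) * (gaussian t * gaussian (t - x)))
      = (LINT t|lborel. cis (2 * pi * y * (x / 2 + 1 * t)) * (gaussian (x / 2 + 1 * t) * gaussian (x / 2 + 1 * t - x)))"
    using lborel_integral_real_affine[of 1 "\<lambda>t. cis (2 * pi * y * t) * (gaussian t * gaussian (t - x))" "x / 2"] by simp
  also have "\<dots> = (LINT t|lborel. (cis (pi * y * x) * of_real (sqrt 2 * exp (- (pi / 2 * x\<^sup>2)))) * (of_real (exp (- (pi * 2 * t\<^sup>2))) * cis (2 * pi * y * t)))"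
  proof (rule Bochner_Integration.integral_cong[OF refl])
    fix t :: real
    have "2 * pi * y * (x / 2 + 1 * t) = pi * y * x + 2 * pi * y * t" by (simp add: algebra_simps)
    then have "cis (2 * pi * y * (x / 2 + 1 * t)) = cis (pi * y * x) * cis (2 * pi * y * t)" by (simp only: cis_mult)
    then show "cis (2 * pi * y * (x / 2 + 1 * t)) * (gaussian (x / 2 + 1 * t) * gaussian (x / 2 + 1 * t - x))
      = (cis (pi * y * x) * of_real (sqrt 2 * exp (- (pi / 2 * x\<^sup>2)))) * (of_real (exp (- (pi * 2 * t\<^sup>2))) * cis (2 * pi * y * t))"
      unfolding g by (simp only: mult_ac)
  qed
  also have "\<dots> = (cis (pi * y * x) * of_real (sqrt 2 * exp (- (pi / 2 * x\<^sup>2)))) * of_real (exp (- (pi * y\<^sup>2 / 2)) / sqrt 2)"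
    by (subst integral_mult_right_zero) (use integral_gauss_cis[of 2 y] in simp)
  also have "\<dots> = cis (pi * y * x) * of_real ((sqrt 2 * exp (- (pi / 2 * x\<^sup>2))) * (exp (- (pi * y\<^sup>2 / 2)) / sqrt 2))"
    by (simp only: of_real_mult mult.assoc)
  also have "(sqrt 2 * exp (- (pi / 2 * x\<^sup>2))) * (exp (- (pi * y\<^sup>2 / 2)) / sqrt 2) = exp (- (pi / 2 * (x\<^sup>2 + y\<^sup>2)))"
    by (simp add: exp_add[symmetric] algebra_simps)
  finally show ?thesis .
qed

lemma real_le_epsilon_mult:
  fixes x y c :: real
  assumes c: "c \<ge> 0" and le: "\<And>e. 0 < e \<Longrightarrow> e \<le> 1 \<Longrightarrow> x \<le> y + e * c"
  shows "x \<le> y"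
proof (rule field_le_epsilon)
  fix e :: real assume e: "e > 0"
  define d where "d = min 1 (e / (c + 1))"
  have d: "0 < d" "d \<le> 1" using e c by (auto simp: d_def)
  have "d * c \<le> e / (c + 1) * c" using c by (intro mult_right_mono) (auto simp: d_def)
  also have "\<dots> \<le> e" using e c by (simp add: field_simps)
  finally show "x \<le> y + e" using le[OF d] by linarith
qed

lemma gauss_span_approx:
  assumes "f \<in> L2" "e > 0"
  obtains d where "gauss_span d" "d \<in> L2" "L2_norm (\<lambda>t. f t - d t) < e" "L2_norm d \<le> L2_norm f + e"
proof -
  obtain d where d: "gauss_span d" "L2_norm (\<lambda>t. f t - d t) < e"
    using gauss_span_dense[OF assms(1)] assms(2) unfolding L2_approx_def by blast
  have dL: "d \<in> L2" by (rule gauss_span_L2[OF d(1)])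
  have "L2_norm (\<lambda>t. f t + (d t - f t)) \<le> L2_norm f + L2_norm (\<lambda>t. d t - f t)"
    by (intro L2_norm_triangle L2_diff assms dL)
  then have "L2_norm d \<le> L2_norm f + e" using d(2) L2_norm_minus_commute[of f d] by simp
  then show ?thesis using that d dL by blast
qed

lemma has_sum_minus:
  fixes f g :: "'i \<Rightarrow> complex"
  assumes "(f has_sum x) A" "(g has_sum y) A"
  shows "((\<lambda>i. f i - g i) has_sum (x - y)) A"
  using has_sum_add[OF assms(1), of "\<lambda>i. - g i" "- y"] assms(2) by (simp add: has_sum_uminus)

lemma infsum_diff:
  fixes f g :: "'i \<Rightarrow> complex"
  assumes "f summable_on A" "g summable_on A"
  shows "(\<Sum>\<^sub>\<infinity>i\<in>A. f i - g i) = infsum f A - infsum g A"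
  using assms by (intro infsumI has_sum_minus has_sum_infsum)

text \<open>The columns of M are integer combinations of those of M', so M = M' P with an integer
  matrix P whose determinant is nonzero. Used in both directions, this shows that the covolume is
  well defined.\<close>

lemma lattice_det_le:
  assumes sub: "lattice_of M \<subseteq> lattice_of M'" and inv: "invertible M"
  shows "\<bar>det M'\<bar> \<le> \<bar>det M\<bar>"
proof -
  have "\<exists>z. M *v axis j 1 = M' *v z \<and> (\<forall>i. z $ i \<in> \<int>)" for j
  proof -
    have "M *v axis j 1 \<in> lattice_of M"
      unfolding lattice_of_def by (auto simp: axis_def intro!: exI[of _ "axis j 1"])
    then show ?thesis using sub unfolding lattice_of_def by auto
  qed
  then obtain z where z: "\<And>j. M *v axis j 1 = M' *v z j" "\<And>j i. z j $ i \<in> \<int>" by metis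
  define P :: "real^2^2" where "P = (\<chi> i j. z j $ i)"
  have "M $ i $ j = (M' ** P) $ i $ j" for i j
  proof -
    have "M $ i $ j = (M *v axis j 1) $ i" by (simp add: matrix_vector_mult_basis column_def)
    also have "\<dots> = (M' ** P) $ i $ j"
      unfolding z by (simp add: P_def matrix_vector_mult_def matrix_matrix_mult_def)
    finally show ?thesis .
  qed
  then have "M = M' ** P" by (simp add: vec_eq_iff)
  then have d: "det M = det M' * det P" by (simp add: det_mul)
  have "det P \<in> \<int>" by (simp add: det_2 P_def z)
  moreover have "det P \<noteq> 0" using d inv by (auto simp: invertible_det_nz)
  ultimately have "\<bar>det P\<bar> \<ge> 1" by (rule Ints_nonzero_abs_ge1)
  then show ?thesis unfolding d abs_mult using mult_left_mono[of 1 "\<bar>det P\<bar>" "\<bar>det M'\<bar>"] by simp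
qed

lemma covolume_lattice_of: "invertible M \<Longrightarrow> covolume (lattice_of M) = \<bar>det M\<bar>"
  unfolding covolume_def by (rule the_equality) (auto intro!: antisym lattice_det_le)

text \<open>Two sums of the same series agree up to a null set. Comparing them through inner
  products is what the representative chosen by \<open>SOME\<close> in the frame operator calls
  for.\<close>

lemma L2_has_sum_unique:
  assumes g: "L2_has_sum u I g" and g': "L2_has_sum u I g'" and u: "\<And>i. i \<in> I \<Longrightarrow> u i \<in> L2" and h: "h \<in> L2"
  shows "L2_inner g h = L2_inner g' h"
proof -
  have L: "g \<in> L2" "g' \<in> L2" using g g' by (auto simp: L2_has_sum_def)
  define e where "e = L2_norm (\<lambda>t. g t - g' t)"
  have "((\<lambda>F. L2_norm (\<lambda>t. (\<Sum>i\<in>F. u i t) - g t) + L2_norm (\<lambda>t. (\<Sum>i\<in>F. u i t) - g' t)) \<longlongrightarrow> 0 + 0) (finite_subsets_at_top I)"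
    using g g' unfolding L2_has_sum_def by (intro tendsto_add) auto
  moreover have "\<forall>\<^sub>F F in finite_subsets_at_top I. e \<le> L2_norm (\<lambda>t. (\<Sum>i\<in>F. u i t) - g t) + L2_norm (\<lambda>t. (\<Sum>i\<in>F. u i t) - g' t)"
  proof (rule eventually_finite_subsets_at_top_weakI)
    fix F assume F: "finite F" "F \<subseteq> I"
    then have SF: "(\<lambda>t. \<Sum>i\<in>F. u i t) \<in> L2" by (intro L2_sum u) auto
    have "L2_norm (\<lambda>t. (g t - (\<Sum>i\<in>F. u i t)) + ((\<Sum>i\<in>F. u i t) - g' t))
        \<le> L2_norm (\<lambda>t. g t - (\<Sum>i\<in>F. u i t)) + L2_norm (\<lambda>t. (\<Sum>i\<in>F. u i t) - g' t)"
      by (intro L2_norm_triangle L2_diff L SF)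
    then show "e \<le> L2_norm (\<lambda>t. (\<Sum>i\<in>F. u i t) - g t) + L2_norm (\<lambda>t. (\<Sum>i\<in>F. u i t) - g' t)"
      unfolding e_def L2_norm_minus_commute[of g "\<lambda>t. \<Sum>i\<in>F. u i t"] by simp
  qed
  ultimately have "e \<le> 0 + 0" by (rule tendsto_lowerbound) simp
  then have "e = 0" by (simp add: e_def antisym)
  then have "cmod (L2_inner (\<lambda>t. g t - g' t) h) \<le> 0"
    using L2_Cauchy_Schwarz[OF L2_diff[OF L] h] by (simp add: e_def)
  then show ?thesis by (simp add: L2_inner_diff_left L h)
qed

section \<open>The hexagonal lattice, adjoint shifts and the Janssen operator\<close>

locale hex_gabor =
  fixes K :: nat
  assumes odd_K: "odd K"
begin

definition density :: real where "density = 2 * real K"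
definition r :: real where "r = sqrt (2 / (sqrt 3 * density))"
definition s :: real where "s = sqrt (sqrt 3 / (2 * density))"
definition nome :: real where "nome = exp (- (pi * density / sqrt 3))"

lemma density_pos: "density > 0" using odd_pos[OF odd_K] by (simp add: density_def)

lemma scales: "r > 0" "s > 0" "r * s = 1 / density" "r\<^sup>2 = 2 / (sqrt 3 * density)" "s\<^sup>2 = sqrt 3 / (2 * density)"
proof -
  show "r > 0" "s > 0" "r\<^sup>2 = 2 / (sqrt 3 * density)" "s\<^sup>2 = sqrt 3 / (2 * density)" using density_pos by (auto simp: r_def s_def)
  have "r * s = sqrt ((1 / density)\<^sup>2)"
    unfolding r_def s_def real_sqrt_mult[symmetric] using density_pos by (simp add: power2_eq_square)
  then show "r * s = 1 / density" using density_pos by simp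
qed

lemma nome_bounds: "0 < nome" "nome < 1"
  using density_pos by (auto simp: nome_def)

definition hx :: "int \<times> int \<Rightarrow> real" where "hx k = of_int (fst k) + of_int (snd k) / 2"
definition hy :: "int \<times> int \<Rightarrow> real" where "hy k = of_int (snd k)"

definition lattice_pt :: "int \<times> int \<Rightarrow> real ^ 2" where "lattice_pt k = vector [r * hx k, s * hy k]"

lemma lattice_pt_nth [simp]: "lattice_pt k $ 1 = r * hx k" "lattice_pt k $ 2 = s * hy k"
  by (simp_all add: lattice_pt_def)

definition weight :: "int \<times> int \<Rightarrow> real" where "weight k = nome powi hex_form (fst k) (snd k)"

text \<open>The point (hx k / s, hy k / r) belongs to the adjoint lattice, and the ambiguity
  function of the Gaussian has modulus exp (- pi/2 times the squared length) there.\<close>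

lemma weight_exp: "weight k = exp (- (pi / 2 * ((hx k / s)\<^sup>2 + (hy k / r)\<^sup>2)))"
proof -
  have s3: "sqrt 3 * (sqrt 3 * x) = 3 * x" for x :: real by (simp add: mult.assoc[symmetric])
  have hq: "real_of_int (hex_form (fst k) (snd k)) = (hx k)\<^sup>2 + 3/4 * (hy k)\<^sup>2"
    by (simp add: real_hex_form hx_def hy_def)
  have "pi / 2 * ((hx k / s)\<^sup>2 + (hy k / r)\<^sup>2) = pi * density / sqrt 3 * of_int (hex_form (fst k) (snd k))"
    unfolding power_divide scales hq using density_pos by (simp add: field_simps s3)
  then show ?thesis unfolding weight_def nome_def exp_power_int by simp
qed

lemma weight_nonneg: "weight k \<ge> 0" by (simp add: weight_exp)

lemma weight_sum: "(weight has_sum cubic_a nome) UNIV"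
  unfolding cubic_a_def using has_sum_infsum[OF summable_hex[OF nome_bounds]]
  by (simp add: weight_def[abs_def] case_prod_unfold)

text \<open>For k = (m, n) the ambiguity function at the adjoint point has the phase (-1)^(K n (2m +
  n)). For odd K this is (-1)^n, which is multiplicative in k and therefore compatible with a
  representation of Z^2.\<close>

definition phase_sign :: "int \<Rightarrow> complex" where "phase_sign n = (if even n then 1 else - 1)"

lemma phase_sign_add: "phase_sign (m + n) = phase_sign m * phase_sign n" by (auto simp: phase_sign_def)
lemma phase_sign_norm [simp]: "cmod (phase_sign n) = 1" by (simp add: phase_sign_def)
lemma phase_sign_sq: "phase_sign n * phase_sign n = 1" by (simp add: phase_sign_def)

text \<open>Janssen's representation: \<open>adj_shift\<close> runs through the time-frequency shifts over the adjoint
  lattice, and \<open>janssen_op\<close> below is the normalized frame operator. The weight \<open>weight k\<close> is the modulus of the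
  ambiguity function of the Gaussian there and the sign \<open>phase_sign\<close> absorbs its phase.\<close>

definition adj_shift :: "int \<times> int \<Rightarrow> (real \<Rightarrow> complex) \<Rightarrow> real \<Rightarrow> complex" where
  "adj_shift k f = (\<lambda>t. (phase_sign (snd k) * cis (2 * pi * (hy k / r) * t)) * f (t - hx k / s))"

lemma adj_shift_L2: "f \<in> L2 \<Longrightarrow> adj_shift k f \<in> L2"
  unfolding adj_shift_def by (rule L2_unimodular_shift, measurable, simp add: norm_mult)

lemma adj_shift_norm: "f \<in> L2 \<Longrightarrow> L2_norm (adj_shift k f) = L2_norm f"
  unfolding adj_shift_def by (rule L2_norm_unimodular_shift, measurable, simp add: norm_mult)

lemma hx_add: "hx (k + l) = hx k + hx l" and hy_add: "hy (k + l) = hy k + hy l"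
  by (simp_all add: hx_def hy_def add_divide_distrib)

text \<open>The phase produced by commuting a modulation past a translation is trivial since the
  density is an even integer.\<close>

lemma phase_trivial: "cis (2 * pi * (hy l / r) * (hx k / s)) = 1"
proof -
  have "hy l / r * (hx k / s) = density * (hy l * hx k)"
    using scales(3) scales(1,2) density_pos by (simp add: field_simps)
  also have "\<dots> = of_int (int K * (snd l * (2 * fst k + snd k)))"
    by (simp add: density_def hy_def hx_def algebra_simps)
  finally have "2 * pi * (hy l / r) * (hx k / s) = 2 * pi * of_int (int K * (snd l * (2 * fst k + snd k)))"
    by (simp only: mult.assoc)
  then show ?thesis by (simp only:) (rule cis_multiple_2pi, simp)
qed

lemma adj_shift_add: "adj_shift k (adj_shift l f) = adj_shift (k + l) f"
proof
  fix t
  have "cis (2 * pi * (hy l / r) * (t - hx k / s)) = cis (2 * pi * (hy l / r) * t) / cis (2 * pi * (hy l / r) * (hx k / s))"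
    by (simp only: cis_divide right_diff_distrib)
  then have 1: "cis (2 * pi * (hy l / r) * (t - hx k / s)) = cis (2 * pi * (hy l / r) * t)"
    by (simp only: phase_trivial div_by_1)
  have 2: "cis (2 * pi * (hy (k + l) / r) * t) = cis (2 * pi * (hy k / r) * t) * cis (2 * pi * (hy l / r) * t)"
    by (simp add: cis_mult hy_add add_divide_distrib algebra_simps)
  have 3: "t - hx (k + l) / s = t - hx k / s - hx l / s"
    by (simp add: hx_add add_divide_distrib)
  show "adj_shift k (adj_shift l f) t = adj_shift (k + l) f t"
    unfolding adj_shift_def 1 2 3 snd_add phase_sign_add by (simp only: mult_ac)
qed

lemma adj_shift_0: "adj_shift 0 f = f"
  by (simp add: adj_shift_def hx_def hy_def phase_sign_def)

lemma adj_shift_isometry: "L2_inner (adj_shift k f) (adj_shift k h) = L2_inner f h"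
proof -
  have "adj_shift k f t * cnj (adj_shift k h t) = f (- (hx k / s) + 1 * t) * cnj (h (- (hx k / s) + 1 * t))" for t
  proof -
    define u where "u = phase_sign (snd k) * cis (2 * pi * (hy k / r) * t)"
    have "u * cnj u = 1" using complex_norm_square[of u] by (simp add: u_def norm_mult)
    then have "(u * a) * cnj (u * b) = a * cnj b" for a b by (simp add: mult_ac)
    then show ?thesis unfolding adj_shift_def u_def by simp
  qed
  then show ?thesis
    unfolding L2_inner_def
    using lborel_integral_real_affine[of 1 "\<lambda>t. f t * cnj (h t)" "- (hx k / s)"] by simp
qed

text \<open>Dependence on k - l alone is what makes the Gram matrix of the shifted functions a
  Toeplitz matrix.\<close>

lemma adj_shift_inner_diff: "L2_inner (adj_shift k f) (adj_shift l h) = L2_inner (adj_shift (k - l) f) h"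
  using adj_shift_isometry[of l "adj_shift (k - l) f" h] by (simp add: adj_shift_add)

lemma adj_shift_inner_bound:
  assumes "f \<in> L2" "h \<in> L2" shows "cmod (L2_inner (adj_shift k f) h) \<le> L2_norm f * L2_norm h"
  using L2_Cauchy_Schwarz[OF adj_shift_L2[OF assms(1)] assms(2)] by (simp add: adj_shift_norm[OF assms(1)])

definition janssen_op :: "(real \<Rightarrow> complex) \<Rightarrow> real \<Rightarrow> complex" where
  "janssen_op f t = (\<Sum>\<^sub>\<infinity>k. of_real (weight k) * adj_shift k f t)"

text \<open>The weight is split into two square roots. Pointwise Cauchy-Schwarz bounds the squared
  modulus by a(q) times the weighted sum of |U_k f|^2, which is integrable because each shift
  preserves the norm.\<close>

lemma janssen_op_L2:
  assumes f: "f \<in> L2" shows "janssen_op f \<in> L2"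
proof -
  note [measurable] = L2_measurable[OF adj_shift_L2[OF f]]
  define g where "g k t = complex_of_real (weight k * (cmod (adj_shift k f t))\<^sup>2)" for k t
  have gi: "integrable lborel (g k)" for k
    unfolding g_def by (intro integrable_of_real integrable_mult_right L2_integrable adj_shift_L2 f)
  have gn: "(LINT t|lborel. cmod (g k t)) = weight k * (L2_norm f)\<^sup>2" for k
  proof -
    have "cmod (g k t) = weight k * (cmod (adj_shift k f t))\<^sup>2" for t
      using weight_nonneg[of k] by (simp add: g_def norm_mult norm_power)
    then show ?thesis
      by (simp add: L2_norm_sq[symmetric] adj_shift_norm[OF f])
  qed
  have gs: "(\<lambda>k. LINT t|lborel. cmod (g k t)) summable_on UNIV"
    unfolding gn by (intro summable_on_cmult_left has_sum_imp_summable[OF weight_sum])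
  have Gm: "janssen_op f \<in> borel_measurable borel"
    unfolding janssen_op_def[abs_def] using borel_measurable_infsum[OF infinite_UNIV_int_prod, of "\<lambda>k t. of_real (weight k) * adj_shift k f t" borel] by simp
  have ae: "AE t in lborel. (cmod (janssen_op f t))\<^sup>2 \<le> cubic_a nome * cmod (\<Sum>\<^sub>\<infinity>k. g k t)"
    using AE_summable_integrals[OF infinite_UNIV_int_prod gi gs]
  proof eventually_elim
    case (elim t)
    define a where "a k = complex_of_real (sqrt (weight k))" for k
    define b where "b k = a k * adj_shift k f t" for k
    have a2: "(cmod (a k))\<^sup>2 = weight k" for k using weight_nonneg[of k] by (simp add: a_def)
    have b2: "(cmod (b k))\<^sup>2 = weight k * (cmod (adj_shift k f t))\<^sup>2" for k
      by (simp add: b_def norm_mult power_mult_distrib a2)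
    have ab: "a k * b k = of_real (weight k) * adj_shift k f t" for k
      using weight_nonneg[of k] by (simp add: b_def a_def mult.assoc[symmetric] flip: of_real_mult)
    have bs: "(\<lambda>k. (cmod (b k))\<^sup>2) summable_on UNIV"
      using summable_on_bounded_linear[OF bounded_linear_Re elim] by (simp add: b2 g_def)
    have as: "(\<lambda>k. (cmod (a k))\<^sup>2) summable_on UNIV"
      unfolding a2 by (rule has_sum_imp_summable[OF weight_sum])
    have "(cmod (janssen_op f t))\<^sup>2 \<le> (\<Sum>\<^sub>\<infinity>k. (cmod (a k))\<^sup>2) * (\<Sum>\<^sub>\<infinity>k. (cmod (b k))\<^sup>2)"
      using infsum_l2_Cauchy_Schwarz[OF as bs] unfolding ab janssen_op_def .
    also have "(\<Sum>\<^sub>\<infinity>k. (cmod (a k))\<^sup>2) = cubic_a nome" unfolding a2 by (rule infsumI[OF weight_sum])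
    also have "(\<Sum>\<^sub>\<infinity>k. (cmod (b k))\<^sup>2) = cmod (\<Sum>\<^sub>\<infinity>k. g k t)"
    proof -
      have "(\<Sum>\<^sub>\<infinity>k. g k t) = of_real (\<Sum>\<^sub>\<infinity>k. (cmod (b k))\<^sup>2)"
        unfolding g_def b2[symmetric] by (rule infsum_of_real_complex)
      moreover have "(\<Sum>\<^sub>\<infinity>k. (cmod (b k))\<^sup>2) \<ge> 0" by (intro infsum_nonneg) simp
      ultimately show ?thesis by simp
    qed
    finally show ?case .
  qed
  show ?thesis
  proof (rule L2I[OF Gm])
    have "integrable lborel (\<lambda>t. cubic_a nome * cmod (\<Sum>\<^sub>\<infinity>k. g k t))"
      by (intro integrable_mult_right integrable_norm integrable_infsum[OF infinite_UNIV_int_prod gi gs])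
    then show "integrable lborel (\<lambda>t. (cmod (janssen_op f t))\<^sup>2)"
      by (rule Bochner_Integration.integrable_bound) (use Gm ae in \<open>auto elim!: eventually_mono\<close>)
  qed
qed

lemma janssen_op_inner:
  assumes f: "f \<in> L2" and h: "h \<in> L2"
  shows "((\<lambda>k. of_real (weight k) * L2_inner (adj_shift k f) h) has_sum L2_inner (janssen_op f) h) UNIV"
proof -
  define g where "g k t = of_real (weight k) * (adj_shift k f t * cnj (h t))" for k t
  have gi: "integrable lborel (g k)" for k
    unfolding g_def by (intro integrable_mult_right L2_inner_integrable adj_shift_L2 f h)
  have gn: "(LINT t|lborel. cmod (g k t)) \<le> weight k * (L2_norm f * L2_norm h)" for k
  proof -
    have c: "cmod (g k t) = weight k * Re (of_real (cmod (adj_shift k f t)) * cnj (of_real (cmod (h t))))" for t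
      using weight_nonneg[of k] by (simp add: g_def norm_mult)
    have adj_shift': "(\<lambda>t. complex_of_real (cmod (adj_shift k f t))) \<in> L2" "(\<lambda>t. complex_of_real (cmod (h t))) \<in> L2"
    proof -
      have n: "(\<lambda>t. complex_of_real (cmod (g t))) \<in> L2" if g: "g \<in> L2" for g
        by (rule L2_bound[OF g measurable_compose[OF measurable_compose[OF L2_measurable[OF g] borel_measurable_norm] borel_measurable_of_real]]) simp
      show "(\<lambda>t. complex_of_real (cmod (adj_shift k f t))) \<in> L2" "(\<lambda>t. complex_of_real (cmod (h t))) \<in> L2"
        by (rule n[OF adj_shift_L2[OF f]], rule n[OF h])
    qed
    have "(LINT t|lborel. cmod (g k t)) = weight k * Re (L2_inner (\<lambda>t. of_real (cmod (adj_shift k f t))) (\<lambda>t. of_real (cmod (h t))))"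
      unfolding c L2_inner_def by (subst integral_Re[symmetric]) (auto intro!: L2_inner_integrable adj_shift' simp del: complex_cnj_complex_of_real)
    also have "\<dots> \<le> weight k * (L2_norm (\<lambda>t. of_real (cmod (adj_shift k f t))) * L2_norm (\<lambda>t. of_real (cmod (h t))))"
      using L2_Cauchy_Schwarz[OF adj_shift'] complex_Re_le_cmod order_trans by (intro mult_left_mono weight_nonneg) blast
    also have "L2_norm (\<lambda>t. of_real (cmod (adj_shift k f t))) = L2_norm (adj_shift k f)"
      by (rule L2_norm_cmod)
    also have "L2_norm (\<lambda>t. of_real (cmod (h t))) = L2_norm h"
      by (rule L2_norm_cmod)
    finally show ?thesis by (simp add: adj_shift_norm[OF f])
  qed
  have gs: "(\<lambda>k. LINT t|lborel. cmod (g k t)) summable_on UNIV"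
    by (rule summable_on_comparison_test[OF summable_on_cmult_left[OF has_sum_imp_summable[OF weight_sum], of "L2_norm f * L2_norm h"]])
       (use gn in auto)
  have "(\<Sum>\<^sub>\<infinity>k. g k t) = janssen_op f t * cnj (h t)" for t
    by (simp add: g_def janssen_op_def mult.assoc[symmetric] infsum_cmult_left')
  then have "((\<lambda>k. LINT t|lborel. g k t) has_sum L2_inner (janssen_op f) h) UNIV"
    using integral_has_sum[OF infinite_UNIV_int_prod gi gs] by (simp add: L2_inner_def)
  moreover have "(LINT t|lborel. g k t) = of_real (weight k) * L2_inner (adj_shift k f) h" for k
    by (simp add: g_def L2_inner_def)
  ultimately show ?thesis by simp
qed

lemma janssen_op_bound:
  assumes f: "f \<in> L2" and h: "h \<in> L2"
  shows "cmod (L2_inner (janssen_op f) h) \<le> cubic_a nome * (L2_norm f * L2_norm h)"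
proof (rule norm_infsum_le[OF janssen_op_inner[OF f h] has_sum_cmult_left[OF weight_sum]])
  show "cmod (of_real (weight k) * L2_inner (adj_shift k f) h) \<le> weight k * (L2_norm f * L2_norm h)" for k
    using adj_shift_inner_bound[OF f h, of k] weight_nonneg[of k] by (simp add: norm_mult mult_left_mono)
qed

section \<open>Janssen's identity and the Bessel bound\<close>

definition gcoef :: "(real \<Rightarrow> complex) \<Rightarrow> int \<times> int \<Rightarrow> complex" where
  "gcoef f k = L2_inner f (tf_shift (lattice_pt k) gaussian)"

lemma gcoef_add: "f \<in> L2 \<Longrightarrow> g \<in> L2 \<Longrightarrow> gcoef (\<lambda>t. f t + g t) k = gcoef f k + gcoef g k"
  by (simp add: gcoef_def L2_inner_add_left tf_shift_L2 gaussian_L2)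

lemma gcoef_diff: "f \<in> L2 \<Longrightarrow> g \<in> L2 \<Longrightarrow> gcoef (\<lambda>t. f t - g t) k = gcoef f k - gcoef g k"
  by (simp add: gcoef_def L2_inner_diff_left tf_shift_L2 gaussian_L2)

lemma gcoef_cmult: "gcoef (\<lambda>t. c * f t) k = c * gcoef f k"
  by (simp add: gcoef_def L2_inner_cmult_left)

lemma cnj_gaussian [simp]: "cnj (gaussian t) = gaussian t"
  by (simp add: gaussian_def)

abbreviation mgauss :: "real \<Rightarrow> real \<Rightarrow> complex" where
  "mgauss w \<equiv> (\<lambda>t. cis (2 * pi * w * t) * gaussian t)"

lemma gcoef_mgauss:
  "gcoef (mgauss w) k = cis (pi * (w - s * hy k) * (r * hx k)) * of_real (exp (- (pi / 2 * ((r * hx k)\<^sup>2 + (w - s * hy k)\<^sup>2))))"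
proof -
  have "mgauss w t * cnj (tf_shift (lattice_pt k) gaussian t) = cis (2 * pi * (w - s * hy k) * t) * (gaussian t * gaussian (t - r * hx k))" for t
  proof -
    have "2 * pi * w * t + - (2 * pi * (s * hy k) * t) = 2 * pi * (w - s * hy k) * t" by (simp add: algebra_simps)
    then have "cis (2 * pi * (w - s * hy k) * t) = cis (2 * pi * w * t) * cis (- (2 * pi * (s * hy k) * t))"
      by (simp only: cis_mult)
    then show ?thesis by (simp add: tf_shift_cis cis_cnj mult_ac)
  qed
  then show ?thesis unfolding gcoef_def L2_inner_def by (simp only: ambiguity_gaussian)
qed

lemma adj_shift_mgauss:
  "L2_inner (adj_shift k (mgauss w)) (mgauss v) = cis (- (pi * (w + v) * (hx k / s))) *
     of_real (exp (- (pi / 2 * ((hx k / s)\<^sup>2 + (hy k / r + (w - v))\<^sup>2))))"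
proof -
  have "adj_shift k (mgauss w) t * cnj (mgauss v t) = (phase_sign (snd k) * cis (- (2 * pi * w * (hx k / s)))) *
      (cis (2 * pi * (hy k / r + (w - v)) * t) * (gaussian t * gaussian (t - hx k / s)))" for t
  proof -
    have "2 * pi * (hy k / r) * t + 2 * pi * w * (t - hx k / s) + - (2 * pi * v * t)
      = - (2 * pi * w * (hx k / s)) + 2 * pi * (hy k / r + (w - v)) * t" by (simp add: algebra_simps)
    then have "cis (2 * pi * (hy k / r) * t) * cis (2 * pi * w * (t - hx k / s)) * cis (- (2 * pi * v * t))
      = cis (- (2 * pi * w * (hx k / s))) * cis (2 * pi * (hy k / r + (w - v)) * t)"
      by (simp only: cis_mult)
    then have "phase_sign (snd k) * gaussian (t - hx k / s) * gaussian t * (cis (2 * pi * (hy k / r) * t) * cis (2 * pi * w * (t - hx k / s)) * cis (- (2 * pi * v * t)))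
      = phase_sign (snd k) * gaussian (t - hx k / s) * gaussian t * (cis (- (2 * pi * w * (hx k / s))) * cis (2 * pi * (hy k / r + (w - v)) * t))"
      by (simp only:)
    then show ?thesis unfolding adj_shift_def complex_cnj_mult cis_cnj cnj_gaussian by (simp only: mult_ac)
  qed
  then have "L2_inner (adj_shift k (mgauss w)) (mgauss v) = (phase_sign (snd k) * cis (- (2 * pi * w * (hx k / s)))) *
      (cis (pi * (hy k / r + (w - v)) * (hx k / s)) * of_real (exp (- (pi / 2 * ((hx k / s)\<^sup>2 + (hy k / r + (w - v))\<^sup>2)))))"
    unfolding L2_inner_def by (simp only: integral_mult_right_zero ambiguity_gaussian)
  \<comment> \<open>The number hy/r * hx/s is an integer of the same parity as \<open>snd k\<close>,
    since K is odd. The resulting sign cancels the one built into \<open>adj_shift\<close>.\<close>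
  also have "cis (pi * (hy k / r + (w - v)) * (hx k / s)) = phase_sign (snd k) * cis (pi * (w - v) * (hx k / s))"
  proof -
    have "hy k / r * (hx k / s) = density * (hy k * hx k)"
      using scales(3) scales(1,2) density_pos by (simp add: field_simps)
    also have "\<dots> = real K * of_int (snd k * (2 * fst k + snd k))"
      by (simp add: density_def hy_def hx_def algebra_simps)
    finally have e: "hy k / r * (hx k / s) = of_int (int K * (snd k * (2 * fst k + snd k)))" by simp
    have "cis (pi * of_int (int K * (snd k * (2 * fst k + snd k)))) = phase_sign (snd k)"
    proof (cases "even (snd k)")
      case True
      then have "even (int K * (snd k * (2 * fst k + snd k)))" by simp
      then obtain j where "int K * (snd k * (2 * fst k + snd k)) = 2 * j" by (elim evenE)
      then have "pi * of_int (int K * (snd k * (2 * fst k + snd k))) = 2 * pi * of_int j" by simp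
      then have "cis (pi * of_int (int K * (snd k * (2 * fst k + snd k)))) = 1" by (simp only:) (rule cis_multiple_2pi, simp)
      then show ?thesis using True by (simp add: phase_sign_def)
    next
      case False
      then have "odd (int K * (snd k * (2 * fst k + snd k)))" using odd_K by simp
      then obtain j where "int K * (snd k * (2 * fst k + snd k)) = 2 * j + 1" by (elim oddE)
      then have "pi * of_int (int K * (snd k * (2 * fst k + snd k))) = 2 * pi * of_int j + pi"
        by (simp add: algebra_simps)
      then have "cis (pi * of_int (int K * (snd k * (2 * fst k + snd k)))) = cis (2 * pi * of_int j) * cis pi"
        by (simp only: cis_mult)
      also have "cis (2 * pi * of_int j) = 1" by (rule cis_multiple_2pi) simp
      finally show ?thesis using False by (simp add: phase_sign_def)
    qed
    moreover have "pi * (hy k / r + (w - v)) * (hx k / s) = pi * (hy k / r * (hx k / s)) + pi * (w - v) * (hx k / s)"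
      by (simp only: distrib_left distrib_right mult.assoc)
    ultimately show ?thesis unfolding e by (simp only: cis_mult[symmetric])
  qed
  also have "(phase_sign (snd k) * cis (- (2 * pi * w * (hx k / s)))) * ((phase_sign (snd k) * cis (pi * (w - v) * (hx k / s))) * c)
     = cis (- (pi * (w + v) * (hx k / s))) * c" for c
  proof -
    have "- (2 * pi * w * (hx k / s)) + pi * (w - v) * (hx k / s) = - (pi * (w + v) * (hx k / s))"
      by (simp add: algebra_simps)
    then have "cis (- (2 * pi * w * (hx k / s))) * cis (pi * (w - v) * (hx k / s)) = cis (- (pi * (w + v) * (hx k / s)))"
      by (simp only: cis_mult)
    then have "(phase_sign (snd k) * phase_sign (snd k)) * (cis (- (2 * pi * w * (hx k / s))) * cis (pi * (w - v) * (hx k / s))) * c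
      = cis (- (pi * (w + v) * (hx k / s))) * c" by (simp only: phase_sign_sq mult_1)
    then show ?thesis by (simp only: mult_ac)
  qed
  finally show ?thesis .
qed

text \<open>After the factor exp (- pi d^2 / 4) is taken out, both sides are Gaussian sums over the
  lattice and its dual, with u the mean and d the difference of the frequencies; hexagonal Poisson
  summation relates them, and 1/(r s) supplies the density.\<close>

lemma janssen_mgauss:
  "((\<lambda>k. gcoef (mgauss w) k * cnj (gcoef (mgauss v) k)) has_sum of_real density * L2_inner (janssen_op (mgauss w)) (mgauss v)) UNIV"
proof -
  define d where "d = w - v"
  define u where "u = (w + v) / 2"
  define e where "e = complex_of_real (exp (- (pi / 4 * d\<^sup>2)))"
  define PL where "PL = (\<lambda>(m::int, n::int). complex_of_real (exp (- (pi * (r * (of_int m + of_int n / 2))\<^sup>2)) * exp (- (pi * (s * of_int n - u)\<^sup>2)))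
         * cis (pi * d * r * (of_int m + of_int n / 2)))"
  define PR where "PR = (\<lambda>(m::int, n::int). complex_of_real (exp (- (pi * ((of_int m + of_int n / 2) / s)\<^sup>2)) * exp (- (pi * (of_int n / r + d / 2)\<^sup>2)))
         * cis (- (2 * pi * u * ((of_int m + of_int n / 2) / s))))"
  have P: "infsum PL UNIV = of_real density * infsum PR UNIV"
    using poisson_hex[OF scales(1,2), of u d] unfolding PL_def PR_def scales(3) by simp
  have L: "gcoef (mgauss w) k * cnj (gcoef (mgauss v) k) = e * PL k" for k
  proof -
    have 1: "exp (- (pi / 2 * ((r * hx k)\<^sup>2 + (w - s * hy k)\<^sup>2))) * exp (- (pi / 2 * ((r * hx k)\<^sup>2 + (v - s * hy k)\<^sup>2)))
       = exp (- (pi / 4 * d\<^sup>2)) * (exp (- (pi * (r * hx k)\<^sup>2)) * exp (- (pi * (s * hy k - u)\<^sup>2)))"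
    proof -
      have "(w - s * hy k)\<^sup>2 + (v - s * hy k)\<^sup>2 = d\<^sup>2 / 2 + 2 * (s * hy k - u)\<^sup>2"
        by (simp add: d_def u_def power2_eq_square field_simps)
      then have "pi / 2 * ((r * hx k)\<^sup>2 + (w - s * hy k)\<^sup>2) + pi / 2 * ((r * hx k)\<^sup>2 + (v - s * hy k)\<^sup>2)
        = pi / 2 * (2 * (r * hx k)\<^sup>2 + (d\<^sup>2 / 2 + 2 * (s * hy k - u)\<^sup>2))"
        unfolding distrib_left[symmetric] by (intro arg_cong[of _ _ "(*) (pi / 2)"]) linarith
      also have "\<dots> = pi / 4 * d\<^sup>2 + (pi * (r * hx k)\<^sup>2 + pi * (s * hy k - u)\<^sup>2)" by (simp add: distrib_left)
      finally show ?thesis unfolding exp_add[symmetric] by (intro arg_cong[of _ _ exp]) linarith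
    qed
    have 2: "cis (pi * (w - s * hy k) * (r * hx k)) * cis (- (pi * (v - s * hy k) * (r * hx k))) = cis (pi * d * r * hx k)"
      unfolding cis_mult by (rule arg_cong[of _ _ cis]) (simp add: d_def algebra_simps)
    have "gcoef (mgauss w) k * cnj (gcoef (mgauss v) k) = (cis (pi * (w - s * hy k) * (r * hx k)) * cis (- (pi * (v - s * hy k) * (r * hx k)))) *
      of_real (exp (- (pi / 2 * ((r * hx k)\<^sup>2 + (w - s * hy k)\<^sup>2))) * exp (- (pi / 2 * ((r * hx k)\<^sup>2 + (v - s * hy k)\<^sup>2))))"
      unfolding gcoef_mgauss complex_cnj_mult cis_cnj complex_cnj_complex_of_real of_real_mult by (simp only: mult_ac)
    also have "\<dots> = e * PL k"
      unfolding 1 2 by (simp only: PL_def case_prod_beta hx_def hy_def e_def of_real_mult mult_ac)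
    finally show ?thesis .
  qed
  have R: "of_real (weight k) * L2_inner (adj_shift k (mgauss w)) (mgauss v) = e * PR k" for k
  proof -
    have 1: "weight k * exp (- (pi / 2 * ((hx k / s)\<^sup>2 + (hy k / r + (w - v))\<^sup>2)))
       = exp (- (pi / 4 * d\<^sup>2)) * (exp (- (pi * (hx k / s)\<^sup>2)) * exp (- (pi * (hy k / r + d / 2)\<^sup>2)))"
      unfolding weight_exp exp_add[symmetric] d_def[symmetric] by (rule arg_cong[of _ _ exp]) (simp add: power2_eq_square algebra_simps add_divide_distrib)
    have 2: "- (pi * (w + v) * (hx k / s)) = - (2 * pi * u * (hx k / s))" by (simp add: u_def)
    have "of_real (weight k) * L2_inner (adj_shift k (mgauss w)) (mgauss v) = cis (- (pi * (w + v) * (hx k / s))) *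
        of_real (weight k * exp (- (pi / 2 * ((hx k / s)\<^sup>2 + (hy k / r + (w - v))\<^sup>2))))"
      unfolding adj_shift_mgauss of_real_mult by (simp only: mult_ac)
    also have "\<dots> = e * PR k"
      unfolding 1 2 by (simp only: PR_def case_prod_beta hx_def hy_def e_def of_real_mult mult_ac)
    finally show ?thesis .
  qed
  have PLs: "PL summable_on UNIV"
  proof (rule summable_on_norm_le)
    show "(\<lambda>(m::int, n::int). exp (- (pi * r\<^sup>2 * (of_int m + of_int n / 2)\<^sup>2)) * exp (- (pi * s\<^sup>2 * (of_int n + (- u / s))\<^sup>2))) summable_on UNIV"
      by (rule summable_gauss_hex) (use scales(1,2) in simp_all)
    fix k :: "int \<times> int"
    have "s\<^sup>2 * (of_int n + (- u / s))\<^sup>2 = (s * of_int n - u)\<^sup>2" for n :: int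
      unfolding power_mult_distrib[symmetric] using scales(2) by (intro arg_cong[of _ _ "\<lambda>x. x\<^sup>2"]) (simp add: right_diff_distrib)
    then show "cmod (PL k) \<le> (case k of (m, n) \<Rightarrow> exp (- (pi * r\<^sup>2 * (of_int m + of_int n / 2)\<^sup>2)) * exp (- (pi * s\<^sup>2 * (of_int n + (- u / s))\<^sup>2)))"
      by (simp add: PL_def case_prod_beta norm_mult power_mult_distrib mult.assoc)
  qed
  have m: "mgauss x \<in> L2" for x
    using gauss_span_L2[OF gauss_span.monom[of 1 x]] by simp
  have "L2_inner (janssen_op (mgauss w)) (mgauss v) = (\<Sum>\<^sub>\<infinity>k. e * PR k)"
    using infsumI[OF janssen_op_inner[OF m m, of w v]] unfolding R by simp
  then have "of_real density * L2_inner (janssen_op (mgauss w)) (mgauss v) = e * infsum PL UNIV"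
    unfolding P infsum_cmult_right' by (simp only: mult_ac)
  then show ?thesis
    unfolding L using has_sum_cmult_right[OF has_sum_infsum[OF PLs], of e] by (simp only:)
qed

lemma janssen_op_inner_add_left: "f \<in> L2 \<Longrightarrow> g \<in> L2 \<Longrightarrow> h \<in> L2 \<Longrightarrow>
    L2_inner (janssen_op (\<lambda>t. f t + g t)) h = L2_inner (janssen_op f) h + L2_inner (janssen_op g) h"
proof -
  assume L: "f \<in> L2" "g \<in> L2" "h \<in> L2"
  have adj_shift: "adj_shift k (\<lambda>t. f t + g t) = (\<lambda>t. adj_shift k f t + adj_shift k g t)" for k by (simp add: adj_shift_def distrib_left)
  have "((\<lambda>k. of_real (weight k) * L2_inner (adj_shift k f) h + of_real (weight k) * L2_inner (adj_shift k g) h) has_sum L2_inner (janssen_op (\<lambda>t. f t + g t)) h) UNIV"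
    using janssen_op_inner[OF L2_add[OF L(1,2)] L(3)] L by (simp add: adj_shift L2_inner_add_left adj_shift_L2 distrib_left)
  then show ?thesis
    using has_sum_unique has_sum_add[OF janssen_op_inner[OF L(1,3)] janssen_op_inner[OF L(2,3)]] by blast
qed

lemma janssen_op_cmult: "janssen_op (\<lambda>t. c * f t) = (\<lambda>t. c * janssen_op f t)"
proof
  fix t
  have "of_real (weight k) * adj_shift k (\<lambda>t. c * f t) t = c * (of_real (weight k) * adj_shift k f t)" for k
    by (simp add: adj_shift_def)
  then show "janssen_op (\<lambda>t. c * f t) t = c * janssen_op f t" by (simp only: janssen_op_def infsum_cmult_right')
qed

lemma janssen_op_inner_diff_left: "f \<in> L2 \<Longrightarrow> g \<in> L2 \<Longrightarrow> h \<in> L2 \<Longrightarrow>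
    L2_inner (janssen_op (\<lambda>t. f t - g t)) h = L2_inner (janssen_op f) h - L2_inner (janssen_op g) h"
  using janssen_op_inner_add_left[of f "\<lambda>t. - 1 * g t" h] janssen_op_cmult[of "- 1" g] L2_cmult[of g "-1"]
    L2_inner_cmult_left[of "-1" "janssen_op g" h] by simp

lemma janssen_span:
  assumes "gauss_span f" "gauss_span h"
  shows "((\<lambda>k. gcoef f k * cnj (gcoef h k)) has_sum of_real density * L2_inner (janssen_op f) h) UNIV"
  using assms
proof (induction f arbitrary: h)
  case (monom c w)
  from monom show ?case
  proof (induction h)
    case (monom d v)
    have "((\<lambda>k. (c * cnj d) * (gcoef (mgauss w) k * cnj (gcoef (mgauss v) k))) has_sum (c * cnj d) * (of_real density * L2_inner (janssen_op (mgauss w)) (mgauss v))) UNIV"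
      by (rule has_sum_cmult_right[OF janssen_mgauss])
    then show ?case
      unfolding janssen_op_cmult L2_inner_cmult_left L2_inner_cmult_right gcoef_cmult complex_cnj_mult by (simp only: mult_ac)
  next
    case (add h1 h2)
    note L = gauss_span_L2[OF add.hyps(1)] gauss_span_L2[OF add.hyps(2)] gauss_span_L2[OF gauss_span.monom[of c w]]
    show ?case
      using has_sum_add[OF add.IH] unfolding L2_inner_add_right[OF L(1,2) janssen_op_L2[OF L(3)]]
      by (simp only: gcoef_add[OF L(1,2)] complex_cnj_add distrib_left)
  qed
next
  case (add f1 f2)
  note L = gauss_span_L2[OF add.hyps(1)] gauss_span_L2[OF add.hyps(2)] gauss_span_L2[OF add.prems]
  show ?case
    using has_sum_add[OF add.IH(1)[OF add.prems] add.IH(2)[OF add.prems]] unfolding janssen_op_inner_add_left[OF L]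
    by (simp only: gcoef_add[OF L(1,2)] distrib_left distrib_right)
qed

definition bessel_const :: real where "bessel_const = density * cubic_a nome"

lemma bessel_const_nonneg: "bessel_const \<ge> 0"
  unfolding bessel_const_def using density_pos has_sum_nonneg[OF weight_sum] weight_nonneg by simp

lemma janssen_op_bound': "f \<in> L2 \<Longrightarrow> h \<in> L2 \<Longrightarrow> cmod (of_real density * L2_inner (janssen_op f) h) \<le> bessel_const * (L2_norm f * L2_norm h)"
  using mult_left_mono[OF janssen_op_bound, of f h density] density_pos by (simp add: norm_mult bessel_const_def mult.assoc)

lemma cnj_mult_self: "z * cnj z = of_real ((cmod z)\<^sup>2)"
  by (simp only: complex_norm_square)

lemma bessel_span:
  assumes d: "gauss_span d" and F: "finite F"
  shows "(\<Sum>k\<in>F. (cmod (gcoef d k))\<^sup>2) \<le> bessel_const * (L2_norm d)\<^sup>2"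
proof -
  have "((\<lambda>k. (cmod (gcoef d k))\<^sup>2) has_sum Re (of_real density * L2_inner (janssen_op d) d)) UNIV"
    using has_sum_Re[OF janssen_span[OF d d]] unfolding cnj_mult_self Re_complex_of_real .
  then have "(\<Sum>k\<in>F. (cmod (gcoef d k))\<^sup>2) \<le> Re (of_real density * L2_inner (janssen_op d) d)"
    by (rule finite_sum_le_has_sum) (use F in auto)
  also have "\<dots> \<le> bessel_const * (L2_norm d * L2_norm d)"
    by (rule order_trans[OF complex_Re_le_cmod janssen_op_bound']) (intro gauss_span_L2 d)+
  finally show ?thesis by (simp add: power2_eq_square)
qed

text \<open>On a finite set the coefficients depend continuously on f, so the bound passes from the
  dense span to all f. The approximation error grows with the size of F, but is removed before F
  varies; the constant does not depend on F.\<close>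

lemma bessel_finite:
  assumes f: "f \<in> L2" and F: "finite F"
  shows "(\<Sum>k\<in>F. (cmod (gcoef f k))\<^sup>2) \<le> bessel_const * (L2_norm f)\<^sup>2"
proof -
  define M where "M = real (card F) * L2_norm gaussian"
  have M: "M \<ge> 0" by (simp add: M_def)
  have "L2_set (\<lambda>k. cmod (gcoef f k)) F \<le> sqrt bessel_const * L2_norm f"
  proof (rule real_le_epsilon_mult[of "sqrt bessel_const + M"])
    show "0 \<le> sqrt bessel_const + M" using M bessel_const_nonneg by simp
    fix e :: real assume e: "e > 0"
    obtain d where d: "gauss_span d" "d \<in> L2" "L2_norm (\<lambda>t. f t - d t) < e" "L2_norm d \<le> L2_norm f + e"
      using gauss_span_approx[OF f e] .
    have "L2_set (\<lambda>k. cmod (gcoef f k)) F \<le> L2_set (\<lambda>k. cmod (gcoef d k) + cmod (gcoef (\<lambda>t. f t - d t) k)) F"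
    proof (rule L2_set_mono)
      show "cmod (gcoef f k) \<le> cmod (gcoef d k) + cmod (gcoef (\<lambda>t. f t - d t) k)" for k
        unfolding gcoef_diff[OF f d(2)] using norm_triangle_ineq[of "gcoef d k" "gcoef f k - gcoef d k"] by simp
    qed simp
    also have "\<dots> \<le> L2_set (\<lambda>k. cmod (gcoef d k)) F + L2_set (\<lambda>k. cmod (gcoef (\<lambda>t. f t - d t) k)) F"
      by (rule L2_set_triangle_ineq)
    also have "L2_set (\<lambda>k. cmod (gcoef d k)) F \<le> sqrt (bessel_const * (L2_norm d)\<^sup>2)"
      unfolding L2_set_def by (intro real_sqrt_le_mono bessel_span d F)
    also have "sqrt (bessel_const * (L2_norm d)\<^sup>2) \<le> sqrt bessel_const * (L2_norm f + e)"
      using d(4) bessel_const_nonneg by (simp add: real_sqrt_mult mult_left_mono)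
    also have "L2_set (\<lambda>k. cmod (gcoef (\<lambda>t. f t - d t) k)) F \<le> (\<Sum>k\<in>F. cmod (gcoef (\<lambda>t. f t - d t) k))"
      by (rule L2_set_le_sum) simp
    also have "\<dots> \<le> (\<Sum>k\<in>F. e * L2_norm gaussian)"
    proof (rule sum_mono)
      fix k
      have "cmod (gcoef (\<lambda>t. f t - d t) k) \<le> L2_norm (\<lambda>t. f t - d t) * L2_norm (tf_shift (lattice_pt k) gaussian)"
        unfolding gcoef_def by (intro L2_Cauchy_Schwarz L2_diff f d tf_shift_L2 gaussian_L2)
      also have "L2_norm (tf_shift (lattice_pt k) gaussian) = L2_norm gaussian"
        unfolding tf_shift_cis by (rule L2_norm_unimodular_shift) (auto intro: gaussian_L2)
      also have "L2_norm (\<lambda>t. f t - d t) * L2_norm gaussian \<le> e * L2_norm gaussian"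
        using d(3) by (intro mult_right_mono) auto
      finally show "cmod (gcoef (\<lambda>t. f t - d t) k) \<le> e * L2_norm gaussian" .
    qed
    finally show "L2_set (\<lambda>k. cmod (gcoef f k)) F \<le> sqrt bessel_const * L2_norm f + e * (sqrt bessel_const + M)"
      by (simp add: M_def algebra_simps)
  qed
  then have "(L2_set (\<lambda>k. cmod (gcoef f k)) F)\<^sup>2 \<le> (sqrt bessel_const * L2_norm f)\<^sup>2"
    by (intro power_mono L2_set_nonneg)
  then show ?thesis using bessel_const_nonneg by (simp add: L2_set_def power_mult_distrib sum_nonneg)
qed

lemma
  assumes f: "f \<in> L2"
  shows bessel_summable: "(\<lambda>k. (cmod (gcoef f k))\<^sup>2) summable_on UNIV"
    and bessel_infsum: "(\<Sum>\<^sub>\<infinity>k. (cmod (gcoef f k))\<^sup>2) \<le> bessel_const * (L2_norm f)\<^sup>2"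
proof -
  show s: "(\<lambda>k. (cmod (gcoef f k))\<^sup>2) summable_on UNIV"
    by (rule nonneg_bdd_above_summable_on) (use bessel_finite[OF f] in \<open>auto intro!: bdd_aboveI\<close>)
  show "(\<Sum>\<^sub>\<infinity>k. (cmod (gcoef f k))\<^sup>2) \<le> bessel_const * (L2_norm f)\<^sup>2"
    by (rule infsum_le_finite_sums[OF s bessel_finite[OF f]])
qed

lemma
  assumes f: "f \<in> L2" and h: "h \<in> L2"
  shows gcoef_product_summable: "(\<lambda>k. gcoef f k * cnj (gcoef h k)) summable_on UNIV"
    and gcoef_product_bound: "cmod (\<Sum>\<^sub>\<infinity>k. gcoef f k * cnj (gcoef h k)) \<le> bessel_const * (L2_norm f * L2_norm h)"
proof -
  have h': "(\<lambda>k. (cmod (cnj (gcoef h k)))\<^sup>2) summable_on UNIV" using bessel_summable[OF h] by simp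
  show "(\<lambda>k. gcoef f k * cnj (gcoef h k)) summable_on UNIV"
    by (rule summable_on_l2_product[OF bessel_summable[OF f] h'])
  have "(cmod (\<Sum>\<^sub>\<infinity>k. gcoef f k * cnj (gcoef h k)))\<^sup>2
      \<le> (\<Sum>\<^sub>\<infinity>k. (cmod (gcoef f k))\<^sup>2) * (\<Sum>\<^sub>\<infinity>k. (cmod (gcoef h k))\<^sup>2)"
    using infsum_l2_Cauchy_Schwarz[OF bessel_summable[OF f] h'] by simp
  also have "\<dots> \<le> (bessel_const * (L2_norm f)\<^sup>2) * (bessel_const * (L2_norm h)\<^sup>2)"
    using bessel_const_nonneg by (intro mult_mono bessel_infsum f h infsum_nonneg) auto
  also have "\<dots> = (bessel_const * (L2_norm f * L2_norm h))\<^sup>2" by (simp add: power2_eq_square mult_ac)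
  finally show "cmod (\<Sum>\<^sub>\<infinity>k. gcoef f k * cnj (gcoef h k)) \<le> bessel_const * (L2_norm f * L2_norm h)"
    by (rule power2_le_imp_le) (use bessel_const_nonneg in simp)
qed

text \<open>The Bessel bound makes the coefficient form bounded on all of L2. The difference
  \<open>E\<close> of the two sides is then a bounded sesquilinear form that vanishes on a dense
  span.\<close>

lemma janssen:
  assumes f: "f \<in> L2" and h: "h \<in> L2"
  shows "((\<lambda>k. gcoef f k * cnj (gcoef h k)) has_sum of_real density * L2_inner (janssen_op f) h) UNIV"
proof -
  define E where "E f h = (\<Sum>\<^sub>\<infinity>k. gcoef f k * cnj (gcoef h k)) - of_real density * L2_inner (janssen_op f) h" for f h
  have bd: "cmod (E f h) \<le> 2 * bessel_const * (L2_norm f * L2_norm h)" if "f \<in> L2" "h \<in> L2" for f h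
    unfolding E_def using norm_triangle_ineq4[of "\<Sum>\<^sub>\<infinity>k. gcoef f k * cnj (gcoef h k)" "of_real density * L2_inner (janssen_op f) h"]
      gcoef_product_bound[OF that] janssen_op_bound'[OF that] by linarith
  have E1: "E (\<lambda>t. f t - g t) h = E f h - E g h" if "f \<in> L2" "g \<in> L2" "h \<in> L2" for f g h
    unfolding E_def janssen_op_inner_diff_left[OF that] gcoef_diff[OF that(1,2)] left_diff_distrib right_diff_distrib
    by (subst infsum_diff) (use gcoef_product_summable that in \<open>auto simp: algebra_simps\<close>)
  have E2: "E h (\<lambda>t. f t - g t) = E h f - E h g" if "f \<in> L2" "g \<in> L2" "h \<in> L2" for f g h
    unfolding E_def L2_inner_diff_right[OF that(1,2) janssen_op_L2[OF that(3)]] gcoef_diff[OF that(1,2)] complex_cnj_diff right_diff_distrib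
    by (subst infsum_diff) (use gcoef_product_summable that in \<open>auto simp: algebra_simps\<close>)
  have E0: "E d d' = 0" if "gauss_span d" "gauss_span d'" for d d'
    unfolding E_def using infsumI[OF janssen_span[OF that]] by simp
  have "cmod (E f h) \<le> 0"
  proof (rule real_le_epsilon_mult[of "2 * bessel_const * (L2_norm h + L2_norm f + 1)"])
    show "0 \<le> 2 * bessel_const * (L2_norm h + L2_norm f + 1)" using bessel_const_nonneg by simp
    fix e :: real assume e: "e > 0" "e \<le> 1"
    obtain d where d: "gauss_span d" "d \<in> L2" "L2_norm (\<lambda>t. f t - d t) < e" "L2_norm d \<le> L2_norm f + e"
      using gauss_span_approx[OF f e(1)] .
    obtain d' where d': "gauss_span d'" "d' \<in> L2" "L2_norm (\<lambda>t. h t - d' t) < e"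
      using gauss_span_approx[OF h e(1)] by blast
    have "E f h = E (\<lambda>t. f t - d t) h + E d (\<lambda>t. h t - d' t)"
      by (simp add: E1 E2 f h d d' E0)
    also have "cmod \<dots> \<le> 2 * bessel_const * (L2_norm (\<lambda>t. f t - d t) * L2_norm h) + 2 * bessel_const * (L2_norm d * L2_norm (\<lambda>t. h t - d' t))"
      by (intro norm_triangle_mono bd L2_diff f h d d')
    also have "\<dots> \<le> 2 * bessel_const * (e * L2_norm h) + 2 * bessel_const * ((L2_norm f + 1) * e)"
      using bessel_const_nonneg d d' e by (intro add_mono mult_left_mono mult_mono) auto
    finally show "cmod (E f h) \<le> 0 + e * (2 * bessel_const * (L2_norm h + L2_norm f + 1))"
      by (simp add: algebra_simps)
  qed
  then show ?thesis
    using has_sum_infsum[OF gcoef_product_summable[OF f h]] by (simp add: E_def)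
qed

section \<open>Identification of the frame operator\<close>

definition lattice_mat :: "real^2^2" where "lattice_mat = vector [vector [r, r / 2], vector [0, s]]"

lemma det_lattice_mat: "det lattice_mat = 1 / density"
  using scales(3) by (simp add: det_2 lattice_mat_def)

lemma invertible_lattice_mat: "invertible lattice_mat"
  using density_pos by (simp add: invertible_det_nz det_lattice_mat)

lemma s_eq: "s = r * (sqrt 3 / 2)"
proof -
  have "s\<^sup>2 = (r * (sqrt 3 / 2))\<^sup>2"
    unfolding power_mult_distrib scales power_divide using density_pos by (simp add: field_simps)
  then show ?thesis using scales(1,2) by (simp add: power2_eq_iff_nonneg)
qed

lemma range_lattice_pt: "range lattice_pt = lattice_of lattice_mat"
proof
  have e: "lattice_pt (m, n) = lattice_mat *v vector [of_int m, of_int n]" for m n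
    by (simp add: vec_eq_iff forall_2 matrix_vector_mult_def sum_2 lattice_mat_def hx_def hy_def algebra_simps)
  have "lattice_pt (m, n) \<in> lattice_of lattice_mat" for m n
    unfolding e lattice_of_def by (auto intro!: exI[of _ "vector [of_int m, of_int n] :: real^2"] simp: forall_2)
  then show "range lattice_pt \<subseteq> lattice_of lattice_mat" by auto
  show "lattice_of lattice_mat \<subseteq> range lattice_pt"
  proof
    fix p assume "p \<in> lattice_of lattice_mat"
    then obtain z where z: "p = lattice_mat *v z" "z $ 1 \<in> \<int>" "z $ 2 \<in> \<int>" by (auto simp: lattice_of_def)
    then obtain m n where mn: "z $ 1 = of_int m" "z $ 2 = of_int n" by (auto elim!: Ints_cases)
    have "z = vector [of_int m, of_int n]" using mn by (simp add: vec_eq_iff forall_2)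
    then show "p \<in> range lattice_pt" using z(1) e[of m n] by (metis rangeI)
  qed
qed

lemma hex_lattice_eq: "hex_lattice density = range lattice_pt"
proof -
  have c: "density powr (- 1 / 2) * sqrt (2 / sqrt 3) = r"
  proof -
    have "density powr (- 1 / 2) = 1 / sqrt density"
      using powr_minus_divide[of density "1/2"] powr_half_sqrt[of density] density_pos by simp
    moreover have "1 / sqrt density * sqrt (2 / sqrt 3) = r"
      unfolding r_def by (simp add: real_sqrt_divide real_sqrt_mult)
    ultimately show ?thesis by (simp only:)
  qed
  have "(density powr (- 1 / 2)) *\<^sub>R (hex_matrix *v z) = lattice_mat *v z" for z
  proof -
    have "(density powr (- 1 / 2)) *\<^sub>R (hex_matrix *v z) = r *\<^sub>R (vector [vector [1, 1/2], vector [0, sqrt 3 / 2]] *v z)"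
      unfolding hex_matrix_def scaleR_matrix_vector_assoc[symmetric] scaleR_scaleR c ..
    also have "\<dots> = lattice_mat *v z"
      using s_eq by (simp add: vec_eq_iff forall_2 matrix_vector_mult_def sum_2 lattice_mat_def distrib_left)
    finally show ?thesis .
  qed
  then show ?thesis
    unfolding range_lattice_pt hex_lattice_def lattice_of_def by (simp only: setcompr_eq_image image_image)
qed

lemma covolume_lattice_pt: "covolume (range lattice_pt) = 1 / density"
  unfolding range_lattice_pt covolume_lattice_of[OF invertible_lattice_mat] det_lattice_mat using density_pos by simp

lemma inj_lattice_pt: "inj lattice_pt"
proof (rule injI)
  fix k l assume "lattice_pt k = lattice_pt l"
  then have "lattice_pt k $ 1 = lattice_pt l $ 1" "lattice_pt k $ 2 = lattice_pt l $ 2" by simp_all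
  then have "hx k = hx l" "hy k = hy l" using scales(1,2) by simp_all
  then show "k = l" by (simp add: hx_def hy_def prod_eq_iff)
qed

text \<open>The identity is known only weakly. The remainder tested against h is at most the root of
  the coefficient tail times a multiple of the norm of h, uniformly in h; testing with the remainder
  itself upgrades this to convergence in norm.\<close>

lemma frame_series:
  assumes f: "f \<in> L2"
  shows "L2_has_sum (\<lambda>p t. L2_inner f (tf_shift p gaussian) * tf_shift p gaussian t) (range lattice_pt) (\<lambda>t. of_real density * janssen_op f t)"
proof -
  define c where "c = gcoef f"
  define S where "S F = (\<lambda>t. \<Sum>k\<in>F. c k * tf_shift (lattice_pt k) gaussian t)" for F
  define g where "g = (\<lambda>t. of_real density * janssen_op f t)"
  define e where "e F = (\<lambda>t. S F t - g t)" for F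
  define T where "T F = (\<Sum>\<^sub>\<infinity>k. (cmod (c k))\<^sup>2) - (\<Sum>k\<in>F. (cmod (c k))\<^sup>2)" for F
  have gL: "g \<in> L2" unfolding g_def by (intro L2_cmult janssen_op_L2 f)
  have SL: "S F \<in> L2" for F unfolding S_def by (intro L2_sum L2_cmult tf_shift_L2 gaussian_L2)
  have eL: "e F \<in> L2" for F unfolding e_def by (intro L2_diff SL gL)
  have T: "T F = (\<Sum>\<^sub>\<infinity>k\<in>- F. (cmod (c k))\<^sup>2)" if "finite F" for F
    unfolding T_def Compl_eq_Diff_UNIV c_def
    by (subst infsum_Diff) (use that bessel_summable[OF f] in auto)
  have eh: "(cmod (L2_inner (e F) h))\<^sup>2 \<le> T F * (bessel_const * (L2_norm h)\<^sup>2)" if F: "finite F" and h: "h \<in> L2" for F h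
  proof -
    define p where "p = (\<lambda>k. gcoef f k * cnj (gcoef h k))"
    have p: "(p has_sum of_real density * L2_inner (janssen_op f) h) UNIV" unfolding p_def by (rule janssen[OF f h])
    have "L2_inner (S F) h = (\<Sum>k\<in>F. c k * L2_inner (tf_shift (lattice_pt k) gaussian) h)"
      unfolding S_def by (subst L2_inner_sum_left) (auto intro: L2_cmult tf_shift_L2 gaussian_L2 h simp: L2_inner_cmult_left)
    also have "\<dots> = (\<Sum>k\<in>F. p k)"
      by (rule sum.cong) (simp_all add: p_def c_def gcoef_def flip: L2_inner_commute)
    finally have "L2_inner (e F) h = (\<Sum>k\<in>F. p k) - infsum p UNIV"
      using L2_inner_diff_left[OF SL gL h, of F] infsumI[OF p] L2_inner_cmult_left[of "of_real density" "janssen_op f" h]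
      by (simp add: e_def g_def)
    also have "\<dots> = - (\<Sum>\<^sub>\<infinity>k\<in>- F. gcoef f k * cnj (gcoef h k))"
      unfolding Compl_eq_Diff_UNIV p_def[symmetric]
      by (subst infsum_Diff) (use F has_sum_imp_summable[OF p] in \<open>auto simp: p_def\<close>)
    finally have 1: "cmod (L2_inner (e F) h) = cmod (\<Sum>\<^sub>\<infinity>k\<in>- F. gcoef f k * cnj (gcoef h k))" by simp
    have s: "(\<lambda>k. (cmod (gcoef f k))\<^sup>2) summable_on - F" "(\<lambda>k. (cmod (cnj (gcoef h k)))\<^sup>2) summable_on - F"
      using summable_on_subset_banach[OF bessel_summable[OF f], of "- F"] summable_on_subset_banach[OF bessel_summable[OF h], of "- F"] by simp_all
    have "(cmod (L2_inner (e F) h))\<^sup>2 \<le> T F * (\<Sum>\<^sub>\<infinity>k\<in>- F. (cmod (gcoef h k))\<^sup>2)"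
      using infsum_l2_Cauchy_Schwarz[OF s] unfolding 1 T[OF F] c_def by simp
    also have "\<dots> \<le> T F * (bessel_const * (L2_norm h)\<^sup>2)"
    proof (rule mult_left_mono)
      have "(\<Sum>\<^sub>\<infinity>k\<in>- F. (cmod (gcoef h k))\<^sup>2) \<le> (\<Sum>\<^sub>\<infinity>k. (cmod (gcoef h k))\<^sup>2)"
        by (rule infsum_mono_neutral) (use s bessel_summable[OF h] in auto)
      then show "(\<Sum>\<^sub>\<infinity>k\<in>- F. (cmod (gcoef h k))\<^sup>2) \<le> bessel_const * (L2_norm h)\<^sup>2"
        using bessel_infsum[OF h] by linarith
      show "0 \<le> T F" unfolding T[OF F] by (intro infsum_nonneg) simp
    qed
    finally show ?thesis .
  qed
  have en: "L2_norm (e F) \<le> sqrt (T F * bessel_const)" if F: "finite F" for F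
  proof (cases "L2_norm (e F) = 0")
    case True
    then show ?thesis using F bessel_const_nonneg by (simp add: T infsum_nonneg)
  next
    case False
    have "(L2_norm (e F))\<^sup>2 * (L2_norm (e F))\<^sup>2 \<le> (T F * bessel_const) * (L2_norm (e F))\<^sup>2"
      using eh[OF F eL[of F]] unfolding L2_inner_self_norm norm_of_real by (simp add: power2_eq_square mult_ac)
    then have "(L2_norm (e F))\<^sup>2 \<le> T F * bessel_const"
      by (rule mult_right_le_imp_le) (use False in simp)
    then show ?thesis by (rule real_le_rsqrt)
  qed
  have "(T \<longlongrightarrow> (\<Sum>\<^sub>\<infinity>k. (cmod (c k))\<^sup>2) - (\<Sum>\<^sub>\<infinity>k. (cmod (c k))\<^sup>2)) (finite_subsets_at_top UNIV)"
    unfolding T_def c_def by (intro tendsto_intros infsum_tendsto bessel_summable f)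
  then have "((\<lambda>F. sqrt (T F * bessel_const)) \<longlongrightarrow> sqrt (0 * bessel_const)) (finite_subsets_at_top UNIV)"
    by (intro tendsto_intros) simp
  then have lim: "((\<lambda>F. sqrt (T F * bessel_const)) \<longlongrightarrow> 0) (finite_subsets_at_top UNIV)" by simp
  have "((\<lambda>F. L2_norm (e F)) \<longlongrightarrow> 0) (finite_subsets_at_top UNIV)"
  proof (rule tendsto_sandwich[OF _ _ tendsto_const lim])
    show "\<forall>\<^sub>F F in finite_subsets_at_top UNIV. 0 \<le> L2_norm (e F)" by simp
    show "\<forall>\<^sub>F F in finite_subsets_at_top UNIV. L2_norm (e F) \<le> sqrt (T F * bessel_const)"
      by (rule eventually_finite_subsets_at_top_weakI) (rule en)
  qed
  moreover have "e F = (\<lambda>t. (\<Sum>p\<in>lattice_pt ` F. L2_inner f (tf_shift p gaussian) * tf_shift p gaussian t) - g t)" for F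
    unfolding e_def S_def c_def gcoef_def sum.reindex[OF inj_on_subset[OF inj_lattice_pt subset_UNIV]] o_def ..
  ultimately have "((\<lambda>F. L2_norm (\<lambda>t. (\<Sum>p\<in>lattice_pt ` F. L2_inner f (tf_shift p gaussian) * tf_shift p gaussian t) - g t)) \<longlongrightarrow> 0)
      (finite_subsets_at_top UNIV)"
    by (simp only:)
  \<comment> \<open>The net over finite sets of indices is carried to the net over finite subsets of
    the lattice by the injective parametrization.\<close>
  then show ?thesis
    unfolding L2_has_sum_def g_def[symmetric] filtermap_image_finite_subsets_at_top[OF inj_lattice_pt, symmetric] filterlim_filtermap
    using gL by (intro conjI)
qed

text \<open>The covolume 1/density cancels the factor from Janssen's identity. The chosen sum need
  not be \<open>janssen_op\<close> pointwise, but has the same inner products.\<close>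

lemma gabor_frame_form:
  assumes f: "f \<in> L2"
  shows "L2_inner (gabor_frame_op (hex_lattice density) f) f = L2_inner (janssen_op f) f"
proof -
  define u where "u = (\<lambda>p t. L2_inner f (tf_shift p gaussian) * tf_shift p gaussian t)"
  define g where "g = (SOME g. L2_has_sum u (range lattice_pt) g)"
  have S: "L2_has_sum u (range lattice_pt) (\<lambda>t. of_real density * janssen_op f t)"
    unfolding u_def by (rule frame_series[OF f])
  have g: "L2_has_sum u (range lattice_pt) g"
    unfolding g_def by (rule someI[of "L2_has_sum u (range lattice_pt)", OF S])
  have uL: "\<And>p. p \<in> range lattice_pt \<Longrightarrow> u p \<in> L2" unfolding u_def by (rule L2_cmult[OF tf_shift_L2[OF gaussian_L2]])
  have "L2_inner g f = L2_inner (\<lambda>t. of_real density * janssen_op f t) f"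
    by (rule L2_has_sum_unique[OF g S uL f])
  also have "\<dots> = of_real density * L2_inner (janssen_op f) f" by (rule L2_inner_cmult_left)
  finally have gf: "L2_inner g f = of_real density * L2_inner (janssen_op f) f" .
  have "gabor_frame_op (hex_lattice density) f = (\<lambda>t. of_real (1 / density) * g t)"
    unfolding gabor_frame_op_def hex_lattice_eq covolume_lattice_pt g_def u_def by (rule refl)
  then have "L2_inner (gabor_frame_op (hex_lattice density) f) f = L2_inner (\<lambda>t. of_real (1 / density) * g t) f"
    by (rule arg_cong)
  also have "\<dots> = of_real (1 / density) * L2_inner g f" by (rule L2_inner_cmult_left)
  finally show ?thesis using density_pos by (simp add: gf)
qed

section \<open>Spectral bounds and their sharpness\<close>

lemma nome_le: "nome \<le> 1 / 32"
proof -
  have K: "real K \<ge> 1" using odd_pos[OF odd_K] by simp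
  have s3: "sqrt 3 \<le> 1.74" by (rule real_le_lsqrt) (simp_all add: power2_eq_square)
  \<comment> \<open>At K = 1 the exponent 2 pi / sqrt 3 is about 3.63. The value 3.5 still suffices,
    because exp 7 is larger than 2.7^7, which exceeds 32^2.\<close>
  have "3.5 * sqrt 3 \<le> pi * 2" using s3 pi_approx by simp
  also have "\<dots> \<le> pi * density" using K by (intro mult_left_mono) (auto simp: density_def)
  finally have "3.5 \<le> pi * density / sqrt 3" by (simp add: pos_le_divide_eq)
  then have q: "nome \<le> exp (- 3.5)" unfolding nome_def by simp
  have "(2.7::real) \<le> exp 1" using e_approx_32 by (simp add: abs_if split: if_split_asm)
  then have "(2.7::real) ^ 7 \<le> exp 1 ^ 7" by (intro power_mono) auto
  also have "exp (1::real) ^ 7 = (exp 3.5)\<^sup>2" by (simp flip: exp_of_nat_mult)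
  finally have "(32::real)\<^sup>2 \<le> (exp 3.5)\<^sup>2" by (simp add: power2_eq_square eval_nat_numeral)
  then have "(32::real) \<le> exp 3.5" by (rule power2_le_imp_le) simp
  then have "exp (- 3.5) \<le> (1 / 32 :: real)" by (simp add: exp_minus field_simps)
  with q show ?thesis by linarith
qed

lemma weight_char_summable: "(\<lambda>k. of_real (weight k) * cis (dot2 a b k)) summable_on UNIV"
  by (rule summable_on_norm_le[OF has_sum_imp_summable[OF weight_sum]]) (simp add: norm_mult weight_nonneg)

lemma weight_char_infsum:
  "(\<Sum>\<^sub>\<infinity>k. of_real (weight k) * cis (dot2 a b k))
     = (\<Sum>\<^sub>\<infinity>(m, n)\<in>UNIV. of_real (nome powi hex_form m n) * cis (a * of_int m + b * of_int n))"
  by (intro infsum_cong) (simp add: weight_def dot2_def case_prod_unfold)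

lemma weight_infsum_0: "(\<Sum>\<^sub>\<infinity>k. of_real (weight k) * cis (dot2 0 0 k)) = of_real (cubic_a nome)"
  using infsumI[OF weight_sum] by (simp add: dot2_def infsum_of_real_complex)

text \<open>The character of the deep hole of the hexagonal lattice.\<close>

lemma weight_infsum_hole: "(\<Sum>\<^sub>\<infinity>k. of_real (weight k) * cis (dot2 (- (2 * pi / 3)) (2 * pi / 3) k)) = of_real (cubic_b nome)"
proof -
  have "cis (dot2 (- (2 * pi / 3)) (2 * pi / 3) k) = w3 (snd k - fst k)" for k
    unfolding w3_def by (rule arg_cong[of _ _ cis]) (simp add: dot2_def right_diff_distrib diff_divide_distrib)
  then show ?thesis
    unfolding cubic_b_sum(1)[OF nome_bounds(1)] by (simp add: weight_def case_prod_unfold)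
qed

lemma janssen_op_le: "f \<in> L2 \<Longrightarrow> Re (L2_inner (janssen_op f) f) \<le> cubic_a nome * (L2_norm f)\<^sup>2"
  using order_trans[OF complex_Re_le_cmod janssen_op_bound[of f f]] by (simp add: power2_eq_square)

text \<open>Lowering the coefficient at 0 by b makes the symbol nonnegative. Positivity of its
  Toeplitz forms is applied to the values U_k f(t) at each fixed t and integrated; dividing by the
  number of indices and letting the box grow recovers the quadratic form of the operator minus
  b.\<close>

lemma janssen_op_ge:
  assumes f: "f \<in> L2"
  shows "cubic_b nome * (L2_norm f)\<^sup>2 \<le> Re (L2_inner (janssen_op f) f)"
proof -
  define \<beta> where "\<beta> = complex_of_real (cubic_b nome)"
  define w where "w k = complex_of_real (weight k) - (if k = 0 then \<beta> else 0)" for k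
  have delta: "((\<lambda>k. if k = (0::int \<times> int) then c else 0) has_sum c) UNIV" for c :: complex
    by (rule has_sum_finite_neutralI[of "{0}"]) auto
  have ws: "w summable_on UNIV"
    unfolding w_def using has_sum_imp_summable[OF has_sum_minus[OF has_sum_infsum[OF weight_char_summable[of 0 0]] delta[of \<beta>]]]
    by (simp add: dot2_def)
  have pos: "0 \<le> Re (\<Sum>\<^sub>\<infinity>k. w k * cis (dot2 a b k))" for a b
  proof -
    have "w k * cis (dot2 a b k) = of_real (weight k) * cis (dot2 a b k) - (if k = 0 then \<beta> else 0)" for k
      by (simp add: w_def left_diff_distrib dot2_def)
    then have "(\<Sum>\<^sub>\<infinity>k. w k * cis (dot2 a b k)) = (\<Sum>\<^sub>\<infinity>k. of_real (weight k) * cis (dot2 a b k)) - \<beta>"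
      using infsum_diff[OF weight_char_summable has_sum_imp_summable[OF delta]] infsumI[OF delta] by simp
    then show ?thesis
      using hex_char_lower_bound[OF nome_bounds(1) nome_le, of a b] by (simp add: weight_char_infsum \<beta>_def)
  qed
  define p where "p k = w k * L2_inner (adj_shift k f) f" for k
  have p: "(p has_sum L2_inner (janssen_op f) f - \<beta> * L2_inner f f) UNIV"
  proof -
    have "p = (\<lambda>k. of_real (weight k) * L2_inner (adj_shift k f) f - (if k = 0 then \<beta> * L2_inner f f else 0))"
      by (rule ext) (simp add: p_def w_def left_diff_distrib adj_shift_0)
    then show ?thesis
      using has_sum_minus[OF janssen_op_inner[OF f f] delta[of "\<beta> * L2_inner f f"]] by (simp only:)
  qed
  have fin: "0 \<le> Re (\<Sum>k\<in>ibox N. \<Sum>l\<in>ibox N. p (k - l))" for N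
  proof -
    define q where "q t = (\<Sum>k\<in>ibox N. \<Sum>l\<in>ibox N. w (k - l) * (adj_shift k f t * cnj (adj_shift l f t)))" for t
    have i: "integrable lborel (\<lambda>t. w (k - l) * (adj_shift k f t * cnj (adj_shift l f t)))" for k l
      by (intro integrable_mult_right L2_inner_integrable adj_shift_L2 f)
    have qi: "integrable lborel q" unfolding q_def by (intro Bochner_Integration.integrable_sum i)
    have "(\<Sum>k\<in>ibox N. \<Sum>l\<in>ibox N. p (k - l)) = (\<Sum>k\<in>ibox N. \<Sum>l\<in>ibox N. LINT t|lborel. w (k - l) * (adj_shift k f t * cnj (adj_shift l f t)))"
      unfolding p_def unfolding adj_shift_inner_diff[symmetric] unfolding L2_inner_def by (simp only: integral_mult_right_zero)
    also have "\<dots> = (LINT t|lborel. q t)"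
      unfolding q_def by (simp add: Bochner_Integration.integral_sum Bochner_Integration.integrable_sum i del: integral_mult_right_zero)
    finally have "Re (\<Sum>k\<in>ibox N. \<Sum>l\<in>ibox N. p (k - l)) = (LINT t|lborel. Re (q t))"
      using integral_Re[OF qi] by simp
    also have "\<dots> \<ge> 0"
      unfolding q_def by (intro Bochner_Integration.integral_nonneg toeplitz_nonneg[OF ws pos finite_ibox])
    finally show ?thesis .
  qed
  have "0 \<le> Re (infsum p UNIV)"
  proof (rule tendsto_lowerbound[OF tendsto_Re[OF fejer_limit[OF has_sum_imp_summable[OF p]]]])
    show "\<forall>\<^sub>F N in sequentially. 0 \<le> Re ((\<Sum>k\<in>ibox N. \<Sum>l\<in>ibox N. p (k - l)) / of_nat (N * N))"
      using fin by (intro always_eventually allI) (simp del: of_nat_mult)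
  qed simp
  then show ?thesis unfolding infsumI[OF p] \<beta>_def L2_inner_self_norm by simp
qed

text \<open>The indicator function of the interval from 0 to r, closed on the left only. Its adjoint
  shifts are mutually orthogonal, so they behave like a standard basis on which the shifts act by
  translation of the index.\<close>

definition block :: "real \<Rightarrow> complex" where "block t = (if \<lfloor>t / r\<rfloor> = 0 then 1 else 0)"

lemma block_cis:
  shows "integrable lborel (\<lambda>t. if \<lfloor>t / r\<rfloor> = 0 then cis (2 * pi * of_int j * (t / r)) else 0)"
    and "(LINT t|lborel. (if \<lfloor>t / r\<rfloor> = 0 then cis (2 * pi * of_int j * (t / r)) else 0)) = (if j = 0 then of_real r else 0)"
proof -
  define u where "u t = (if \<lfloor>t\<rfloor> = 0 then cis (2 * pi * of_int j * t) else 0)" for t :: real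
  have c: "continuous_on UNIV (\<lambda>t. cis (2 * pi * of_int j * t))" by (intro continuous_intros)
  have e: "(if \<lfloor>t / r\<rfloor> = 0 then cis (2 * pi * of_int j * (t / r)) else 0) = u (0 + 1 / r * t)" for t
    by (simp add: u_def)
  have ui: "integrable lborel u" unfolding u_def by (rule integrable_unit[OF c])
  show "integrable lborel (\<lambda>t. if \<lfloor>t / r\<rfloor> = 0 then cis (2 * pi * of_int j * (t / r)) else 0)"
    unfolding e by (rule lborel_integrable_real_affine[OF ui]) (use scales(1) in simp)
  have "(LINT t|lborel. u t) = (if j = 0 then 1 else 0)"
    unfolding u_def integral_unit[OF c] by (rule integral_cis_unit)
  moreover have "(LINT t|lborel. u t) = (1 / r) *\<^sub>R (LINT t|lborel. u (0 + 1 / r * t))"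
    using lborel_integral_real_affine[of "1 / r" u 0] scales(1) by simp
  ultimately show "(LINT t|lborel. (if \<lfloor>t / r\<rfloor> = 0 then cis (2 * pi * of_int j * (t / r)) else 0)) = (if j = 0 then of_real r else 0)"
    unfolding e using scales(1) by (auto simp: scaleR_conv_of_real field_simps)
qed

lemma block_L2: "block \<in> L2"
proof (rule L2I)
  have i: "integrable lborel block" using block_cis(1)[of 0] by (simp add: block_def[abs_def] cong: if_cong)
  then show "block \<in> borel_measurable borel" by simp
  have "(cmod (block t))\<^sup>2 = cmod (block t)" for t by (simp add: block_def)
  then show "integrable lborel (\<lambda>t. (cmod (block t))\<^sup>2)" using integrable_norm[OF i] by simp
qed

text \<open>The translations move \<open>block\<close> off its support, the remaining modulations are characters of
  the circle of length \<open>r\<close>.\<close>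

lemma block_orthogonal: "L2_inner (adj_shift k block) block = (if k = 0 then of_real r else 0)"
proof (cases "hx k = 0")
  case True
  then have k: "snd k = - 2 * fst k" by (simp add: hx_def field_simps)
  have "adj_shift k block t * cnj (block t) = (if \<lfloor>t / r\<rfloor> = 0 then cis (2 * pi * of_int (snd k) * (t / r)) else 0)" for t
    using True by (simp add: adj_shift_def block_def phase_sign_def k hy_def)
  then have "L2_inner (adj_shift k block) block = (if snd k = 0 then of_real r else 0)"
    unfolding L2_inner_def by (simp only: block_cis(2))
  moreover have "snd k = 0 \<longleftrightarrow> k = 0" using k by (auto simp: prod_eq_iff)
  ultimately show ?thesis by simp
next
  case False
  have "adj_shift k block t * cnj (block t) = 0" for t
  proof (rule ccontr)
    assume "adj_shift k block t * cnj (block t) \<noteq> 0"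
    then have "\<lfloor>(t - hx k / s) / r\<rfloor> = 0" "\<lfloor>t / r\<rfloor> = 0" by (auto simp: adj_shift_def block_def split: if_splits)
    then have "\<bar>t / r - (t - hx k / s) / r\<bar> < 1" by (simp add: floor_eq_iff abs_less_iff)
    \<comment> \<open>In units of r the translation is hx times the density. As |hx| \<ge> 1/2 and
      the density is at least 2, the support moves by at least its own length.\<close>
    moreover have "t / r - (t - hx k / s) / r = hx k * (1 / (r * s))"
      by (simp add: diff_divide_distrib)
    ultimately have "\<bar>hx k\<bar> * density < 1" unfolding scales(3) using density_pos by (simp add: abs_mult)
    moreover have "\<bar>hx k\<bar> \<ge> 1 / 2"
    proof -
      have h: "hx k = of_int (2 * fst k + snd k) / 2" by (simp add: hx_def)
      then have "2 * fst k + snd k \<noteq> 0" using False by auto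
      then have "\<bar>2 * fst k + snd k\<bar> \<ge> 1" by linarith
      then have "(1::real) \<le> of_int \<bar>2 * fst k + snd k\<bar>" by linarith
      then show ?thesis unfolding h abs_divide of_int_abs by simp
    qed
    moreover have "density \<ge> 2" using odd_pos[OF odd_K] by (simp add: density_def)
    ultimately show False using mult_mono[of "1/2" "\<bar>hx k\<bar>" 2 density] by simp
  qed
  moreover have "k \<noteq> 0" using False by (auto simp: hx_def)
  ultimately show ?thesis unfolding L2_inner_def by (simp only: Bochner_Integration.integral_zero if_False)
qed

text \<open>A truncated generalized eigenvector: without truncation to the box, a shift by k would
  multiply it by the value of the character at k.\<close>

definition chi_block :: "real \<Rightarrow> real \<Rightarrow> nat \<Rightarrow> real \<Rightarrow> complex" where
  "chi_block a b N = (\<lambda>t. \<Sum>l\<in>ibox N. cnj (cis (dot2 a b l)) * adj_shift l block t)"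

lemma chi_block_L2: "chi_block a b N \<in> L2"
  unfolding chi_block_def by (intro L2_sum L2_cmult adj_shift_L2 block_L2)

lemma chi_block_U:
  "L2_inner (adj_shift m (chi_block a b N)) (chi_block a b N)
     = (\<Sum>k\<in>ibox N. \<Sum>l\<in>ibox N. if m = l - k then cis (dot2 a b m) * of_real r else 0)"
proof -
  let ?c = "\<lambda>l. cis (dot2 a b l)"
  have u: "adj_shift m (chi_block a b N) = (\<lambda>t. \<Sum>k\<in>ibox N. cnj (?c k) * adj_shift (m + k) block t)"
  proof
    fix t
    have "adj_shift m (chi_block a b N) t = (\<Sum>k\<in>ibox N. cnj (?c k) * adj_shift m (adj_shift k block) t)"
      by (simp add: chi_block_def adj_shift_def sum_distrib_left mult_ac)
    then show "adj_shift m (chi_block a b N) t = (\<Sum>k\<in>ibox N. cnj (?c k) * adj_shift (m + k) block t)" by (simp only: adj_shift_add)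
  qed
  have "L2_inner (adj_shift m (chi_block a b N)) (chi_block a b N)
      = (\<Sum>k\<in>ibox N. cnj (?c k) * L2_inner (adj_shift (m + k) block) (chi_block a b N))"
    unfolding u by (subst L2_inner_sum_left) (auto intro: L2_cmult adj_shift_L2 block_L2 chi_block_L2 simp: L2_inner_cmult_left)
  also have "\<dots> = (\<Sum>k\<in>ibox N. cnj (?c k) * (\<Sum>l\<in>ibox N. ?c l * L2_inner (adj_shift (m + k) block) (adj_shift l block)))"
    unfolding chi_block_def by (subst L2_inner_sum_right) (auto intro: L2_cmult adj_shift_L2 block_L2 simp: L2_inner_cmult_right)
  also have "\<dots> = (\<Sum>k\<in>ibox N. \<Sum>l\<in>ibox N. if m = l - k then ?c m * of_real r else 0)"
    unfolding sum_distrib_left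
  proof (intro sum.cong refl)
    fix k l
    have "m + k - l = 0 \<longleftrightarrow> m = l - k" by (simp only: right_minus_eq eq_diff_eq)
    moreover have "cnj (?c k) * ?c l = ?c (l - k)" by (simp add: cis_cnj cis_mult dot2_diff)
    ultimately show "cnj (?c k) * (?c l * L2_inner (adj_shift (m + k) block) (adj_shift l block)) = (if m = l - k then ?c m * of_real r else 0)"
      unfolding adj_shift_inner_diff block_orthogonal by (simp add: mult.assoc[symmetric])
  qed
  finally show ?thesis .
qed

lemma chi_block_norm: "(L2_norm (chi_block a b N))\<^sup>2 = r * real (N * N)"
proof -
  have "complex_of_real ((L2_norm (chi_block a b N))\<^sup>2) = (\<Sum>k\<in>ibox N. \<Sum>l\<in>ibox N. if 0 = l - k then of_real r else 0)"
    unfolding L2_inner_self_norm[symmetric] using chi_block_U[of 0 a b N] by (simp add: adj_shift_0 dot2_def)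
  also have "\<dots> = (\<Sum>k\<in>ibox N. of_real r)"
  proof (intro sum.cong refl)
    fix k assume k: "k \<in> ibox N"
    have "0 = l - k \<longleftrightarrow> l = k" for l by (metis right_minus_eq)
    then show "(\<Sum>l\<in>ibox N. if 0 = l - k then complex_of_real r else 0) = of_real r"
      using k by (simp only: sum.delta[OF finite_ibox] if_True)
  qed
  also have "\<dots> = of_real (r * real (N * N))" by (simp add: card_ibox)
  finally show ?thesis unfolding of_real_eq_iff .
qed

lemma chi_block_G:
  "L2_inner (janssen_op (chi_block a b N)) (chi_block a b N)
     = of_real r * (\<Sum>k\<in>ibox N. \<Sum>l\<in>ibox N. of_real (weight (k - l)) * cis (dot2 a b (k - l)))"
proof -
  have "((\<lambda>m. \<Sum>k\<in>ibox N. \<Sum>l\<in>ibox N. if m = l - k then of_real r * (of_real (weight m) * cis (dot2 a b m)) else 0)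
     has_sum (\<Sum>k\<in>ibox N. \<Sum>l\<in>ibox N. of_real r * (of_real (weight (l - k)) * cis (dot2 a b (l - k))))) UNIV"
    by (intro has_sum_sum) (rule has_sum_finite_neutralI[of "{_ - _}"], auto)
  moreover have "of_real (weight m) * L2_inner (adj_shift m (chi_block a b N)) (chi_block a b N)
     = (\<Sum>k\<in>ibox N. \<Sum>l\<in>ibox N. if m = l - k then of_real r * (of_real (weight m) * cis (dot2 a b m)) else 0)" for m
    unfolding chi_block_U sum_distrib_left by (intro sum.cong refl) simp
  ultimately have "L2_inner (janssen_op (chi_block a b N)) (chi_block a b N)
      = (\<Sum>k\<in>ibox N. \<Sum>l\<in>ibox N. of_real r * (of_real (weight (l - k)) * cis (dot2 a b (l - k))))"
    using has_sum_unique[OF janssen_op_inner[OF chi_block_L2 chi_block_L2, of a b N a b N]] by simp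
  then show ?thesis unfolding sum_distrib_left by (rule trans[OF _ sum.swap])
qed

text \<open>The Rayleigh quotients are Fejer means of the symbol at the character (a, b), so every
  value of the symbol is a limit of such quotients and both bounds are sharp.\<close>

lemma chi_block_limit:
  "(\<lambda>N. Re (L2_inner (janssen_op (chi_block a b N)) (chi_block a b N)) / (L2_norm (chi_block a b N))\<^sup>2)
     \<longlonglongrightarrow> Re (\<Sum>\<^sub>\<infinity>k. of_real (weight k) * cis (dot2 a b k))"
proof -
  have "Re (L2_inner (janssen_op (chi_block a b N)) (chi_block a b N)) / (L2_norm (chi_block a b N))\<^sup>2
    = Re ((\<Sum>k\<in>ibox N. \<Sum>l\<in>ibox N. of_real (weight (k - l)) * cis (dot2 a b (k - l))) / of_nat (N * N))" for N
    unfolding chi_block_G chi_block_norm using scales(1) by (simp add: Re_divide_of_nat del: of_nat_mult)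
  then show ?thesis
    using tendsto_Re[OF fejer_limit[OF weight_char_summable[of a b]]] by simp
qed

lemma eventually_chi_block_norm: "\<forall>\<^sub>F N in sequentially. (L2_norm (chi_block a b N))\<^sup>2 > 0"
  using eventually_gt_at_top[of 0] unfolding chi_block_norm by eventually_elim (use scales(1) in simp)

lemma lower_spectral_bound_hex: "lower_spectral_bound (hex_lattice density) = cubic_b nome"
  unfolding lower_spectral_bound_def
proof (rule Greatest_equality)
  show "\<forall>f\<in>L2. cubic_b nome * (L2_norm f)\<^sup>2 \<le> Re (L2_inner (gabor_frame_op (hex_lattice density) f) f)"
    using janssen_op_ge by (simp add: gabor_frame_form)
  fix A assume A: "\<forall>f\<in>L2. A * (L2_norm f)\<^sup>2 \<le> Re (L2_inner (gabor_frame_op (hex_lattice density) f) f)"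
  have "A \<le> Re (of_real (cubic_b nome))"
    unfolding weight_infsum_hole[symmetric]
  proof (rule tendsto_lowerbound[OF chi_block_limit])
    show "\<forall>\<^sub>F N in sequentially. A \<le> Re (L2_inner (janssen_op (chi_block (- (2 * pi / 3)) (2 * pi / 3) N)) (chi_block (- (2 * pi / 3)) (2 * pi / 3) N))
        / (L2_norm (chi_block (- (2 * pi / 3)) (2 * pi / 3) N))\<^sup>2"
      using eventually_chi_block_norm[of "- (2 * pi / 3)" "2 * pi / 3"]
    proof eventually_elim
      case (elim N)
      then show ?case using A chi_block_L2 by (simp add: gabor_frame_form pos_le_divide_eq)
    qed
  qed simp
  then show "A \<le> cubic_b nome" by simp
qed

lemma upper_spectral_bound_hex: "upper_spectral_bound (hex_lattice density) = cubic_a nome"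
  unfolding upper_spectral_bound_def
proof (rule Least_equality)
  show "\<forall>f\<in>L2. Re (L2_inner (gabor_frame_op (hex_lattice density) f) f) \<le> cubic_a nome * (L2_norm f)\<^sup>2"
    using janssen_op_le by (simp add: gabor_frame_form)
  fix B assume B: "\<forall>f\<in>L2. Re (L2_inner (gabor_frame_op (hex_lattice density) f) f) \<le> B * (L2_norm f)\<^sup>2"
  have "Re (of_real (cubic_a nome)) \<le> B"
    unfolding weight_infsum_0[symmetric]
  proof (rule tendsto_upperbound[OF chi_block_limit])
    show "\<forall>\<^sub>F N in sequentially. Re (L2_inner (janssen_op (chi_block 0 0 N)) (chi_block 0 0 N)) / (L2_norm (chi_block 0 0 N))\<^sup>2 \<le> B"
      using eventually_chi_block_norm[of 0 0]
    proof eventually_elim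
      case (elim N)
      then show ?case using B chi_block_L2 by (simp add: gabor_frame_form pos_divide_le_eq)
    qed
  qed simp
  then show "cubic_a nome \<le> B" by simp
qed

end

lemma
  shows A2_hex: "A2 (2 * 3 ^ n) = cubic_b (hex_nome n)"
    and B2_hex: "B2 (2 * 3 ^ n) = cubic_a (hex_nome n)"
proof -
  interpret hex_gabor "3 ^ n" by unfold_locales simp
  have d: "density = 2 * 3 ^ n" by (simp add: density_def)
  have "nome = exp (real (3 ^ n) * (- (2 * pi / sqrt 3)))" unfolding nome_def d by (simp add: mult_ac)
  also have "\<dots> = hex_nome n" unfolding hex_nome_def by (rule exp_of_nat_mult)
  finally have q: "nome = hex_nome n" .
  show "A2 (2 * 3 ^ n) = cubic_b (hex_nome n)" "B2 (2 * 3 ^ n) = cubic_a (hex_nome n)"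
    using lower_spectral_bound_hex upper_spectral_bound_hex unfolding d q by (simp_all add: A2_def B2_def)
qed

theorem theorem1p2:
  shows "(\<forall>n::nat. n \<ge> 1 \<longrightarrow>
            B2 (2 * 3 ^ n) = (B2 (2 * 3 ^ (n - 1)) + 2 * A2 (2 * 3 ^ (n - 1))) / 3 \<and>
            A2 (2 * 3 ^ n) =
              root 3 (A2 (2 * 3 ^ (n - 1)) *
                (((A2 (2 * 3 ^ (n - 1)))\<^sup>2 + A2 (2 * 3 ^ (n - 1)) * B2 (2 * 3 ^ (n - 1))
                  + (B2 (2 * 3 ^ (n - 1)))\<^sup>2) / 3))) \<and>
         B2 2 / A2 2 = root 3 2 \<and>
         A2 2 = 1 / (2 * landau_plus) \<and>
         A2 2 = 1 / ag3 (root 3 2) 1 \<and>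
         complex_of_real (A2 2) = cubic_theta_b (complex_of_real (exp (- (2 * pi / sqrt 3)))) \<and>
         0.920371 \<le> A2 2 \<and> A2 2 < 0.920372"
proof -
  have A: "A2 2 = cubic_b (hex_nome 0)" and B: "B2 2 = cubic_a (hex_nome 0)"
    using A2_hex[of 0] B2_hex[of 0] by simp_all
  have rec: "B2 (2 * 3 ^ Suc m) = (B2 (2 * 3 ^ m) + 2 * A2 (2 * 3 ^ m)) / 3"
    "A2 (2 * 3 ^ Suc m) = root 3 (A2 (2 * 3 ^ m) *
      (((A2 (2 * 3 ^ m))\<^sup>2 + A2 (2 * 3 ^ m) * B2 (2 * 3 ^ m) + (B2 (2 * 3 ^ m))\<^sup>2) / 3))" for m
    unfolding A2_hex B2_hex
    by (rule cubic_a_hex_nome_Suc) (simp only: hex_nome_Suc cubic_b_cube[OF hex_nome_bounds])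
  have "B2 2 / A2 2 = root 3 2"
    unfolding A B cubic_ratio using cubic_b_pos_le(1)[of 0] by simp
  moreover have "complex_of_real (A2 2) = cubic_theta_b (complex_of_real (exp (- (2 * pi / sqrt 3))))"
    unfolding A using of_real_cubic_b[OF hex_nome_bounds(1)[of 0]] by (simp only: hex_nome_0)
  moreover have "\<forall>n::nat. n \<ge> 1 \<longrightarrow>
      B2 (2 * 3 ^ n) = (B2 (2 * 3 ^ (n - 1)) + 2 * A2 (2 * 3 ^ (n - 1))) / 3 \<and>
      A2 (2 * 3 ^ n) = root 3 (A2 (2 * 3 ^ (n - 1)) *
        (((A2 (2 * 3 ^ (n - 1)))\<^sup>2 + A2 (2 * 3 ^ (n - 1)) * B2 (2 * 3 ^ (n - 1)) + (B2 (2 * 3 ^ (n - 1)))\<^sup>2) / 3))"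
  proof (intro allI impI)
    fix n :: nat assume "n \<ge> 1"
    then obtain m where n: "n = Suc m" by (cases n) auto
    show "B2 (2 * 3 ^ n) = (B2 (2 * 3 ^ (n - 1)) + 2 * A2 (2 * 3 ^ (n - 1))) / 3 \<and>
      A2 (2 * 3 ^ n) = root 3 (A2 (2 * 3 ^ (n - 1)) *
        (((A2 (2 * 3 ^ (n - 1)))\<^sup>2 + A2 (2 * 3 ^ (n - 1)) * B2 (2 * 3 ^ (n - 1)) + (B2 (2 * 3 ^ (n - 1)))\<^sup>2) / 3))"
      unfolding n diff_Suc_1 by (intro conjI rec)
  qed
  ultimately show ?thesis
    using cubic_b_landau cubic_b_ag3 cubic_b_numeric unfolding A by (intro conjI)
qed

end
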